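(* The family $(V^{h})_{h\in(0,h_0]}$ of solutions of the Schrödinger-Poisson system is bounded in $W^{1,\infty}(0,L)$ and, as $h\to 0$, $V^h$ tends strongly in $C^{0,\alpha}(0,L)$, for every $\alpha\in(0,1)$, to the potential $V_0$ given by $$V_{0}(x)=\begin{cases}\left(\sum_{i\geq1}f(e_{i}+\theta)\right)\left(1-\frac{x_{0}}{L}\right)x, & 0<x\leq x_{0},\\[1mm] \left(\sum_{i\geq1}f(e_{i}+\theta)\right)\frac{x_{0}}{L}(L-x), & x_{0}<x<L,\end{cases}$$ where $\{e_i\}_{1\le i\le N}$ is the discrete spectrum of $H_0$, $e_i=0$ for $i\ge N+1$, and $\theta\in(0,\varepsilon_S-e_1)$ is the unique non-negative solution of the nonlinear equation $$\theta=x_{0}\left(1-\frac{x_{0}}{L}\right)\sum_{i\geq 1}f(e_{i}+\theta).$$ Moreover, as $h\to0$, the density $n[V^{h}]$ tends to the measure $$\mu=\sum_{i\geq 1}f(e_{i}+\theta)\,\delta_{x_0}$$ for the weak* topology on the space $\mathcal{M}_b(0,L)$ of bounded measures on $(0,L)$.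
   Context: Setting. Let $L>0$, $\Omega=(0,L)$, $x_0\in\Omega$, and let $U\in C_0^\infty(\mathbb{R})$ be a non-positive function supported in the ball of radius one centered at the origin. For $h>0$ put $U^h(x)=U\left(\frac{x-x_0}{h}\right)$ for $x\in\Omega$, with support $\omega^h$, and let $h_0>0$ be a constant small enough that $\omega^h\subset\Omega$ for all $h\in(0,h_0]$. Let $\varepsilon_S<0$ and let $f\in C^\infty(\mathbb{R})$ satisfy $f(x)>0$ for $x<\varepsilon_S$, $f(x)=0$ for $x\ge\varepsilon_S$, and $f'(x)\le 0$ for all $x\in\mathbb{R}$. Limit operator. $H_0=-\frac{d^2}{dx^2}+U$ on $L^2(\mathbb{R})$ with domain $D(H_0)=H^2(\mathbb{R})$. Its spectrum is $\{e_1,\dots,e_N\}\cup[0,+\infty)$, where $e_1<\dots<e_N<0$ are the finitely many (simple) negative eigenvalues. The convention $e_i=0$ for $i\ge N+1$ is used. It is assumed that $e_1=\inf\sigma(H_0)<\varepsilon_S$. Schrödinger-Poisson system. For $h\in(0,h_0]$, $V^h\in H_0^1(\Omega)$ denotes the solution (it is known to exist and be unique) of $$-\frac{d^2}{dx^2}V^h=n[V^h]\ \text{ in }\Omega,\qquad V^h|_{\partial\Omega}=0,\qquad n[V^h]=\sum_{i\ge1}f(\varepsilon_i^h)|\Psi_i^h|^2,$$ where $\{\varepsilon_i^h\}_{i\ge1}$ are the eigenvalues, numbered in increasing order counting multiplicities, of $H^h=-h^2\frac{d^2}{dx^2}+U^h+V^h$ with domain $H^2\cap H_0^1(\Omega)$,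 and $\{\Psi_i^h\}_{i\ge1}$ are the corresponding real-valued eigenfunctions normalized by $\|\Psi_i^h\|_{L^2(\Omega)}=1$. The density $n[V^h]\in L^1(0,L)$ is identified with the measure $n[V^h]\,dx$; weak* convergence of measures is tested against functions $\varphi\in C([0,L])$. $\delta_{x_0}$ is the Dirac mass at $x_0$. *)

theory Defs
  imports "HOL-Analysis.Analysis" "HOL-Probability.Essential_Supremum"
    "HOL-Probability.Giry_Monad"
begin

section \<open>Function spaces on an open subset of the real line\<close>

text \<open>
  Elements of the Lebesgue and Sobolev spaces are represented by functions on the whole real
  line; only their values almost everywhere on the open set \<open>\<Omega>\<close> matter.
\<close>

definition smooth :: "(real \<Rightarrow> real) \<Rightarrow> bool" where
  "smooth f \<longleftrightarrow> (\<forall>k x. (deriv ^^ k) f field_differentiable at x)"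

definition test_function :: "real set \<Rightarrow> (real \<Rightarrow> real) \<Rightarrow> bool" where
  "test_function \<Omega> \<phi> \<longleftrightarrow>
     smooth \<phi> \<and> compact (closure {x. \<phi> x \<noteq> 0}) \<and> closure {x. \<phi> x \<noteq> 0} \<subseteq> \<Omega>"

definition L2 :: "real set \<Rightarrow> (real \<Rightarrow> 'a::{banach, second_countable_topology}) set" where
  "L2 \<Omega> = {u. u \<in> borel_measurable (lebesgue_on \<Omega>) \<and>
              integrable (lebesgue_on \<Omega>) (\<lambda>x. (norm (u x))\<^sup>2)}"

definition L2_norm_on :: "real set \<Rightarrow> (real \<Rightarrow> 'a::{banach, second_countable_topology}) \<Rightarrow> real" where
  "L2_norm_on \<Omega> u = sqrt (LINT x|lebesgue_on \<Omega>. (norm (u x))\<^sup>2)"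

definition locally_integrable ::
    "real set \<Rightarrow> (real \<Rightarrow> 'a::{banach, second_countable_topology}) \<Rightarrow> bool" where
  "locally_integrable \<Omega> u \<longleftrightarrow> (\<forall>K. compact K \<and> K \<subseteq> \<Omega> \<longrightarrow> integrable (lebesgue_on K) u)"

definition has_weak_deriv ::
    "real set \<Rightarrow> (real \<Rightarrow> 'a::{banach, second_countable_topology}) \<Rightarrow> (real \<Rightarrow> 'a) \<Rightarrow> bool" where
  "has_weak_deriv \<Omega> u g \<longleftrightarrow> locally_integrable \<Omega> u \<and> locally_integrable \<Omega> g \<and>
     (\<forall>\<phi>. test_function \<Omega> \<phi> \<longrightarrow>
        (LINT x|lebesgue_on \<Omega>. deriv \<phi> x *\<^sub>R u x) = - (LINT x|lebesgue_on \<Omega>. \<phi> x *\<^sub>R g x))"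

definition H2 :: "real set \<Rightarrow> (real \<Rightarrow> 'a::{banach, second_countable_topology}) set" where
  "H2 \<Omega> = {u \<in> L2 \<Omega>. \<exists>g \<in> L2 \<Omega>. \<exists>k \<in> L2 \<Omega>. has_weak_deriv \<Omega> u g \<and> has_weak_deriv \<Omega> g k}"

text \<open>The closure of the test functions in the norm of \<open>H\<^sup>1(\<Omega>)\<close>.\<close>

definition H10 :: "real set \<Rightarrow> (real \<Rightarrow> real) set" where
  "H10 \<Omega> = {u \<in> L2 \<Omega>. \<exists>g \<in> L2 \<Omega>. has_weak_deriv \<Omega> u g \<and>
     (\<exists>\<phi>. (\<forall>n::nat. test_function \<Omega> (\<phi> n)) \<and>
        (\<lambda>n. L2_norm_on \<Omega> (\<lambda>x. u x - \<phi> n x)) \<longlonglongrightarrow> 0 \<and>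
        (\<lambda>n. L2_norm_on \<Omega> (\<lambda>x. g x - deriv (\<phi> n) x)) \<longlonglongrightarrow> 0)}"

definition Linf_norm :: "real set \<Rightarrow> (real \<Rightarrow> real) \<Rightarrow> ennreal" where
  "Linf_norm \<Omega> u = esssup (lebesgue_on \<Omega>) (\<lambda>x. ennreal \<bar>u x\<bar>)"

text \<open>Weak derivatives are unique almost everywhere, so the infimum runs over a single value;
  it is infinite if there is no weak derivative.\<close>

definition W1inf_norm :: "real set \<Rightarrow> (real \<Rightarrow> real) \<Rightarrow> ennreal" where
  "W1inf_norm \<Omega> u = (INF g \<in> {g. has_weak_deriv \<Omega> u g}. Linf_norm \<Omega> u + Linf_norm \<Omega> g)"

definition holder_norm :: "real \<Rightarrow> real set \<Rightarrow> (real \<Rightarrow> real) \<Rightarrow> ennreal" where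
  "holder_norm \<alpha> \<Omega> u =
     (SUP x\<in>\<Omega>. ennreal \<bar>u x\<bar>) +
     (SUP (x, y)\<in>{(x, y). x \<in> \<Omega> \<and> y \<in> \<Omega> \<and> x \<noteq> y}. ennreal (\<bar>u x - u y\<bar> / \<bar>x - y\<bar> powr \<alpha>))"

section \<open>Schroedinger operators\<close>

text \<open>An unbounded operator in \<open>L\<^sup>2(\<Omega>)\<close> is given by its graph, a set of pairs of
  representatives.\<close>

type_synonym 'a operator = "((real \<Rightarrow> 'a) \<times> (real \<Rightarrow> 'a)) set"

text \<open>The operator \<open>-h\<^sup>2 d\<^sup>2/dx\<^sup>2 + W\<close> with domain \<open>D\<close>.\<close>

definition schroedinger ::
    "real set \<Rightarrow> real \<Rightarrow> (real \<Rightarrow> real) \<Rightarrow> (real \<Rightarrow> 'a::{banach, second_countable_topology}) set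
     \<Rightarrow> 'a operator" where
  "schroedinger \<Omega> h W D = {(\<psi>, \<eta>). \<psi> \<in> D \<and> \<eta> \<in> L2 \<Omega> \<and>
     (\<exists>g k. has_weak_deriv \<Omega> \<psi> g \<and> has_weak_deriv \<Omega> g k \<and>
        (AE x in lebesgue_on \<Omega>. \<eta> x = - (h\<^sup>2 *\<^sub>R k x) + W x *\<^sub>R \<psi> x))}"

text \<open>The resolvent set consists of the \<open>z\<close> for which \<open>T - z\<close> is a bijection from its domain
  onto \<open>L\<^sup>2(\<Omega>)\<close> with bounded inverse; the estimate contains the injectivity.\<close>

definition resolvent_set :: "real set \<Rightarrow> complex operator \<Rightarrow> complex set" where
  "resolvent_set \<Omega> T = {z.
     (\<exists>C. \<forall>(\<psi>, \<eta>)\<in>T. L2_norm_on \<Omega> \<psi> \<le> C * L2_norm_on \<Omega> (\<lambda>x. \<eta> x - z * \<psi> x)) \<and>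
     (\<forall>\<phi>\<in>L2 \<Omega>. \<exists>(\<psi>, \<eta>)\<in>T. AE x in lebesgue_on \<Omega>. \<eta> x - z * \<psi> x = \<phi> x)}"

definition spectrum_on :: "real set \<Rightarrow> complex operator \<Rightarrow> complex set" where
  "spectrum_on \<Omega> T = - resolvent_set \<Omega> T"

definition eigenfunction ::
    "real set \<Rightarrow> 'a::{banach, second_countable_topology} operator \<Rightarrow> real \<Rightarrow> (real \<Rightarrow> 'a) \<Rightarrow> bool" where
  "eigenfunction \<Omega> T E \<psi> \<longleftrightarrow>
     (\<exists>\<eta>. (\<psi>, \<eta>) \<in> T \<and> (AE x in lebesgue_on \<Omega>. \<eta> x = E *\<^sub>R \<psi> x)) \<and>
     \<not> (AE x in lebesgue_on \<Omega>. \<psi> x = 0)"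

text \<open>All eigenvalues \<open>\<epsilon> 1 \<le> \<epsilon> 2 \<le> \<dots>\<close>, each repeated according to its multiplicity, with
  real orthonormal eigenfunctions: the \<open>\<Psi> i\<close> belonging to an eigenvalue form a basis of its
  eigenspace.\<close>

definition eigensystem ::
    "real set \<Rightarrow> real operator \<Rightarrow> (nat \<Rightarrow> real) \<Rightarrow> (nat \<Rightarrow> real \<Rightarrow> real) \<Rightarrow> bool" where
  "eigensystem \<Omega> T \<epsilon> \<Psi> \<longleftrightarrow>
     mono_on {1..} \<epsilon> \<and>
     (\<forall>i\<ge>1. eigenfunction \<Omega> T (\<epsilon> i) (\<Psi> i)) \<and>
     (\<forall>i\<ge>1. \<forall>j\<ge>1. (LINT x|lebesgue_on \<Omega>. \<Psi> i x * \<Psi> j x) = (if i = j then 1 else 0)) \<and>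
     (\<forall>E \<psi>. eigenfunction \<Omega> T E \<psi> \<longrightarrow>
        (\<exists>c. AE x in lebesgue_on \<Omega>. \<psi> x = (\<Sum>i | 1 \<le> i \<and> \<epsilon> i = E. c i * \<Psi> i x)))"

definition H0 :: "(real \<Rightarrow> real) \<Rightarrow> complex operator" where
  "H0 U = schroedinger UNIV 1 U (H2 UNIV)"

section \<open>The Schroedinger-Poisson system\<close>

definition scaled_well :: "(real \<Rightarrow> real) \<Rightarrow> real \<Rightarrow> real \<Rightarrow> real \<Rightarrow> real" where
  "scaled_well U x0 h x = U ((x - x0) / h)"

definition dirichlet_op :: "real \<Rightarrow> real \<Rightarrow> (real \<Rightarrow> real) \<Rightarrow> real operator" where
  "dirichlet_op L h W = schroedinger {0<..<L} h W (H2 {0<..<L} \<inter> H10 {0<..<L})"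

definition charge_density ::
    "(real \<Rightarrow> real) \<Rightarrow> (nat \<Rightarrow> real) \<Rightarrow> (nat \<Rightarrow> real \<Rightarrow> real) \<Rightarrow> real \<Rightarrow> real" where
  "charge_density f \<epsilon> \<Psi> x = (\<Sum>\<^sub>\<infinity>i\<in>{1..}. f (\<epsilon> i) * \<bar>\<Psi> i x\<bar>\<^sup>2)"

text \<open>\<open>V\<close> solves the system, with \<open>\<epsilon>\<close>, \<open>\<Psi>\<close> the eigenvalues and eigenfunctions of the
  associated Hamiltonian. The class \<open>V\<close> in \<open>H\<^sup>1\<^sub>0(0,L)\<close> is represented by its continuous
  representative, and the Poisson equation holds in the sense of distributions.\<close>

definition schroedinger_poisson ::
    "real \<Rightarrow> real \<Rightarrow> (real \<Rightarrow> real) \<Rightarrow> (real \<Rightarrow> real) \<Rightarrow> real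
     \<Rightarrow> (real \<Rightarrow> real) \<Rightarrow> (nat \<Rightarrow> real) \<Rightarrow> (nat \<Rightarrow> real \<Rightarrow> real) \<Rightarrow> bool" where
  "schroedinger_poisson L x0 U f h V \<epsilon> \<Psi> \<longleftrightarrow>
     V \<in> H10 {0<..<L} \<and> continuous_on {0<..<L} V \<and>
     eigensystem {0<..<L} (dirichlet_op L h (\<lambda>x. scaled_well U x0 h x + V x)) \<epsilon> \<Psi> \<and>
     (\<exists>g. has_weak_deriv {0<..<L} V g \<and>
          has_weak_deriv {0<..<L} g (\<lambda>x. - charge_density f \<epsilon> \<Psi> x))"

text \<open>Weak* convergence of finite measures on \<open>(0,L)\<close>, tested against \<open>C([0,L])\<close>.
  The finiteness excludes the default value of the integral of a non-integrable function.\<close>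

definition tendsto_weak_star ::
    "real \<Rightarrow> ('i \<Rightarrow> real measure) \<Rightarrow> real measure \<Rightarrow> 'i filter \<Rightarrow> bool" where
  "tendsto_weak_star L M \<mu> F \<longleftrightarrow>
     (\<forall>\<^sub>F i in F. finite_measure (M i)) \<and> finite_measure \<mu> \<and>
     (\<forall>\<phi>::real \<Rightarrow> real. continuous_on {0..L} \<phi> \<longrightarrow>
        ((\<lambda>i. LINT x|M i. \<phi> x) \<longlongrightarrow> (LINT x|\<mu>. \<phi> x)) F)"

definition density_measure :: "real \<Rightarrow> (real \<Rightarrow> real) \<Rightarrow> real measure" where
  "density_measure L n = density (lebesgue_on {0<..<L}) (\<lambda>x. ennreal (n x))"

definition dirac_mass :: "real \<Rightarrow> real \<Rightarrow> real measure" where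
  "dirac_mass L x0 = return (lebesgue_on {0<..<L}) x0"

definition limit_potential :: "real \<Rightarrow> real \<Rightarrow> real \<Rightarrow> real \<Rightarrow> real" where
  "limit_potential L x0 S x = (if x \<le> x0 then S * (1 - x0 / L) * x else S * (x0 / L) * (L - x))"

end

theory Submission
  imports Defs
begin

text \<open>For a fixed \<open>h\<close> the system is classical: weak derivatives that agree almost everywhere with
  continuous functions are true derivatives, so \<open>V\<close> is a twice differentiable concave function with
  zero boundary values, and the eigenfunctions solve
  \<open>h\<^sup>2 u'' = (U\<^sup>h + V - \<epsilon>) u\<close> (\<open>schroedinger_poisson_classical\<close>). As \<open>f\<close> vanishes above \<open>\<epsilon>S\<close>,
  only the eigenvalues below \<open>\<epsilon>S\<close> carry charge.

  A priori bounds. The total charge \<open>S\<close> is the sum of \<open>f\<close> over the eigenvalues below \<open>\<epsilon>S\<close>, and it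
  bounds \<open>V'\<close>. Because \<open>V\<close> is non-negative, no eigenvalue lies below the minimum of the well, and only
  the well contributes negatively to their sum. A bound on the sum of the squared eigenfunctions
  (\<open>trace_bound\<close>) then limits the number of eigenvalues below \<open>\<epsilon>S\<close> independently of \<open>h\<close>
  (\<open>card_uniform\<close>): the well has width of order \<open>h\<close>, and the squares are of order \<open>1 / h\<close>. This
  bounds \<open>S\<close>.

  Concentration. Outside the well the charged states lie below the potential by a fixed amount, so
  the second moment of the density about \<open>x0\<close> is of order \<open>h\<^sup>2\<close> (\<open>second_moment\<close>), and the Lipschitz
  continuity of the Green function puts \<open>V\<close> within order \<open>h\<close> of the potential of a point charge \<open>S\<close>
  at \<open>x0\<close> (\<open>V_close_to_point_charge\<close>). It remains to find the limit of \<open>S\<close>.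

  Comparison of the spectra. In the variable \<open>y = (x - x0) / h\<close> the well is \<open>U\<close>, and on any fixed
  window around it \<open>V\<close> is nearly the constant \<open>V x0\<close>. A solution starting at the left end of the
  interval is dominated by its growing mode when it reaches the well, hence follows the solution
  \<open>\<phi>\<close> of the limit equation that decays on the left, and its value at the right end is up to a
  positive factor and a small error the mismatch between \<open>\<phi>\<close> and the exponential that decays on
  the right (\<open>shooting_imp_matched\<close>). The zeros of the mismatch are the bound states of the limit
  operator (\<open>bound_state_iff\<close>). So every eigenvalue below \<open>\<epsilon>S\<close>, shifted by \<open>V x0\<close>, is near a bound
  state; at each bound state the mismatch changes sign (\<open>mismatch_sign_change\<close>), which produces an
  eigenvalue by the intermediate value theorem; and two eigenvalues near the same bound state would
  have eigenfunctions that are not orthogonal. Therefore \<open>S\<close> differs by \<open>o(1)\<close> from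
  \<open>\<Sum>k. f (e k + V x0)\<close> (\<open>charge_asymptotics\<close>).

  Conclusion. With \<open>c = x0 (1 - x0 / L)\<close> the two approximations say that \<open>t = V x0\<close> solves
  \<open>t = c \<Sum>k. f (e k + t)\<close> up to \<open>o(1)\<close>. Since \<open>f\<close> is non-increasing, an approximate solution is
  close to the exact one (\<open>decreasing_fixed_point\<close>), so \<open>V x0\<close> tends to \<open>\<theta>\<close> and \<open>S\<close> converges.
  Uniform closeness together with the uniform Lipschitz bound gives the Hoelder convergence by
  interpolation, and the concentration of the density gives the weak* convergence.\<close>

section \<open>Linear second-order equations on an interval\<close>

text \<open>The derivative is carried along as a second function, because at the end points of the interval
  only one-sided derivatives exist.\<close>

definition is_sol ::
    "(real \<Rightarrow> real) \<Rightarrow> real \<Rightarrow> real \<Rightarrow> (real \<Rightarrow> real) \<Rightarrow> (real \<Rightarrow> real) \<Rightarrow> bool" where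
  "is_sol Q a b w w' \<longleftrightarrow> (\<forall>x\<in>{a..b}. (w has_real_derivative w' x) (at x within {a..b}) \<and>
     (w' has_real_derivative Q x * w x) (at x within {a..b}))"

lemma mvt_within:
  fixes f :: "real \<Rightarrow> real"
  assumes "a < b" "\<And>x. x \<in> {a..b} \<Longrightarrow> (f has_real_derivative f' x) (at x within {a..b})"
  obtains x where "a < x" "x < b" "f b - f a = f' x * (b - a)"
  using mvt_simple[OF assms(1), of f "\<lambda>x. (*) (f' x)"] assms(2)
  by (auto simp: has_field_derivative_def)

lemma nonneg_derivative_imp_le:
  fixes f :: "real \<Rightarrow> real"
  assumes "a \<le> b" "\<And>x. x \<in> {a..b} \<Longrightarrow> (f has_real_derivative f' x) (at x within {a..b})"
    "\<And>x. x \<in> {a..b} \<Longrightarrow> 0 \<le> f' x"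
  shows "f a \<le> f b"
proof (cases "a = b")
  case False
  then have "a < b" using assms(1) by simp
  then obtain x where "a < x" "x < b" "f b - f a = f' x * (b - a)"
    using mvt_within assms(2) by blast
  moreover have "0 \<le> f' x * (b - a)"
    using \<open>a < b\<close> \<open>a < x\<close> \<open>x < b\<close> assms(3)[of x] by (intro mult_nonneg_nonneg) auto
  ultimately show ?thesis by linarith
qed simp

lemma nonpos_derivative_imp_ge:
  fixes f :: "real \<Rightarrow> real"
  assumes "a \<le> b" "\<And>x. x \<in> {a..b} \<Longrightarrow> (f has_real_derivative f' x) (at x within {a..b})"
    "\<And>x. x \<in> {a..b} \<Longrightarrow> f' x \<le> 0"
  shows "f b \<le> f a"
  using nonneg_derivative_imp_le[of a b "\<lambda>x. - f x" "\<lambda>x. - f' x"] assms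
  by (auto intro!: derivative_eq_intros)

lemma continuous_on_interval_bounded:
  fixes f :: "real \<Rightarrow> real"
  assumes "continuous_on {a..b} f"
  obtains K where "0 \<le> K" "\<And>x. x \<in> {a..b} \<Longrightarrow> \<bar>f x\<bar> \<le> K"
proof -
  have "bounded (f ` {a..b})"
    by (intro compact_imp_bounded compact_continuous_image assms) auto
  then obtain K where "\<forall>x\<in>{a..b}. \<bar>f x\<bar> \<le> K" by (auto simp: bounded_iff)
  then have "\<bar>f x\<bar> \<le> max K 0" if "x \<in> {a..b}" for x using that by force
  then show thesis using that[of "max K 0"] by auto
qed

lemma is_solD:
  assumes "is_sol Q a b w w'" "x \<in> {a..b}"
  shows "(w has_real_derivative w' x) (at x within {a..b})"
    and "(w' has_real_derivative Q x * w x) (at x within {a..b})"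
  using assms by (auto simp: is_sol_def)

lemma is_sol_subinterval:
  assumes "is_sol Q a b w w'" "{c..d} \<subseteq> {a..b}"
  shows "is_sol Q c d w w'"
  unfolding is_sol_def
proof (intro ballI)
  fix x assume "x \<in> {c..d}"
  then have "x \<in> {a..b}" using assms(2) by auto
  then show "(w has_real_derivative w' x) (at x within {c..d}) \<and>
      (w' has_real_derivative Q x * w x) (at x within {c..d})"
    using is_solD[OF assms(1)] assms(2) DERIV_subset by blast
qed

lemma is_sol_continuous:
  assumes "is_sol Q a b w w'"
  shows "continuous_on {a..b} w" "continuous_on {a..b} w'"
  using is_solD[OF assms] by (meson DERIV_continuous continuous_on_eq_continuous_within)+

lemma is_sol_cong:
  assumes "is_sol Q a b w w'" "\<And>x. x \<in> {a..b} \<Longrightarrow> Q x = Q2 x"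
  shows "is_sol Q2 a b w w'"
  using assms by (auto simp: is_sol_def)

lemma is_sol_linear:
  assumes "is_sol Q a b w w'" "is_sol Q a b z z'"
  shows "is_sol Q a b (\<lambda>x. c * w x + d * z x) (\<lambda>x. c * w' x + d * z' x)"
  unfolding is_sol_def
  by (intro ballI conjI; insert is_solD[OF assms(1)] is_solD[OF assms(2)];
      force intro!: derivative_eq_intros simp: algebra_simps)

lemma is_sol_scale: "is_sol Q a b w w' \<Longrightarrow> is_sol Q a b (\<lambda>x. c * w x) (\<lambda>x. c * w' x)"
  using is_sol_linear[of Q a b w w' w w' c 0] by simp

lemma is_sol_zero: "is_sol Q a b (\<lambda>x. 0) (\<lambda>x. 0)"
  by (auto simp: is_sol_def)

lemma is_sol_affine:
  assumes sol: "is_sol Q a b w w'" and "m \<noteq> 0"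
    and sub: "\<And>y. y \<in> {c..d} \<Longrightarrow> m * y + p \<in> {a..b}"
  shows "is_sol (\<lambda>y. m\<^sup>2 * Q (m * y + p)) c d (\<lambda>y. w (m * y + p)) (\<lambda>y. m * w' (m * y + p))"
proof -
  have *: "((\<lambda>y. g (m * y + p)) has_real_derivative g' (m * y + p) * m) (at y within {c..d})"
    if "y \<in> {c..d}" and g: "\<And>x. x \<in> {a..b} \<Longrightarrow> (g has_real_derivative g' x) (at x within {a..b})"
    for y g g'
  proof -
    have "(\<lambda>y. m * y + p) ` {c..d} \<subseteq> {a..b}" using sub by auto
    then have "(g has_real_derivative g' (m * y + p)) (at (m * y + p) within (\<lambda>y. m * y + p) ` {c..d})"
      using g[OF sub[OF that(1)]] DERIV_subset by blast
    moreover have "((\<lambda>y. m * y + p) has_real_derivative m) (at y within {c..d})"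
      by (auto intro!: derivative_eq_intros)
    ultimately show ?thesis using DERIV_image_chain[of g _ "\<lambda>y. m * y + p"] by (simp add: o_def)
  qed
  show ?thesis
    unfolding is_sol_def
  proof (intro ballI conjI)
    fix y assume y: "y \<in> {c..d}"
    show "((\<lambda>y. w (m * y + p)) has_real_derivative m * w' (m * y + p)) (at y within {c..d})"
      using *[OF y is_solD(1)[OF sol]] by (simp add: mult.commute)
    have "((\<lambda>y. m * w' (m * y + p)) has_real_derivative m * (Q (m * y + p) * w (m * y + p) * m)) (at y within {c..d})"
      by (rule DERIV_cmult) (use *[OF y is_solD(2)[OF sol]] in simp)
    then show "((\<lambda>y. m * w' (m * y + p)) has_real_derivative m\<^sup>2 * Q (m * y + p) * w (m * y + p)) (at y within {c..d})"
      by (simp add: power2_eq_square mult_ac)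
  qed
qed

lemma is_sol_reflect:
  assumes "is_sol Q a b w w'"
  shows "is_sol (\<lambda>x. Q (- x)) (- b) (- a) (\<lambda>x. w (- x)) (\<lambda>x. - w' (- x))"
  using is_sol_affine[OF assms, of "-1" "-b" "-a" 0] by simp

text \<open>Solutions depend Lipschitz-continuously on data and coefficient: the square of the distance
  in phase space obeys a differential inequality of Gronwall type.\<close>

lemma sol_dependence:
  assumes s1: "is_sol Q1 a b w1 w1'" and s2: "is_sol Q2 a b w2 w2'"
    and K: "\<And>x. x \<in> {a..b} \<Longrightarrow> \<bar>Q1 x\<bar> \<le> K"
    and d: "\<And>x. x \<in> {a..b} \<Longrightarrow> \<bar>(Q1 x - Q2 x) * w2 x\<bar> \<le> d"
    and y: "y \<in> {a..b}"
  shows "(w1 y - w2 y)\<^sup>2 + (w1' y - w2' y)\<^sup>2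
    \<le> exp ((K + 2) * (y - a)) * ((w1 a - w2 a)\<^sup>2 + (w1' a - w2' a)\<^sup>2 + d\<^sup>2 * (y - a))"
proof -
  define z where "z x = (w1 x - w2 x)\<^sup>2 + (w1' x - w2' x)\<^sup>2" for x
  define z' where "z' x = 2 * (w1 x - w2 x) * (w1' x - w2' x)
    + 2 * (w1' x - w2' x) * (Q1 x * w1 x - Q2 x * w2 x)" for x
  have sub: "{a..y} \<subseteq> {a..b}" using y by auto
  note D = is_solD[OF is_sol_subinterval[OF s1 sub]] is_solD[OF is_sol_subinterval[OF s2 sub]]
  have dz: "(z has_real_derivative z' x) (at x within {a..y})" if "x \<in> {a..y}" for x
    unfolding z_def z'_def using D[OF that]
    by (auto intro!: derivative_eq_intros simp: algebra_simps)
  have K0: "0 \<le> K" using K[OF y] by linarith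
  have z'_le: "z' x \<le> (K + 2) * z x + d\<^sup>2" if "x \<in> {a..y}" for x
  proof -
    have x: "x \<in> {a..b}" using that sub by auto
    define p q r where "p = w1 x - w2 x" and "q = w1' x - w2' x" and "r = (Q1 x - Q2 x) * w2 x"
    have "z' x = 2 * (p * q) * (1 + Q1 x) + 2 * (q * r)"
      by (simp add: z'_def p_def q_def r_def algebra_simps)
    also have "2 * (p * q) * (1 + Q1 x) \<le> \<bar>2 * (p * q)\<bar> * \<bar>1 + Q1 x\<bar>"
      by (simp only: abs_mult[symmetric] abs_ge_self)
    also have "\<dots> \<le> (p\<^sup>2 + q\<^sup>2) * (1 + K)"
    proof (rule mult_mono)
      show "\<bar>2 * (p * q)\<bar> \<le> p\<^sup>2 + q\<^sup>2"
        using sum_squares_bound[of p q] sum_squares_bound[of p "-q"] by (auto simp: abs_le_iff)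
      show "\<bar>1 + Q1 x\<bar> \<le> 1 + K" using K[OF x] by linarith
    qed auto
    also have "2 * (q * r) \<le> q\<^sup>2 + r\<^sup>2" using sum_squares_bound[of q r] by simp
    also have "r\<^sup>2 \<le> d\<^sup>2"
      using power_mono[OF d[OF x] abs_ge_zero, of 2] by (simp add: r_def)
    finally have zle: "z' x \<le> (p\<^sup>2 + q\<^sup>2) * (1 + K) + (q\<^sup>2 + d\<^sup>2)" by simp
    moreover have "z x = p\<^sup>2 + q\<^sup>2" by (simp add: z_def p_def q_def)
    ultimately have "(K + 2) * z x + d\<^sup>2 = (p\<^sup>2 + q\<^sup>2) * (1 + K) + (q\<^sup>2 + d\<^sup>2) + p\<^sup>2"
      by (simp add: algebra_simps)
    then show ?thesis using zle zero_le_power2[of p] by linarith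
  qed
  define g where "g x = exp (- ((K + 2) * (x - a))) * z x - d\<^sup>2 * (x - a)" for x
  have "g y \<le> g a"
  proof (rule nonpos_derivative_imp_ge[where f = g])
    show "a \<le> y" using y by simp
    fix x assume x: "x \<in> {a..y}"
    show "(g has_real_derivative exp (- ((K + 2) * (x - a))) * (z' x - (K + 2) * z x) - d\<^sup>2)
        (at x within {a..y})"
      unfolding g_def using dz[OF x] by (auto intro!: derivative_eq_intros simp: algebra_simps)
    have "exp (- ((K + 2) * (x - a))) * (z' x - (K + 2) * z x) \<le> exp (- ((K + 2) * (x - a))) * d\<^sup>2"
      using z'_le[OF x] by (intro mult_left_mono) auto
    also have "\<dots> \<le> 1 * d\<^sup>2" using x K0 by (intro mult_right_mono) auto
    finally show "exp (- ((K + 2) * (x - a))) * (z' x - (K + 2) * z x) - d\<^sup>2 \<le> 0" by simp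
  qed
  then have "exp (- ((K + 2) * (y - a))) * z y \<le> z a + d\<^sup>2 * (y - a)"
    by (simp add: g_def)
  then have "exp ((K + 2) * (y - a)) * (exp (- ((K + 2) * (y - a))) * z y)
      \<le> exp ((K + 2) * (y - a)) * (z a + d\<^sup>2 * (y - a))"
    by (intro mult_left_mono) auto
  then show ?thesis by (simp add: mult.assoc[symmetric] exp_add[symmetric] z_def)
qed

lemma sol_unique:
  assumes s1: "is_sol Q a b w1 w1'" and s2: "is_sol Q a b w2 w2'"
    and Q: "continuous_on {a..b} Q" and "w1 a = w2 a" "w1' a = w2' a" and y: "y \<in> {a..b}"
  shows "w1 y = w2 y \<and> w1' y = w2' y"
proof -
  obtain K where K: "\<And>x. x \<in> {a..b} \<Longrightarrow> \<bar>Q x\<bar> \<le> K"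
    using continuous_on_interval_bounded[OF Q] by metis
  have "(w1 y - w2 y)\<^sup>2 + (w1' y - w2' y)\<^sup>2 \<le> 0"
    using sol_dependence[OF s1 s2 K, of 0 y] y assms by auto
  then show ?thesis by (simp add: sum_power2_le_zero_iff)
qed

lemma sol_unique_right:
  assumes s1: "is_sol Q a b w1 w1'" and s2: "is_sol Q a b w2 w2'"
    and Q: "continuous_on {a..b} Q" and "w1 b = w2 b" "w1' b = w2' b" and y: "y \<in> {a..b}"
  shows "w1 y = w2 y \<and> w1' y = w2' y"
proof -
  have "continuous_on {-b..-a} (\<lambda>x. Q (- x))"
    by (rule continuous_on_compose2[OF Q]) (auto intro!: continuous_intros)
  from sol_unique[OF is_sol_reflect[OF s1] is_sol_reflect[OF s2] this, of "-y"]
  show ?thesis using assms by auto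
qed

text \<open>Existence by the contraction principle: in the norm weighted with \<open>exp (- l x)\<close> the double
  integration gains the factor \<open>1 / l\<^sup>2\<close>.\<close>

lemma linear_ode_exists:
  assumes ab: "a \<le> b" and Q: "continuous_on {a..b} Q"
  shows "\<exists>w w'. w a = \<alpha> \<and> w' a = \<beta> \<and> is_sol Q a b w w'"
proof -
  obtain K where K: "\<And>x. x \<in> {a..b} \<Longrightarrow> \<bar>Q x\<bar> \<le> K"
    using continuous_on_interval_bounded[OF Q] by metis
  have K0: "0 \<le> K" using K[of a] ab by fastforce
  define l where "l = K + 1"
  have l: "l > 0" using K0 by (simp add: l_def)
  have exp_int: "integral {a..t} (\<lambda>s. exp (l * s)) \<le> exp (l * t) / l" if "a \<le> t" for t
  proof -
    have "((\<lambda>s. exp (l * s)) has_integral exp (l * t) / l - exp (l * a) / l) {a..t}"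
      using that l by (intro fundamental_theorem_of_calculus)
        (auto intro!: derivative_eq_intros simp flip: has_real_derivative_iff_has_vector_derivative)
    then have "integral {a..t} (\<lambda>s. exp (l * s)) = exp (l * t) / l - exp (l * a) / l" by blast
    moreover have "exp (l * a) / l > 0" using l by simp
    ultimately show ?thesis by linarith
  qed
  have exp_intg: "(\<lambda>s. c * exp (l * s)) integrable_on {a..t}" for t c
    by (intro integrable_continuous_real continuous_intros)
  define I1 where "I1 z t = \<beta> + integral {a..t} (\<lambda>s. Q s * (exp (l * s) * z s))" for z :: "real \<Rightarrow> real" and t
  define I2 where "I2 z y = \<alpha> + integral {a..y} (I1 z)" for z y
  define c where "c y = max a (min b y)" for y
  define g where "g z y = exp (- (l * c y)) * I2 z (c y)" for z y
  have c: "c y \<in> {a..b}" "c y \<ge> a" for y using ab by (auto simp: c_def)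
  have c_id: "c y = y" if "y \<in> {a..b}" for y using that by (auto simp: c_def)
  have int0: "continuous_on {a..b} (\<lambda>s. Q s * (exp (l * s) * z s))" if "continuous_on {a..b} z" for z
    by (intro continuous_intros Q that)
  have I1c: "continuous_on {a..b} (I1 z)" if "continuous_on {a..b} z" for z
    unfolding I1_def
    by (intro continuous_intros indefinite_integral_continuous_1 integrable_continuous_real int0 that)
  have I2c: "continuous_on {a..b} (I2 z)" if "continuous_on {a..b} z" for z
    unfolding I2_def
    by (intro continuous_intros indefinite_integral_continuous_1 integrable_continuous_real I1c that)
  have g_bc: "g (apply_bcontfun z) \<in> bcontfun" for z
  proof -
    define k where "k x = exp (- (l * x)) * I2 (apply_bcontfun z) x" for x
    have k: "continuous_on {a..b} k" unfolding k_def by (intro continuous_intros I2c) auto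
    then obtain B where B: "\<And>x. x \<in> {a..b} \<Longrightarrow> \<bar>k x\<bar> \<le> B"
      using continuous_on_interval_bounded by metis
    show ?thesis
    proof (rule bcontfun_normI)
      have "continuous_on UNIV c" unfolding c_def by (intro continuous_intros)
      then have "continuous_on UNIV (\<lambda>y. k (c y))"
        by (rule continuous_on_compose2[OF k]) (use c in auto)
      then show "continuous_on UNIV (g (apply_bcontfun z))" by (simp add: k_def g_def[abs_def])
      show "norm (g (apply_bcontfun z) x) \<le> B" for x
        using B[OF c(1)[of x]] by (simp add: g_def k_def)
    qed
  qed
  define T where "T z = Bcontfun (g (apply_bcontfun z))" for z
  have T: "apply_bcontfun (T z) = g (apply_bcontfun z)" for z
    unfolding T_def using g_bc by (rule Bcontfun_inverse)
  have contr: "dist (T z1) (T z2) \<le> 1/2 * dist z1 z2" for z1 z2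
  proof (rule dist_bound)
    fix y
    define D where "D = dist z1 z2"
    have z: "\<bar>apply_bcontfun z1 s - apply_bcontfun z2 s\<bar> \<le> D" for s
      using dist_bounded[of z1 s z2] by (simp add: D_def dist_real_def)
    have D0: "0 \<le> D" by (simp add: D_def)
    have cz: "continuous_on {a..b} (apply_bcontfun z)" for z :: "real \<Rightarrow>\<^sub>C real" by auto
    have sub: "{a..t} \<subseteq> {a..b}" if "t \<in> {a..b}" for t using that by auto
    have i0: "(\<lambda>s. Q s * (exp (l * s) * apply_bcontfun z s)) integrable_on {a..t}" if "t \<in> {a..b}" for t z
      by (intro integrable_continuous_real continuous_on_subset[OF int0 sub] that) auto
    have d1: "\<bar>I1 z1 t - I1 z2 t\<bar> \<le> K * D / l * exp (l * t)" if t: "t \<in> {a..b}" for t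
    proof -
      have "I1 z1 t - I1 z2 t =
          integral {a..t} (\<lambda>s. Q s * (exp (l * s) * z1 s) - Q s * (exp (l * s) * z2 s))"
        unfolding I1_def by (subst Henstock_Kurzweil_Integration.integral_diff[OF i0[OF t] i0[OF t]]) simp
      also have "\<bar>\<dots>\<bar> \<le> integral {a..t} (\<lambda>s. (K * D) * exp (l * s))"
        unfolding real_norm_def[symmetric]
      proof (rule Henstock_Kurzweil_Integration.integral_norm_bound_integral)
        show "(\<lambda>s. Q s * (exp (l * s) * z1 s) - Q s * (exp (l * s) * z2 s)) integrable_on {a..t}"
          by (intro Henstock_Kurzweil_Integration.integrable_diff i0 t)
        show "(\<lambda>s. (K * D) * exp (l * s)) integrable_on {a..t}" by (rule exp_intg)
        fix s assume "s \<in> {a..t}"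
        then have s: "a \<le> s \<and> s \<le> t" by simp
        have "\<bar>Q s * (exp (l * s) * z1 s) - Q s * (exp (l * s) * z2 s)\<bar> = \<bar>Q s\<bar> * \<bar>z1 s - z2 s\<bar> * exp (l * s)"
          by (simp add: abs_mult flip: right_diff_distrib)
        also have "\<dots> \<le> K * D * exp (l * s)"
          using s t by (intro mult_right_mono mult_mono K z) (auto simp: K0)
        finally show "norm (Q s * (exp (l * s) * z1 s) - Q s * (exp (l * s) * z2 s)) \<le> (K * D) * exp (l * s)" by simp
      qed
      also have "\<dots> = K * D * integral {a..t} (\<lambda>s. exp (l * s))" by simp
      also have "\<dots> \<le> K * D * (exp (l * t) / l)"
        using t K0 D0 by (intro mult_left_mono exp_int) auto
      finally show ?thesis by simp
    qed
    have i1: "I1 (apply_bcontfun z) integrable_on {a..t}" if "t \<in> {a..b}" for t z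
      by (intro integrable_continuous_real continuous_on_subset[OF I1c sub] that) auto
    have d2: "\<bar>I2 z1 t - I2 z2 t\<bar> \<le> K * D / l / l * exp (l * t)" if t: "t \<in> {a..b}" for t
    proof -
      have "I2 z1 t - I2 z2 t = integral {a..t} (\<lambda>s. I1 z1 s - I1 z2 s)"
        unfolding I2_def by (subst Henstock_Kurzweil_Integration.integral_diff[OF i1[OF t] i1[OF t]]) simp
      also have "\<bar>\<dots>\<bar> \<le> integral {a..t} (\<lambda>s. (K * D / l) * exp (l * s))"
        unfolding real_norm_def[symmetric]
      proof (rule Henstock_Kurzweil_Integration.integral_norm_bound_integral)
        show "(\<lambda>s. I1 z1 s - I1 z2 s) integrable_on {a..t}"
          by (intro Henstock_Kurzweil_Integration.integrable_diff i1 t)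
        show "(\<lambda>s. (K * D / l) * exp (l * s)) integrable_on {a..t}" by (rule exp_intg)
        show "norm (I1 z1 s - I1 z2 s) \<le> (K * D / l) * exp (l * s)" if "s \<in> {a..t}" for s
          using d1[of s] that t by auto
      qed
      also have "\<dots> = K * D / l * integral {a..t} (\<lambda>s. exp (l * s))" by simp
      also have "\<dots> \<le> K * D / l * (exp (l * t) / l)"
        using t K0 D0 l by (intro mult_left_mono exp_int) auto
      finally show ?thesis by simp
    qed
    have "dist (T z1 y) (T z2 y) = exp (- (l * c y)) * \<bar>I2 z1 (c y) - I2 z2 (c y)\<bar>"
      by (simp add: T g_def dist_real_def abs_mult flip: right_diff_distrib)
    also have "\<dots> \<le> exp (- (l * c y)) * (K * D / l / l * exp (l * c y))"
      by (intro mult_left_mono d2 c) auto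
    also have "\<dots> = K / (l * l) * D" by (simp add: field_simps flip: exp_add)
    also have "\<dots> \<le> 1 / 2 * D"
    proof (rule mult_right_mono[OF _ D0])
      have "2 * K \<le> l * l" using K0 by (simp add: l_def algebra_simps)
      then show "K / (l * l) \<le> 1 / 2" using l by (simp add: divide_simps)
    qed
    finally show "dist (T z1 y) (T z2 y) \<le> 1 / 2 * dist z1 z2" by (simp add: D_def)
  qed
  obtain z where z: "T z = z"
    using banach_fix_type[of "1/2" T] contr by auto
  have fixp: "exp (l * t) * z t = I2 z t" if "t \<in> {a..b}" for t
  proof -
    have "apply_bcontfun z t = g z t" using T[of z] z by simp
    then show ?thesis using c_id[OF that] by (simp add: g_def exp_minus)
  qed
  show ?thesis
  proof (intro exI conjI)
    show "I2 z a = \<alpha>" "I1 z a = \<beta>" by (simp_all add: I1_def I2_def)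
    show "is_sol Q a b (I2 z) (I1 z)"
      unfolding is_sol_def
    proof (intro ballI conjI)
      fix t assume t: "t \<in> {a..b}"
      show "(I2 z has_real_derivative I1 z t) (at t within {a..b})"
        unfolding I2_def[abs_def]
        by (rule derivative_eq_intros integral_has_real_derivative I1c t refl | simp)+
      have "(I1 z has_real_derivative Q t * (exp (l * t) * z t)) (at t within {a..b})"
        unfolding I1_def[abs_def]
        by (rule derivative_eq_intros integral_has_real_derivative[OF int0] t refl | simp)+
      then show "(I1 z has_real_derivative Q t * I2 z t) (at t within {a..b})"
        using fixp[OF t] by simp
    qed
  qed
qed

lemma linear_ode_exists_right:
  assumes ab: "a \<le> b" and Q: "continuous_on {a..b} Q"
  shows "\<exists>w w'. w b = \<alpha> \<and> w' b = \<beta> \<and> is_sol Q a b w w'"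
proof -
  have "continuous_on {-b..-a} (\<lambda>x. Q (- x))"
    by (rule continuous_on_compose2[OF Q]) (auto intro!: continuous_intros)
  from linear_ode_exists[OF _ this, of \<alpha> "-\<beta>"] ab
  obtain w w' where "w (-b) = \<alpha>" "w' (-b) = - \<beta>" "is_sol (\<lambda>x. Q (- x)) (-b) (-a) w w'" by auto
  with is_sol_reflect[OF this(3)] show ?thesis
    by (intro exI[of _ "\<lambda>x. w (- x)"] exI[of _ "\<lambda>x. - w' (- x)"]) simp
qed

lemma wronskian_has_derivative:
  assumes "is_sol Q1 a b w1 w1'" "is_sol Q2 a b w2 w2'" "x \<in> {a..b}"
  shows "((\<lambda>x. w1' x * w2 x - w1 x * w2' x) has_real_derivative (Q1 x - Q2 x) * (w1 x * w2 x))
    (at x within {a..b})"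
  using is_solD[OF assms(1,3)] is_solD[OF assms(2,3)]
  by (auto intro!: derivative_eq_intros simp: algebra_simps)

lemma wronskian_constant:
  assumes "is_sol Q a b w z" "is_sol Q a b w2 z2" "x \<in> {a..b}" "y \<in> {a..b}"
  shows "z x * w2 x - w x * z2 x = z y * w2 y - w y * z2 y"
proof -
  have "((\<lambda>x. z x * w2 x - w x * z2 x) has_real_derivative 0) (at x within {a..b})"
    if "x \<in> {a..b}" for x
    using wronskian_has_derivative[OF assms(1,2) that] by simp
  then obtain c where "\<And>x. x \<in> {a..b} \<Longrightarrow> z x * w2 x - w x * z2 x = c"
    using has_field_derivative_zero_constant[of "{a..b}" "\<lambda>x. z x * w2 x - w x * z2 x"] by auto
  then show ?thesis using assms(3,4) by metis
qed

text \<open>A solution leaving zero upwards under a non-negative coefficient stays convex, because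
  \<open>w\<^sup>2\<close> cannot decrease and so \<open>w\<close> cannot change sign.\<close>

lemma sol_from_zero:
  assumes s: "is_sol Q a b w w'" and w0: "w a = 0" "w' a = 1"
    and Q: "\<And>x. x \<in> {a..b} \<Longrightarrow> 0 \<le> Q x" and Qc: "continuous_on {a..b} Q" and y: "y \<in> {a..b}"
  shows "1 \<le> w' y" and "0 \<le> w y" and "a < y \<Longrightarrow> 0 < w y"
proof -
  have nonneg: "0 \<le> w y" if y: "y \<in> {a..b}" for y
  proof (rule ccontr)
    assume neg: "\<not> 0 \<le> w y"
    then have ay: "a < y" using w0 y by (cases "a = y") auto
    have sub: "is_sol Q a y w w'" using is_sol_subinterval[OF s, of a y] y by auto
    have ww': "0 \<le> w x * w' x" if x: "x \<in> {a..y}" for x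
    proof -
      have "w a * w' a \<le> w x * w' x"
      proof (rule nonneg_derivative_imp_le[where f = "\<lambda>x. w x * w' x"])
        show "a \<le> x" using x by simp
        fix t assume t: "t \<in> {a..x}"
        have sx: "is_sol Q a x w w'" using is_sol_subinterval[OF sub, of a x] x by auto
        show "((\<lambda>x. w x * w' x) has_real_derivative (w' t)\<^sup>2 + Q t * (w t)\<^sup>2) (at t within {a..x})"
          using is_solD[OF sx t] by (auto intro!: derivative_eq_intros simp: power2_eq_square)
        show "0 \<le> (w' t)\<^sup>2 + Q t * (w t)\<^sup>2" using Q[of t] t x y by auto
      qed
      then show ?thesis using w0 by simp
    qed
    have mono: "(w x)\<^sup>2 \<le> (w t)\<^sup>2" if xt: "a \<le> x" "x \<le> t" "t \<le> y" for x t
    proof (rule nonneg_derivative_imp_le[OF xt(2), where f = "\<lambda>x. (w x)\<^sup>2"])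
      fix r assume r: "r \<in> {x..t}"
      have sx: "is_sol Q x t w w'" using is_sol_subinterval[OF sub, of x t] xt by auto
      show "((\<lambda>x. (w x)\<^sup>2) has_real_derivative 2 * (w r * w' r)) (at r within {x..t})"
        using is_solD[OF sx r] by (auto intro!: derivative_eq_intros)
      show "0 \<le> 2 * (w r * w' r)" using ww'[of r] r xt by auto
    qed
    \<comment> \<open>just to the right of \<open>a\<close> the solution is positive, since \<open>w' a = 1\<close>\<close>
    have "(w has_real_derivative 1) (at a within {a..y})"
      using is_solD(1)[OF sub, of a] ay w0 by simp
    then obtain d where d: "d > 0" "\<And>h. 0 < h \<Longrightarrow> a + h \<in> {a..y} \<Longrightarrow> h < d \<Longrightarrow> w a < w (a + h)"
      using has_real_derivative_pos_inc_right[of w 1 a "{a..y}"] by auto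
    define x where "x = a + min (d / 2) (y - a)"
    have x: "a < x" "x \<le> y" "0 < w x"
      using d(1) d(2)[of "min (d / 2) (y - a)"] ay w0 by (auto simp: x_def)
    have "continuous_on {x..y} w"
      using is_sol_continuous(1)[OF sub] by (rule continuous_on_subset) (use x in auto)
    then obtain t where t: "x \<le> t" "t \<le> y" "w t = 0"
      using IVT2'[of w y 0 x] x neg by auto
    then have "(w x)\<^sup>2 \<le> 0" using mono[of x t] x by auto
    then show False using x by simp
  qed
  have deriv: "1 \<le> w' y" if y: "y \<in> {a..b}" for y
  proof -
    have "w' a \<le> w' y"
    proof (rule nonneg_derivative_imp_le[where f = w'])
      fix t assume t: "t \<in> {a..y}"
      have "is_sol Q a y w w'" using is_sol_subinterval[OF s, of a y] y by auto
      then show "(w' has_real_derivative Q t * w t) (at t within {a..y})" using is_solD t by blast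
      show "0 \<le> Q t * w t" using t y Q[of t] nonneg[of t] by auto
    qed (use y in auto)
    then show ?thesis using w0 by simp
  qed
  show "1 \<le> w' y" "0 \<le> w y" using deriv nonneg y by auto
  show "0 < w y" if ay: "a < y"
  proof -
    obtain x where "a < x" "x < y" "w y - w a = w' x * (y - a)"
      using mvt_within[OF ay, of w w'] is_solD(1)[OF is_sol_subinterval[OF s, of a y]] y by auto
    moreover have "0 < w' x * (y - a)" using deriv[of x] y calculation by (intro mult_pos_pos) auto
    ultimately show ?thesis using w0 by simp
  qed
qed

text \<open>If the coefficient is close to \<open>\<kappa>\<^sup>2\<close> on the last stretch of length \<open>R\<close>, the growing mode
  \<open>exp (\<kappa> x)\<close> has taken over: \<open>p = w' - \<kappa> w\<close> obeys \<open>p' = - \<kappa> p + (Q - \<kappa>\<^sup>2) w\<close>, so it is damped at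
  rate \<open>\<kappa>\<close>, while at the beginning of the stretch convexity bounds \<open>w'\<close> by the final value of \<open>w\<close>.\<close>

lemma log_derivative_estimate:
  assumes s: "is_sol Q a b w w'" and w0: "w a = 0" "w' a = 1"
    and Q: "\<And>x. x \<in> {a..b} \<Longrightarrow> 0 \<le> Q x" and Qc: "continuous_on {a..b} Q"
    and k: "\<kappa> > 0" and R: "1 \<le> R" "a \<le> b - R"
    and r: "\<And>x. x \<in> {b - R..b} \<Longrightarrow> \<bar>Q x - \<kappa>\<^sup>2\<bar> \<le> \<rho>"
  shows "\<bar>w' b - \<kappa> * w b\<bar> \<le> w b * (exp (- \<kappa> * R) * (1 + \<kappa>) + \<rho> / \<kappa>)"
proof -
  define c where "c = b - R"
  have c: "a \<le> c" "c + 1 \<le> b" "c < b" using R by (auto simp: c_def)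
  have pos: "1 \<le> w' x" "0 \<le> w x" if "x \<in> {a..b}" for x
    using sol_from_zero[OF s w0 Q Qc that] by auto
  have w_mono: "w x \<le> w b" if x: "x \<in> {a..b}" for x
  proof (rule nonneg_derivative_imp_le[where f = w])
    fix t assume t: "t \<in> {x..b}"
    have "is_sol Q x b w w'" using is_sol_subinterval[OF s, of x b] x by auto
    then show "(w has_real_derivative w' t) (at t within {x..b})" using is_solD t by blast
    show "0 \<le> w' t" using pos(1)[of t] t x by auto
  qed (use x in auto)
  have w'_mono: "w' x \<le> w' y" if xy: "x \<in> {a..b}" "y \<in> {a..b}" "x \<le> y" for x y
  proof (rule nonneg_derivative_imp_le[OF xy(3), where f = w'])
    fix t assume t: "t \<in> {x..y}"
    have "is_sol Q x y w w'" using is_sol_subinterval[OF s, of x y] xy by auto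
    then show "(w' has_real_derivative Q t * w t) (at t within {x..y})" using is_solD t by blast
    show "0 \<le> Q t * w t" using pos(2)[of t] t xy Q[of t] by auto
  qed
  have w'c: "w' c \<le> w b"
  proof -
    obtain x where x: "c < x" "x < b" "w b - w c = w' x * (b - c)"
      using mvt_within[OF c(3), of w w'] is_solD(1)[OF is_sol_subinterval[OF s, of c b]] c by auto
    have "w' c \<le> w' x" using w'_mono[of c x] x c by auto
    also have "w' x * 1 \<le> w' x * (b - c)"
      using pos(1)[of x] x c by (intro mult_left_mono) auto
    finally show ?thesis using x(3) pos(2)[of c] c by simp
  qed
  define p where "p x = w' x - \<kappa> * w x" for x
  have pc: "\<bar>p c\<bar> \<le> (1 + \<kappa>) * w b"
  proof -
    have "0 \<le> \<kappa> * w c" "\<kappa> * w c \<le> \<kappa> * w b"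
      using pos(2)[of c] w_mono[of c] k c by auto
    moreover have "0 \<le> \<kappa> * w b" using pos(2)[of b] k c by auto
    moreover have "0 \<le> w b" using pos(2)[of b] c by auto
    ultimately show ?thesis using pos(1)[of c] w'c c by (simp add: p_def abs_le_iff algebra_simps)
  qed
  have sc: "is_sol Q c b w w'" using is_sol_subinterval[OF s, of c b] c by auto
  have bound: "\<sigma> * p b - \<rho> * w b / \<kappa> \<le> exp (\<kappa> * (c - b)) * (\<sigma> * p c - \<rho> * w b / \<kappa>)"
    if \<sigma>: "\<bar>\<sigma>\<bar> = 1" for \<sigma>
  proof -
    have "exp (\<kappa> * (b - b)) * (\<sigma> * p b - \<rho> * w b / \<kappa>) \<le> exp (\<kappa> * (c - b)) * (\<sigma> * p c - \<rho> * w b / \<kappa>)"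
    proof (rule nonpos_derivative_imp_ge[where f = "\<lambda>x. exp (\<kappa> * (x - b)) * (\<sigma> * p x - \<rho> * w b / \<kappa>)"])
      fix x assume x: "x \<in> {c..b}"
      show "((\<lambda>x. exp (\<kappa> * (x - b)) * (\<sigma> * p x - \<rho> * w b / \<kappa>)) has_real_derivative
          exp (\<kappa> * (x - b)) * (\<sigma> * ((Q x - \<kappa>\<^sup>2) * w x) - \<rho> * w b)) (at x within {c..b})"
        unfolding p_def using is_solD[OF sc x] k
        by (auto intro!: derivative_eq_intros simp: field_simps power2_eq_square)
      have xab: "x \<in> {a..b}" using x c by auto
      have "\<sigma> * ((Q x - \<kappa>\<^sup>2) * w x) \<le> \<bar>Q x - \<kappa>\<^sup>2\<bar> * \<bar>w x\<bar>"
        using abs_ge_self[of "\<sigma> * ((Q x - \<kappa>\<^sup>2) * w x)"] \<sigma> by (simp add: abs_mult)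
      also have "\<dots> \<le> \<rho> * w b"
      proof -
        have "0 \<le> \<rho>" using r[of b] R by fastforce
        then show ?thesis
          using r[of x] x w_mono[OF xab] pos(2)[OF xab] by (intro mult_mono) (auto simp: c_def)
      qed
      finally show "exp (\<kappa> * (x - b)) * (\<sigma> * ((Q x - \<kappa>\<^sup>2) * w x) - \<rho> * w b) \<le> 0"
        by (simp add: mult_nonneg_nonpos)
    qed (use c in auto)
    then show ?thesis by simp
  qed
  have e: "exp (\<kappa> * (c - b)) = exp (- \<kappa> * R)" by (simp add: c_def algebra_simps)
  have wb: "0 \<le> \<rho> * w b / \<kappa>"
    using r[of b] R pos(2)[of b] c k by (intro divide_nonneg_pos mult_nonneg_nonneg) force+
  have "\<sigma> * p b \<le> w b * (exp (- \<kappa> * R) * (1 + \<kappa>) + \<rho> / \<kappa>)" if \<sigma>: "\<bar>\<sigma>\<bar> = 1" for \<sigma>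
  proof -
    have "\<sigma> * p c \<le> (1 + \<kappa>) * w b"
      using pc \<sigma> abs_ge_self[of "\<sigma> * p c"] by (simp add: abs_mult)
    then have "exp (- \<kappa> * R) * (\<sigma> * p c - \<rho> * w b / \<kappa>) \<le> exp (- \<kappa> * R) * ((1 + \<kappa>) * w b)"
      using wb by (intro mult_left_mono) auto
    then have "\<sigma> * p b - \<rho> * w b / \<kappa> \<le> exp (- \<kappa> * R) * ((1 + \<kappa>) * w b)"
      using bound[OF \<sigma>] unfolding e by linarith
    then show ?thesis by (simp add: algebra_simps)
  qed
  from this[of 1] this[of "-1"] show ?thesis by (simp add: p_def abs_le_iff)
qed

section \<open>Smooth functions and test functions\<close>

lemma smooth_differentiable: "smooth f \<Longrightarrow> f field_differentiable at x"
  unfolding smooth_def by (metis funpow_0)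

lemma smooth_deriv: "smooth f \<Longrightarrow> smooth (deriv f)"
  unfolding smooth_def by (metis comp_apply funpow_Suc_right)

lemma smooth_has_derivative:
  "smooth f \<Longrightarrow> (f has_real_derivative deriv f x) (at x within S)"
  using smooth_differentiable[of f x]
  by (simp add: field_differentiable_derivI has_field_derivative_at_within)

lemma smooth_continuous_on: "smooth f \<Longrightarrow> continuous_on S f"
  by (meson DERIV_continuous continuous_on_eq_continuous_within smooth_has_derivative)

lemma smooth_coinduct:
  assumes "P f"
    and diff: "\<And>g x. P g \<Longrightarrow> g field_differentiable at x"
    and step: "\<And>g. P g \<Longrightarrow> P (deriv g)"
  shows "smooth f"
proof -
  have "P ((deriv ^^ k) f)" for k
    by (induction k) (use assms in auto)
  then show ?thesis
    unfolding smooth_def using diff by blast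
qed

text \<open>The functions \<open>x\<^sup>-\<^sup>k exp (-1/x)\<close>, extended by zero, are closed under differentiation up to
  linear combinations; for \<open>k = 0\<close> this is the standard flat function.\<close>

definition flat :: "nat \<Rightarrow> real \<Rightarrow> real" where
  "flat k x = (if x > 0 then inverse x ^ k * exp (- inverse x) else 0)"

lemma flat_over_x_tendsto: "((\<lambda>x. flat k x / x) \<longlongrightarrow> 0) (at 0)"
proof (rule filterlim_split_at)
  have *: "((\<lambda>x. inverse x ^ Suc k / exp (inverse x)) \<longlongrightarrow> 0) (at_right (0::real))"
    by (rule filterlim_compose[OF tendsto_power_div_exp_0 filterlim_inverse_at_top_right])
  show "((\<lambda>x. flat k x / x) \<longlongrightarrow> 0) (at_right 0)"
    by (rule Lim_transform_eventually[OF *])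
      (auto simp: eventually_at_filter flat_def exp_minus divide_simps)
  have "\<forall>\<^sub>F x in at_left (0::real). flat k x / x = 0"
    by (auto simp: eventually_at_filter flat_def)
  then show "((\<lambda>x. flat k x / x) \<longlongrightarrow> 0) (at_left 0)"
    by (rule tendsto_eventually)
qed

lemma flat_has_derivative:
  "(flat k has_real_derivative flat (k + 2) x - real k * flat (k + 1) x) (at x)"
proof -
  consider "x < 0" | "x = 0" | "x > 0" by linarith
  then show ?thesis
  proof cases
    case 1
    have "((\<lambda>x. 0) has_real_derivative 0) (at x)" by simp
    then have "(flat k has_real_derivative 0) (at x)"
      by (rule DERIV_cong_ev[THEN iffD1, rotated -1])
        (use 1 in \<open>auto simp: flat_def intro!: eventually_mono[OF eventually_nhds_in_open[of "{..<0}"]]\<close>)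
    then show ?thesis using 1 by (simp add: flat_def)
  next
    case 2
    have "(flat k has_real_derivative 0) (at 0)"
      using flat_over_x_tendsto[of k] by (simp add: has_field_derivative_iff flat_def)
    then show ?thesis using 2 by (simp add: flat_def)
  next
    case 3
    have "((\<lambda>x. inverse x ^ k * exp (- inverse x)) has_real_derivative
        flat (k + 2) x - real k * flat (k + 1) x) (at x)"
      using 3 by (auto intro!: derivative_eq_intros simp: flat_def field_simps power2_eq_square)
        (cases k; simp add: field_simps)
    then show ?thesis
      by (rule DERIV_cong_ev[THEN iffD1, rotated -1])
        (use 3 in \<open>auto simp: flat_def intro!: eventually_mono[OF eventually_nhds_in_open[of "{0<..}"]]\<close>)
  qed
qed

text \<open>One coinduction over this algebra gives all the closure properties of smooth functions.\<close>

inductive smooth_alg :: "(real \<Rightarrow> real) \<Rightarrow> bool" where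
  base: "smooth f \<Longrightarrow> smooth_alg f"
| const: "smooth_alg (\<lambda>x. c)"
| ident: "smooth_alg (\<lambda>x. x)"
| flat: "smooth_alg (flat k)"
| add: "smooth_alg f \<Longrightarrow> smooth_alg g \<Longrightarrow> smooth_alg (\<lambda>x. f x + g x)"
| mult: "smooth_alg f \<Longrightarrow> smooth_alg g \<Longrightarrow> smooth_alg (\<lambda>x. f x * g x)"
| affine: "smooth_alg f \<Longrightarrow> smooth_alg (\<lambda>x. f (a * x + b))"

lemma smooth_alg_has_derivative:
  "smooth_alg f \<Longrightarrow> \<exists>f'. smooth_alg f' \<and> (\<forall>x. (f has_real_derivative f' x) (at x))"
proof (induction rule: smooth_alg.induct)
  case (base f)
  then show ?case
    using smooth_deriv smooth_has_derivative smooth_alg.base by blast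
next
  case (const c)
  show ?case by (rule exI[of _ "\<lambda>x. 0"]) (auto intro: smooth_alg.const)
next
  case ident
  show ?case by (rule exI[of _ "\<lambda>x. 1"]) (auto intro: smooth_alg.const)
next
  case (flat k)
  have "smooth_alg (\<lambda>x. flat (k + 2) x + (- real k) * flat (k + 1) x)"
    by (intro smooth_alg.add smooth_alg.mult smooth_alg.const smooth_alg.flat)
  then show ?case
    using flat_has_derivative[of k] by (intro exI[of _ "\<lambda>x. flat (k + 2) x + (- real k) * flat (k + 1) x"]) auto
next
  case (add f g)
  then show ?case
    by (metis (mono_tags, lifting) DERIV_add smooth_alg.add)
next
  case (mult f g)
  then obtain f' g' where "smooth_alg f'" "\<forall>x. (f has_real_derivative f' x) (at x)"
    "smooth_alg g'" "\<forall>x. (g has_real_derivative g' x) (at x)" by blast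
  then show ?case
    using mult by (intro exI[of _ "\<lambda>x. f' x * g x + g' x * f x"])
      (auto intro: smooth_alg.add smooth_alg.mult DERIV_mult)
next
  case (affine f a b)
  then obtain f' where f': "smooth_alg f'" "\<forall>x. (f has_real_derivative f' x) (at x)" by blast
  have "((\<lambda>x. f (a * x + b)) has_real_derivative f' (a * x + b) * a) (at x)" for x
    by (rule DERIV_chain2[OF f'(2)[rule_format]]) (auto intro!: derivative_eq_intros)
  then show ?case
    using f'(1) by (intro exI[of _ "\<lambda>x. f' (a * x + b) * a"]) (auto intro: smooth_alg.mult[OF smooth_alg.affine smooth_alg.const])
qed

lemma smooth_alg_smooth: "smooth_alg f \<Longrightarrow> smooth f"
proof (erule smooth_coinduct[where P = smooth_alg])
  show "g field_differentiable at x" if "smooth_alg g" for g x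
    using smooth_alg_has_derivative[OF that] by (auto simp: field_differentiable_def)
  show "smooth_alg (deriv g)" if g: "smooth_alg g" for g
  proof -
    obtain g' where g': "smooth_alg g'" "\<forall>x. (g has_real_derivative g' x) (at x)"
      using smooth_alg_has_derivative[OF g] by blast
    then have "deriv g = g'" by (intro ext DERIV_imp_deriv) auto
    then show ?thesis using g' by simp
  qed
qed

lemma smooth_const: "smooth (\<lambda>x. c)"
  by (rule smooth_alg_smooth[OF smooth_alg.const])

lemma smooth_flat: "smooth (flat k)"
  by (rule smooth_alg_smooth[OF smooth_alg.flat])

lemma smooth_add: "smooth f \<Longrightarrow> smooth g \<Longrightarrow> smooth (\<lambda>x. f x + g x)"
  by (intro smooth_alg_smooth[OF smooth_alg.add] smooth_alg.base)

lemma smooth_mult: "smooth f \<Longrightarrow> smooth g \<Longrightarrow> smooth (\<lambda>x. f x * g x)"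
  by (intro smooth_alg_smooth[OF smooth_alg.mult] smooth_alg.base)

lemma smooth_cmult: "smooth f \<Longrightarrow> smooth (\<lambda>x. c * f x)"
  by (rule smooth_mult[OF smooth_const])

lemma smooth_affine: "smooth f \<Longrightarrow> smooth (\<lambda>x. f (a * x + b))"
  by (intro smooth_alg_smooth[OF smooth_alg.affine] smooth_alg.base)

lemma smooth_diff: "smooth f \<Longrightarrow> smooth g \<Longrightarrow> smooth (\<lambda>x. f x - g x)"
  using smooth_add[OF _ smooth_mult[OF smooth_const[of "-1"]], of f g] by simp

lemma smooth_polynomial_function: "real_polynomial_function p \<Longrightarrow> smooth p"
proof (induction rule: real_polynomial_function.induct)
  case (linear f)
  then obtain c where "f = (\<lambda>x. x * c)" using real_bounded_linear by blast
  then show ?case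
    using smooth_alg_smooth[OF smooth_alg.mult[OF smooth_alg.ident smooth_alg.const], of c] by simp
qed (auto intro: smooth_const smooth_add smooth_mult)

lemma smooth_antiderivative:
  assumes "smooth f" "\<And>x. (F has_real_derivative f x) (at x)"
  shows "smooth F"
proof -
  have "deriv F = f" using assms(2) by (intro ext DERIV_imp_deriv)
  show ?thesis
  proof (rule smooth_coinduct[where P = "\<lambda>g. g = F \<or> smooth g"])
    show "g field_differentiable at x" if "g = F \<or> smooth g" for g x
      using that assms(2) smooth_differentiable by (auto simp: field_differentiable_def)
    show "deriv g = F \<or> smooth (deriv g)" if "g = F \<or> smooth g" for g
      using that \<open>deriv F = f\<close> assms(1) smooth_deriv by auto
  qed simp
qed

text \<open>A smooth function vanishing off a compact interval inside \<open>\<Omega>\<close> is a test function, and up to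
  enlarging the interval every test function on an interval arises in this way.\<close>

lemma test_functionI:
  assumes "smooth \<phi>" "{a..b} \<subseteq> \<Omega>" "\<And>x. x \<notin> {a..b} \<Longrightarrow> \<phi> x = 0"
  shows "test_function \<Omega> \<phi>"
proof -
  have "closure {x. \<phi> x \<noteq> 0} \<subseteq> {a..b}"
    by (intro closure_minimal subsetI) (use assms(3) in blast, simp)
  moreover from this have "compact (closure {x. \<phi> x \<noteq> 0})"
    by (meson bounded_closed_interval bounded_subset closed_closure compact_eq_bounded_closed)
  ultimately show ?thesis using assms by (auto simp: test_function_def)
qed

lemma test_functionE:
  assumes \<phi>: "test_function \<Omega> \<phi>" and \<Omega>: "is_interval \<Omega>" "c \<in> \<Omega>"
  obtains a b where "a \<le> b" "{a..b} \<subseteq> \<Omega>" "\<And>x. x \<notin> {a..b} \<Longrightarrow> \<phi> x = 0" "c \<in> {a..b}"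
proof -
  define K where "K = insert c (closure {x. \<phi> x \<noteq> 0})"
  have K: "compact K" "K \<noteq> {}" "K \<subseteq> \<Omega>"
    using \<phi> \<Omega> by (auto simp: K_def test_function_def)
  obtain a b where ab: "a \<in> K" "b \<in> K" "\<And>x. x \<in> K \<Longrightarrow> a \<le> x" "\<And>x. x \<in> K \<Longrightarrow> x \<le> b"
    using compact_attains_inf[OF K(1,2)] compact_attains_sup[OF K(1,2)] by metis
  show thesis
  proof
    show "{a..b} \<subseteq> \<Omega>"
    proof
      fix x assume x: "x \<in> {a..b}"
      have "a \<in> \<Omega>" "b \<in> \<Omega>" using ab K(3) by auto
      with x \<Omega>(1) show "x \<in> \<Omega>" unfolding is_interval_1 by (metis atLeastAtMost_iff)
    qed
    show "\<phi> x = 0" if "x \<notin> {a..b}" for x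
    proof (rule ccontr)
      assume "\<phi> x \<noteq> 0"
      then have "x \<in> K" using closure_subset[of "{x. \<phi> x \<noteq> 0}"] by (auto simp: K_def)
      then show False using ab(3,4)[of x] that by simp
    qed
    show c: "c \<in> {a..b}" using ab(3,4)[of c] by (simp add: K_def)
    show "a \<le> b" using c by simp
  qed
qed

lemma test_function_smooth: "test_function \<Omega> \<phi> \<Longrightarrow> smooth \<phi>"
  by (simp add: test_function_def)

text \<open>Because the flat function increases to \<open>1\<close> at infinity, these functions increase to the
  indicator function of the open interval.\<close>

definition plateau :: "real \<Rightarrow> real \<Rightarrow> nat \<Rightarrow> real \<Rightarrow> real" where
  "plateau a b n x = flat 0 (real n * (x - a)) * flat 0 (real n * (b - x))"

lemma flat_0_bounds: "0 \<le> flat 0 x" "flat 0 x \<le> 1"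
  by (auto simp: flat_def)

lemma plateau_bounds: "0 \<le> plateau a b n x" "plateau a b n x \<le> 1"
  unfolding plateau_def using flat_0_bounds by (auto intro!: mult_le_one)

lemma plateau_smooth: "smooth (plateau a b n)"
proof -
  have "smooth (\<lambda>x. flat 0 (real n * x + (- (real n * a))) * flat 0 ((- real n) * x + real n * b))"
    by (intro smooth_mult smooth_affine smooth_flat)
  moreover have "(\<lambda>x. flat 0 (real n * x + (- (real n * a))) * flat 0 ((- real n) * x + real n * b)) = plateau a b n"
    by (auto simp: plateau_def fun_eq_iff algebra_simps)
  ultimately show ?thesis by simp
qed

lemma plateau_zero: "x \<notin> {a<..<b} \<Longrightarrow> plateau a b n x = 0"
  by (auto simp: plateau_def flat_def zero_less_mult_iff)

lemma plateau_positive: "n > 0 \<Longrightarrow> x \<in> {a<..<b} \<Longrightarrow> plateau a b n x > 0"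
  by (auto simp: plateau_def flat_def)

lemma plateau_test_function: "{a..b} \<subseteq> \<Omega> \<Longrightarrow> test_function \<Omega> (plateau a b n)"
  by (rule test_functionI[OF plateau_smooth]) (auto intro: plateau_zero)

lemma flat_0_tendsto:
  assumes "filterlim g at_top F" shows "((\<lambda>n. flat 0 (g n)) \<longlongrightarrow> 1) F"
proof -
  have "((\<lambda>n. exp (- inverse (g n))) \<longlongrightarrow> exp (- 0)) F"
    by (intro tendsto_intros tendsto_inverse_0_at_top assms)
  moreover have "\<forall>\<^sub>F n in F. exp (- inverse (g n)) = flat 0 (g n)"
    using assms filterlim_at_top_dense[of g F] by (auto simp: flat_def elim: eventually_mono)
  ultimately show ?thesis by (simp add: tendsto_cong)
qed

lemma plateau_tendsto: "(\<lambda>n. plateau a b n x) \<longlonglongrightarrow> indicator {a<..<b} x"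
proof (cases "x \<in> {a<..<b}")
  case True
  have *: "filterlim (\<lambda>n. real n * c) at_top sequentially" if "c > 0" for c
    by (intro filterlim_at_top_mult_tendsto_pos[OF tendsto_const that] filterlim_real_sequentially)
  have "(\<lambda>n. plateau a b n x) \<longlonglongrightarrow> 1 * 1"
    unfolding plateau_def using True by (intro tendsto_mult flat_0_tendsto *) auto
  then show ?thesis using True by simp
next
  case False
  then show ?thesis by (simp add: plateau_zero)
qed

section \<open>Lebesgue integrals on an interval\<close>

lemma AE_lebesgue_on_iff:
  assumes "S \<in> sets lebesgue"
  shows "(AE x in lebesgue_on S. P x) \<longleftrightarrow> negligible {x \<in> S. \<not> P x}"
proof -
  have "(AE x in lebesgue_on S. P x) \<longleftrightarrow> (\<exists>N. negligible N \<and> {x. \<not> (x \<in> S \<longrightarrow> P x)} \<subseteq> N)"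
    using assms AE_restrict_space_iff[of S lebesgue P]
      eventually_ae_filter_negligible[of "\<lambda>x. x \<in> S \<longrightarrow> P x"] by simp
  also have "{x. \<not> (x \<in> S \<longrightarrow> P x)} = {x \<in> S. \<not> P x}" by auto
  finally show ?thesis using negligible_subset by blast
qed

lemma AE_lebesgue_on_Ioo_iff:
  fixes a b :: real
  shows "(AE x in lebesgue_on {a<..<b}. P x) \<longleftrightarrow> (AE x in lebesgue_on {a..b}. P x)"
proof -
  have 1: "{x \<in> {a..b}. \<not> P x} \<subseteq> {x \<in> {a<..<b}. \<not> P x} \<union> {a, b}" by auto
  have 2: "{x \<in> {a<..<b}. \<not> P x} \<subseteq> {x \<in> {a..b}. \<not> P x}" by auto
  have 3: "negligible {a, b}" by (rule negligible_finite) auto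
  show ?thesis
    using negligible_subset[OF negligible_Un[OF _ 3] 1] negligible_subset[OF _ 2]
    by (auto simp: AE_lebesgue_on_iff)
qed

lemma lebesgue_on_Ioo:
  fixes f :: "real \<Rightarrow> 'b::euclidean_space"
  shows integrable_lebesgue_on_Ioo: "integrable (lebesgue_on {a<..<b}) f \<longleftrightarrow> integrable (lebesgue_on {a..b}) f"
    and LINT_lebesgue_on_Ioo: "(LINT x|lebesgue_on {a<..<b}. f x) = (LINT x|lebesgue_on {a..b}. f x)"
proof -
  have "f absolutely_integrable_on {a<..<b} \<longleftrightarrow> f absolutely_integrable_on {a..b}"
    using absolutely_integrable_on_open_interval[where f = f and a = a and b = b] by simp
  then show *: "integrable (lebesgue_on {a<..<b}) f \<longleftrightarrow> integrable (lebesgue_on {a..b}) f"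
    by (simp add: integrable_restrict_space set_integrable_def)
  show "(LINT x|lebesgue_on {a<..<b}. f x) = (LINT x|lebesgue_on {a..b}. f x)"
  proof (cases "integrable (lebesgue_on {a..b}) f")
    case True
    then show ?thesis
      using * by (simp add: lebesgue_integral_eq_integral integral_open_interval_real)
  next
    case False
    then show ?thesis using * by (simp add: not_integrable_integral_eq)
  qed
qed

lemma supported_on_subset:
  fixes f :: "real \<Rightarrow> 'b::{banach, second_countable_topology}"
  assumes "K \<subseteq> \<Omega>" "\<Omega> \<in> sets lebesgue" "K \<in> sets lebesgue" "\<And>x. x \<in> \<Omega> - K \<Longrightarrow> f x = 0"
  shows integrable_supported: "integrable (lebesgue_on \<Omega>) f \<longleftrightarrow> integrable (lebesgue_on K) f"
    and LINT_supported: "(LINT x|lebesgue_on \<Omega>. f x) = (LINT x|lebesgue_on K. f x)"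
proof -
  have "(\<lambda>x. indicator \<Omega> x *\<^sub>R f x) = (\<lambda>x. indicator K x *\<^sub>R f x)"
    using assms by (force simp: indicator_def fun_eq_iff)
  then show "integrable (lebesgue_on \<Omega>) f \<longleftrightarrow> integrable (lebesgue_on K) f"
    "(LINT x|lebesgue_on \<Omega>. f x) = (LINT x|lebesgue_on K. f x)"
    using assms by (simp_all add: integrable_restrict_space integral_restrict_space)
qed

lemma continuous_on_compact_integrable:
  fixes f :: "real \<Rightarrow> 'b::euclidean_space"
  assumes K: "compact K" and f: "continuous_on K f"
  shows "integrable (lebesgue_on K) f"
proof -
  have "bounded (f ` K)" by (intro compact_imp_bounded compact_continuous_image f K)
  then obtain B where B: "\<And>x. x \<in> K \<Longrightarrow> norm (f x) \<le> B" by (force simp: bounded_iff)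
  have lm: "K \<in> lmeasurable" using K by (rule lmeasurable_compact)
  then have Ks: "K \<in> sets lebesgue" by (rule fmeasurableD)
  interpret finite_measure "lebesgue_on K" using lm by (rule finite_measure_lebesgue_on)
  show ?thesis
    by (rule measurable_bounded_by_integrable_imp_lebesgue_integrable[where g = "\<lambda>x. B"])
      (use B Ks f in \<open>auto intro: continuous_imp_measurable_on_sets_lebesgue\<close>)
qed

lemma integrable_continuous_mult:
  fixes f :: "real \<Rightarrow> 'b::{banach, second_countable_topology}" and \<phi> :: "real \<Rightarrow> real"
  assumes f: "integrable (lebesgue_on {a..b}) f" and \<phi>: "continuous_on {a..b} \<phi>"
  shows "integrable (lebesgue_on {a..b}) (\<lambda>x. \<phi> x *\<^sub>R f x)"
proof -
  obtain K where K: "0 \<le> K" "\<And>x. x \<in> {a..b} \<Longrightarrow> \<bar>\<phi> x\<bar> \<le> K"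
    using continuous_on_interval_bounded[OF \<phi>] by metis
  have m: "\<phi> \<in> borel_measurable (lebesgue_on {a..b})"
    using \<phi> by (auto intro: continuous_imp_measurable_on_sets_lebesgue)
  show ?thesis
  proof (rule Bochner_Integration.integrable_bound)
    show "integrable (lebesgue_on {a..b}) (\<lambda>x. K *\<^sub>R f x)" using f by simp
    show "(\<lambda>x. \<phi> x *\<^sub>R f x) \<in> borel_measurable (lebesgue_on {a..b})"
      using m f by (intro borel_measurable_scaleR) auto
    show "AE x in lebesgue_on {a..b}. norm (\<phi> x *\<^sub>R f x) \<le> norm (K *\<^sub>R f x)"
      using K by (intro AE_I2) (auto intro!: mult_right_mono)
  qed
qed

text \<open>By the Lebesgue differentiation theorem: almost everywhere a function is the limit of its means
  over shrinking intervals.\<close>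

lemma integral_zero_imp_AE_zero:
  fixes w :: "real \<Rightarrow> real"
  assumes w: "w integrable_on {a..b}"
    and z: "\<And>c d. a \<le> c \<Longrightarrow> c \<le> d \<Longrightarrow> d \<le> b \<Longrightarrow> integral {c..d} w = 0"
  shows "negligible {x \<in> {a..b}. w x \<noteq> 0}"
proof -
  define g where "g x = (if x \<in> {a..b} then w x else 0)" for x
  have "g integrable_on UNIV"
    using Henstock_Kurzweil_Integration.integrable_restrict_UNIV[of "{a..b}" w] w
    by (simp add: g_def[abs_def] del: atLeastAtMost_iff)
  then have "g integrable_on cbox c d" for c d
    by (rule integrable_on_subcbox) auto
  then obtain N where N: "negligible N" "\<And>x e. \<lbrakk>x \<notin> N; 0 < e\<rbrakk> \<Longrightarrow>
      \<exists>d>0. \<forall>h. 0 < h \<and> h < d \<longrightarrow> norm (integral (cbox x (x + h *\<^sub>R One)) g /\<^sub>R h ^ DIM(real) - g x) < e"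
    using integrable_ccontinuous_explicit by blast
  have "{x \<in> {a..b}. w x \<noteq> 0} \<subseteq> insert b N"
  proof (rule ccontr)
    assume "\<not> ?thesis"
    then obtain x where x: "a \<le> x" "x < b" "w x \<noteq> 0" "x \<notin> N" by force
    obtain d where d: "d > 0" "\<And>h. 0 < h \<Longrightarrow> h < d \<Longrightarrow> \<bar>integral {x..x + h} g / h - w x\<bar> < \<bar>w x\<bar>"
      using N(2)[of x "\<bar>w x\<bar>"] x by (auto simp: g_def divide_inverse mult.commute)
    define h where "h = min (d / 2) (b - x)"
    have h: "0 < h" "h < d" "x + h \<le> b" using d x by (auto simp: h_def)
    have "integral {x..x + h} g = integral {x..x + h} w"
      using h x by (intro Henstock_Kurzweil_Integration.integral_cong) (auto simp: g_def)
    also have "\<dots> = 0" using z[of x "x + h"] h x by auto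
    finally show False using d(2)[OF h(1,2)] by simp
  qed
  moreover have "negligible (insert b N)" using N(1) by simp
  ultimately show ?thesis using negligible_subset by blast
qed

section \<open>Weak derivatives\<close>

lemma test_function_times_integrable:
  fixes u :: "real \<Rightarrow> 'a::{banach, second_countable_topology}"
  assumes \<Omega>: "is_interval \<Omega>" "\<Omega> \<noteq> {}" "\<Omega> \<in> sets lebesgue"
    and u: "locally_integrable \<Omega> u" and \<phi>: "test_function \<Omega> \<phi>"
  shows "integrable (lebesgue_on \<Omega>) (\<lambda>x. \<phi> x *\<^sub>R u x)"
proof -
  obtain c where "c \<in> \<Omega>" using \<Omega> by auto
  with \<phi> \<Omega> obtain a b where ab: "{a..b} \<subseteq> \<Omega>" "\<And>x. x \<notin> {a..b} \<Longrightarrow> \<phi> x = 0"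
    using test_functionE by metis
  have "integrable (lebesgue_on {a..b}) (\<lambda>x. \<phi> x *\<^sub>R u x)"
    using u ab \<phi> by (intro integrable_continuous_mult smooth_continuous_on test_function_smooth)
      (auto simp: locally_integrable_def)
  then show ?thesis
    using integrable_supported[of "{a..b}" \<Omega> "\<lambda>x. \<phi> x *\<^sub>R u x"] ab \<Omega> by auto
qed

lemma deriv_zero_outside:
  fixes \<phi> :: "real \<Rightarrow> real"
  assumes \<phi>: "\<And>x. x \<notin> {a..b} \<Longrightarrow> \<phi> x = 0" and x: "x \<notin> {a..b}"
  shows "deriv \<phi> x = 0"
proof -
  have "\<forall>\<^sub>F y in nhds x. y \<in> - {a..b}"
    by (rule eventually_nhds_in_open) (use x in \<open>auto simp: open_Compl\<close>)
  then have "\<forall>\<^sub>F y in nhds x. \<phi> y = 0" by (rule eventually_mono) (use \<phi> in blast)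
  then have "deriv \<phi> x = deriv (\<lambda>_. 0) x" by (rule deriv_cong_ev) simp
  then show ?thesis by simp
qed

lemma test_function_deriv: "test_function \<Omega> \<phi> \<Longrightarrow> is_interval \<Omega> \<Longrightarrow> \<Omega> \<noteq> {} \<Longrightarrow> test_function \<Omega> (deriv \<phi>)"
proof -
  assume \<phi>: "test_function \<Omega> \<phi>" and \<Omega>: "is_interval \<Omega>" "\<Omega> \<noteq> {}"
  obtain c where "c \<in> \<Omega>" using \<Omega> by auto
  with \<phi> \<Omega> obtain a b where ab: "{a..b} \<subseteq> \<Omega>" "\<And>x. x \<notin> {a..b} \<Longrightarrow> \<phi> x = 0"
    using test_functionE by metis
  show ?thesis
  proof (rule test_functionI[OF smooth_deriv[OF test_function_smooth[OF \<phi>]] ab(1)])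
    fix x assume x: "x \<notin> {a..b}"
    show "deriv \<phi> x = 0" by (rule deriv_zero_outside[OF ab(2) x])
  qed
qed

text \<open>The plateau functions turn vanishing against test functions into vanishing of all integrals
  over intervals.\<close>

lemma orthogonal_to_test_functions_imp_AE_zero:
  fixes w :: "real \<Rightarrow> real"
  assumes \<Omega>: "open \<Omega>" and w: "locally_integrable \<Omega> w"
    and z: "\<And>\<phi>. test_function \<Omega> \<phi> \<Longrightarrow> (LINT x|lebesgue_on \<Omega>. \<phi> x * w x) = 0"
  shows "AE x in lebesgue_on \<Omega>. w x = 0"
proof -
  have \<Omega>s: "\<Omega> \<in> sets lebesgue" using \<Omega> by auto
  have zero: "integral {a..b} w = 0" if ab: "{a..b} \<subseteq> \<Omega>" for a b
  proof -
    have wi: "integrable (lebesgue_on {a..b}) w"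
      using w ab by (auto simp: locally_integrable_def)
    have pw: "(LINT x|lebesgue_on {a..b}. plateau a b n x * w x) = 0" for n
    proof -
      have "(LINT x|lebesgue_on \<Omega>. plateau a b n x * w x) = (LINT x|lebesgue_on {a..b}. plateau a b n x * w x)"
        by (rule LINT_supported[OF ab \<Omega>s]) (simp, subst plateau_zero, auto)
      then show ?thesis using z[OF plateau_test_function[OF ab, of n]] by simp
    qed
    have "(\<lambda>n. LINT x|lebesgue_on {a..b}. plateau a b n x * w x)
        \<longlonglongrightarrow> (LINT x|lebesgue_on {a..b}. indicator {a<..<b} x * w x)"
    proof (rule integral_dominated_convergence[where w = "\<lambda>x. \<bar>w x\<bar>"])
      show pm: "(\<lambda>x. plateau a b n x * w x) \<in> borel_measurable (lebesgue_on {a..b})" for n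
        using wi continuous_imp_measurable_on_sets_lebesgue[OF smooth_continuous_on[OF plateau_smooth]]
        by (intro borel_measurable_times) auto
      show "(\<lambda>x. indicator {a<..<b} x * w x) \<in> borel_measurable (lebesgue_on {a..b})"
        by (rule borel_measurable_LIMSEQ_real[where u = "\<lambda>n x. plateau a b n x * w x", OF _ pm])
          (intro tendsto_mult plateau_tendsto tendsto_const)
      show "AE x in lebesgue_on {a..b}. (\<lambda>n. plateau a b n x * w x) \<longlonglongrightarrow> indicator {a<..<b} x * w x"
        by (intro AE_I2 tendsto_mult plateau_tendsto tendsto_const)
      show "AE x in lebesgue_on {a..b}. norm (plateau a b n x * w x) \<le> \<bar>w x\<bar>" for n
        using plateau_bounds[of a b n] by (intro AE_I2) (auto simp: abs_mult intro!: mult_left_le_one_le)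
    qed (use wi in auto)
    then have "(LINT x|lebesgue_on {a..b}. indicator {a<..<b} x * w x) = 0"
      unfolding pw by (simp add: LIMSEQ_const_iff)
    also have "(LINT x|lebesgue_on {a..b}. indicator {a<..<b} x * w x) = (LINT x|lebesgue_on {a<..<b}. indicator {a<..<b} x * w x)"
      by (rule LINT_supported) auto
    also have "\<dots> = (LINT x|lebesgue_on {a<..<b}. w x)"
      by (rule Bochner_Integration.integral_cong) auto
    also have "\<dots> = integral {a..b} w"
      using wi by (simp add: LINT_lebesgue_on_Ioo lebesgue_integral_eq_integral)
    finally show ?thesis .
  qed
  have neg: "negligible {x \<in> {a..b}. w x \<noteq> 0}" if ab: "{a..b} \<subseteq> \<Omega>" for a b
  proof (rule integral_zero_imp_AE_zero)
    show "w integrable_on {a..b}"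
      using w ab by (intro integrable_on_lebesgue_on) (auto simp: locally_integrable_def)
    show "integral {c..d} w = 0" if "a \<le> c" "c \<le> d" "d \<le> b" for c d
      using that ab by (intro zero) auto
  qed
  obtain \<D> where \<D>: "countable \<D>" "\<D> \<subseteq> Pow \<Omega>" "\<And>X. X \<in> \<D> \<Longrightarrow> \<exists>a b. X = cbox a b" "\<Union>\<D> = \<Omega>"
    using open_countable_Union_open_cbox[OF \<Omega>] by blast
  have "negligible (\<Union>X\<in>\<D>. {x \<in> X. w x \<noteq> 0})"
  proof (rule negligible_countable_Union)
    show "countable ((\<lambda>X. {x \<in> X. w x \<noteq> 0}) ` \<D>)" using \<D> by simp
    show "negligible Y" if Y: "Y \<in> (\<lambda>X. {x \<in> X. w x \<noteq> 0}) ` \<D>" for Y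
    proof -
      obtain X where X: "X \<in> \<D>" "Y = {x \<in> X. w x \<noteq> 0}" using Y by auto
      obtain a b where "X = cbox a b" using \<D>(3) X by blast
      then show ?thesis using X \<D>(2) neg[of a b] by auto
    qed
  qed
  moreover have "(\<Union>X\<in>\<D>. {x \<in> X. w x \<noteq> 0}) = {x \<in> \<Omega>. \<not> w x = 0}" using \<D>(4) by auto
  ultimately show ?thesis using \<Omega>s by (simp add: AE_lebesgue_on_iff)
qed

lemma test_function_antiderivative:
  assumes \<eta>: "smooth \<eta>" "\<And>x. x \<notin> {a..b} \<Longrightarrow> \<eta> x = 0" and int: "integral {a..b} \<eta> = 0"
    and ab: "a \<le> b" "{a..b} \<subseteq> \<Omega>"
  obtains Z where "test_function \<Omega> Z" "\<And>x. (Z has_real_derivative \<eta> x) (at x)"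
    "\<And>x. x \<notin> {a..b} \<Longrightarrow> Z x = 0" "Z a = 0"
proof -
  have "\<exists>F. \<forall>x::real. (-\<infinity>::ereal) < x \<longrightarrow> x < (\<infinity>::ereal) \<longrightarrow> (F has_vector_derivative \<eta> x) (at x)"
    by (rule einterval_antiderivative)
      (use smooth_continuous_on[OF \<eta>(1), of UNIV] in \<open>auto simp: continuous_on_eq_continuous_at\<close>)
  then obtain F where F: "\<And>x. (F has_real_derivative \<eta> x) (at x)"
    by (auto simp: has_real_derivative_iff_has_vector_derivative)
  define Z where "Z x = F x - F a" for x
  have Z: "(Z has_real_derivative \<eta> x) (at x)" for x
    unfolding Z_def using F by (auto intro!: derivative_eq_intros)
  have Zb: "Z b = 0"
  proof -
    have "(\<eta> has_integral F b - F a) {a..b}"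
      using ab F by (intro fundamental_theorem_of_calculus)
        (auto simp flip: has_real_derivative_iff_has_vector_derivative intro: has_field_derivative_at_within)
    then show ?thesis using int by (simp add: Z_def integral_unique)
  qed
  have out: "Z x = 0" if x: "x \<notin> {a..b}" for x
  proof -
    define c where "c = (if x < a then a else b)"
    have c: "Z c = 0" using Zb by (auto simp: c_def Z_def)
    define l r where "l = min x c" and "r = max x c"
    have lr: "l < r" using x by (auto simp: l_def r_def c_def)
    obtain y where y: "l < y" "y < r" "Z r - Z l = (r - l) * \<eta> y"
      using MVT2[OF lr, of Z \<eta>] Z by auto
    have "\<eta> y = 0" using y x by (intro \<eta>(2)) (auto simp: l_def r_def c_def split: if_splits)
    then have "Z r = Z l" using y by simp
    then show ?thesis using c by (auto simp: l_def r_def max_def min_def split: if_splits)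
  qed
  have "test_function \<Omega> Z"
    by (rule test_functionI[OF smooth_antiderivative[OF \<eta>(1) Z] ab(2) out])
  then show thesis using that Z out by (simp add: Z_def)
qed

text \<open>The test functions with zero integral are the derivatives of test functions, so only
  constants are orthogonal to all of them.\<close>

lemma weak_deriv_zero_imp_AE_constant:
  fixes v :: "real \<Rightarrow> real"
  assumes \<Omega>: "open \<Omega>" "is_interval \<Omega>" "\<Omega> \<noteq> {}" and v: "locally_integrable \<Omega> v"
    and z: "\<And>\<phi>. test_function \<Omega> \<phi> \<Longrightarrow> (LINT x|lebesgue_on \<Omega>. deriv \<phi> x * v x) = 0"
  shows "\<exists>C. AE x in lebesgue_on \<Omega>. v x = C"
proof -
  have \<Omega>s: "\<Omega> \<in> sets lebesgue" using \<Omega> by auto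
  obtain c where c: "c \<in> \<Omega>" using \<Omega> by auto
  obtain e where e: "e > 0" "cball c e \<subseteq> \<Omega>" using \<Omega> c open_contains_cball by blast
  define p q where "p = c - e" and "q = c + e"
  have pq: "p < q" "{p..q} \<subseteq> \<Omega>" using e by (auto simp: p_def q_def cball_eq_atLeastAtMost)
  define \<rho> where "\<rho> = plateau p q 1"
  have \<rho>t: "test_function \<Omega> \<rho>" unfolding \<rho>_def by (rule plateau_test_function[OF pq(2)])
  have \<rho>0: "\<rho> x = 0" if "x \<notin> {p..q}" for x
    using that by (auto simp: \<rho>_def intro: plateau_zero)
  define m where "m = integral {p..q} \<rho>"
  have \<rho>c: "continuous_on S \<rho>" for S unfolding \<rho>_def by (intro smooth_continuous_on plateau_smooth)
  have m: "m \<noteq> 0"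
  proof
    assume "m = 0"
    then have "\<forall>x\<in>{p..q}. \<rho> x = 0"
      unfolding m_def using integral_eq_0_iff[OF \<rho>c pq(1)] plateau_bounds by (auto simp: \<rho>_def)
    moreover have "\<rho> c > 0" unfolding \<rho>_def using e by (intro plateau_positive) (auto simp: p_def q_def)
    ultimately show False using e by (auto simp: p_def q_def)
  qed
  define C where "C = (LINT x|lebesgue_on \<Omega>. \<rho> x * v x) / m"
  have "AE x in lebesgue_on \<Omega>. v x - C = 0"
  proof (rule orthogonal_to_test_functions_imp_AE_zero[OF \<Omega>(1)])
    have lc: "locally_integrable \<Omega> (\<lambda>x. C)"
      unfolding locally_integrable_def by (auto intro!: continuous_on_compact_integrable)
    show lvC: "locally_integrable \<Omega> (\<lambda>x. v x - C)"
      using v lc by (auto simp: locally_integrable_def intro: Bochner_Integration.integrable_diff)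
    fix \<phi> assume \<phi>: "test_function \<Omega> \<phi>"
    obtain a' b' where ab': "{a'..b'} \<subseteq> \<Omega>" "\<And>x. x \<notin> {a'..b'} \<Longrightarrow> \<phi> x = 0" "c \<in> {a'..b'}"
      using test_functionE[OF \<phi> \<Omega>(2) c] by metis
    define a b where "a = min p a'" and "b = max q b'"
    have ab: "a \<le> b" "{p..q} \<subseteq> {a..b}" "{a'..b'} \<subseteq> {a..b}" using pq by (auto simp: a_def b_def)
    have ab\<Omega>: "{a..b} \<subseteq> \<Omega>"
    proof -
      have "a \<in> \<Omega>" "b \<in> \<Omega>" using pq ab' by (auto simp: a_def b_def min_def max_def)
      then show ?thesis using \<Omega>(2) unfolding is_interval_1 by (meson atLeastAtMost_iff subsetI)
    qed
    have \<phi>0: "\<phi> x = 0" if "x \<notin> {a..b}" for x using ab'(2) ab that by blast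
    have \<rho>0': "\<rho> x = 0" if "x \<notin> {a..b}" for x using \<rho>0 ab that by blast
    define k where "k = integral {a..b} \<phi>"
    have \<phi>c: "continuous_on S \<phi>" for S using \<phi> by (intro smooth_continuous_on test_function_smooth)
    have m': "integral {a..b} \<rho> = m"
    proof -
      have "{x \<in> {p..q} - {a..b}. \<rho> x \<noteq> 0} = {}" "{x \<in> {a..b} - {p..q}. \<rho> x \<noteq> 0} = {}"
        using ab \<rho>0 by auto
      then have "integral {p..q} \<rho> = integral {a..b} \<rho>"
        by (intro integral_spike_set) (simp_all only: negligible_empty)
      then show ?thesis by (simp add: m_def)
    qed
    define \<eta> where "\<eta> x = \<phi> x - (k / m) * \<rho> x" for x
    have \<eta>s: "smooth \<eta>" unfolding \<eta>_def
      using \<phi> \<rho>t by (intro smooth_diff smooth_cmult) (auto simp: test_function_def)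
    have \<eta>i: "integral {a..b} \<eta> = 0"
    proof -
      have "integral {a..b} \<eta> = integral {a..b} \<phi> - integral {a..b} (\<lambda>x. (k / m) * \<rho> x)"
        unfolding \<eta>_def
        by (intro Henstock_Kurzweil_Integration.integral_diff integrable_continuous_real continuous_intros \<phi>c \<rho>c)
      then show ?thesis using m m' by (simp add: k_def)
    qed
    have \<eta>0: "\<eta> x = 0" if "x \<notin> {a..b}" for x using that by (simp add: \<eta>_def \<phi>0 \<rho>0')
    obtain Z where Z: "test_function \<Omega> Z" "\<And>x. (Z has_real_derivative \<eta> x) (at x)"
      by (rule test_function_antiderivative[OF \<eta>s \<eta>0 \<eta>i ab(1) ab\<Omega>]) blast+
    have dZ: "deriv Z x = \<eta> x" for x using Z(2) by (rule DERIV_imp_deriv)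
    note ti = test_function_times_integrable[OF \<Omega>(2,3) \<Omega>s, simplified]
    have "(LINT x|lebesgue_on \<Omega>. \<phi> x * v x - (k / m) * (\<rho> x * v x)) = 0"
      using z[OF Z(1)] by (simp add: dZ \<eta>_def algebra_simps)
    then have 1: "(LINT x|lebesgue_on \<Omega>. \<phi> x * v x) = k * C"
      using ti[OF v \<phi>] ti[OF v \<rho>t] by (simp add: C_def)
    have 2: "(LINT x|lebesgue_on \<Omega>. \<phi> x * C) = k * C"
    proof -
      have "(LINT x|lebesgue_on \<Omega>. \<phi> x * C) = (LINT x|lebesgue_on {a..b}. \<phi> x * C)"
        using \<phi>0 \<Omega>s ab\<Omega> by (intro LINT_supported) auto
      also have "\<dots> = integral {a..b} (\<lambda>x. \<phi> x * C)"
        by (intro lebesgue_integral_eq_integral continuous_imp_integrable_real continuous_intros \<phi>c) auto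
      finally show ?thesis by (simp add: k_def)
    qed
    show "(LINT x|lebesgue_on \<Omega>. \<phi> x * (v x - C)) = 0"
      using 1 2 ti[OF v \<phi>] ti[OF lc \<phi>] by (auto simp: right_diff_distrib)
  qed
  then show ?thesis by auto
qed

text \<open>Differences of \<open>G\<close> rather than \<open>G\<close> itself, so that no base point has to be chosen in \<open>\<Omega>\<close>.\<close>

definition indefinite_integral :: "real set \<Rightarrow> (real \<Rightarrow> real) \<Rightarrow> (real \<Rightarrow> real) \<Rightarrow> bool" where
  "indefinite_integral \<Omega> g G \<longleftrightarrow>
     (\<forall>c d. c \<le> d \<and> {c..d} \<subseteq> \<Omega> \<longrightarrow> g integrable_on {c..d} \<and> G d - G c = integral {c..d} g)"

lemma indefinite_integral_mono:
  "indefinite_integral \<Omega> g G \<Longrightarrow> S \<subseteq> \<Omega> \<Longrightarrow> indefinite_integral S g G"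
  unfolding indefinite_integral_def by (meson order_trans)

lemma indefinite_integral_exists:
  assumes \<Omega>: "is_interval \<Omega>" "c \<in> \<Omega>"
    and g: "\<And>a b. {a..b} \<subseteq> \<Omega> \<Longrightarrow> g integrable_on {a..b}"
  shows "\<exists>G. indefinite_integral \<Omega> g G"
proof -
  define G where "G x = (if c \<le> x then integral {c..x} g else - integral {x..c} g)" for x
  have sub: "{a..b} \<subseteq> \<Omega>" if "a \<in> \<Omega>" "b \<in> \<Omega>" for a b
    using \<Omega>(1) that unfolding is_interval_1 by (meson atLeastAtMost_iff subsetI)
  have comb: "integral {p..q} g + integral {q..r} g = integral {p..r} g"
    if "p \<le> q" "q \<le> r" "p \<in> \<Omega>" "r \<in> \<Omega>" for p q r
    using that by (intro Henstock_Kurzweil_Integration.integral_combine g sub)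
  have "G b - G a = integral {a..b} g" if ab: "a \<le> b" "a \<in> \<Omega>" "b \<in> \<Omega>" for a b
  proof -
    consider "c \<le> a" | "a < c" "c \<le> b" | "b < c" by linarith
    then show ?thesis
      by cases (use comb[of c a b] comb[of a c b] comb[of a b c] ab \<Omega> in \<open>auto simp: G_def\<close>)
  qed
  then have "indefinite_integral \<Omega> g G"
    unfolding indefinite_integral_def using g by (metis atLeastAtMost_iff order_refl subsetD)
  then show ?thesis by blast
qed

lemma indefinite_integral_continuous:
  assumes G: "indefinite_integral \<Omega> g G" and \<Omega>: "open \<Omega>"
  shows "continuous_on \<Omega> G"
proof -
  have "isCont G x" if x: "x \<in> \<Omega>" for x
  proof -
    obtain e where e: "e > 0" "cball x e \<subseteq> \<Omega>" using \<Omega> x open_contains_cball by blast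
    have sub: "{x - e..x + e} \<subseteq> \<Omega>" using e by (simp add: cball_eq_atLeastAtMost)
    have "continuous_on {x - e..x + e} (\<lambda>y. G (x - e) + integral {x - e..y} g)"
      using G sub e unfolding indefinite_integral_def
      by (intro continuous_intros indefinite_integral_continuous_1) auto
    moreover have "G (x - e) + integral {x - e..y} g = G y" if "y \<in> {x - e..x + e}" for y
    proof -
      have "x - e \<le> y" "{x - e..y} \<subseteq> \<Omega>" using that sub by auto
      then have "G y - G (x - e) = integral {x - e..y} g" using G unfolding indefinite_integral_def by blast
      then show ?thesis by simp
    qed
    ultimately have "continuous_on {x - e..x + e} G" by (rule continuous_on_eq)
    then show ?thesis using e by (intro continuous_on_interior[of "{x - e..x + e}"]) auto
  qed
  then show ?thesis by (simp add: continuous_at_imp_continuous_on)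
qed

lemma indefinite_integral_has_derivative:
  assumes G: "indefinite_integral {a..b} g G" and g: "continuous_on {a..b} g" and x: "x \<in> {a..b}"
  shows "(G has_real_derivative g x) (at x within {a..b})"
proof -
  have "((\<lambda>x. G a + integral {a..x} g) has_real_derivative g x) (at x within {a..b})"
    by (rule derivative_eq_intros integral_has_real_derivative[OF g x] refl | simp)+
  moreover have "G a + integral {a..y} g = G y" if "y \<in> {a..b}" for y
  proof -
    have "a \<le> y" "{a..y} \<subseteq> {a..b}" using that by auto
    then have "G y - G a = integral {a..y} g" using G unfolding indefinite_integral_def by blast
    then show ?thesis by simp
  qed
  ultimately show ?thesis
    using has_field_derivative_transform_within[OF _ zero_less_one x] by blast
qed

text \<open>Integration by parts for an absolutely continuous factor: at a fixed \<open>x\<close> the integral of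
  \<open>(\<phi> - \<phi> x) g\<close> from \<open>x\<close> is of smaller order than the increment.\<close>

lemma integration_by_parts_indefinite:
  assumes ab: "a \<le> b" and g: "integrable (lebesgue_on {a..b}) g" and G: "indefinite_integral {a..b} g G"
    and \<phi>: "\<And>x. x \<in> {a..b} \<Longrightarrow> (\<phi> has_real_derivative \<phi>' x) (at x within {a..b})"
    and \<phi>': "continuous_on {a..b} \<phi>'"
  shows "((\<lambda>x. \<phi>' x * G x) has_integral \<phi> b * G b - \<phi> a * G a - integral {a..b} (\<lambda>x. \<phi> x * g x)) {a..b}"
proof -
  have Gx: "G d - G c = integral {c..d} g" if "a \<le> c" "c \<le> d" "d \<le> b" for c d
    using G that unfolding indefinite_integral_def by (meson atLeastatMost_subset_iff)
  have \<phi>c: "continuous_on {a..b} \<phi>"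
    using \<phi> by (meson DERIV_continuous continuous_on_eq_continuous_within)
  have int: "(\<lambda>x. (\<phi> x - k) * g x) integrable_on {a..b}" for k
    using integrable_continuous_mult[OF g, of "\<lambda>x. \<phi> x - k"] continuous_on_diff[OF \<phi>c continuous_on_const]
    by (intro integrable_on_lebesgue_on) auto
  have int\<phi>: "(\<lambda>x. \<phi> x * g x) integrable_on {a..b}" using int[of 0] by simp
  have intg: "g integrable_on {a..b}" "(\<lambda>x. \<bar>g x\<bar>) integrable_on {a..b}"
    using g by (auto intro!: integrable_on_lebesgue_on)
  obtain K where K: "0 \<le> K" "\<And>x. x \<in> {a..b} \<Longrightarrow> \<bar>\<phi>' x\<bar> \<le> K"
    using continuous_on_interval_bounded[OF \<phi>'] by metis
  have lip: "\<bar>\<phi> d - \<phi> c\<bar> \<le> K * \<bar>d - c\<bar>" if "c \<in> {a..b}" "d \<in> {a..b}" for c d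
    using field_differentiable_bound[of "{a..b}" \<phi> \<phi>' K d c] \<phi> K that by auto
  define A where "A x = integral {a..x} (\<lambda>x. \<bar>g x\<bar>)" for x
  have Ac: "continuous_on {a..b} A" unfolding A_def by (rule indefinite_integral_continuous_1[OF intg(2)])
  have Gc: "continuous_on {a..b} G"
  proof -
    have "continuous_on {a..b} (\<lambda>y. G a + integral {a..y} g)"
      by (intro continuous_intros indefinite_integral_continuous_1 intg)
    moreover have "G a + integral {a..y} g = G y" if "y \<in> {a..b}" for y using Gx[of a y] that by auto
    ultimately show ?thesis by (rule continuous_on_eq)
  qed
  define P where "P y = \<phi> y * G y - integral {a..y} (\<lambda>x. \<phi> x * g x)" for y
  have "(P has_real_derivative \<phi>' x * G x) (at x within {a..b})" if x: "x \<in> {a..b}" for x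
  proof -
    define H where "H y = integral {a..y} (\<lambda>s. (\<phi> s - \<phi> x) * g s)" for y
    have step: "\<bar>integral {c..d} (\<lambda>s. (\<phi> s - \<phi> x) * g s)\<bar> \<le> K * (d - c) * (A d - A c)"
      if cd: "a \<le> c" "c \<le> d" "d \<le> b" "x \<in> {c, d}" for c d
    proof -
      have sub: "{c..d} \<subseteq> {a..b}" using cd by auto
      have "norm (integral {c..d} (\<lambda>s. (\<phi> s - \<phi> x) * g s)) \<le> integral {c..d} (\<lambda>s. K * (d - c) * \<bar>g s\<bar>)"
      proof (rule Henstock_Kurzweil_Integration.integral_norm_bound_integral)
        show "(\<lambda>s. (\<phi> s - \<phi> x) * g s) integrable_on {c..d}"
          by (rule integrable_subinterval_real[OF int sub])
        show "(\<lambda>s. K * (d - c) * \<bar>g s\<bar>) integrable_on {c..d}"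
          by (intro integrable_on_mult_right integrable_subinterval_real[OF intg(2) sub])
        fix s assume s: "s \<in> {c..d}"
        have "\<bar>\<phi> s - \<phi> x\<bar> \<le> K * \<bar>s - x\<bar>" using lip[of x s] s sub x by auto
        also have "\<dots> \<le> K * (d - c)" using s cd K(1) by (intro mult_left_mono) auto
        finally show "norm ((\<phi> s - \<phi> x) * g s) \<le> K * (d - c) * \<bar>g s\<bar>"
          by (simp add: abs_mult mult_right_mono)
      qed
      also have "\<dots> = K * (d - c) * integral {c..d} (\<lambda>s. \<bar>g s\<bar>)" by simp
      also have "integral {c..d} (\<lambda>s. \<bar>g s\<bar>) = A d - A c"
        using Henstock_Kurzweil_Integration.integral_combine[of a c d "\<lambda>s. \<bar>g s\<bar>"]
          integrable_subinterval_real[OF intg(2), of a d] cd by (auto simp: A_def)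
      finally show ?thesis by simp
    qed
    have Hdiff: "H d - H c = integral {c..d} (\<lambda>s. (\<phi> s - \<phi> x) * g s)" if "a \<le> c" "c \<le> d" "d \<le> b" for c d
      using Henstock_Kurzweil_Integration.integral_combine[of a c d "\<lambda>s. (\<phi> s - \<phi> x) * g s"]
        integrable_subinterval_real[OF int, of a d] that by (auto simp: H_def)
    have Hle: "\<bar>H y - H x\<bar> \<le> K * \<bar>y - x\<bar> * \<bar>A y - A x\<bar>" if y: "y \<in> {a..b}" for y
    proof (cases "x \<le> y")
      case True
      then have "\<bar>H y - H x\<bar> \<le> K * (y - x) * (A y - A x)" using step[of x y] Hdiff[of x y] x y by auto
      also have "\<dots> \<le> K * (y - x) * \<bar>A y - A x\<bar>" using True K by (intro mult_left_mono) auto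
      finally show ?thesis using True by simp
    next
      case False
      then have "\<bar>H y - H x\<bar> \<le> K * (x - y) * (A x - A y)" using step[of y x] Hdiff[of y x] x y by auto
      also have "\<dots> \<le> K * (x - y) * \<bar>A y - A x\<bar>" using False K by (intro mult_left_mono) auto
      finally show ?thesis using False by simp
    qed
    have "((\<lambda>y. (H y - H x) / (y - x)) \<longlongrightarrow> 0) (at x within {a..b})"
    proof (rule Lim_null_comparison)
      show "\<forall>\<^sub>F y in at x within {a..b}. norm ((H y - H x) / (y - x)) \<le> K * \<bar>A y - A x\<bar>"
        using Hle by (auto simp: eventually_at_filter divide_simps mult_ac intro!: always_eventually)
      have "(A \<longlongrightarrow> A x) (at x within {a..b})" using Ac x by (auto simp: continuous_on_def)
      then have "((\<lambda>y. K * \<bar>A y - A x\<bar>) \<longlongrightarrow> K * \<bar>A x - A x\<bar>) (at x within {a..b})"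
        by (intro tendsto_intros)
      then show "((\<lambda>y. K * \<bar>A y - A x\<bar>) \<longlongrightarrow> 0) (at x within {a..b})" by simp
    qed
    then have dH: "(H has_real_derivative 0) (at x within {a..b})"
      by (simp add: has_field_derivative_iff)
    have dF: "((\<lambda>y. (\<phi> y - \<phi> x) * G y) has_real_derivative \<phi>' x * G x) (at x within {a..b})"
    proof -
      have "((\<lambda>y. (\<phi> y - \<phi> x) / (y - x) * G y) \<longlongrightarrow> \<phi>' x * G x) (at x within {a..b})"
        using \<phi>[OF x] Gc x by (intro tendsto_mult) (auto simp: has_field_derivative_iff continuous_on_def)
      then show ?thesis by (simp add: has_field_derivative_iff)
    qed
    have "((\<lambda>y. (\<phi> y - \<phi> x) * G y + \<phi> x * G a - H y) has_real_derivative \<phi>' x * G x + 0 - 0) (at x within {a..b})"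
      by (intro derivative_intros dF dH)
    moreover have "(\<phi> y - \<phi> x) * G y + \<phi> x * G a - H y = P y" if y: "y \<in> {a..b}" for y
    proof -
      have sub: "{a..y} \<subseteq> {a..b}" using y by auto
      have "H y = integral {a..y} (\<lambda>s. \<phi> s * g s - \<phi> x * g s)"
        unfolding H_def by (simp add: left_diff_distrib)
      also have "\<dots> = integral {a..y} (\<lambda>s. \<phi> s * g s) - integral {a..y} (\<lambda>s. \<phi> x * g s)"
        by (intro Henstock_Kurzweil_Integration.integral_diff integrable_on_mult_right
            integrable_subinterval_real[OF int\<phi> sub] integrable_subinterval_real[OF intg(1) sub])
      also have "integral {a..y} (\<lambda>s. \<phi> x * g s) = \<phi> x * (G y - G a)" using Gx[of a y] y by simp
      finally show ?thesis by (simp add: P_def algebra_simps)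
    qed
    ultimately have "(P has_real_derivative \<phi>' x * G x + 0 - 0) (at x within {a..b})"
      using has_field_derivative_transform_within[OF _ zero_less_one x] by blast
    then show ?thesis by simp
  qed
  then have "((\<lambda>x. \<phi>' x * G x) has_integral P b - P a) {a..b}"
    using ab by (intro fundamental_theorem_of_calculus) (auto simp flip: has_real_derivative_iff_has_vector_derivative)
  then show ?thesis by (simp add: P_def algebra_simps)
qed

lemma test_function_by_parts:
  assumes \<Omega>: "open \<Omega>" "is_interval \<Omega>" "\<Omega> \<noteq> {}" and g: "locally_integrable \<Omega> g"
    and G: "indefinite_integral \<Omega> g G" and \<phi>: "test_function \<Omega> \<phi>"
  shows "(LINT x|lebesgue_on \<Omega>. deriv \<phi> x * G x) = - (LINT x|lebesgue_on \<Omega>. \<phi> x * g x)"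
proof -
  have \<Omega>s: "\<Omega> \<in> sets lebesgue" using \<Omega> by auto
  obtain c where c: "c \<in> \<Omega>" using \<Omega> by auto
  obtain a b where ab: "a \<le> b" "{a..b} \<subseteq> \<Omega>" "\<And>x. x \<notin> {a..b} \<Longrightarrow> \<phi> x = 0" "\<And>x. x \<notin> {a..b} \<Longrightarrow> deriv \<phi> x = 0"
      "\<phi> a = 0" "\<phi> b = 0"
  proof -
    obtain p q where pq: "p \<le> q" "{p..q} \<subseteq> \<Omega>" "\<And>x. x \<notin> {p..q} \<Longrightarrow> \<phi> x = 0"
      using test_functionE[OF \<phi> \<Omega>(2) c] by metis
    obtain e1 where e1: "e1 > 0" "cball p e1 \<subseteq> \<Omega>" using \<Omega>(1) pq open_contains_cball by (metis atLeastAtMost_iff order_refl subsetD)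
    obtain e2 where e2: "e2 > 0" "cball q e2 \<subseteq> \<Omega>" using \<Omega>(1) pq open_contains_cball by (metis atLeastAtMost_iff order_refl subsetD)
    show thesis
    proof (rule that[of "p - e1" "q + e2"])
      show "{p - e1..q + e2} \<subseteq> \<Omega>"
      proof -
        have "p - e1 \<in> \<Omega>" "q + e2 \<in> \<Omega>" using e1 e2 by (auto simp: dist_real_def subset_iff)
        then show ?thesis using \<Omega>(2) unfolding is_interval_1 by (meson atLeastAtMost_iff subsetI)
      qed
      fix x assume x: "x \<notin> {p - e1..q + e2}"
      show "\<phi> x = 0" using x e1 e2 by (intro pq(3)) auto
      show "deriv \<phi> x = 0" by (rule deriv_zero_outside[OF pq(3)]) (use x e1 e2 in auto)
    qed (use e1 e2 pq in auto)
  qed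
  have gi: "integrable (lebesgue_on {a..b}) g" using g ab by (auto simp: locally_integrable_def)
  have Gab: "indefinite_integral {a..b} g G" by (rule indefinite_integral_mono[OF G ab(2)])
  have \<phi>s: "smooth \<phi>" using \<phi> by (rule test_function_smooth)
  have \<phi>c: "continuous_on S \<phi>" "continuous_on S (deriv \<phi>)" for S
    using \<phi>s by (auto intro: smooth_continuous_on smooth_deriv)
  have "((\<lambda>x. deriv \<phi> x * G x) has_integral \<phi> b * G b - \<phi> a * G a - integral {a..b} (\<lambda>x. \<phi> x * g x)) {a..b}"
    by (rule integration_by_parts_indefinite[OF ab(1) gi Gab smooth_has_derivative[OF \<phi>s] \<phi>c(2)])
  then have 1: "integral {a..b} (\<lambda>x. deriv \<phi> x * G x) = - integral {a..b} (\<lambda>x. \<phi> x * g x)"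
    using ab by (simp add: integral_unique)
  have "integrable (lebesgue_on {a..b}) (\<lambda>x. deriv \<phi> x * G x)"
    by (intro continuous_imp_integrable_real continuous_intros \<phi>c
        continuous_on_subset[OF indefinite_integral_continuous[OF G \<Omega>(1)] ab(2)])
  moreover have "integrable (lebesgue_on {a..b}) (\<lambda>x. \<phi> x * g x)"
    using integrable_continuous_mult[OF gi \<phi>c(1)] by simp
  ultimately show ?thesis
    using 1 LINT_supported[OF ab(2) \<Omega>s, of "\<lambda>x. deriv \<phi> x * G x"] LINT_supported[OF ab(2) \<Omega>s, of "\<lambda>x. \<phi> x * g x"] ab
    by (simp add: lebesgue_integral_eq_integral)
qed

lemma continuous_imp_locally_integrable:
  fixes u :: "real \<Rightarrow> real"
  shows "continuous_on \<Omega> u \<Longrightarrow> locally_integrable \<Omega> u"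
  unfolding locally_integrable_def by (auto intro: continuous_on_compact_integrable continuous_on_subset)

text \<open>The difference of a function and of the indefinite integral of its weak derivative has weak
  derivative zero, hence is constant, and the constant is absorbed into the indefinite integral.\<close>

theorem weak_deriv_imp_indefinite_integral:
  fixes u g :: "real \<Rightarrow> real"
  assumes \<Omega>: "open \<Omega>" "is_interval \<Omega>" "\<Omega> \<noteq> {}" and w: "has_weak_deriv \<Omega> u g"
  obtains G where "indefinite_integral \<Omega> g G" "continuous_on \<Omega> G" "AE x in lebesgue_on \<Omega>. u x = G x"
proof -
  have \<Omega>s: "\<Omega> \<in> sets lebesgue" using \<Omega> by auto
  have li: "locally_integrable \<Omega> u" "locally_integrable \<Omega> g"
    and parts: "\<And>\<phi>. test_function \<Omega> \<phi> \<Longrightarrow>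
      (LINT x|lebesgue_on \<Omega>. deriv \<phi> x * u x) = - (LINT x|lebesgue_on \<Omega>. \<phi> x * g x)"
    using w by (auto simp: has_weak_deriv_def)
  obtain c where c: "c \<in> \<Omega>" using \<Omega> by auto
  have "g integrable_on {a..b}" if "{a..b} \<subseteq> \<Omega>" for a b
    using li(2) that by (intro integrable_on_lebesgue_on) (auto simp: locally_integrable_def)
  then obtain G where G: "indefinite_integral \<Omega> g G"
    using indefinite_integral_exists[OF \<Omega>(2) c] by blast
  have Gc: "continuous_on \<Omega> G" by (rule indefinite_integral_continuous[OF G \<Omega>(1)])
  have lG: "locally_integrable \<Omega> G" by (rule continuous_imp_locally_integrable[OF Gc])
  note ti = test_function_times_integrable[OF \<Omega>(2,3) \<Omega>s, simplified]
  have "\<exists>C. AE x in lebesgue_on \<Omega>. u x - G x = C"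
  proof (rule weak_deriv_zero_imp_AE_constant[OF \<Omega>])
    show "locally_integrable \<Omega> (\<lambda>x. u x - G x)"
      using li lG by (auto simp: locally_integrable_def intro: Bochner_Integration.integrable_diff)
    fix \<phi> assume \<phi>: "test_function \<Omega> \<phi>"
    have d: "test_function \<Omega> (deriv \<phi>)" by (rule test_function_deriv[OF \<phi> \<Omega>(2,3)])
    show "(LINT x|lebesgue_on \<Omega>. deriv \<phi> x * (u x - G x)) = 0"
      using ti[OF li(1) d] ti[OF lG d] parts[OF \<phi>] test_function_by_parts[OF \<Omega> li(2) G \<phi>]
      by (simp add: right_diff_distrib)
  qed
  then obtain C where C: "AE x in lebesgue_on \<Omega>. u x - G x = C" by blast
  show thesis
  proof
    show "indefinite_integral \<Omega> g (\<lambda>x. G x + C)" using G by (simp add: indefinite_integral_def)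
    show "continuous_on \<Omega> (\<lambda>x. G x + C)" by (intro continuous_intros Gc)
    show "AE x in lebesgue_on \<Omega>. u x = G x + C" using C by eventually_elim auto
  qed
qed

lemma has_weak_deriv_locally_integrable:
  "has_weak_deriv \<Omega> u g \<Longrightarrow> locally_integrable \<Omega> u"
  "has_weak_deriv \<Omega> u g \<Longrightarrow> locally_integrable \<Omega> g"
  by (auto simp: has_weak_deriv_def)

lemma has_weak_deriv_AE_unique:
  fixes u g :: "real \<Rightarrow> real"
  assumes \<Omega>: "open \<Omega>" "is_interval \<Omega>" "\<Omega> \<noteq> {}"
    and 1: "has_weak_deriv \<Omega> u g" and 2: "has_weak_deriv \<Omega> v h" and eq: "AE x in lebesgue_on \<Omega>. u x = v x"
  shows "AE x in lebesgue_on \<Omega>. g x = h x"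
proof -
  have \<Omega>s: "\<Omega> \<in> sets lebesgue" using \<Omega> by auto
  note li = has_weak_deriv_locally_integrable[OF 1] has_weak_deriv_locally_integrable[OF 2]
  note ti = test_function_times_integrable[OF \<Omega>(2,3) \<Omega>s, simplified]
  have "AE x in lebesgue_on \<Omega>. g x - h x = 0"
  proof (rule orthogonal_to_test_functions_imp_AE_zero[OF \<Omega>(1)])
    show "locally_integrable \<Omega> (\<lambda>x. g x - h x)"
      using li by (auto simp: locally_integrable_def intro: Bochner_Integration.integrable_diff)
    fix \<phi> assume \<phi>: "test_function \<Omega> \<phi>"
    have d: "test_function \<Omega> (deriv \<phi>)" by (rule test_function_deriv[OF \<phi> \<Omega>(2,3)])
    have "(LINT x|lebesgue_on \<Omega>. deriv \<phi> x * u x) = (LINT x|lebesgue_on \<Omega>. deriv \<phi> x * v x)"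
      using ti[OF li(1) d] ti[OF li(3) d] eq by (intro integral_cong_AE) auto
    then show "(LINT x|lebesgue_on \<Omega>. \<phi> x * (g x - h x)) = 0"
      using 1 2 \<phi> ti[OF li(2) \<phi>] ti[OF li(4) \<phi>] by (simp add: has_weak_deriv_def right_diff_distrib)
  qed
  then show ?thesis by simp
qed

lemma has_weak_deriv_bounded_linear:
  fixes u g :: "real \<Rightarrow> 'a::{banach, second_countable_topology}"
    and T :: "'a \<Rightarrow> 'b::{banach, second_countable_topology}"
  assumes \<Omega>: "is_interval \<Omega>" "\<Omega> \<noteq> {}" "\<Omega> \<in> sets lebesgue"
    and T: "bounded_linear T" and w: "has_weak_deriv \<Omega> u g"
  shows "has_weak_deriv \<Omega> (\<lambda>x. T (u x)) (\<lambda>x. T (g x))"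
proof -
  interpret bounded_linear T by fact
  note li = has_weak_deriv_locally_integrable[OF w]
  have liT: "locally_integrable \<Omega> (\<lambda>x. T (v x))" if "locally_integrable \<Omega> v" for v
    using that T by (auto simp: locally_integrable_def intro: integrable_bounded_linear)
  have T_int: "(LINT x|lebesgue_on \<Omega>. \<phi> x *\<^sub>R T (v x)) = T (LINT x|lebesgue_on \<Omega>. \<phi> x *\<^sub>R v x)"
    if "locally_integrable \<Omega> v" "test_function \<Omega> \<phi>" for v \<phi>
    using integral_bounded_linear[OF T test_function_times_integrable[OF \<Omega> that]] by (simp add: scaleR)
  show ?thesis
    unfolding has_weak_deriv_def
  proof (intro conjI allI impI liT li)
    fix \<phi> assume \<phi>: "test_function \<Omega> \<phi>"
    have d: "test_function \<Omega> (deriv \<phi>)" by (rule test_function_deriv[OF \<phi> \<Omega>(1,2)])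
    show "(LINT x|lebesgue_on \<Omega>. deriv \<phi> x *\<^sub>R T (u x)) = - (LINT x|lebesgue_on \<Omega>. \<phi> x *\<^sub>R T (g x))"
      using w \<phi> unfolding T_int[OF li(1) d] T_int[OF li(2) \<phi>] by (simp add: has_weak_deriv_def linear_neg[OF bounded_linear.linear[OF T]])
  qed
qed

lemma C1_imp_has_weak_deriv:
  fixes u u' :: "real \<Rightarrow> real"
  assumes \<Omega>: "open \<Omega>" "is_interval \<Omega>" "\<Omega> \<noteq> {}"
    and u: "\<And>x. x \<in> \<Omega> \<Longrightarrow> (u has_real_derivative u' x) (at x)" and u': "continuous_on \<Omega> u'"
  shows "has_weak_deriv \<Omega> u u'"
proof -
  have uc: "continuous_on \<Omega> u"
    by (intro continuous_at_imp_continuous_on ballI DERIV_isCont[OF u])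
  have ii: "indefinite_integral \<Omega> u' u"
    unfolding indefinite_integral_def
  proof (intro allI impI)
    fix c d assume cd: "c \<le> d \<and> {c..d} \<subseteq> \<Omega>"
    have "(u' has_integral u d - u c) {c..d}"
      using cd has_field_derivative_at_within[OF u] by (intro fundamental_theorem_of_calculus)
        (auto simp flip: has_real_derivative_iff_has_vector_derivative)
    then show "u' integrable_on {c..d} \<and> u d - u c = integral {c..d} u'" by (auto simp: integral_unique)
  qed
  show ?thesis
    unfolding has_weak_deriv_def
    using test_function_by_parts[OF \<Omega> continuous_imp_locally_integrable[OF u'] ii]
    by (auto intro: continuous_imp_locally_integrable uc u')
qed

section \<open>Square-integrable functions on a bounded interval\<close>

lemma L2_realD:
  fixes f :: "real \<Rightarrow> real"
  shows "f \<in> L2 \<Omega> \<Longrightarrow> f \<in> borel_measurable (lebesgue_on \<Omega>)"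
    and "f \<in> L2 \<Omega> \<Longrightarrow> integrable (lebesgue_on \<Omega>) (\<lambda>x. (f x)\<^sup>2)"
  by (auto simp: L2_def)

lemma L2_diff:
  fixes f g :: "real \<Rightarrow> real"
  assumes "f \<in> L2 \<Omega>" "g \<in> L2 \<Omega>"
  shows "(\<lambda>x. f x - g x) \<in> L2 \<Omega>"
proof -
  note m = L2_realD[OF assms(1)] L2_realD[OF assms(2)]
  have "integrable (lebesgue_on \<Omega>) (\<lambda>x. (f x - g x)\<^sup>2)"
  proof (rule Bochner_Integration.integrable_bound)
    show "integrable (lebesgue_on \<Omega>) (\<lambda>x. 2 * (f x)\<^sup>2 + 2 * (g x)\<^sup>2)" using m by simp
    show "AE x in lebesgue_on \<Omega>. norm ((f x - g x)\<^sup>2) \<le> norm (2 * (f x)\<^sup>2 + 2 * (g x)\<^sup>2)"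
    proof (intro AE_I2)
      fix x
      have "(f x - g x)\<^sup>2 \<le> 2 * (f x)\<^sup>2 + 2 * (g x)\<^sup>2"
        using zero_le_power2[of "f x + g x"] unfolding power2_sum power2_diff by linarith
      then show "norm ((f x - g x)\<^sup>2) \<le> norm (2 * (f x)\<^sup>2 + 2 * (g x)\<^sup>2)" by simp
    qed
  qed (use m in measurable)
  then show ?thesis using m by (auto simp: L2_def)
qed

lemma continuous_on_Icc_Ioo:
  fixes f :: "real \<Rightarrow> real"
  assumes "continuous_on {a..b} f"
  shows integrable_Ioo_continuous: "integrable (lebesgue_on {a<..<b}) f"
    and LINT_Ioo_continuous: "(LINT x|lebesgue_on {a<..<b}. f x) = integral {a..b} f"
  using continuous_imp_integrable_real[OF assms]
  by (auto simp: lebesgue_on_Ioo lebesgue_integral_eq_integral)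

lemma continuous_imp_L2:
  fixes f :: "real \<Rightarrow> real"
  assumes "continuous_on {a..b} f"
  shows "f \<in> L2 {a<..<b}"
  using integrable_Ioo_continuous[OF assms] integrable_Ioo_continuous[of a b "\<lambda>x. (f x)\<^sup>2"] assms
  by (auto simp: L2_def intro: continuous_intros)

lemma L2_imp_L1:
  fixes f :: "real \<Rightarrow> real"
  assumes L: "L > 0" and f: "f \<in> L2 {0<..<L}"
  shows "integrable (lebesgue_on {0<..<L}) f"
    and "(LINT x|lebesgue_on {0<..<L}. \<bar>f x\<bar>) \<le> sqrt L * L2_norm_on {0<..<L} f"
proof -
  let ?M = "lebesgue_on {0<..<L}"
  interpret finite_measure ?M by (rule finite_measure_lebesgue_on) auto
  have ms: "measure ?M (space ?M) = L" using L by (simp add: measure_restrict_space)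
  note m = L2_realD[OF f]
  show fi: "integrable ?M f"
  proof (rule Bochner_Integration.integrable_bound)
    show "integrable ?M (\<lambda>x. 1 + (f x)\<^sup>2)" using m by simp
    show "AE x in ?M. norm (f x) \<le> norm (1 + (f x)\<^sup>2)"
    proof (intro AE_I2)
      fix x
      have "2 * \<bar>f x\<bar> \<le> 1 + \<bar>f x\<bar>\<^sup>2" using sum_squares_bound[of 1 "\<bar>f x\<bar>"] by simp
      then show "norm (f x) \<le> norm (1 + (f x)\<^sup>2)" by simp
    qed
  qed (use m in auto)
  define I where "I = (LINT x|?M. \<bar>f x\<bar>)"
  have "0 \<le> (LINT x|?M. (\<bar>f x\<bar> - I / L)\<^sup>2)" by (intro Bochner_Integration.integral_nonneg) auto
  also have "(\<lambda>x. (\<bar>f x\<bar> - I / L)\<^sup>2) = (\<lambda>x. (f x)\<^sup>2 - 2 * (I / L) * \<bar>f x\<bar> + (I / L)\<^sup>2)"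
    by (auto simp: power2_eq_square algebra_simps)
  also have "(LINT x|?M. (f x)\<^sup>2 - 2 * (I / L) * \<bar>f x\<bar> + (I / L)\<^sup>2)
      = (LINT x|?M. (f x)\<^sup>2) - 2 * (I / L) * I + (I / L)\<^sup>2 * L"
    using m fi ms by (simp add: I_def)
  finally have "I\<^sup>2 \<le> L * (LINT x|?M. (f x)\<^sup>2)" using L by (simp add: power2_eq_square field_simps)
  then have "sqrt (I\<^sup>2) \<le> sqrt (L * (LINT x|?M. (f x)\<^sup>2))" by (rule real_sqrt_le_mono)
  moreover have "0 \<le> I" unfolding I_def by (intro Bochner_Integration.integral_nonneg) auto
  ultimately show "(LINT x|?M. \<bar>f x\<bar>) \<le> sqrt L * L2_norm_on {0<..<L} f"
    by (simp add: I_def L2_norm_on_def real_sqrt_mult)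
qed

lemma test_function_Ioo_endpoints:
  assumes "test_function {a<..<b} \<phi>" shows "\<phi> a = 0" "\<phi> b = 0"
proof -
  have "closure {x. \<phi> x \<noteq> 0} \<subseteq> {a<..<b}" using assms by (simp add: test_function_def)
  then have "{x. \<phi> x \<noteq> 0} \<subseteq> {a<..<b}" by (rule order_trans[OF closure_subset])
  then show "\<phi> a = 0" "\<phi> b = 0" by auto
qed

section \<open>The space of functions vanishing at the boundary\<close>

text \<open>Integrating the convergent derivatives of the approximating test functions from the left
  end point shows that the limit is the integral of its weak derivative, with both boundary values
  zero.\<close>

lemma H10_imp_indefinite_integral:
  assumes L: "L > 0" and u: "u \<in> H10 {0<..<L}"
  obtains g G where "has_weak_deriv {0<..<L} u g" "indefinite_integral {0..L} g G"
    "continuous_on {0..L} G" "G 0 = 0" "G L = 0" "AE x in lebesgue_on {0<..<L}. u x = G x"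
proof -
  let ?M = "lebesgue_on {0<..<L}"
  interpret finite_measure ?M by (rule finite_measure_lebesgue_on) auto
  have ms: "measure ?M (space ?M) = L" using L by (simp add: measure_restrict_space)
  from u obtain g \<phi> where g: "u \<in> L2 {0<..<L}" "g \<in> L2 {0<..<L}" "has_weak_deriv {0<..<L} u g"
    and \<phi>: "\<And>n::nat. test_function {0<..<L} (\<phi> n)"
      "(\<lambda>n. L2_norm_on {0<..<L} (\<lambda>x. u x - \<phi> n x)) \<longlonglongrightarrow> 0"
      "(\<lambda>n. L2_norm_on {0<..<L} (\<lambda>x. g x - deriv (\<phi> n) x)) \<longlonglongrightarrow> 0"
    by (auto simp: H10_def)
  have \<phi>c: "continuous_on S (\<phi> n)" "continuous_on S (deriv (\<phi> n))" for n S
    using \<phi>(1)[of n] by (auto intro: smooth_continuous_on smooth_deriv test_function_smooth)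
  have gi: "integrable ?M g" by (rule L2_imp_L1(1)[OF L g(2)])
  then have gi': "integrable (lebesgue_on {0..L}) g" by (simp add: integrable_lebesgue_on_Ioo)
  then have gI: "g integrable_on {0..L}" by (rule integrable_on_lebesgue_on) auto
  define G where "G x = integral {0..x} g" for x
  have Gc: "continuous_on {0..L} G" unfolding G_def by (rule indefinite_integral_continuous_1[OF gI])
  have GI: "indefinite_integral {0..L} g G"
    unfolding indefinite_integral_def
  proof (intro allI impI)
    fix c d assume cd: "c \<le> d \<and> {c..d} \<subseteq> {0..L}"
    then have "0 \<le> c" "d \<le> L" "c \<le> d" by auto
    then show "g integrable_on {c..d} \<and> G d - G c = integral {c..d} g"
      using Henstock_Kurzweil_Integration.integral_combine[of 0 c d g] cd
        integrable_subinterval_real[OF gI, of 0 d] integrable_subinterval_real[OF gI, of c d]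
      by (auto simp: G_def)
  qed
  define \<delta> where "\<delta> n = sqrt L * L2_norm_on {0<..<L} (\<lambda>x. g x - deriv (\<phi> n) x)" for n
  have \<delta>0: "\<delta> \<longlonglongrightarrow> 0" unfolding \<delta>_def using tendsto_mult[OF tendsto_const \<phi>(3), of "sqrt L"] by simp
  have dL2: "(\<lambda>x. g x - deriv (\<phi> n) x) \<in> L2 {0<..<L}" for n
    by (intro L2_diff g continuous_imp_L2 \<phi>c)
  have close: "\<bar>\<phi> n x - G x\<bar> \<le> \<delta> n" if x: "x \<in> {0..L}" for n x
  proof -
    have sub: "{0..x} \<subseteq> {0..L}" using x by auto
    have gx: "integrable (lebesgue_on {0..x}) g" by (rule Equivalence_Lebesgue_Henstock_Integration.integrable_subinterval[OF gi' sub])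
    have dx: "integrable (lebesgue_on {0..x}) (deriv (\<phi> n))" by (intro continuous_imp_integrable_real \<phi>c)
    have "(deriv (\<phi> n) has_integral \<phi> n x - \<phi> n 0) {0..x}"
      using x by (intro fundamental_theorem_of_calculus)
        (auto simp flip: has_real_derivative_iff_has_vector_derivative
          intro: smooth_has_derivative test_function_smooth \<phi>(1))
    then have "\<phi> n x = integral {0..x} (deriv (\<phi> n))"
      using test_function_Ioo_endpoints[OF \<phi>(1)] by (simp add: integral_unique)
    then have "G x - \<phi> n x = (LINT y|lebesgue_on {0..x}. g y - deriv (\<phi> n) y)"
      using gx dx by (simp add: G_def lebesgue_integral_eq_integral)
    also have "\<bar>\<dots>\<bar> \<le> (LINT y|lebesgue_on {0..x}. \<bar>g y - deriv (\<phi> n) y\<bar>)"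
      by (rule integral_abs_bound)
    also have "\<dots> \<le> (LINT y|lebesgue_on {0..L}. \<bar>g y - deriv (\<phi> n) y\<bar>)"
      using gi' continuous_imp_integrable_real[OF \<phi>c(2)] sub
      by (intro integral_mono_lebesgue_on_AE) auto
    also have "\<dots> \<le> \<delta> n"
      using L2_imp_L1(2)[OF L dL2] unfolding \<delta>_def LINT_lebesgue_on_Ioo .
    finally show ?thesis by (simp add: abs_minus_commute)
  qed
  have "\<phi> n L = 0" for n by (rule test_function_Ioo_endpoints[OF \<phi>(1)])
  then have "\<bar>G L\<bar> \<le> \<delta> n" for n using close[of L n] L by simp
  then have "\<bar>G L\<bar> \<le> 0" using LIMSEQ_le_const[OF \<delta>0, of "\<bar>G L\<bar>"] by auto
  then have GL: "G L = 0" by simp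
  have uG: "(LINT x|?M. \<bar>u x - G x\<bar>) \<le> sqrt L * L2_norm_on {0<..<L} (\<lambda>x. u x - \<phi> n x) + L * \<delta> n" for n
  proof -
    have d: "(\<lambda>x. u x - \<phi> n x) \<in> L2 {0<..<L}" by (intro L2_diff g continuous_imp_L2 \<phi>c)
    have iu: "integrable ?M u" by (rule L2_imp_L1(1)[OF L g(1)])
    have i\<phi>: "integrable ?M (\<phi> n)" "integrable ?M G" by (intro integrable_Ioo_continuous \<phi>c Gc)+
    have "(LINT x|?M. \<bar>u x - G x\<bar>) \<le> (LINT x|?M. \<bar>u x - \<phi> n x\<bar> + \<delta> n)"
    proof (rule integral_mono)
      show "\<bar>u x - G x\<bar> \<le> \<bar>u x - \<phi> n x\<bar> + \<delta> n" if "x \<in> space ?M" for x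
        using close[of x n] that by auto
    qed (use iu i\<phi> in auto)
    also have "\<dots> = (LINT x|?M. \<bar>u x - \<phi> n x\<bar>) + L * \<delta> n" using iu i\<phi> ms by simp
    also have "\<dots> \<le> sqrt L * L2_norm_on {0<..<L} (\<lambda>x. u x - \<phi> n x) + L * \<delta> n"
      using L2_imp_L1(2)[OF L d] by simp
    finally show ?thesis .
  qed
  have "(\<lambda>n. sqrt L * L2_norm_on {0<..<L} (\<lambda>x. u x - \<phi> n x) + L * \<delta> n) \<longlonglongrightarrow> sqrt L * 0 + L * 0"
    by (intro tendsto_intros \<phi> \<delta>0)
  then have "(LINT x|?M. \<bar>u x - G x\<bar>) \<le> 0" using LIMSEQ_le_const[of _ 0 "LINT x|?M. \<bar>u x - G x\<bar>"] uG by auto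
  moreover have "0 \<le> (LINT x|?M. \<bar>u x - G x\<bar>)" by (intro Bochner_Integration.integral_nonneg) auto
  ultimately have "(LINT x|?M. \<bar>u x - G x\<bar>) = 0" by simp
  then have "AE x in ?M. \<bar>u x - G x\<bar> = 0"
    using L2_imp_L1(1)[OF L g(1)] integrable_Ioo_continuous[OF Gc]
    by (subst (asm) integral_nonneg_eq_0_iff_AE) auto
  then have "AE x in ?M. u x = G x" by eventually_elim simp
  then show thesis using that[OF g(3) GI Gc _ GL] by (simp add: G_def)
qed

text \<open>For the converse, \<open>w'\<close> is approximated in \<open>L\<^sup>2\<close> by polynomials with a smooth cutoff; subtracting
  a small multiple of a fixed bump restores the mean value zero, so that the approximations can be
  integrated to test functions.\<close>

lemma zero_boundary_imp_H10:
  assumes L: "L > 0" and w: "\<And>x. x \<in> {0..L} \<Longrightarrow> (w has_real_derivative w' x) (at x within {0..L})"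
    and w': "continuous_on {0..L} w'" and bd: "w 0 = 0" "w L = 0"
  shows "w \<in> H10 {0<..<L}"
proof -
  let ?M = "lebesgue_on {0<..<L}"
  interpret finite_measure ?M by (rule finite_measure_lebesgue_on) auto
  have ms: "measure ?M (space ?M) = L" using L by (simp add: measure_restrict_space)
  have wc: "continuous_on {0..L} w"
    using w by (meson DERIV_continuous continuous_on_eq_continuous_within)
  obtain B where B: "0 \<le> B" "\<And>x. x \<in> {0..L} \<Longrightarrow> \<bar>w' x\<bar> \<le> B"
    using continuous_on_interval_bounded[OF w'] by metis
  have "\<exists>p. real_polynomial_function p \<and> (\<forall>x\<in>{0..L}. \<bar>w' x - p x\<bar> < inverse (real (Suc n)))" for n
  proof -
    have "0 < inverse (real (Suc n))" by simp
    with w' obtain p where "real_polynomial_function p" "\<And>x. x \<in> {0..L} \<Longrightarrow> \<bar>w' x - p x\<bar> < inverse (real (Suc n))"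
      by (rule Stone_Weierstrass_real_polynomial_function[OF compact_Icc]) blast
    then show ?thesis by blast
  qed
  then obtain p where p: "\<And>n. real_polynomial_function (p n)"
    "\<And>n x. x \<in> {0..L} \<Longrightarrow> \<bar>w' x - p n x\<bar> < inverse (real (Suc n))" by metis
  define a b where "a n = L / (real n + 4)" and "b n = L - L / (real n + 4)" for n :: nat
  have an: "0 < a n" "a n \<le> L / 4" "3 * L / 4 \<le> b n" "b n < L" for n
  proof -
    show 1: "0 < a n" using L by (simp add: a_def)
    show 2: "a n \<le> L / 4" unfolding a_def using L by (intro divide_left_mono) auto
    show "3 * L / 4 \<le> b n" "b n < L" using 1 2 by (simp_all add: a_def b_def)
  qed
  have ab: "a n \<le> b n" "{a n..b n} \<subseteq> {0<..<L}" for n using an[of n] L by auto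
  define \<zeta> where "\<zeta> n = plateau (a n) (b n) n" for n
  define \<rho> where "\<rho> = plateau (L / 4) (3 * L / 4) 1"
  have s: "smooth (\<zeta> n)" "smooth \<rho>" for n by (simp_all add: \<zeta>_def \<rho>_def plateau_smooth)
  have c: "continuous_on S (\<zeta> n)" "continuous_on S \<rho>" "continuous_on S (p n)" for S n
    using s p(1) by (auto intro: smooth_continuous_on smooth_polynomial_function)
  have \<zeta>0: "\<zeta> n x = 0" if "x \<notin> {a n..b n}" for n x using that by (auto simp: \<zeta>_def intro: plateau_zero)
  have \<rho>0: "\<rho> x = 0" if "x \<notin> {a n..b n}" for n x
    using that an[of n] by (auto simp: \<rho>_def intro!: plateau_zero)
  have \<rho>b: "0 \<le> \<rho> x" "\<rho> x \<le> 1" for x by (simp_all add: \<rho>_def plateau_bounds)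
  have \<zeta>b: "0 \<le> \<zeta> n x" "\<zeta> n x \<le> 1" for n x by (simp_all add: \<zeta>_def plateau_bounds)
  define m where "m = integral {0..L} \<rho>"
  have m: "m \<noteq> 0"
  proof
    assume "m = 0"
    then have "\<forall>x\<in>{0..L}. \<rho> x = 0"
      unfolding m_def using integral_eq_0_iff[OF c(2) L] \<rho>b by auto
    moreover have "\<rho> (L / 2) > 0" unfolding \<rho>_def using L by (intro plateau_positive) auto
    ultimately show False using L by auto
  qed
  define k where "k n = integral {0..L} (\<lambda>x. p n x * \<zeta> n x) / m" for n
  define g where "g n x = p n x * \<zeta> n x - k n * \<rho> x" for n x
  have gs: "smooth (g n)" for n
    unfolding g_def by (intro smooth_diff smooth_mult smooth_cmult smooth_polynomial_function s p)
  have gc: "continuous_on S (g n)" for S n by (intro smooth_continuous_on gs)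
  have g0: "g n x = 0" if "x \<notin> {a n..b n}" for n x using \<zeta>0[OF that] \<rho>0[OF that] by (simp add: g_def)
  have gint: "integral {a n..b n} (g n) = 0" for n
  proof -
    have e: "{x \<in> {a n..b n} - {0..L}. g n x \<noteq> 0} = {}" "{x \<in> {0..L} - {a n..b n}. g n x \<noteq> 0} = {}"
      using ab[of n] g0 by auto
    have "integral {a n..b n} (g n) = integral {0..L} (g n)"
      by (rule integral_spike_set) (simp_all only: e negligible_empty)
    also have "\<dots> = integral {0..L} (\<lambda>x. p n x * \<zeta> n x) - integral {0..L} (\<lambda>x. k n * \<rho> x)"
      unfolding g_def by (intro Henstock_Kurzweil_Integration.integral_diff integrable_continuous_real continuous_intros c)
    also have "\<dots> = 0" using m by (simp add: k_def m_def)
    finally show ?thesis .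
  qed
  have "\<exists>Z. test_function {0<..<L} Z \<and> (\<forall>x. (Z has_real_derivative g n x) (at x))" for n
    using test_function_antiderivative[OF gs g0 gint ab, of n] by metis
  then obtain Z where Z: "\<And>n. test_function {0<..<L} (Z n)" "\<And>n x. (Z n has_real_derivative g n x) (at x)"
    by metis
  have dZ: "deriv (Z n) = g n" for n using Z(2)[of n] by (intro ext DERIV_imp_deriv)
  have pb: "\<bar>p n x\<bar> \<le> B + 1" if "x \<in> {0..L}" for n x
  proof -
    have "inverse (real (Suc n)) \<le> 1" by (simp add: divide_simps)
    then show ?thesis using p(2)[OF that, of n] B(2)[OF that] by linarith
  qed
  have p\<zeta>b: "\<bar>p n x * \<zeta> n x\<bar> \<le> B + 1" if "x \<in> {0..L}" for n x
    using mult_mono[OF pb[OF that, of n] \<zeta>b(2)[of n x]] B(1) \<zeta>b[of n x] by (simp add: abs_mult)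
  have p_lim: "(\<lambda>n. p n x) \<longlonglongrightarrow> w' x" if "x \<in> {0..L}" for x
  proof -
    have "(\<lambda>n. w' x - p n x) \<longlonglongrightarrow> 0"
      by (rule Lim_null_comparison[OF _ LIMSEQ_inverse_real_of_nat])
        (use p(2)[OF that] in \<open>auto intro!: always_eventually less_imp_le simp del: of_nat_Suc\<close>)
    from tendsto_diff[OF tendsto_const[of "w' x"] this] show ?thesis by simp
  qed
  have a_lim: "a \<longlonglongrightarrow> 0"
    unfolding a_def by real_asymp
  have \<zeta>_lim: "(\<lambda>n. \<zeta> n x) \<longlonglongrightarrow> 1" if x: "x \<in> {0<..<L}" for x
  proof -
    have b: "b n = L - a n" for n by (simp add: a_def b_def)
    have 1: "(\<lambda>n. x - a n) \<longlonglongrightarrow> x" using tendsto_diff[OF tendsto_const[of x] a_lim] by simp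
    have 2: "(\<lambda>n. b n - x) \<longlonglongrightarrow> L - x"
      unfolding b using tendsto_diff[OF tendsto_const[of "L - x"] a_lim] by (simp add: algebra_simps)
    have *: "filterlim (\<lambda>n. real n * h n) at_top sequentially" if "h \<longlonglongrightarrow> l" "l > 0" for h l
      using filterlim_tendsto_pos_mult_at_top[OF that filterlim_real_sequentially] by (simp add: mult.commute)
    have "(\<lambda>n. \<zeta> n x) \<longlonglongrightarrow> 1 * 1"
      unfolding \<zeta>_def plateau_def using x by (intro tendsto_mult flat_0_tendsto *[OF 1] *[OF 2]) auto
    then show ?thesis by simp
  qed
  have p\<zeta>_lim: "(\<lambda>n. p n x * \<zeta> n x) \<longlonglongrightarrow> w' x" if x: "x \<in> {0<..<L}" for x
    using tendsto_mult[OF p_lim \<zeta>_lim[OF x]] x by auto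
  have k_lim: "k \<longlonglongrightarrow> 0"
  proof -
    have "(\<lambda>n. LINT x|?M. p n x * \<zeta> n x) \<longlonglongrightarrow> (LINT x|?M. w' x)"
    proof (rule integral_dominated_convergence[where w = "\<lambda>x. B + 1"])
      show "w' \<in> borel_measurable ?M" "\<And>n. (\<lambda>x. p n x * \<zeta> n x) \<in> borel_measurable ?M"
        by (intro borel_measurable_integrable integrable_Ioo_continuous w' continuous_intros c)+
      show "AE x in ?M. (\<lambda>n. p n x * \<zeta> n x) \<longlonglongrightarrow> w' x" using p\<zeta>_lim by (intro AE_I2) auto
      show "AE x in ?M. norm (p n x * \<zeta> n x) \<le> B + 1" for n using p\<zeta>b by (intro AE_I2) auto
    qed auto
    moreover have "(LINT x|?M. p n x * \<zeta> n x) = k n * m" for n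
      using LINT_Ioo_continuous[OF continuous_on_mult[OF c(3) c(1)]] m by (simp add: k_def)
    moreover have "(LINT x|?M. w' x) = 0"
    proof -
      have "(w' has_integral w L - w 0) {0..L}"
        using L w by (intro fundamental_theorem_of_calculus)
          (auto simp flip: has_real_derivative_iff_has_vector_derivative)
      then show ?thesis using LINT_Ioo_continuous[OF w'] bd by (simp add: integral_unique)
    qed
    ultimately have "(\<lambda>n. k n * m) \<longlonglongrightarrow> 0" by simp
    from tendsto_divide[OF this tendsto_const[of m] m] show ?thesis using m by simp
  qed
  obtain Kb where Kb: "\<And>n. \<bar>k n\<bar> \<le> Kb"
    using convergent_imp_Bseq[of k] k_lim unfolding Bseq_def convergent_def by (metis real_norm_def)
  have g_L2: "(\<lambda>n. L2_norm_on {0<..<L} (\<lambda>x. w' x - g n x)) \<longlonglongrightarrow> 0"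
  proof -
    have "(\<lambda>n. LINT x|?M. (w' x - g n x)\<^sup>2) \<longlonglongrightarrow> (LINT x|?M. 0)"
    proof (rule integral_dominated_convergence[where w = "\<lambda>x. (B + (B + 1) + Kb)\<^sup>2"])
      show "(\<lambda>x. (w' x - g n x)\<^sup>2) \<in> borel_measurable ?M" for n
        by (intro borel_measurable_integrable integrable_Ioo_continuous w' continuous_intros gc)
      show "AE x in ?M. (\<lambda>n. (w' x - g n x)\<^sup>2) \<longlonglongrightarrow> 0"
      proof (intro AE_I2)
        fix x assume x: "x \<in> space ?M"
        then have "(\<lambda>n. p n x * \<zeta> n x - k n * \<rho> x) \<longlonglongrightarrow> w' x - 0 * \<rho> x"
          by (intro tendsto_intros p\<zeta>_lim k_lim) auto
        from tendsto_power[OF tendsto_diff[OF tendsto_const[of "w' x"] this], of 2]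
        show "(\<lambda>n. (w' x - g n x)\<^sup>2) \<longlonglongrightarrow> 0" by (simp add: g_def)
      qed
      show "AE x in ?M. norm ((w' x - g n x)\<^sup>2) \<le> (B + (B + 1) + Kb)\<^sup>2" for n
      proof (intro AE_I2)
        fix x assume "x \<in> space ?M"
        then have x: "x \<in> {0..L}" by auto
        have "\<bar>k n * \<rho> x\<bar> \<le> Kb * 1"
          unfolding abs_mult using Kb[of n] \<rho>b[of x] by (intro mult_mono) auto
        then have "\<bar>w' x - g n x\<bar> \<le> B + (B + 1) + Kb"
          using B(2)[OF x] p\<zeta>b[OF x, of n] unfolding g_def by linarith
        then have "\<bar>w' x - g n x\<bar>\<^sup>2 \<le> (B + (B + 1) + Kb)\<^sup>2" by (intro power_mono) auto
        then show "norm ((w' x - g n x)\<^sup>2) \<le> (B + (B + 1) + Kb)\<^sup>2" by simp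
      qed
    qed auto
    from tendsto_real_sqrt[OF this] show ?thesis by (simp add: L2_norm_on_def)
  qed
  have close: "\<bar>w x - Z n x\<bar> \<le> sqrt L * L2_norm_on {0<..<L} (\<lambda>x. w' x - g n x)" if x: "x \<in> {0..L}" for n x
  proof -
    have sub: "{0..x} \<subseteq> {0..L}" using x by auto
    have d: "continuous_on {0..L} (\<lambda>y. w' y - g n y)" by (intro continuous_intros w' gc)
    have "((\<lambda>y. w' y - g n y) has_integral (w x - Z n x) - (w 0 - Z n 0)) {0..x}"
    proof (rule fundamental_theorem_of_calculus)
      fix y assume "y \<in> {0..x}"
      then have "y \<in> {0..L}" using sub by auto
      then have "((\<lambda>x. w x - Z n x) has_real_derivative w' y - g n y) (at y within {0..x})"
        by (intro DERIV_diff DERIV_subset[OF w sub] has_field_derivative_at_within[OF Z(2)])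
      then show "((\<lambda>x. w x - Z n x) has_vector_derivative w' y - g n y) (at y within {0..x})"
        by (simp add: has_real_derivative_iff_has_vector_derivative)
    qed (use x in auto)
    then have "w x - Z n x = (LINT y|lebesgue_on {0..x}. w' y - g n y)"
      using bd test_function_Ioo_endpoints[OF Z(1)] continuous_on_subset[OF d sub]
      by (simp add: integral_unique lebesgue_integral_eq_integral continuous_imp_integrable_real)
    also have "\<bar>\<dots>\<bar> \<le> (LINT y|lebesgue_on {0..x}. \<bar>w' y - g n y\<bar>)" by (rule integral_abs_bound)
    also have "\<dots> \<le> (LINT y|lebesgue_on {0..L}. \<bar>w' y - g n y\<bar>)"
      using continuous_imp_integrable_real[OF d] sub by (intro integral_mono_lebesgue_on_AE) auto
    also have "\<dots> \<le> sqrt L * L2_norm_on {0<..<L} (\<lambda>x. w' x - g n x)"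
      using L2_imp_L1(2)[OF L continuous_imp_L2[OF d]] unfolding LINT_lebesgue_on_Ioo .
    finally show ?thesis .
  qed
  have Zc: "continuous_on S (Z n)" for S n by (rule smooth_continuous_on[OF test_function_smooth[OF Z(1)]])
  have Z_L2: "(\<lambda>n. L2_norm_on {0<..<L} (\<lambda>x. w x - Z n x)) \<longlonglongrightarrow> 0"
  proof (rule Lim_null_comparison)
    show "\<forall>\<^sub>F n in sequentially. norm (L2_norm_on {0<..<L} (\<lambda>x. w x - Z n x)) \<le> L * L2_norm_on {0<..<L} (\<lambda>x. w' x - g n x)"
    proof (intro always_eventually allI)
      fix n
      define D where "D = sqrt L * L2_norm_on {0<..<L} (\<lambda>x. w' x - g n x)"
      have D0: "0 \<le> D" unfolding D_def using L by (simp add: L2_norm_on_def Bochner_Integration.integral_nonneg)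
      have "(LINT x|?M. (w x - Z n x)\<^sup>2) \<le> (LINT x|?M. D\<^sup>2)"
      proof (rule integral_mono)
        show "(w x - Z n x)\<^sup>2 \<le> D\<^sup>2" if "x \<in> space ?M" for x
          using power_mono[OF close[of x n], of 2] that by (auto simp: D_def)
      qed (auto intro!: integrable_Ioo_continuous continuous_intros wc Zc)
      also have "\<dots> = L * D\<^sup>2" using ms by simp
      finally have "sqrt (LINT x|?M. (w x - Z n x)\<^sup>2) \<le> sqrt (L * D\<^sup>2)" by (rule real_sqrt_le_mono)
      also have "\<dots> = L * L2_norm_on {0<..<L} (\<lambda>x. w' x - g n x)"
        using L D0 by (simp add: real_sqrt_mult D_def)
      finally show "norm (L2_norm_on {0<..<L} (\<lambda>x. w x - Z n x)) \<le> L * L2_norm_on {0<..<L} (\<lambda>x. w' x - g n x)"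
        by (simp add: L2_norm_on_def Bochner_Integration.integral_nonneg)
    qed
    show "(\<lambda>n. L * L2_norm_on {0<..<L} (\<lambda>x. w' x - g n x)) \<longlonglongrightarrow> 0"
      using tendsto_mult[OF tendsto_const g_L2, of L] by simp
  qed
  have "has_weak_deriv {0<..<L} w w'"
  proof (rule C1_imp_has_weak_deriv)
    show "(w has_real_derivative w' x) (at x)" if "x \<in> {0<..<L}" for x
      using w[of x] that by (simp add: at_within_Icc_at)
    show "continuous_on {0<..<L} w'" by (rule continuous_on_subset[OF w']) auto
  qed (use L in \<open>auto simp: is_interval_convex_1\<close>)
  then show ?thesis
    unfolding H10_def using continuous_imp_L2[OF wc] continuous_imp_L2[OF w'] Z(1) Z_L2 g_L2
    by (auto intro!: bexI[of _ w'] exI[of _ Z] simp: dZ)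
qed

section \<open>Regularity\<close>

text \<open>Knowing the second weak derivative up to null sets determines a classical primitive twice.\<close>

lemma H10_regularity:
  assumes L: "L > 0" and u: "u \<in> H10 {0<..<L}" and ug: "has_weak_deriv {0<..<L} u g"
    and gk: "has_weak_deriv {0<..<L} g k" and q: "continuous_on {0..L} q"
    and kq: "AE x in lebesgue_on {0<..<L}. k x = q x"
  obtains w w' where "AE x in lebesgue_on {0<..<L}. u x = w x" "w 0 = 0" "w L = 0"
    "\<And>x. x \<in> {0..L} \<Longrightarrow> (w has_real_derivative w' x) (at x within {0..L})"
    "\<And>x. x \<in> {0..L} \<Longrightarrow> (w' has_real_derivative q x) (at x within {0..L})"
proof -
  let ?\<Omega> = "{0<..<L}"
  have \<Omega>: "open ?\<Omega>" "is_interval ?\<Omega>" "?\<Omega> \<noteq> {}" using L by (auto simp: is_interval_convex_1)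
  obtain g0 w where w: "has_weak_deriv ?\<Omega> u g0" "indefinite_integral {0..L} g0 w"
    "continuous_on {0..L} w" "w 0 = 0" "w L = 0" "AE x in lebesgue_on ?\<Omega>. u x = w x"
    using H10_imp_indefinite_integral[OF L u] by metis
  obtain G where G: "indefinite_integral ?\<Omega> k G" "AE x in lebesgue_on ?\<Omega>. g x = G x"
    using weak_deriv_imp_indefinite_integral[OF \<Omega> gk] by metis
  define w' where "w' x = G (L / 2) - integral {0..L / 2} q + integral {0..x} q" for x
  have qi: "q integrable_on {a..b}" if "{a..b} \<subseteq> {0..L}" for a b
    by (intro integrable_continuous_real continuous_on_subset[OF q that])
  have w'd: "(w' has_real_derivative q x) (at x within {0..L})" if "x \<in> {0..L}" for x
    unfolding w'_def by (rule derivative_eq_intros integral_has_real_derivative[OF q that] refl | simp)+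
  have w'c: "continuous_on {0..L} w'"
    using w'd by (meson DERIV_continuous continuous_on_eq_continuous_within)
  have kint: "integral {a..b} k = integral {a..b} q" if "{a..b} \<subseteq> ?\<Omega>" for a b
  proof (rule integral_spike)
    show "negligible {x \<in> ?\<Omega>. \<not> k x = q x}" using kq by (simp add: AE_lebesgue_on_iff)
    show "q x = k x" if "x \<in> {a..b} - {x \<in> ?\<Omega>. \<not> k x = q x}" for x
      using that \<open>{a..b} \<subseteq> ?\<Omega>\<close> by auto
  qed
  have Gw': "G x = w' x" if x: "x \<in> ?\<Omega>" for x
  proof (cases "L / 2 \<le> x")
    case True
    then have sub: "{L / 2..x} \<subseteq> ?\<Omega>" using x L by auto
    then have "G x - G (L / 2) = integral {L / 2..x} q"
      using G(1) True kint[OF sub] unfolding indefinite_integral_def by auto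
    moreover have "integral {0..L / 2} q + integral {L / 2..x} q = integral {0..x} q"
      using True L x by (intro Henstock_Kurzweil_Integration.integral_combine qi) auto
    ultimately show ?thesis by (simp add: w'_def)
  next
    case False
    then have sub: "{x..L / 2} \<subseteq> ?\<Omega>" using x L by auto
    then have "G (L / 2) - G x = integral {x..L / 2} q"
      using G(1) False kint[OF sub] unfolding indefinite_integral_def by auto
    moreover have "integral {0..x} q + integral {x..L / 2} q = integral {0..L / 2} q"
      using False L x by (intro Henstock_Kurzweil_Integration.integral_combine qi) auto
    ultimately show ?thesis by (simp add: w'_def)
  qed
  have "AE x in lebesgue_on ?\<Omega>. g0 x = g x"
    by (rule has_weak_deriv_AE_unique[OF \<Omega> w(1) ug]) simp
  with G(2) have "AE x in lebesgue_on ?\<Omega>. g0 x = G x" by eventually_elim simp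
  then have g0w': "AE x in lebesgue_on ?\<Omega>. g0 x = w' x" by (rule lebesgue_on_mono) (simp add: Gw')
  then have neg: "negligible {x \<in> {0..L}. \<not> g0 x = w' x}"
    unfolding AE_lebesgue_on_Ioo_iff by (simp add: AE_lebesgue_on_iff)
  have wi: "indefinite_integral {0..L} w' w"
    unfolding indefinite_integral_def
  proof (intro allI impI conjI)
    fix c d assume cd: "c \<le> d \<and> {c..d} \<subseteq> {0..L}"
    show "w' integrable_on {c..d}"
      using cd by (intro integrable_continuous_real continuous_on_subset[OF w'c]) auto
    have "integral {c..d} g0 = integral {c..d} w'"
      by (rule integral_spike[OF neg]) (use cd in auto)
    then show "w d - w c = integral {c..d} w'" using w(2) cd unfolding indefinite_integral_def by auto
  qed
  show thesis
    by (rule that[OF w(6,4,5) indefinite_integral_has_derivative[OF wi w'c] w'd])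
qed

text \<open>A continuous representative of the weak derivative turns the indefinite integral into a
  classical primitive.\<close>

lemma weak_deriv_regularity:
  assumes \<Omega>: "open \<Omega>" "is_interval \<Omega>" "\<Omega> \<noteq> {}" and ug: "has_weak_deriv \<Omega> u g"
    and q: "continuous_on \<Omega> q" and gq: "AE x in lebesgue_on \<Omega>. g x = q x"
  obtains w where "AE x in lebesgue_on \<Omega>. u x = w x"
    "\<And>x. x \<in> \<Omega> \<Longrightarrow> (w has_real_derivative q x) (at x)"
proof -
  have \<Omega>s: "\<Omega> \<in> sets lebesgue" using \<Omega> by auto
  obtain w where w: "indefinite_integral \<Omega> g w" "AE x in lebesgue_on \<Omega>. u x = w x"
    using weak_deriv_imp_indefinite_integral[OF \<Omega> ug] by metis
  have neg: "negligible {x \<in> \<Omega>. \<not> g x = q x}" using gq \<Omega>s by (simp add: AE_lebesgue_on_iff)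
  have wi: "indefinite_integral \<Omega> q w"
    unfolding indefinite_integral_def
  proof (intro allI impI conjI)
    fix c d assume cd: "c \<le> d \<and> {c..d} \<subseteq> \<Omega>"
    show "q integrable_on {c..d}"
      using cd by (intro integrable_continuous_real continuous_on_subset[OF q]) auto
    have "integral {c..d} g = integral {c..d} q"
      by (rule integral_spike[OF neg]) (use cd in auto)
    then show "w d - w c = integral {c..d} q" using w(1) cd unfolding indefinite_integral_def by auto
  qed
  have "(w has_real_derivative q x) (at x)" if x: "x \<in> \<Omega>" for x
  proof -
    obtain e where e: "e > 0" "cball x e \<subseteq> \<Omega>" using \<Omega> x open_contains_cball by blast
    have sub: "{x - e..x + e} \<subseteq> \<Omega>" using e by (simp add: cball_eq_atLeastAtMost)
    have "(w has_real_derivative q x) (at x within {x - e..x + e})"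
      using e by (intro indefinite_integral_has_derivative indefinite_integral_mono[OF wi sub]
          continuous_on_subset[OF q sub]) auto
    then show ?thesis using e by (simp add: at_within_Icc_at)
  qed
  then show thesis using that w(2) by blast
qed

lemma AE_eq_continuous_imp_eq:
  fixes f g :: "real \<Rightarrow> real"
  assumes \<Omega>: "open \<Omega>" and f: "continuous_on \<Omega> f" and g: "continuous_on \<Omega> g"
    and eq: "AE x in lebesgue_on \<Omega>. f x = g x" and x: "x \<in> \<Omega>"
  shows "f x = g x"
proof (rule ccontr)
  assume ne: "f x \<noteq> g x"
  have \<Omega>s: "\<Omega> \<in> sets lebesgue" using \<Omega> by auto
  have "open ((\<lambda>x. f x - g x) -` (- {0}) \<inter> \<Omega>)"
    using continuous_on_open_vimage[OF \<Omega>, of "\<lambda>x. f x - g x"] f g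
    by (auto intro!: continuous_intros)
  moreover have "(\<lambda>x. f x - g x) -` (- {0}) \<inter> \<Omega> = {x \<in> \<Omega>. \<not> f x = g x}" by auto
  moreover have "negligible {x \<in> \<Omega>. \<not> f x = g x}" using eq \<Omega>s by (simp add: AE_lebesgue_on_iff)
  ultimately have "{x \<in> \<Omega>. \<not> f x = g x} = {}" using open_not_negligible by metis
  then show False using ne x by auto
qed

section \<open>Eigenfunctions are classical solutions\<close>

text \<open>The eigenvalue equation gives the second weak derivative of an eigenfunction as a multiple of its
  continuous representative, so regularity applies. The potential of the operator matters only
  inside the interval, whereas the ordinary differential equation lives on its closure; hence the
  two functions \<open>W\<close> and \<open>Wc\<close>.\<close>

lemma dirichlet_eigenfunction_classical:
  assumes L: "L > 0" and h: "h > 0" and Wc: "continuous_on {0..L} Wc"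
    and W: "\<And>x. x \<in> {0<..<L} \<Longrightarrow> W x = Wc x"
    and ef: "eigenfunction {0<..<L} (dirichlet_op L h W) E \<psi>"
  obtains u u' where "is_sol (\<lambda>x. (Wc x - E) / h\<^sup>2) 0 L u u'" "u 0 = 0" "u L = 0"
    "AE x in lebesgue_on {0<..<L}. \<psi> x = u x"
proof -
  let ?\<Omega> = "{0<..<L}" and ?Q = "\<lambda>x. (Wc x - E) / h\<^sup>2"
  from ef obtain \<eta> g k where \<psi>: "\<psi> \<in> H10 ?\<Omega>" and g: "has_weak_deriv ?\<Omega> \<psi> g"
    and k: "has_weak_deriv ?\<Omega> g k"
    and \<eta>: "AE x in lebesgue_on ?\<Omega>. \<eta> x = - (h\<^sup>2 * k x) + W x * \<psi> x"
      "AE x in lebesgue_on ?\<Omega>. \<eta> x = E * \<psi> x"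
    by (auto simp: eigenfunction_def dirichlet_op_def schroedinger_def)
  obtain G where G: "continuous_on {0..L} G" "G 0 = 0" "G L = 0" "AE x in lebesgue_on ?\<Omega>. \<psi> x = G x"
    using H10_imp_indefinite_integral[OF L \<psi>] by metis
  have Q: "continuous_on {0..L} ?Q" using h by (intro continuous_intros Wc) auto
  have "AE x in lebesgue_on ?\<Omega>. k x = (W x - E) / h\<^sup>2 * G x"
    using \<eta> G(4) by eventually_elim (use h in \<open>auto simp: field_simps\<close>)
  then have kq: "AE x in lebesgue_on ?\<Omega>. k x = ?Q x * G x"
    by (rule lebesgue_on_mono) (simp add: W)
  obtain w w' where w: "AE x in lebesgue_on ?\<Omega>. \<psi> x = w x" "w 0 = 0" "w L = 0"
    "\<And>x. x \<in> {0..L} \<Longrightarrow> (w has_real_derivative w' x) (at x within {0..L})"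
    "\<And>x. x \<in> {0..L} \<Longrightarrow> (w' has_real_derivative ?Q x * G x) (at x within {0..L})"
    using H10_regularity[OF L \<psi> g k continuous_on_mult[OF Q G(1)] kq] by blast
  have wc: "continuous_on {0..L} w"
    using w(4) by (meson DERIV_continuous continuous_on_eq_continuous_within)
  have wG: "w x = G x" if x: "x \<in> {0..L}" for x
  proof (cases "x \<in> ?\<Omega>")
    case True
    have "AE x in lebesgue_on ?\<Omega>. w x = G x" using w(1) G(4) by eventually_elim simp
    then show ?thesis
      by (rule AE_eq_continuous_imp_eq[rotated 3])
        (use True in \<open>auto intro: continuous_on_subset[OF wc] continuous_on_subset[OF G(1)]\<close>)
  next
    case False
    then have "x = 0 \<or> x = L" using x by auto
    then show ?thesis using w(2,3) G(2,3) by auto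
  qed
  have "is_sol ?Q 0 L w w'" unfolding is_sol_def using w(4,5) wG by auto
  then show thesis using that w by blast
qed

lemma is_sol_dirichlet_eigenfunction:
  assumes L: "L > 0" and h: "h > 0" and Wc: "continuous_on {0..L} Wc"
    and W: "\<And>x. x \<in> {0<..<L} \<Longrightarrow> W x = Wc x"
    and sol: "is_sol (\<lambda>x. (Wc x - E) / h\<^sup>2) 0 L u u'" and bd: "u 0 = 0" "u L = 0"
    and nz: "x0 \<in> {0<..<L}" "u x0 \<noteq> 0"
  shows "eigenfunction {0<..<L} (dirichlet_op L h W) E u"
proof -
  let ?\<Omega> = "{0<..<L}" and ?k = "\<lambda>x. (Wc x - E) / h\<^sup>2 * u x"
  have \<Omega>: "open ?\<Omega>" "is_interval ?\<Omega>" "?\<Omega> \<noteq> {}" using L by (auto simp: is_interval_convex_1)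
  note d = is_solD[OF sol] and c = is_sol_continuous[OF sol]
  have kc: "continuous_on {0..L} ?k" using h by (intro continuous_intros Wc c) auto
  have at: "at x within {0..L} = at x" if "x \<in> ?\<Omega>" for x
    using that by (simp add: at_within_Icc_at)
  have sub: "?\<Omega> \<subseteq> {0..L}" by auto
  have d': "(u has_real_derivative u' x) (at x)" "(u' has_real_derivative ?k x) (at x)" if "x \<in> ?\<Omega>" for x
    using d[OF subsetD[OF sub that]] at[OF that] by simp_all
  have 1: "has_weak_deriv ?\<Omega> u u'"
    by (rule C1_imp_has_weak_deriv[OF \<Omega> d'(1) continuous_on_subset[OF c(2) sub]])
  have 2: "has_weak_deriv ?\<Omega> u' ?k"
    by (rule C1_imp_has_weak_deriv[OF \<Omega> d'(2) continuous_on_subset[OF kc sub]])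
  have "u \<in> H2 ?\<Omega>"
    unfolding H2_def
    using 1 2 continuous_imp_L2[OF c(1)] continuous_imp_L2[OF c(2)] continuous_imp_L2[OF kc] by blast
  with zero_boundary_imp_H10[OF L d(1) c(2) bd] have "u \<in> H2 ?\<Omega> \<inter> H10 ?\<Omega>" by simp
  moreover have "(\<lambda>x. E * u x) \<in> L2 ?\<Omega>" by (intro continuous_imp_L2 continuous_intros c)
  moreover have "AE x in lebesgue_on ?\<Omega>. E * u x = - (h\<^sup>2 * ?k x) + W x * u x"
    using h W by (intro AE_I2) (auto simp: field_simps)
  ultimately have "(u, \<lambda>x. E * u x) \<in> dirichlet_op L h W"
    unfolding dirichlet_op_def schroedinger_def mem_Collect_eq case_prod_conv real_scaleR_def
    using 1 2 by blast
  moreover have "\<not> (AE x in lebesgue_on ?\<Omega>. u x = 0)"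
    using AE_eq_continuous_imp_eq[OF \<Omega>(1) continuous_on_subset[OF c(1) sub] continuous_on_const, of 0 x0] nz
    by auto
  ultimately show ?thesis unfolding eigenfunction_def by auto
qed

lemma H0_eigenfunction_classical:
  assumes U: "continuous_on UNIV U" and ef: "eigenfunction UNIV (H0 U) E \<psi>"
  obtains u u' where "\<And>x. (u has_real_derivative u' x) (at x)"
    "\<And>x. (u' has_real_derivative (U x - E) * u x) (at x)"
    "integrable lebesgue (\<lambda>x. (u x)\<^sup>2)" "\<exists>x. u x \<noteq> 0"
proof -
  have \<Omega>: "open (UNIV :: real set)" "is_interval (UNIV :: real set)" "(UNIV :: real set) \<noteq> {}"
    by (auto simp: is_interval_convex_1)
  from ef obtain \<eta> g k where \<psi>: "\<psi> \<in> L2 UNIV" and g: "has_weak_deriv UNIV \<psi> g"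
    and k: "has_weak_deriv UNIV g k"
    and \<eta>: "AE x in lebesgue_on UNIV. \<eta> x = - k x + U x *\<^sub>R \<psi> x"
      "AE x in lebesgue_on UNIV. \<eta> x = E *\<^sub>R \<psi> x" and nz: "\<not> (AE x in lebesgue_on UNIV. \<psi> x = 0)"
    by (auto simp: eigenfunction_def H0_def schroedinger_def H2_def)
  have "\<exists>T::complex \<Rightarrow> real. bounded_linear T \<and> (\<forall>z. \<bar>T z\<bar> \<le> norm z) \<and> \<not> (AE x in lebesgue_on UNIV. T (\<psi> x) = 0)"
  proof (rule ccontr)
    assume no: "\<not> ?thesis"
    have "AE x in lebesgue_on UNIV. Re (\<psi> x) = 0"
      using no bounded_linear_Re abs_Re_le_cmod by blast
    moreover have "AE x in lebesgue_on UNIV. Im (\<psi> x) = 0"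
      using no bounded_linear_Im abs_Im_le_cmod by blast
    ultimately have "AE x in lebesgue_on UNIV. \<psi> x = 0" by eventually_elim (simp add: complex_eq_iff)
    then show False using nz by simp
  qed
  then obtain T :: "complex \<Rightarrow> real" where T: "bounded_linear T" "\<And>z. \<bar>T z\<bar> \<le> norm z"
    and Tnz: "\<not> (AE x in lebesgue_on UNIV. T (\<psi> x) = 0)" by blast
  interpret T: bounded_linear T by fact
  have wT: "has_weak_deriv UNIV (\<lambda>x. T (\<psi> x)) (\<lambda>x. T (g x))" "has_weak_deriv UNIV (\<lambda>x. T (g x)) (\<lambda>x. T (k x))"
    using has_weak_deriv_bounded_linear[OF \<Omega>(2,3) _ T(1)] g k by auto
  obtain G where G: "continuous_on UNIV G" "AE x in lebesgue_on UNIV. T (\<psi> x) = G x"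
    using weak_deriv_imp_indefinite_integral[OF \<Omega> wT(1)] by metis
  have qc: "continuous_on UNIV (\<lambda>x. (U x - E) * G x)" by (intro continuous_intros U G)
  have "AE x in lebesgue_on UNIV. T (k x) = (U x - E) * G x"
    using \<eta> G(2)
  proof eventually_elim
    case (elim x)
    then have "k x = (U x - E) *\<^sub>R \<psi> x" by (simp add: scaleR_left_diff_distrib)
    then show ?case using elim by (simp add: T.scaleR)
  qed
  then obtain w' where w': "AE x in lebesgue_on UNIV. T (g x) = w' x"
      "\<And>x. (w' has_real_derivative (U x - E) * G x) (at x)"
    by (rule weak_deriv_regularity[OF \<Omega> wT(2) qc]) blast
  have w'c: "continuous_on UNIV w'" using DERIV_isCont[OF w'(2)] by (simp add: continuous_at_imp_continuous_on)
  obtain w where w: "AE x in lebesgue_on UNIV. T (\<psi> x) = w x" "\<And>x. (w has_real_derivative w' x) (at x)"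
    using weak_deriv_regularity[OF \<Omega> wT(1) w'c w'(1)] by auto
  have wc: "continuous_on UNIV w" using DERIV_isCont[OF w(2)] by (simp add: continuous_at_imp_continuous_on)
  have "AE x in lebesgue_on UNIV. w x = G x" using w(1) G(2) by eventually_elim simp
  then have wG: "w x = G x" for x by (rule AE_eq_continuous_imp_eq[OF \<Omega>(1) wc G(1)]) simp
  show thesis
  proof
    show "(w has_real_derivative w' x) (at x)" "(w' has_real_derivative (U x - E) * w x) (at x)" for x
      using w(2) w'(2) wG by auto
    have "integrable (lebesgue_on UNIV) (\<lambda>x. (w x)\<^sup>2)"
    proof (rule Bochner_Integration.integrable_bound)
      show "integrable (lebesgue_on UNIV) (\<lambda>x. (norm (\<psi> x))\<^sup>2)" using \<psi> by (simp add: L2_def)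
      show "(\<lambda>x. (w x)\<^sup>2) \<in> borel_measurable (lebesgue_on UNIV)"
        by (intro continuous_imp_measurable_on_sets_lebesgue continuous_intros wc) auto
      show "AE x in lebesgue_on UNIV. norm ((w x)\<^sup>2) \<le> norm ((norm (\<psi> x))\<^sup>2)"
        using w(1)
      proof eventually_elim
        case (elim x)
        then have "\<bar>w x\<bar>\<^sup>2 \<le> (norm (\<psi> x))\<^sup>2" using T(2)[of "\<psi> x"] by (intro power_mono) auto
        then show ?case by simp
      qed
    qed
    then show "integrable lebesgue (\<lambda>x. (w x)\<^sup>2)" by (simp add: lebesgue_on_UNIV_eq)
    show "\<exists>x. w x \<noteq> 0"
    proof (rule ccontr)
      assume "\<not> ?thesis"
      with w(1) have "AE x in lebesgue_on UNIV. T (\<psi> x) = 0" by simp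
      then show False using Tnz by simp
    qed
  qed
qed

lemma integrable_exp_minus_abs:
  assumes c: "c > 0" shows "integrable lebesgue (\<lambda>x::real. exp (- (c * \<bar>x\<bar>)))"
proof -
  define g where "g x = indicator {0..} x *\<^sub>R exp (- c * x)" for x :: real
  have "(\<lambda>x::real. exp (- c * x)) absolutely_integrable_on {0..}"
    using integrable_on_exp_minus_to_infinity[OF c] by (intro nonnegative_absolutely_integrable_1) auto
  then have "integrable lebesgue g" by (simp add: set_integrable_def g_def[abs_def])
  moreover have gm: "g \<in> borel_measurable lborel" unfolding g_def by measurable
  ultimately have gl: "integrable lborel g" by (simp add: integrable_completion)
  then have "integrable lborel (\<lambda>x. g (0 + (-1) * x))" by (rule lborel_integrable_real_affine) simp
  with gl have "integrable lborel (\<lambda>x. g x + g (- x))" by simp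
  then have "integrable lborel (\<lambda>x::real. exp (- (c * \<bar>x\<bar>)))"
    by (rule Bochner_Integration.integrable_bound) (auto intro!: AE_I2 simp: g_def indicator_def)
  then show ?thesis by (simp add: integrable_completion)
qed

lemma classical_H0_eigenfunction:
  assumes U: "continuous_on UNIV U" "\<And>x. \<bar>U x\<bar> \<le> M"
    and u: "\<And>x. (u has_real_derivative u' x) (at x)" "\<And>x. (u' has_real_derivative (U x - E) * u x) (at x)"
    and decay: "\<kappa> > 0" "\<And>x. \<bar>u x\<bar> \<le> C * exp (- (\<kappa> * \<bar>x\<bar>))" "\<And>x. \<bar>u' x\<bar> \<le> C * exp (- (\<kappa> * \<bar>x\<bar>))"
    and nz: "u x0 \<noteq> 0"
  shows "\<exists>\<psi>. eigenfunction UNIV (H0 U) E \<psi>"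
proof -
  have \<Omega>: "open (UNIV :: real set)" "is_interval (UNIV :: real set)" "(UNIV :: real set) \<noteq> {}"
    by (auto simp: is_interval_convex_1)
  have L2_decay: "(\<lambda>x. complex_of_real (v x)) \<in> L2 UNIV"
    if v: "continuous_on UNIV v" "\<And>x. \<bar>v x\<bar> \<le> D * exp (- (\<kappa> * \<bar>x\<bar>))" for v :: "real \<Rightarrow> real" and D
  proof -
    have m: "v \<in> borel_measurable (lebesgue_on UNIV)"
      by (intro continuous_imp_measurable_on_sets_lebesgue v) auto
    have "integrable (lebesgue_on UNIV) (\<lambda>x. (v x)\<^sup>2)"
    proof (rule Bochner_Integration.integrable_bound)
      show "integrable (lebesgue_on UNIV) (\<lambda>x. D\<^sup>2 * exp (- ((2 * \<kappa>) * \<bar>x\<bar>)))"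
        unfolding lebesgue_on_UNIV_eq using decay(1)
        by (intro Bochner_Integration.integrable_mult_right integrable_exp_minus_abs) auto
      show "AE x in lebesgue_on UNIV. norm ((v x)\<^sup>2) \<le> norm (D\<^sup>2 * exp (- ((2 * \<kappa>) * \<bar>x\<bar>)))"
      proof (intro AE_I2)
        fix x
        have "\<bar>v x\<bar>\<^sup>2 \<le> (D * exp (- (\<kappa> * \<bar>x\<bar>)))\<^sup>2" by (intro power_mono v) auto
        also have "\<dots> = D\<^sup>2 * exp (- ((2 * \<kappa>) * \<bar>x\<bar>))"
          by (simp add: power_mult_distrib flip: exp_double)
        finally show "norm ((v x)\<^sup>2) \<le> norm (D\<^sup>2 * exp (- ((2 * \<kappa>) * \<bar>x\<bar>)))" by simp
      qed
    qed (use m in auto)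
    then show ?thesis using m by (auto simp: L2_def)
  qed
  have uc: "continuous_on UNIV u" using DERIV_isCont[OF u(1)] by (simp add: continuous_at_imp_continuous_on)
  have u'c: "continuous_on UNIV u'" using DERIV_isCont[OF u(2)] by (simp add: continuous_at_imp_continuous_on)
  define k where "k x = (U x - E) * u x" for x
  have kc: "continuous_on UNIV k" unfolding k_def by (intro continuous_intros U uc)
  have kd: "\<bar>k x\<bar> \<le> ((M + \<bar>E\<bar>) * C) * exp (- (\<kappa> * \<bar>x\<bar>))" for x
  proof -
    have "\<bar>U x - E\<bar> * \<bar>u x\<bar> \<le> (M + \<bar>E\<bar>) * (C * exp (- (\<kappa> * \<bar>x\<bar>)))"
      using U(2)[of x] by (intro mult_mono decay(2)) auto
    then show ?thesis by (simp add: k_def abs_mult mult_ac)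
  qed
  note b = bounded_linear_of_real[where 'a = complex]
  have 1: "has_weak_deriv UNIV (\<lambda>x. complex_of_real (u x)) (\<lambda>x. complex_of_real (u' x))"
    by (rule has_weak_deriv_bounded_linear[OF \<Omega>(2,3) _ b C1_imp_has_weak_deriv[OF \<Omega> u(1) u'c]]) simp
  have 2: "has_weak_deriv UNIV (\<lambda>x. complex_of_real (u' x)) (\<lambda>x. complex_of_real (k x))"
    by (rule has_weak_deriv_bounded_linear[OF \<Omega>(2,3) _ b C1_imp_has_weak_deriv[OF \<Omega> _ kc]])
      (use u(2) in \<open>auto simp: k_def\<close>)
  have "(\<lambda>x. complex_of_real (u x)) \<in> H2 UNIV"
    unfolding H2_def
    using 1 2 L2_decay[OF uc decay(2)] L2_decay[OF u'c decay(3)] L2_decay[OF kc kd] by blast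
  moreover have "(\<lambda>x. complex_of_real (E * u x)) \<in> L2 UNIV"
  proof (rule L2_decay)
    show "\<bar>E * u x\<bar> \<le> (\<bar>E\<bar> * C) * exp (- (\<kappa> * \<bar>x\<bar>))" for x
      using mult_left_mono[OF decay(2), of "\<bar>E\<bar>" x] by (simp add: abs_mult mult_ac)
  qed (intro continuous_intros uc)
  moreover have "AE x in lebesgue_on UNIV. complex_of_real (E * u x) = - (1\<^sup>2 *\<^sub>R complex_of_real (k x)) + U x *\<^sub>R complex_of_real (u x)"
    by (intro AE_I2) (simp add: k_def scaleR_conv_of_real algebra_simps)
  ultimately have "((\<lambda>x. complex_of_real (u x)), (\<lambda>x. complex_of_real (E * u x))) \<in> H0 U"
    unfolding H0_def schroedinger_def mem_Collect_eq case_prod_conv using 1 2 by blast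
  moreover have "\<not> (AE x in lebesgue_on UNIV. complex_of_real (u x) = 0)"
    using AE_eq_continuous_imp_eq[OF \<Omega>(1) uc continuous_on_const, of 0 x0] nz by auto
  moreover have "AE x in lebesgue_on UNIV. complex_of_real (E * u x) = E *\<^sub>R complex_of_real (u x)"
    by (simp add: scaleR_conv_of_real)
  ultimately show ?thesis unfolding eigenfunction_def by blast
qed

section \<open>Bound states of the limit operator\<close>

text \<open>The classical bound state is glued from exponentials outside the well and from a solution inside.\<close>

lemma glue_has_derivative:
  fixes f g :: "real \<Rightarrow> real"
  assumes f: "\<And>x. x \<in> S \<Longrightarrow> x \<le> c \<Longrightarrow> (f has_real_derivative f' x) (at x within S \<inter> {..c})"
    and g: "\<And>x. x \<in> S \<Longrightarrow> c \<le> x \<Longrightarrow> (g has_real_derivative g' x) (at x within S \<inter> {c..})"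
    and eq: "f c = g c" "f' c = g' c" and x: "x \<in> S"
  shows "((\<lambda>x. if x \<le> c then f x else g x) has_real_derivative (if x \<le> c then f' x else g' x)) (at x within S)"
proof -
  let ?F = "\<lambda>x. if x \<le> c then f x else g x" and ?F' = "if x \<le> c then f' x else g' x"
  have left: "(?F has_real_derivative ?F') (at x within S \<inter> {..c})"
  proof (cases "x \<le> c")
    case True
    have "(?F has_real_derivative f' x) (at x within S \<inter> {..c})"
      by (rule has_field_derivative_transform_within[OF f[OF x True] zero_less_one]) (use x True in auto)
    then show ?thesis using True by simp
  next
    case False
    then have "x \<notin> closure (S \<inter> {..c})"
      using closure_mono[of "S \<inter> {..c}" "{..c}"] by auto
    then show ?thesis
      by (simp add: has_field_derivative_iff not_in_closure_trivial_limitI trivial_limit_def[symmetric] tendsto_bot)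
  qed
  have right: "(?F has_real_derivative ?F') (at x within S \<inter> {c..})"
  proof (cases "c \<le> x")
    case True
    have "(?F has_real_derivative g' x) (at x within S \<inter> {c..})"
      by (rule has_field_derivative_transform_within[OF g[OF x True] zero_less_one]) (use x True eq in auto)
    then show ?thesis using True eq by (cases "x = c") auto
  next
    case False
    then have "x \<notin> closure (S \<inter> {c..})"
      using closure_mono[of "S \<inter> {c..}" "{c..}"] by auto
    then show ?thesis
      by (simp add: has_field_derivative_iff not_in_closure_trivial_limitI)
  qed
  have "(?F has_real_derivative ?F') (at x within (S \<inter> {..c}) \<union> (S \<inter> {c..}))"
    using left right unfolding has_field_derivative_iff by (rule Lim_Un)
  also have "(S \<inter> {..c}) \<union> (S \<inter> {c..}) = S" by auto
  finally show ?thesis .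
qed

text \<open>A decaying solution on a half-line is a multiple of \<open>exp (\<kappa> x)\<close>: the component
  \<open>u' - \<kappa> u\<close> is a multiple of \<open>exp (- \<kappa> x)\<close>, which is not square-integrable at \<open>- \<infinity>\<close>.\<close>

lemma square_integrable_tail:
  assumes u: "\<And>x. (u has_real_derivative u' x) (at x)" "\<And>x. (u' has_real_derivative q x * u x) (at x)"
    and q: "\<And>x. x \<le> c \<Longrightarrow> q x = \<kappa>\<^sup>2" and k: "\<kappa> > 0" and int: "integrable lebesgue (\<lambda>x. (u x)\<^sup>2)"
  shows "u' c = \<kappa> * u c"
proof (rule ccontr)
  assume ne: "\<not> ?thesis"
  define p r where "p x = exp (\<kappa> * (x - c)) * (u' x - \<kappa> * u x)"
    and "r x = exp (- (\<kappa> * (x - c))) * (u' x + \<kappa> * u x)" for x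
  have dp: "(p has_real_derivative exp (\<kappa> * (x - c)) * ((q x - \<kappa>\<^sup>2) * u x)) (at x)" for x
    unfolding p_def using u by (auto intro!: derivative_eq_intros simp: algebra_simps power2_eq_square)
  have dr: "(r has_real_derivative exp (- (\<kappa> * (x - c))) * ((q x - \<kappa>\<^sup>2) * u x)) (at x)" for x
    unfolding r_def using u by (auto intro!: derivative_eq_intros simp: algebra_simps power2_eq_square)
  have const: "p y = p c \<and> r y = r c" if y: "y \<le> c" for y
  proof (cases "y = c")
    case False
    then have "y < c" using y by simp
    then show ?thesis
      using MVT2[of y c p] MVT2[of y c r] dp dr q by (metis diff_self eq_iff_diff_eq_0 less_imp_le mult_zero_left mult_zero_right)
  qed simp
  have pc: "p c \<noteq> 0" using ne by (simp add: p_def)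
  define T where "T = (2 * \<kappa> + \<bar>r c\<bar>) / (\<bar>p c\<bar> * \<kappa>)"
  have T0: "0 \<le> T" using k by (simp add: T_def)
  have big: "1 \<le> (u y)\<^sup>2" if y: "y \<le> c - T" for y
  proof -
    have yc: "y \<le> c" using y T0 by simp
    have "u' y - \<kappa> * u y = exp (- (\<kappa> * (y - c))) * p y" "u' y + \<kappa> * u y = exp (\<kappa> * (y - c)) * r y"
      by (simp_all add: p_def r_def mult.assoc[symmetric] exp_add[symmetric])
    then have "u' y - \<kappa> * u y = exp (- (\<kappa> * (y - c))) * p c" "u' y + \<kappa> * u y = exp (\<kappa> * (y - c)) * r c"
      using const[OF yc] by simp_all
    then have uy: "2 * \<kappa> * u y = exp (\<kappa> * (y - c)) * r c - exp (- (\<kappa> * (y - c))) * p c" by linarith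
    have "\<bar>exp (\<kappa> * (y - c)) * r c\<bar> \<le> 1 * \<bar>r c\<bar>"
      unfolding abs_mult using k yc by (intro mult_right_mono) (auto simp: mult_nonneg_nonpos)
    moreover have "2 * \<kappa> + \<bar>r c\<bar> \<le> \<bar>exp (- (\<kappa> * (y - c))) * p c\<bar>"
    proof -
      have "2 * \<kappa> + \<bar>r c\<bar> = (\<kappa> * T) * \<bar>p c\<bar>" using pc k by (simp add: T_def)
      also have "\<dots> \<le> (\<kappa> * (c - y)) * \<bar>p c\<bar>" using y k by (intro mult_right_mono mult_left_mono) auto
      also have "\<dots> \<le> exp (- (\<kappa> * (y - c))) * \<bar>p c\<bar>"
        using exp_ge_add_one_self[of "- (\<kappa> * (y - c))"] by (intro mult_right_mono) (auto simp: algebra_simps)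
      finally show ?thesis by (simp add: abs_mult)
    qed
    ultimately have "2 * \<kappa> \<le> \<bar>2 * \<kappa> * u y\<bar>" using uy by linarith
    then have "1 \<le> \<bar>u y\<bar>" using k by (simp add: abs_mult)
    then have "1\<^sup>2 \<le> \<bar>u y\<bar>\<^sup>2" by (intro power_mono) auto
    then show ?thesis by simp
  qed
  have le: "real n \<le> (LINT x|lebesgue. (u x)\<^sup>2)" for n :: nat
  proof -
    have "(LINT x|lebesgue. indicator {c - T - real n..c - T} x) \<le> (LINT x|lebesgue. (u x)\<^sup>2)"
    proof (rule integral_mono)
      show "integrable lebesgue (indicat_real {c - T - real n..c - T})" by simp
      show "indicat_real {c - T - real n..c - T} x \<le> (u x)\<^sup>2" for x
        using big[of x] by (auto simp: indicator_def)
    qed (rule int)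
    then show ?thesis by simp
  qed
  obtain n where "(LINT x|lebesgue. (u x)\<^sup>2) < real n" using reals_Archimedean2 by blast
  then show False using le[of n] by simp
qed

text \<open>\<open>\<phi>\<close> is the solution on the support of the well that starts as the decaying exponential on the
  left; it is a bound state iff it leaves as the decaying exponential on the right.\<close>

lemma bound_state_iff:
  assumes U: "continuous_on UNIV U" "\<And>x. 1 \<le> \<bar>x\<bar> \<Longrightarrow> U x = 0"
    and k: "\<kappa> > 0" and sol: "is_sol (\<lambda>x. U x + \<kappa>\<^sup>2) (-1) 1 \<phi> \<phi>'" and init: "\<phi> (-1) = 1" "\<phi>' (-1) = \<kappa>"
  shows "(\<exists>\<psi>. eigenfunction UNIV (H0 U) (- \<kappa>\<^sup>2) \<psi>) \<longleftrightarrow> \<phi>' 1 + \<kappa> * \<phi> 1 = 0"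
proof
  assume "\<exists>\<psi>. eigenfunction UNIV (H0 U) (- \<kappa>\<^sup>2) \<psi>"
  then obtain \<psi> where "eigenfunction UNIV (H0 U) (- \<kappa>\<^sup>2) \<psi>" by blast
  then obtain u u' where u0: "\<And>x. (u has_real_derivative u' x) (at x)"
    "\<And>x. (u' has_real_derivative (U x - - \<kappa>\<^sup>2) * u x) (at x)"
    and int: "integrable lebesgue (\<lambda>x. (u x)\<^sup>2)" and nz: "\<exists>x. u x \<noteq> 0"
    by (rule H0_eigenfunction_classical[OF U(1)]) blast
  have u: "(u has_real_derivative u' x) (at x)" "(u' has_real_derivative (U x + \<kappa>\<^sup>2) * u x) (at x)" for x
    using u0[of x] by simp_all
  have left: "u' (-1) = \<kappa> * u (-1)"
    by (rule square_integrable_tail[OF u _ k int]) (use U(2) in auto)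
  have right: "u' 1 = - \<kappa> * u 1"
  proof -
    have m: "((\<lambda>x. - x) has_real_derivative - 1) (at x)" for x :: real
      by (auto intro!: derivative_eq_intros)
    have "- u' (- (-1)) = \<kappa> * u (- (-1))"
    proof (rule square_integrable_tail[where u = "\<lambda>x. u (- x)" and u' = "\<lambda>x. - u' (- x)" and q = "\<lambda>x. U (- x) + \<kappa>\<^sup>2"])
      show "((\<lambda>x. u (- x)) has_real_derivative - u' (- x)) (at x)" for x
        using DERIV_chain2[OF u(1) m, of x] by simp
      show "((\<lambda>x. - u' (- x)) has_real_derivative (U (- x) + \<kappa>\<^sup>2) * u (- x)) (at x)" for x
        using DERIV_minus[OF DERIV_chain2[OF u(2) m, of x]] by simp
      have "integrable lborel (\<lambda>x. (u x)\<^sup>2)"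
        using int DERIV_isCont[OF u(1)] by (subst (asm) integrable_completion)
          (auto intro!: borel_measurable_continuous_onI continuous_intros continuous_at_imp_continuous_on)
      from lborel_integrable_real_affine[OF this, of "-1" 0]
      show "integrable lebesgue (\<lambda>x. (u (- x))\<^sup>2)" by (subst integrable_completion) auto
    qed (use U(2) k in auto)
    then show ?thesis by simp
  qed
  have sol_u: "is_sol (\<lambda>x. U x + \<kappa>\<^sup>2) a b u u'" for a b
    unfolding is_sol_def using has_field_derivative_at_within[OF u(1)] has_field_derivative_at_within[OF u(2)] by auto
  have Qc: "continuous_on S (\<lambda>x. U x + \<kappa>\<^sup>2)" for S
    by (intro continuous_intros continuous_on_subset[OF U(1)]) auto
  have ne: "u (-1) \<noteq> 0"
  proof
    assume z: "u (-1) = 0"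
    obtain x where x: "u x \<noteq> 0" using nz by blast
    show False
    proof (cases "-1 \<le> x")
      case True
      then show False
        using sol_unique[OF sol_u is_sol_zero Qc, of "-1" x] x z left by auto
    next
      case False
      then show False
        using sol_unique_right[OF sol_u is_sol_zero Qc, where a = x and b = "-1" and y = x] x z left by simp
    qed
  qed
  have match: "u 1 = u (-1) * \<phi> 1 \<and> u' 1 = u (-1) * \<phi>' 1"
    by (rule sol_unique[OF sol_u is_sol_scale[OF sol] Qc]) (use init left in auto)
  have "u (-1) * (\<phi>' 1 + \<kappa> * \<phi> 1) = u (-1) * \<phi>' 1 + \<kappa> * (u (-1) * \<phi> 1)"
    by (simp add: algebra_simps)
  also have "\<dots> = u' 1 + \<kappa> * u 1" using match by simp
  also have "\<dots> = 0" using right by simp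
  finally have "u (-1) * (\<phi>' 1 + \<kappa> * \<phi> 1) = 0" .
  then show "\<phi>' 1 + \<kappa> * \<phi> 1 = 0" using ne by simp
next
  assume exit: "\<phi>' 1 + \<kappa> * \<phi> 1 = 0"
  define v where "v x = (if x \<le> -1 then exp (\<kappa> * (x + 1)) else \<phi> x)" for x
  define v' where "v' x = (if x \<le> -1 then \<kappa> * exp (\<kappa> * (x + 1)) else \<phi>' x)" for x
  define w where "w x = (if x \<le> 1 then v x else \<phi> 1 * exp (- (\<kappa> * (x - 1))))" for x
  define w' where "w' x = (if x \<le> 1 then v' x else - \<kappa> * \<phi> 1 * exp (- (\<kappa> * (x - 1))))" for x
  have ivl: "{..1} \<inter> {-1..} = {-1..1::real}" by auto
  have dv: "(v has_real_derivative v' x) (at x within {..1})" if "x \<in> {..1}" for x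
    unfolding v_def[abs_def] v'_def
    by (rule glue_has_derivative[OF _ _ _ _ that])
      (use is_solD[OF sol] init in \<open>auto intro!: derivative_eq_intros simp: ivl\<close>)
  have dv': "(v' has_real_derivative (if x \<le> -1 then \<kappa>\<^sup>2 * exp (\<kappa> * (x + 1)) else (U x + \<kappa>\<^sup>2) * \<phi> x)) (at x within {..1})"
    if "x \<in> {..1}" for x
    unfolding v'_def[abs_def]
    by (rule glue_has_derivative[OF _ _ _ _ that])
      (use is_solD[OF sol] init U(2)[of "-1"] in \<open>auto intro!: derivative_eq_intros simp: ivl power2_eq_square\<close>)
  have v1: "v 1 = \<phi> 1" "v' 1 = - (\<kappa> * \<phi> 1)" using exit by (auto simp: v_def v'_def)
  have dw: "(w has_real_derivative w' x) (at x)" for x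
  proof -
    have "(w has_real_derivative w' x) (at x within UNIV)"
      unfolding w_def[abs_def] w'_def
      by (rule glue_has_derivative) (use dv v1 in \<open>auto intro!: derivative_eq_intros\<close>)
    then show ?thesis by simp
  qed
  have dw': "(w' has_real_derivative (U x - (- \<kappa>\<^sup>2)) * w x) (at x)" for x
  proof -
    have "(w' has_real_derivative (if x \<le> 1 then (if x \<le> -1 then \<kappa>\<^sup>2 * exp (\<kappa> * (x + 1)) else (U x + \<kappa>\<^sup>2) * \<phi> x)
        else \<kappa>\<^sup>2 * \<phi> 1 * exp (- (\<kappa> * (x - 1))))) (at x within UNIV)"
      unfolding w'_def[abs_def]
      by (rule glue_has_derivative)
        (use dv' v1 U(2)[of 1] in \<open>auto intro!: derivative_eq_intros simp: power2_eq_square\<close>)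
    moreover have "(if x \<le> 1 then (if x \<le> -1 then \<kappa>\<^sup>2 * exp (\<kappa> * (x + 1)) else (U x + \<kappa>\<^sup>2) * \<phi> x)
        else \<kappa>\<^sup>2 * \<phi> 1 * exp (- (\<kappa> * (x - 1)))) = (U x - (- \<kappa>\<^sup>2)) * w x"
      using U(2)[of x] by (auto simp: w_def v_def)
    ultimately show ?thesis by simp
  qed
  obtain M where M: "\<And>x. \<bar>U x\<bar> \<le> M"
  proof -
    obtain K where K: "0 \<le> K" "\<And>x. x \<in> {-1..1} \<Longrightarrow> \<bar>U x\<bar> \<le> K"
      using continuous_on_interval_bounded[OF continuous_on_subset[OF U(1) subset_UNIV]] by metis
    have "\<bar>U x\<bar> \<le> K" for x using K U(2)[of x] by (cases "x \<in> {-1..1}") auto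
    then show thesis using that by blast
  qed
  obtain B1 where B1: "0 \<le> B1" "\<And>x. x \<in> {-1..1} \<Longrightarrow> \<bar>\<phi> x\<bar> \<le> B1"
    using continuous_on_interval_bounded[OF is_sol_continuous(1)[OF sol]] by metis
  obtain B2 where B2: "0 \<le> B2" "\<And>x. x \<in> {-1..1} \<Longrightarrow> \<bar>\<phi>' x\<bar> \<le> B2"
    using continuous_on_interval_bounded[OF is_sol_continuous(2)[OF sol]] by metis
  define C where "C = exp \<kappa> * (1 + \<kappa> + B1 + B2 + \<kappa> * B1)"
  have C: "\<bar>w x\<bar> \<le> C * exp (- (\<kappa> * \<bar>x\<bar>)) \<and> \<bar>w' x\<bar> \<le> C * exp (- (\<kappa> * \<bar>x\<bar>))" for x
  proof -
    have main: "\<bar>t\<bar> * s \<le> C * exp (- (\<kappa> * \<bar>x\<bar>))"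
      if t: "\<bar>t\<bar> \<le> 1 + \<kappa> + B1 + B2 + \<kappa> * B1" and s: "0 \<le> s" "s \<le> exp \<kappa> * exp (- (\<kappa> * \<bar>x\<bar>))" for t s
    proof -
      have "\<bar>t\<bar> * s \<le> (1 + \<kappa> + B1 + B2 + \<kappa> * B1) * (exp \<kappa> * exp (- (\<kappa> * \<bar>x\<bar>)))"
        using t s k B1(1) B2(1) by (intro mult_mono) auto
      then show ?thesis by (simp add: C_def mult_ac)
    qed
    have k0: "0 \<le> \<kappa> * B1" using k B1 by simp
    consider "x \<le> -1" | "-1 < x" "x \<le> 1" | "1 < x" by linarith
    then show ?thesis
    proof cases
      case 1
      have e: "exp (\<kappa> * (x + 1)) = exp \<kappa> * exp (- (\<kappa> * \<bar>x\<bar>))"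
        using 1 by (simp add: algebra_simps flip: exp_add)
      show ?thesis
        using main[of 1 "exp (\<kappa> * (x + 1))"] main[of \<kappa> "exp (\<kappa> * (x + 1))"] e 1 k k0 B1(1) B2(1)
        by (simp add: w_def w'_def v_def v'_def abs_mult)
    next
      case 2
      have "\<kappa> * \<bar>x\<bar> \<le> \<kappa> * 1" using 2 k by (intro mult_left_mono) auto
      then have e: "1 \<le> exp \<kappa> * exp (- (\<kappa> * \<bar>x\<bar>))" by (simp flip: exp_add)
      have "\<bar>\<phi> x\<bar> \<le> B1" "\<bar>\<phi>' x\<bar> \<le> B2" using B1(2)[of x] B2(2)[of x] 2 by auto
      then have "\<bar>\<phi> x\<bar> \<le> 1 + \<kappa> + B1 + B2 + \<kappa> * B1" "\<bar>\<phi>' x\<bar> \<le> 1 + \<kappa> + B1 + B2 + \<kappa> * B1"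
        using k k0 B1(1) B2(1) by linarith+
      from main[OF this(1), of 1] main[OF this(2), of 1] show ?thesis
        using e 2 by (simp add: w_def w'_def v_def v'_def)
    next
      case 3
      have e: "exp (- (\<kappa> * (x - 1))) = exp \<kappa> * exp (- (\<kappa> * \<bar>x\<bar>))"
        using 3 by (simp add: algebra_simps flip: exp_add)
      have "\<bar>\<kappa> * \<phi> 1\<bar> \<le> \<kappa> * B1" using k B1(2)[of 1] by (simp add: abs_mult)
      moreover have "\<bar>\<phi> 1\<bar> \<le> B1" using B1(2)[of 1] by simp
      ultimately have "\<bar>\<phi> 1\<bar> \<le> 1 + \<kappa> + B1 + B2 + \<kappa> * B1" "\<bar>\<kappa> * \<phi> 1\<bar> \<le> 1 + \<kappa> + B1 + B2 + \<kappa> * B1"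
        using k k0 B1(1) B2(1) by linarith+
      from main[OF this(1), of "exp (- (\<kappa> * (x - 1)))"] main[OF this(2), of "exp (- (\<kappa> * (x - 1)))"]
      show ?thesis using e 3 by (simp add: w_def w'_def abs_mult)
    qed
  qed
  have "w (-1) \<noteq> 0" by (simp add: w_def v_def)
  then show "\<exists>\<psi>. eigenfunction UNIV (H0 U) (- \<kappa>\<^sup>2) \<psi>"
    using classical_H0_eigenfunction[OF U(1) M dw dw' k, of C "-1"] C by blast
qed

section \<open>Matching at the edge of the well\<close>

text \<open>For an energy \<open>\<mu> < 0\<close> the function \<open>\<phi> \<mu>\<close> continues the exponential that decays on the left
  through the well.\<close>

locale limit_well =
  fixes U :: "real \<Rightarrow> real" and M :: real and \<phi> \<phi>' :: "real \<Rightarrow> real \<Rightarrow> real"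
  assumes U_cont: "continuous_on UNIV U" and U_bound: "\<And>x. \<bar>U x\<bar> \<le> M"
    and U_supp: "\<And>x. 1 \<le> \<bar>x\<bar> \<Longrightarrow> U x = 0"
    and sol: "\<And>\<mu>. \<mu> < 0 \<Longrightarrow> is_sol (\<lambda>x. U x - \<mu>) (-1) 1 (\<phi> \<mu>) (\<phi>' \<mu>)"
    and init: "\<And>\<mu>. \<mu> < 0 \<Longrightarrow> \<phi> \<mu> (-1) = 1" "\<And>\<mu>. \<mu> < 0 \<Longrightarrow> \<phi>' \<mu> (-1) = sqrt (- \<mu>)"
begin

definition mismatch :: "real \<Rightarrow> real" where
  "mismatch \<mu> = \<phi>' \<mu> 1 + sqrt (- \<mu>) * \<phi> \<mu> 1"

lemma M_nonneg: "0 \<le> M"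
  using U_bound[of 0] by linarith

lemma \<phi>_continuous: "\<mu> < 0 \<Longrightarrow> continuous_on {-1..1} (\<phi> \<mu>)"
  using is_sol_continuous(1)[OF sol] .

text \<open>The amplification factor of the linear system across the well, for energies above \<open>- m\<close>.\<close>

definition gain :: "real \<Rightarrow> real" where
  "gain m = exp (M + m + 3)"

lemma gain_ge: "1 \<le> gain m" if "0 \<le> m"
  using that M_nonneg by (simp add: gain_def)

lemma \<phi>_bound:
  assumes \<mu>: "- m \<le> \<mu>" "\<mu> < 0" and y: "y \<in> {-1..1}"
  shows "\<bar>\<phi> \<mu> y\<bar> \<le> gain m * (1 + sqrt m)"
proof -
  have m0: "0 < m" using \<mu> by simp
  have K: "\<bar>U x - \<mu>\<bar> \<le> M + m" for x using U_bound[of x] \<mu> by linarith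
  have "(\<phi> \<mu> y - 0)\<^sup>2 + (\<phi>' \<mu> y - 0)\<^sup>2
      \<le> exp ((M + m + 2) * (y - (-1))) * ((\<phi> \<mu> (-1) - 0)\<^sup>2 + (\<phi>' \<mu> (-1) - 0)\<^sup>2 + 0\<^sup>2 * (y - (-1)))"
    by (rule sol_dependence[OF sol[OF \<mu>(2)] is_sol_zero[of "\<lambda>x. U x - \<mu>"] K _ y]) simp
  then have "(\<phi> \<mu> y)\<^sup>2 + (\<phi>' \<mu> y)\<^sup>2 \<le> exp ((M + m + 2) * (y + 1)) * (1 - \<mu>)"
    using init[OF \<mu>(2)] \<mu> by simp
  also have "\<dots> \<le> exp (2 * (M + m + 3)) * (1 + sqrt m)\<^sup>2"
  proof (rule mult_mono)
    have "(M + m + 2) * (y + 1) \<le> (M + m + 2) * 2" using y M_nonneg m0 by (intro mult_left_mono) auto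
    then show "exp ((M + m + 2) * (y + 1)) \<le> exp (2 * (M + m + 3))" by simp
    have "1 - \<mu> \<le> 1 + m" using \<mu> by simp
    also have "\<dots> \<le> (1 + sqrt m)\<^sup>2" using m0 by (simp add: power2_sum)
    finally show "1 - \<mu> \<le> (1 + sqrt m)\<^sup>2" .
  qed (use \<mu> in auto)
  also have "\<dots> = (gain m * (1 + sqrt m))\<^sup>2"
    by (simp only: gain_def power_mult_distrib exp_double)
  finally have "\<bar>\<phi> \<mu> y\<bar>\<^sup>2 \<le> (gain m * (1 + sqrt m))\<^sup>2"
    using zero_le_power2[of "\<phi>' \<mu> y"] unfolding power2_abs by linarith
  then show ?thesis by (rule power2_le_imp_le) (use m0 in \<open>simp add: gain_def\<close>)
qed

text \<open>Initial slope and coefficient only enter through their deviations \<open>\<tau>\<close> and \<open>\<rho>\<close>: Lipschitz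
  dependence of solutions on their data.\<close>

lemma \<phi>_close:
  assumes \<mu>: "- m \<le> \<mu>" "\<mu> < 0" and g: "is_sol (\<lambda>x. U x - \<mu> + r x) (-1) 1 g g'"
    and r: "\<And>x. x \<in> {-1..1} \<Longrightarrow> \<bar>r x\<bar> \<le> \<rho>" "\<rho> \<le> 1"
    and g0: "g (-1) = 1" "\<bar>g' (-1) - sqrt (- \<mu>)\<bar> \<le> \<tau>" and y: "y \<in> {-1..1}"
  defines "\<omega> \<equiv> gain m * (\<tau> + 2 * \<rho> * (gain m * (1 + sqrt m)))"
  shows "\<bar>g y - \<phi> \<mu> y\<bar> \<le> \<omega>" and "\<bar>g' y - \<phi>' \<mu> y\<bar> \<le> \<omega>"
proof -
  define C where "C = gain m * (1 + sqrt m)"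
  have \<omega>: "\<omega> = gain m * (\<tau> + 2 * \<rho> * C)" by (simp add: \<omega>_def C_def)
  have m0: "0 < m" using \<mu> by simp
  have C0: "0 \<le> C" using m0 by (simp add: C_def gain_def)
  have r0: "0 \<le> \<rho>" using r(1)[of 0] by simp
  have t0: "0 \<le> \<tau>" using g0(2) by linarith
  have K: "\<bar>U x - \<mu> + r x\<bar> \<le> M + m + 1" if "x \<in> {-1..1}" for x
    using U_bound[of x] \<mu> r(1)[OF that] r(2) by linarith
  have d: "\<bar>(U x - \<mu> + r x - (U x - \<mu>)) * \<phi> \<mu> x\<bar> \<le> \<rho> * C" if "x \<in> {-1..1}" for x
    using mult_mono[OF r(1)[OF that] \<phi>_bound[OF \<mu> that]] r0 by (simp add: abs_mult C_def)
  have "(g y - \<phi> \<mu> y)\<^sup>2 + (g' y - \<phi>' \<mu> y)\<^sup>2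
      \<le> exp ((M + m + 1 + 2) * (y - (-1))) * ((g (-1) - \<phi> \<mu> (-1))\<^sup>2 + (g' (-1) - \<phi>' \<mu> (-1))\<^sup>2 + (\<rho> * C)\<^sup>2 * (y - (-1)))"
    by (rule sol_dependence[OF g sol[OF \<mu>(2)] K d y])
  also have "\<dots> = exp ((M + m + 3) * (y + 1)) * ((g' (-1) - sqrt (- \<mu>))\<^sup>2 + (\<rho> * C)\<^sup>2 * (y + 1))"
    using init[OF \<mu>(2)] g0 by simp
  also have "\<dots> \<le> exp ((M + m + 3) * 2) * (\<tau>\<^sup>2 + (\<rho> * C)\<^sup>2 * 2)"
  proof (rule mult_mono)
    have "(M + m + 3) * (y + 1) \<le> (M + m + 3) * 2" using y M_nonneg m0 by (intro mult_left_mono) auto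
    then show "exp ((M + m + 3) * (y + 1)) \<le> exp ((M + m + 3) * 2)" by simp
    have "\<bar>g' (-1) - sqrt (- \<mu>)\<bar>\<^sup>2 \<le> \<tau>\<^sup>2" using g0(2) by (intro power_mono) auto
    then show "(g' (-1) - sqrt (- \<mu>))\<^sup>2 + (\<rho> * C)\<^sup>2 * (y + 1) \<le> \<tau>\<^sup>2 + (\<rho> * C)\<^sup>2 * 2"
      using y by (intro add_mono mult_left_mono) auto
  qed (use y in auto)
  also have "\<dots> \<le> exp ((M + m + 3) * 2) * (\<tau> + 2 * \<rho> * C)\<^sup>2"
  proof (rule mult_left_mono)
    have "0 \<le> 4 * (\<tau> * (\<rho> * C)) + 2 * (\<rho> * C)\<^sup>2" using t0 r0 C0 by simp
    then show "\<tau>\<^sup>2 + (\<rho> * C)\<^sup>2 * 2 \<le> (\<tau> + 2 * \<rho> * C)\<^sup>2" by (simp add: power2_eq_square algebra_simps)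
  qed simp
  also have "\<dots> = \<omega>\<^sup>2"
  proof -
    have "exp ((M + m + 3) * 2) = (gain m)\<^sup>2" by (simp only: gain_def mult.commute[of _ 2] exp_double)
    then show ?thesis by (simp only: \<omega> power_mult_distrib)
  qed
  finally have *: "(g y - \<phi> \<mu> y)\<^sup>2 + (g' y - \<phi>' \<mu> y)\<^sup>2 \<le> \<omega>\<^sup>2" .
  have w0: "0 \<le> \<omega>" using t0 r0 C0 unfolding \<omega> by (simp add: gain_def)
  have "\<bar>g y - \<phi> \<mu> y\<bar>\<^sup>2 \<le> \<omega>\<^sup>2"
    using * zero_le_power2[of "g' y - \<phi>' \<mu> y"] unfolding power2_abs by linarith
  then show "\<bar>g y - \<phi> \<mu> y\<bar> \<le> \<omega>" using w0 by (rule power2_le_imp_le)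
  have "\<bar>g' y - \<phi>' \<mu> y\<bar>\<^sup>2 \<le> \<omega>\<^sup>2"
    using * zero_le_power2[of "g y - \<phi> \<mu> y"] unfolding power2_abs by linarith
  then show "\<bar>g' y - \<phi>' \<mu> y\<bar> \<le> \<omega>" using w0 by (rule power2_le_imp_le)
qed

lemma \<phi>_continuous_energy:
  assumes \<nu>: "\<nu> < 0" and e: "\<eta> > 0"
  shows "\<exists>\<delta>>0. \<forall>\<mu><0. \<bar>\<mu> - \<nu>\<bar> < \<delta> \<longrightarrow> (\<forall>y\<in>{-1..1}. \<bar>\<phi> \<mu> y - \<phi> \<nu> y\<bar> \<le> \<eta> \<and> \<bar>\<phi>' \<mu> y - \<phi>' \<nu> y\<bar> \<le> \<eta>)"
proof -
  define m C where "m = - \<nu>" and "C = gain m * (1 + sqrt m)"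
  define \<omega> where "\<omega> \<tau> \<rho> = gain m * (\<tau> + 2 * \<rho> * C)" for \<tau> \<rho>
  have "((\<lambda>\<mu>. \<omega> \<bar>sqrt (- \<mu>) - sqrt (- \<nu>)\<bar> \<bar>\<nu> - \<mu>\<bar>) \<longlongrightarrow> \<omega> \<bar>sqrt (- \<nu>) - sqrt (- \<nu>)\<bar> \<bar>\<nu> - \<nu>\<bar>) (nhds \<nu>)"
    unfolding \<omega>_def by (intro tendsto_intros filterlim_ident)
  then have "\<forall>\<^sub>F \<mu> in nhds \<nu>. \<omega> \<bar>sqrt (- \<mu>) - sqrt (- \<nu>)\<bar> \<bar>\<nu> - \<mu>\<bar> < \<eta>"
    by (rule order_tendstoD) (simp add: \<omega>_def e)
  then obtain d where d: "d > 0" "\<And>\<mu>. dist \<mu> \<nu> < d \<Longrightarrow> \<omega> \<bar>sqrt (- \<mu>) - sqrt (- \<nu>)\<bar> \<bar>\<nu> - \<mu>\<bar> < \<eta>"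
    unfolding eventually_nhds_metric by blast
  show ?thesis
  proof (intro exI[of _ "min d 1"] conjI allI impI ballI)
    fix \<mu> y assume \<mu>: "\<mu> < 0" "\<bar>\<mu> - \<nu>\<bar> < min d 1" and y: "y \<in> {-1..1::real}"
    have s: "is_sol (\<lambda>x. U x - \<nu> + (\<nu> - \<mu>)) (-1) 1 (\<phi> \<mu>) (\<phi>' \<mu>)"
      using sol[OF \<mu>(1)] by simp
    have "\<omega> \<bar>sqrt (- \<mu>) - sqrt (- \<nu>)\<bar> \<bar>\<nu> - \<mu>\<bar> < \<eta>" using d(2)[of \<mu>] \<mu>(2) by (simp add: dist_real_def)
    moreover have "\<bar>\<phi> \<mu> y - \<phi> \<nu> y\<bar> \<le> \<omega> \<bar>sqrt (- \<mu>) - sqrt (- \<nu>)\<bar> \<bar>\<nu> - \<mu>\<bar>"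
      "\<bar>\<phi>' \<mu> y - \<phi>' \<nu> y\<bar> \<le> \<omega> \<bar>sqrt (- \<mu>) - sqrt (- \<nu>)\<bar> \<bar>\<nu> - \<mu>\<bar>"
      unfolding \<omega>_def C_def using \<mu> init[OF \<mu>(1)] y
      by (intro \<phi>_close[OF _ \<nu> s]; simp add: m_def abs_minus_commute)+
    ultimately show "\<bar>\<phi> \<mu> y - \<phi> \<nu> y\<bar> \<le> \<eta>" "\<bar>\<phi>' \<mu> y - \<phi>' \<nu> y\<bar> \<le> \<eta>" by linarith+
  qed (use d in auto)
qed

lemma mismatch_continuous: "continuous_on {..<0} mismatch"
proof -
  have "isCont mismatch \<nu>" if \<nu>: "\<nu> < 0" for \<nu>
  proof -
    have lim: "((\<lambda>\<mu>. f \<mu> 1) \<longlongrightarrow> f \<nu> 1) (at \<nu>)" if "f = \<phi> \<or> f = \<phi>'" for f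
    proof (rule tendstoI)
      fix e :: real assume e: "e > 0"
      then obtain d where d: "d > 0" "\<forall>\<mu><0. \<bar>\<mu> - \<nu>\<bar> < d \<longrightarrow> (\<forall>y\<in>{-1..1}. \<bar>\<phi> \<mu> y - \<phi> \<nu> y\<bar> \<le> e / 2 \<and> \<bar>\<phi>' \<mu> y - \<phi>' \<nu> y\<bar> \<le> e / 2)"
        using \<phi>_continuous_energy[OF \<nu>, of "e / 2"] by auto
      have "dist (f \<mu> 1) (f \<nu> 1) < e" if \<mu>: "dist \<mu> \<nu> < min d (- \<nu>)" for \<mu>
      proof -
        have "\<mu> < 0" "\<bar>\<mu> - \<nu>\<bar> < d" using \<mu> by (auto simp: dist_real_def)
        then have "\<bar>\<phi> \<mu> 1 - \<phi> \<nu> 1\<bar> \<le> e / 2" "\<bar>\<phi>' \<mu> 1 - \<phi>' \<nu> 1\<bar> \<le> e / 2" using d(2) by auto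
        then show ?thesis using \<open>f = \<phi> \<or> f = \<phi>'\<close> e by (auto simp: dist_real_def)
      qed
      moreover have "min d (- \<nu>) > 0" using d(1) \<nu> by simp
      ultimately show "\<forall>\<^sub>F \<mu> in at \<nu>. dist (f \<mu> 1) (f \<nu> 1) < e"
        unfolding eventually_at by blast
    qed
    show ?thesis
      unfolding isCont_def mismatch_def using lim[of \<phi>] lim[of \<phi>'] by (intro tendsto_intros) auto
  qed
  then show ?thesis by (auto intro: continuous_at_imp_continuous_on)
qed

text \<open>The equation on \<open>(0, L)\<close> in the variable in which the well has size one: the interval is
  \<open>[-A, B]\<close>, the electrostatic potential \<open>v\<close> is within \<open>\<rho>\<close> of the constant \<open>\<theta>\<close> on the window of
  radius \<open>1 + R\<close>, and \<open>w\<close> is the solution shot from the left end.\<close>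

definition shooting ::
    "real \<Rightarrow> real \<Rightarrow> real \<Rightarrow> real \<Rightarrow> real \<Rightarrow> real \<Rightarrow> real \<Rightarrow> (real \<Rightarrow> real) \<Rightarrow> real
     \<Rightarrow> (real \<Rightarrow> real) \<Rightarrow> (real \<Rightarrow> real) \<Rightarrow> bool" where
  "shooting s m R \<rho> A B \<theta> v E w w' \<longleftrightarrow> 1 + R \<le> A \<and> 1 + R \<le> B \<and> continuous_on {-A..B} v \<and>
     (\<forall>y\<in>{-A..B}. 0 \<le> v y) \<and> (\<forall>y. \<bar>y\<bar> \<le> 1 + R \<longrightarrow> \<bar>v y - \<theta>\<bar> \<le> \<rho>) \<and> 0 \<le> \<theta> \<and> E \<le> - s \<and> - m \<le> E - \<theta> \<and>
     is_sol (\<lambda>y. U y + v y - E) (-A) B w w' \<and> w (-A) = 0 \<and> w' (-A) = 1"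

text \<open>\<open>w\<close> behaves up to \<open>\<eta>\<close> like \<open>\<phi> \<mu>\<close>. In the last clause \<open>z\<close> is the solution shot from the right end;
  when \<open>w\<close> satisfies both boundary conditions, it shows that \<open>w\<close> keeps its sign on the right tail.\<close>

definition matched :: "real \<Rightarrow> real \<Rightarrow> real \<Rightarrow> real \<Rightarrow> (real \<Rightarrow> real) \<Rightarrow> bool" where
  "matched \<eta> A B \<mu> w \<longleftrightarrow> (\<forall>y\<in>{-A..-1}. 0 \<le> w y) \<and> 0 < w (-1) \<and>
     (\<forall>y\<in>{-1..1}. \<bar>w y / w (-1) - \<phi> \<mu> y\<bar> \<le> \<eta>) \<and>
     (\<exists>c>0. \<bar>c * w B - mismatch \<mu>\<bar> \<le> \<eta>) \<and>
     (w B = 0 \<longrightarrow> (\<exists>a z. 0 < z 1 \<and> (\<forall>y\<in>{1..B}. 0 \<le> z y \<and> w y = a * z y)))"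

lemma tail_estimate:
  assumes s: "is_sol Q (-A) B w w'" and w0: "w (-A) = 0" "w' (-A) = 1" and R: "1 \<le> R" "1 + R \<le> A" "-1 \<le> B"
    and Q: "continuous_on {-A..B} Q" "\<And>x. x \<in> {-A..-1} \<Longrightarrow> 0 \<le> Q x"
    and r: "\<And>x. x \<in> {-1 - R..-1} \<Longrightarrow> \<bar>Q x - \<kappa>\<^sup>2\<bar> \<le> \<rho>" and k: "0 < \<kappa>0" "\<kappa>0 \<le> \<kappa>" "\<kappa> \<le> \<kappa>1"
    and \<tau>: "exp (- \<kappa>0 * R) * (1 + \<kappa>1) \<le> \<tau> / 2" "\<rho> / \<kappa>0 \<le> \<tau> / 2"
  shows "\<And>y. y \<in> {-A..-1} \<Longrightarrow> 0 \<le> w y" "0 < w (-1)" "\<bar>w' (-1) / w (-1) - \<kappa>\<bar> \<le> \<tau>"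
proof -
  have s1: "is_sol Q (-A) (-1) w w'" by (rule is_sol_subinterval[OF s]) (use R in auto)
  have Qc: "continuous_on {-A..-1} Q" by (rule continuous_on_subset[OF Q(1)]) (use R in auto)
  show "0 \<le> w y" if "y \<in> {-A..-1}" for y
    using sol_from_zero(2)[OF s1 w0 Q(2) Qc that] .
  show pos: "0 < w (-1)"
    using sol_from_zero(3)[OF s1 w0 Q(2) Qc, of "-1"] R by auto
  have "\<bar>w' (-1) - \<kappa> * w (-1)\<bar> \<le> w (-1) * (exp (- \<kappa> * R) * (1 + \<kappa>) + \<rho> / \<kappa>)"
    by (rule log_derivative_estimate[OF s1 w0 Q(2) Qc _ R(1)]) (use r k R in auto)
  also have "\<dots> \<le> w (-1) * \<tau>"
  proof (rule mult_left_mono)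
    have "exp (- \<kappa> * R) * (1 + \<kappa>) \<le> exp (- \<kappa>0 * R) * (1 + \<kappa>1)"
      using k R by (intro mult_mono) auto
    moreover have "\<rho> / \<kappa> \<le> \<rho> / \<kappa>0"
    proof -
      have "0 \<le> \<rho>" using r[of "-1"] R by fastforce
      then show ?thesis using k by (intro divide_left_mono) auto
    qed
    ultimately show "exp (- \<kappa> * R) * (1 + \<kappa>) + \<rho> / \<kappa> \<le> \<tau>" using \<tau> by linarith
  qed (use pos in simp)
  finally have "\<bar>w' (-1) - \<kappa> * w (-1)\<bar> / w (-1) \<le> \<tau>" using pos by (simp add: pos_divide_le_eq mult.commute)
  moreover have "w' (-1) / w (-1) - \<kappa> = (w' (-1) - \<kappa> * w (-1)) / w (-1)"
    using pos by (simp add: diff_divide_distrib)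
  then have "\<bar>w' (-1) - \<kappa> * w (-1)\<bar> / w (-1) = \<bar>w' (-1) / w (-1) - \<kappa>\<bar>"
    using pos by (simp add: abs_divide)
  ultimately show "\<bar>w' (-1) / w (-1) - \<kappa>\<bar> \<le> \<tau>" by simp
qed

text \<open>Both tails force the logarithmic derivatives at the edges of the well to be those of the
  exponentials, and between the edges the solution then follows \<open>\<phi>\<close>. The Wronskian with the
  solution from the right end identifies \<open>w B\<close> with a positive multiple of the mismatch.\<close>

theorem shooting_imp_matched:
  assumes s: "0 < s" "s \<le> m" and \<eta>: "0 < \<eta>"
  shows "\<exists>R \<rho>. 1 \<le> R \<and> 0 < \<rho> \<and> (\<forall>A B \<theta> v E w w'. shooting s m R \<rho> A B \<theta> v E w w' \<longrightarrow> matched \<eta> A B (E - \<theta>) w)"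
proof -
  define \<kappa>0 \<kappa>1 where "\<kappa>0 = sqrt s" and "\<kappa>1 = sqrt m"
  have k0: "0 < \<kappa>0" "0 \<le> \<kappa>1" using s by (auto simp: \<kappa>0_def \<kappa>1_def)
  define C where "C = gain m * (1 + sqrt m)"
  have m0: "0 \<le> m" using s by simp
  have g1: "1 \<le> gain m" by (rule gain_ge[OF m0])
  have C0: "0 \<le> C" using g1 m0 by (simp add: C_def)
  define D where "D = gain m * (1 + 2 * C) * (2 + \<kappa>1) + C"
  have D1: "gain m * (1 + 2 * C) \<le> D"
  proof -
    have "gain m * (1 + 2 * C) * 1 \<le> gain m * (1 + 2 * C) * (2 + \<kappa>1)"
      using g1 C0 k0 by (intro mult_left_mono) auto
    then show ?thesis using C0 by (simp add: D_def)
  qed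
  have D0: "0 < D"
  proof -
    have "0 < gain m * (1 + 2 * C)" using g1 C0 by (intro mult_pos_pos) auto
    then show ?thesis using D1 by linarith
  qed
  define \<tau> where "\<tau> = min 1 (\<eta> / D)"
  have \<tau>: "0 < \<tau>" "\<tau> \<le> 1" "\<tau> * D \<le> \<eta>"
    using \<eta> D0 by (auto simp: \<tau>_def min_def field_simps)
  define \<rho> where "\<rho> = min \<tau> (\<kappa>0 * \<tau> / 2)"
  have \<rho>: "0 < \<rho>" "\<rho> \<le> \<tau>" "\<rho> / \<kappa>0 \<le> \<tau> / 2"
    using \<tau> k0 by (auto simp: \<rho>_def min_def field_simps)
  define R where "R = max 1 (2 * (1 + \<kappa>1) / (\<tau> * \<kappa>0))"
  have R: "1 \<le> R" "exp (- \<kappa>0 * R) * (1 + \<kappa>1) \<le> \<tau> / 2"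
  proof -
    show "1 \<le> R" by (simp add: R_def)
    have "2 * (1 + \<kappa>1) / (\<tau> * \<kappa>0) \<le> R" by (simp add: R_def)
    then have "2 * (1 + \<kappa>1) \<le> \<tau> * (\<kappa>0 * R)" using \<tau> k0 by (simp add: field_simps)
    also have "\<dots> \<le> \<tau> * exp (\<kappa>0 * R)"
    proof (rule mult_left_mono)
      show "\<kappa>0 * R \<le> exp (\<kappa>0 * R)" using exp_ge_add_one_self[of "\<kappa>0 * R"] by linarith
    qed (use \<tau> in simp)
    finally show "exp (- \<kappa>0 * R) * (1 + \<kappa>1) \<le> \<tau> / 2" by (simp add: exp_minus field_simps)
  qed
  have "matched \<eta> A B (E - \<theta>) w" if sh: "shooting s m R \<rho> A B \<theta> v E w w'" for A B \<theta> v E w w'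
  proof -
    from sh have AB: "1 + R \<le> A" "1 + R \<le> B" and vc: "continuous_on {-A..B} v"
      and v0: "\<And>y. y \<in> {-A..B} \<Longrightarrow> 0 \<le> v y" and v\<theta>: "\<And>y. \<bar>y\<bar> \<le> 1 + R \<Longrightarrow> \<bar>v y - \<theta>\<bar> \<le> \<rho>"
      and \<theta>: "0 \<le> \<theta>" and E: "E \<le> - s" "- m \<le> E - \<theta>"
      and w: "is_sol (\<lambda>y. U y + v y - E) (-A) B w w'" and w0: "w (-A) = 0" "w' (-A) = 1"
      by (auto simp: shooting_def)
    define \<mu> \<kappa> where "\<mu> = E - \<theta>" and "\<kappa> = sqrt (- \<mu>)"
    have \<mu>: "- m \<le> \<mu>" "\<mu> < 0" "\<mu> \<le> - s" using E \<theta> s by (auto simp: \<mu>_def)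
    have \<kappa>: "\<kappa>0 \<le> \<kappa>" "\<kappa> \<le> \<kappa>1" "\<kappa>\<^sup>2 = \<theta> - E" using \<mu> by (auto simp: \<kappa>_def \<kappa>0_def \<kappa>1_def \<mu>_def)
    define Q where "Q y = U y + v y - E" for y
    have Qc: "continuous_on {-A..B} Q"
      unfolding Q_def by (intro continuous_intros vc continuous_on_subset[OF U_cont]) auto
    have Qout: "Q y = v y - E" if "1 \<le> \<bar>y\<bar>" for y using U_supp[OF that] by (simp add: Q_def)
    have Q0: "0 \<le> Q y" if "y \<in> {-A..B}" "1 \<le> \<bar>y\<bar>" for y
      using v0[OF that(1)] Qout[OF that(2)] E s by simp
    have w: "is_sol Q (-A) B w w'" using w by (simp add: Q_def[abs_def])
    have AB1: "-1 \<le> A" "-1 \<le> B" using AB R(1) by auto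
    have Ql: "0 \<le> Q y" if "y \<in> {-A..-1}" for y using Q0[of y] that AB R(1) by auto
    have Qr: "\<bar>Q y - \<kappa>\<^sup>2\<bar> \<le> \<rho>" if "y \<in> {-1 - R..-1}" for y
      using v\<theta>[of y] that by (auto simp: Qout \<kappa>(3))
    note left = tail_estimate[OF w w0 R(1) AB(1) AB1(2) Qc Ql Qr k0(1) \<kappa>(1,2) R(2) \<rho>(3)]
    obtain z z' where z0: "z B = 0" "z' B = -1" and z: "is_sol Q (-A) B z z'"
      using linear_ode_exists_right[OF _ Qc, of 0 "-1"] AB R by auto
    define q where "q y = Q (- y)" for y
    have zr: "is_sol q (-B) A (\<lambda>x. z (- x)) (\<lambda>x. - z' (- x))"
      using is_sol_reflect[OF z] by (simp add: q_def[abs_def])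
    have qc: "continuous_on {-B..A} q"
      unfolding q_def by (rule continuous_on_compose2[OF Qc]) (auto intro!: continuous_intros)
    have q0: "0 \<le> q y" if "y \<in> {-B..-1}" for y using Q0[of "- y"] that AB R by (auto simp: q_def)
    have qr: "\<bar>q y - \<kappa>\<^sup>2\<bar> \<le> \<rho>" if "y \<in> {-1 - R..-1}" for y
      using v\<theta>[of "- y"] that by (auto simp: q_def Qout \<kappa>(3))
    have zB: "z (- (- B)) = 0" "- z' (- (- B)) = 1" using z0 by simp_all
    note right = tail_estimate[OF zr zB R(1) AB(2) AB1(1) qc q0 qr k0(1) \<kappa>(1,2) R(2) \<rho>(3)]
    have z1: "0 < z 1" using right(2) by simp
    have zpos: "0 \<le> z y" if "y \<in> {1..B}" for y using right(1)[of "- y"] that by simp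
    have zp: "\<bar>z' 1 / z 1 + \<kappa>\<bar> \<le> \<tau>" using right(3) by (simp add: abs_le_iff)
    define g g' where "g y = (1 / w (-1)) * w y" and "g' y = (1 / w (-1)) * w' y" for y
    define r where "r y = v y - \<theta>" for y
    have "is_sol Q (-1) 1 g g'"
      unfolding g_def[abs_def] g'_def[abs_def]
      by (rule is_sol_subinterval[OF is_sol_scale[OF w]]) (use AB R(1) in auto)
    then have g: "is_sol (\<lambda>x. U x - \<mu> + r x) (-1) 1 g g'"
      by (rule is_sol_cong) (simp add: Q_def r_def \<mu>_def)
    have g0: "g (-1) = 1" "\<bar>g' (-1) - sqrt (- \<mu>)\<bar> \<le> \<tau>"
      using left by (auto simp: g_def g'_def \<kappa>_def)
    have rb: "\<bar>r x\<bar> \<le> \<rho>" if "x \<in> {-1..1}" for x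
      unfolding r_def using that R(1) by (intro v\<theta>) auto
    define \<omega> where "\<omega> = gain m * (\<tau> + 2 * \<rho> * C)"
    have close: "\<bar>g y - \<phi> \<mu> y\<bar> \<le> \<omega>" "\<bar>g' y - \<phi>' \<mu> y\<bar> \<le> \<omega>" if "y \<in> {-1..1}" for y
      unfolding \<omega>_def C_def using \<rho> \<tau> that
      by (intro \<phi>_close[OF \<mu>(1,2) g rb _ g0 that]; simp)+
    have \<omega>: "\<omega> \<le> \<tau> * (gain m * (1 + 2 * C))"
    proof -
      have "\<tau> + 2 * \<rho> * C \<le> \<tau> + 2 * \<tau> * C" using \<rho> C0 by (intro add_left_mono mult_right_mono) auto
      then have "\<omega> \<le> gain m * (\<tau> + 2 * \<tau> * C)" unfolding \<omega>_def using g1 by (intro mult_left_mono) auto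
      then show ?thesis by (simp add: algebra_simps)
    qed
    have \<omega>\<eta>: "\<omega> \<le> \<eta>"
    proof -
      have "\<tau> * (gain m * (1 + 2 * C)) \<le> \<tau> * D" using D1 \<tau> by (intro mult_left_mono) auto
      then show ?thesis using \<omega> \<tau>(3) by linarith
    qed
    define p where "p = z' 1 / z 1"
    have "\<bar>p + \<kappa>\<bar> \<le> \<tau>" using zp by (simp add: p_def)
    then have pb: "\<bar>p\<bar> \<le> \<kappa>1 + 1" using \<kappa>(1,2) \<tau>(2) k0 by linarith
    have wronskian: "w B = w (-1) * z 1 * (g' 1 - p * g 1)"
    proof -
      have "w' 1 * z 1 - w 1 * z' 1 = w' B * z B - w B * z' B"
        by (rule wronskian_constant[OF w z]) (use AB R in auto)
      then have "w B = w' 1 * z 1 - w 1 * z' 1" using z0 by simp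
      also have "\<dots> = w (-1) * z 1 * (g' 1 - p * g 1)"
        using left(2) z1 by (simp add: g_def g'_def p_def field_simps)
      finally show ?thesis .
    qed
    have mis: "\<bar>g' 1 - p * g 1 - mismatch \<mu>\<bar> \<le> \<eta>"
    proof -
      have "g' 1 - p * g 1 - mismatch \<mu> = (g' 1 - \<phi>' \<mu> 1) - p * (g 1 - \<phi> \<mu> 1) - (p + \<kappa>) * \<phi> \<mu> 1"
        by (simp add: mismatch_def \<kappa>_def algebra_simps)
      then have "\<bar>g' 1 - p * g 1 - mismatch \<mu>\<bar> \<le> \<bar>g' 1 - \<phi>' \<mu> 1\<bar> + \<bar>p\<bar> * \<bar>g 1 - \<phi> \<mu> 1\<bar> + \<bar>p + \<kappa>\<bar> * \<bar>\<phi> \<mu> 1\<bar>"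
        by (simp add: abs_mult[symmetric])
      also have "\<dots> \<le> \<omega> + (\<kappa>1 + 1) * \<omega> + \<tau> * C"
        using close[of 1] pb zp \<phi>_bound[OF \<mu>(1,2), of 1] k0 \<tau>
        by (intro add_mono mult_mono) (auto simp: p_def C_def)
      also have "\<dots> = (2 + \<kappa>1) * \<omega> + \<tau> * C" by (simp add: algebra_simps)
      also have "\<dots> \<le> (2 + \<kappa>1) * (\<tau> * (gain m * (1 + 2 * C))) + \<tau> * C"
        using \<omega> k0 by (intro add_right_mono mult_left_mono) auto
      also have "\<dots> = \<tau> * D" by (simp add: D_def algebra_simps)
      finally show ?thesis using \<tau>(3) by linarith
    qed
    show ?thesis
      unfolding matched_def
    proof (intro conjI ballI impI)
      show "0 \<le> w y" if "y \<in> {-A..-1}" for y by (rule left(1)) (use that in auto)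
      show "0 < w (-1)" using left(2) by simp
      show "\<bar>w y / w (-1) - \<phi> (E - \<theta>) y\<bar> \<le> \<eta>" if "y \<in> {-1..1}" for y
        using close(1)[OF that] \<omega>\<eta> by (simp add: g_def \<mu>_def)
      show "\<exists>c>0. \<bar>c * w B - mismatch (E - \<theta>)\<bar> \<le> \<eta>"
      proof (intro exI[of _ "1 / (w (-1) * z 1)"] conjI)
        show "0 < 1 / (w (-1) * z 1)" using left(2) z1 by simp
        have "1 / (w (-1) * z 1) * w B = g' 1 - p * g 1" unfolding wronskian using left(2) z1 by simp
        then show "\<bar>1 / (w (-1) * z 1) * w B - mismatch (E - \<theta>)\<bar> \<le> \<eta>" using mis by (simp add: \<mu>_def)
      qed
      assume wB: "w B = 0"
      have "w y = - w' B * z y" if "y \<in> {1..B}" for y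
        using sol_unique_right[OF is_sol_subinterval[OF w] is_sol_subinterval[OF is_sol_scale[OF z, of "- w' B"]]
            continuous_on_subset[OF Qc], of 1 B y] that AB R wB z0 by auto
      then show "\<exists>a z. 0 < z 1 \<and> (\<forall>y\<in>{1..B}. 0 \<le> z y \<and> w y = a * z y)"
        using z1 zpos by blast
    qed
  qed
  then show ?thesis using R(1) \<rho>(1) by blast
qed

text \<open>Near a bound state the profiles on the well are so close to \<open>\<phi> \<nu>\<close> that the product of any two
  has positive integral and the same sign as \<open>(\<phi> \<nu>)\<^sup>2\<close> at the right edge; this yields both the sign
  change of the mismatch and, by orthogonality, the uniqueness of a nearby eigenvalue.\<close>

lemma profiles_near_bound_state:
  assumes \<nu>: "\<nu> < 0" and zero: "mismatch \<nu> = 0"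
  shows "\<exists>\<delta>>0. \<exists>\<eta>>0. \<forall>\<mu>1 \<mu>2 g1 g2. \<mu>1 < 0 \<and> \<mu>2 < 0 \<and> \<bar>\<mu>1 - \<nu>\<bar> < \<delta> \<and> \<bar>\<mu>2 - \<nu>\<bar> < \<delta> \<and>
     continuous_on {-1..1} g1 \<and> continuous_on {-1..1} g2 \<and>
     (\<forall>y\<in>{-1..1}. \<bar>g1 y - \<phi> \<mu>1 y\<bar> \<le> \<eta> \<and> \<bar>g2 y - \<phi> \<mu>2 y\<bar> \<le> \<eta>) \<longrightarrow>
     0 < integral {-1..1} (\<lambda>y. g1 y * g2 y) \<and> 0 < g1 1 * g2 1"
proof -
  define f where "f = \<phi> \<nu>"
  have fc: "continuous_on {-1..1} f" unfolding f_def by (rule \<phi>_continuous[OF \<nu>])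
  obtain C where C: "0 \<le> C" "\<And>y. y \<in> {-1..1} \<Longrightarrow> \<bar>f y\<bar> \<le> C"
    using continuous_on_interval_bounded[OF fc] by metis
  define m0 where "m0 = integral {-1..1} (\<lambda>y. (f y)\<^sup>2)"
  have fi: "(\<lambda>y. (f y)\<^sup>2) integrable_on {-1..1}" by (intro integrable_continuous_real continuous_intros fc)
  have m0: "0 < m0"
  proof -
    have "0 \<le> m0" unfolding m0_def by (intro Henstock_Kurzweil_Integration.integral_nonneg fi) auto
    moreover have "m0 \<noteq> 0"
    proof
      assume "m0 = 0"
      then have "\<forall>y\<in>{-1..1}. (f y)\<^sup>2 = 0"
        unfolding m0_def using integral_eq_0_iff[of "-1" 1 "\<lambda>y. (f y)\<^sup>2"] fc by (auto intro!: continuous_intros)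
      then show False using init(1)[OF \<nu>] by (auto simp: f_def)
    qed
    ultimately show ?thesis by simp
  qed
  have f1: "0 < (f 1)\<^sup>2"
  proof -
    have "f 1 \<noteq> 0"
    proof
      assume "f 1 = 0"
      then have z: "\<phi> \<nu> 1 = 0" "\<phi>' \<nu> 1 = 0" using zero by (auto simp: f_def mismatch_def)
      have "\<phi> \<nu> (-1) = 0 \<and> \<phi>' \<nu> (-1) = 0"
        by (rule sol_unique_right[OF sol[OF \<nu>] is_sol_zero]) (use z in \<open>auto intro!: continuous_intros continuous_on_subset[OF U_cont]\<close>)
      then show False using init(1)[OF \<nu>] by simp
    qed
    then show ?thesis by simp
  qed
  define m where "m = min m0 ((f 1)\<^sup>2)"
  have m: "0 < m" "m \<le> m0" "m \<le> (f 1)\<^sup>2" using m0 f1 by (auto simp: m_def)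
  define \<eta> where "\<eta> = min 1 (m / (16 * (C + 1)))"
  have \<eta>: "0 < \<eta>" "\<eta> \<le> 1" "16 * (\<eta> * (C + 1)) \<le> m"
  proof -
    show "0 < \<eta>" "\<eta> \<le> 1" using m C(1) by (auto simp: \<eta>_def)
    have "\<eta> \<le> m / (16 * (C + 1))" by (simp add: \<eta>_def)
    then show "16 * (\<eta> * (C + 1)) \<le> m" using C(1) by (simp add: pos_le_divide_eq algebra_simps)
  qed
  obtain \<delta> where \<delta>: "\<delta> > 0" "\<forall>\<mu><0. \<bar>\<mu> - \<nu>\<bar> < \<delta> \<longrightarrow> (\<forall>y\<in>{-1..1}. \<bar>\<phi> \<mu> y - \<phi> \<nu> y\<bar> \<le> \<eta> \<and> \<bar>\<phi>' \<mu> y - \<phi>' \<nu> y\<bar> \<le> \<eta>)"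
    using \<phi>_continuous_energy[OF \<nu> \<eta>(1)] by blast
  have main: "0 < integral {-1..1} (\<lambda>y. g1 y * g2 y) \<and> 0 < g1 1 * g2 1"
    if H: "\<mu>1 < 0" "\<mu>2 < 0" "\<bar>\<mu>1 - \<nu>\<bar> < \<delta>" "\<bar>\<mu>2 - \<nu>\<bar> < \<delta>" "continuous_on {-1..1} g1" "continuous_on {-1..1} g2"
      "\<And>y. y \<in> {-1..1} \<Longrightarrow> \<bar>g1 y - \<phi> \<mu>1 y\<bar> \<le> \<eta> \<and> \<bar>g2 y - \<phi> \<mu>2 y\<bar> \<le> \<eta>" for \<mu>1 \<mu>2 g1 g2
  proof -
    have prod: "(f y)\<^sup>2 - m / 4 \<le> g1 y * g2 y" if y: "y \<in> {-1..1}" for y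
    proof -
      define a b where "a = g1 y - f y" and "b = g2 y - f y"
      have p: "\<bar>\<phi> \<mu>1 y - f y\<bar> \<le> \<eta>" "\<bar>\<phi> \<mu>2 y - f y\<bar> \<le> \<eta>" using \<delta>(2) H(1-4) y by (auto simp: f_def)
      have ab: "\<bar>a\<bar> \<le> 2 * \<eta>" "\<bar>b\<bar> \<le> 2 * \<eta>" using p H(7)[OF y] unfolding a_def b_def by linarith+
      have "\<bar>f y * (a + b) + a * b\<bar> \<le> \<bar>f y\<bar> * \<bar>a + b\<bar> + \<bar>a\<bar> * \<bar>b\<bar>"
        using abs_triangle_ineq[of "f y * (a + b)" "a * b"] by (simp add: abs_mult)
      also have "\<dots> \<le> C * (4 * \<eta>) + (2 * \<eta>) * 2"
        using ab C(1) C(2)[OF y] \<eta> by (intro add_mono mult_mono) auto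
      also have "\<dots> = 4 * (\<eta> * (C + 1))" by (simp add: algebra_simps)
      also have "\<dots> \<le> m / 4" using \<eta>(3) by simp
      finally have "- (m / 4) \<le> f y * (a + b) + a * b" by linarith
      moreover have "g1 y * g2 y = (f y)\<^sup>2 + (f y * (a + b) + a * b)"
        by (simp add: a_def b_def power2_eq_square algebra_simps)
      ultimately show ?thesis by linarith
    qed
    have "integral {-1..1} (\<lambda>y. (f y)\<^sup>2 - m / 4) \<le> integral {-1..1} (\<lambda>y. g1 y * g2 y)"
      by (intro integral_le integrable_continuous_real continuous_intros fc H prod)
    moreover have "integral {-1..1} (\<lambda>y. (f y)\<^sup>2 - m / 4) = m0 - m / 2"
      by (subst Henstock_Kurzweil_Integration.integral_diff[OF fi]) (auto simp: m0_def)
    moreover have "(f 1)\<^sup>2 - m / 4 \<le> g1 1 * g2 1" by (rule prod) simp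
    ultimately show ?thesis using m by auto
  qed
  show ?thesis
  proof (rule exI[of _ \<delta>], rule conjI[OF \<delta>(1)], rule exI[of _ \<eta>], rule conjI[OF \<eta>(1)], intro allI impI)
    fix \<mu>1 \<mu>2 g1 g2
    assume "\<mu>1 < 0 \<and> \<mu>2 < 0 \<and> \<bar>\<mu>1 - \<nu>\<bar> < \<delta> \<and> \<bar>\<mu>2 - \<nu>\<bar> < \<delta> \<and>
      continuous_on {-1..1} g1 \<and> continuous_on {-1..1} g2 \<and>
      (\<forall>y\<in>{-1..1}. \<bar>g1 y - \<phi> \<mu>1 y\<bar> \<le> \<eta> \<and> \<bar>g2 y - \<phi> \<mu>2 y\<bar> \<le> \<eta>)"
    then show "0 < integral {-1..1} (\<lambda>y. g1 y * g2 y) \<and> 0 < g1 1 * g2 1"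
      by (intro main[of \<mu>1 \<mu>2]) simp_all
  qed
qed

text \<open>The Wronskian of the two solutions at the energies \<open>\<nu>\<close> and \<open>\<mu>\<close> expresses the mismatch at \<open>\<mu>\<close> by
  the integral of their product, with a sign given by that of \<open>\<nu> - \<mu>\<close>.\<close>

lemma mismatch_sign_change:
  assumes \<nu>: "\<nu> < 0" and zero: "mismatch \<nu> = 0" and \<mu>: "\<mu> < 0"
    and pos: "0 < integral {-1..1} (\<lambda>y. \<phi> \<nu> y * \<phi> \<mu> y)" "0 < \<phi> \<nu> 1 * \<phi> \<mu> 1"
  shows "\<mu> < \<nu> \<Longrightarrow> 0 < \<phi> \<nu> 1 * mismatch \<mu>" and "\<nu> < \<mu> \<Longrightarrow> \<phi> \<nu> 1 * mismatch \<mu> < 0"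
proof -
  define k l where "k = sqrt (- \<nu>)" and "l = sqrt (- \<mu>)"
  have hi: "((\<lambda>x. (U x - \<nu> - (U x - \<mu>)) * (\<phi> \<nu> x * \<phi> \<mu> x)) has_integral
      (\<phi>' \<nu> 1 * \<phi> \<mu> 1 - \<phi> \<nu> 1 * \<phi>' \<mu> 1) - (\<phi>' \<nu> (-1) * \<phi> \<mu> (-1) - \<phi> \<nu> (-1) * \<phi>' \<mu> (-1))) {-1..1}"
    by (intro fundamental_theorem_of_calculus)
      (use wronskian_has_derivative[OF sol[OF \<nu>] sol[OF \<mu>]] in
        \<open>auto simp flip: has_real_derivative_iff_has_vector_derivative\<close>)
  have "(\<mu> - \<nu>) * integral {-1..1} (\<lambda>x. \<phi> \<nu> x * \<phi> \<mu> x) =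
      (\<phi>' \<nu> 1 * \<phi> \<mu> 1 - \<phi> \<nu> 1 * \<phi>' \<mu> 1) - (k - l)"
    using integral_unique[OF hi] init[OF \<nu>] init[OF \<mu>] by (simp add: k_def l_def)
  moreover have "\<phi>' \<nu> 1 = - k * \<phi> \<nu> 1" using zero by (simp add: mismatch_def k_def)
  moreover have "\<phi>' \<mu> 1 = mismatch \<mu> - l * \<phi> \<mu> 1" by (simp add: mismatch_def l_def)
  ultimately have eq: "\<phi> \<nu> 1 * mismatch \<mu> =
      (\<nu> - \<mu>) * integral {-1..1} (\<lambda>x. \<phi> \<nu> x * \<phi> \<mu> x) + (l - k) * (1 + \<phi> \<nu> 1 * \<phi> \<mu> 1)"
    by (simp add: algebra_simps)
  show "0 < \<phi> \<nu> 1 * mismatch \<mu>" if "\<mu> < \<nu>"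
  proof -
    have "k < l" using that by (simp add: k_def l_def)
    then have "0 < (l - k) * (1 + \<phi> \<nu> 1 * \<phi> \<mu> 1)" using pos(2) by (intro mult_pos_pos[of "l - k" "1 + \<phi> \<nu> 1 * \<phi> \<mu> 1"]) linarith+
    moreover have "0 < (\<nu> - \<mu>) * integral {-1..1} (\<lambda>x. \<phi> \<nu> x * \<phi> \<mu> x)"
      using that pos(1) by (intro mult_pos_pos[of "\<nu> - \<mu>"]) auto
    ultimately show ?thesis unfolding eq by linarith
  qed
  show "\<phi> \<nu> 1 * mismatch \<mu> < 0" if "\<nu> < \<mu>"
  proof -
    have "l < k" using that by (simp add: k_def l_def)
    then have "(l - k) * (1 + \<phi> \<nu> 1 * \<phi> \<mu> 1) < 0" using pos(2) by (intro mult_neg_pos[of "l - k" "1 + \<phi> \<nu> 1 * \<phi> \<mu> 1"]) linarith+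
    moreover have "(\<nu> - \<mu>) * integral {-1..1} (\<lambda>x. \<phi> \<nu> x * \<phi> \<mu> x) < 0"
      using that pos(1) by (intro mult_neg_pos[of "\<nu> - \<mu>"]) auto
    ultimately show ?thesis unfolding eq by linarith
  qed
qed

end

section \<open>A priori estimates\<close>

lemma integral_double_sum:
  fixes F :: "'i \<Rightarrow> 'i \<Rightarrow> real \<Rightarrow> real"
  assumes "finite J" "\<And>i j. i \<in> J \<Longrightarrow> j \<in> J \<Longrightarrow> continuous_on {a..b} (F i j)"
  shows "integral {a..b} (\<lambda>x. \<Sum>i\<in>J. \<Sum>j\<in>J. c i * c j * F i j x)
    = (\<Sum>i\<in>J. \<Sum>j\<in>J. c i * c j * integral {a..b} (F i j))"
proof -
  have int: "(\<lambda>x. c i * c j * F i j x) integrable_on {a..b}" if "i \<in> J" "j \<in> J" for i j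
    using assms(2)[OF that] by (intro integrable_continuous_real continuous_intros)
  have "integral {a..b} (\<lambda>x. \<Sum>i\<in>J. \<Sum>j\<in>J. c i * c j * F i j x)
      = (\<Sum>i\<in>J. integral {a..b} (\<lambda>x. \<Sum>j\<in>J. c i * c j * F i j x))"
    by (intro Henstock_Kurzweil_Integration.integral_sum Henstock_Kurzweil_Integration.integrable_sum assms(1) int)
  also have "\<dots> = (\<Sum>i\<in>J. \<Sum>j\<in>J. integral {a..b} (\<lambda>x. c i * c j * F i j x))"
    by (intro sum.cong refl Henstock_Kurzweil_Integration.integral_sum assms(1) int)
  finally show ?thesis by simp
qed

lemma integral_has_real_derivative_eq:
  fixes F :: "real \<Rightarrow> real"
  assumes "a \<le> b" "\<And>x. x \<in> {a..b} \<Longrightarrow> (F has_real_derivative f x) (at x within {a..b})"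
  shows "f integrable_on {a..b}" and "integral {a..b} f = F b - F a"
proof -
  have "(f has_integral F b - F a) {a..b}"
    using assms by (intro fundamental_theorem_of_calculus) (auto simp flip: has_real_derivative_iff_has_vector_derivative)
  then show "f integrable_on {a..b}" "integral {a..b} f = F b - F a" by (auto simp: integral_unique)
qed

text \<open>Finitely many orthonormal Dirichlet eigenfunctions of \<open>-h\<^sup>2 d\<^sup>2/dx\<^sup>2 + W\<close>.\<close>

locale dirichlet_states =
  fixes L h :: real and W :: "real \<Rightarrow> real" and J :: "nat set" and \<epsilon> :: "nat \<Rightarrow> real" and u u' :: "nat \<Rightarrow> real \<Rightarrow> real"
  assumes L: "0 < L" and h: "0 < h" and J: "finite J" and W_cont: "continuous_on {0..L} W"
    and states: "\<And>i. i \<in> J \<Longrightarrow> is_sol (\<lambda>x. (W x - \<epsilon> i) / h\<^sup>2) 0 L (u i) (u' i)"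
    and ends: "\<And>i. i \<in> J \<Longrightarrow> u i 0 = 0" "\<And>i. i \<in> J \<Longrightarrow> u i L = 0"
    and orthonormal: "\<And>i j. i \<in> J \<Longrightarrow> j \<in> J \<Longrightarrow> integral {0..L} (\<lambda>x. u i x * u j x) = (if i = j then 1 else 0)"
begin

lemmas u_cont = is_sol_continuous(1)[OF states] and u'_cont = is_sol_continuous(2)[OF states]

lemma energy_form:
  assumes i: "i \<in> J" and j: "j \<in> J"
  shows "integral {0..L} (\<lambda>x. h\<^sup>2 * (u' i x * u' j x) + W x * (u i x * u j x)) = (if i = j then \<epsilon> i else 0)"
proof -
  have d: "((\<lambda>x. h\<^sup>2 * (u' i x * u j x)) has_real_derivative
      h\<^sup>2 * (u' i x * u' j x) + W x * (u i x * u j x) - \<epsilon> i * (u i x * u j x)) (at x within {0..L})"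
    if "x \<in> {0..L}" for x
    using is_solD[OF states[OF i] that] is_solD[OF states[OF j] that] h
    by (auto intro!: derivative_eq_intros simp: field_simps)
  have "integral {0..L} (\<lambda>x. (h\<^sup>2 * (u' i x * u' j x) + W x * (u i x * u j x)) - \<epsilon> i * (u i x * u j x)) = 0"
    using integral_has_real_derivative_eq(2)[OF _ d] L ends i j by simp
  moreover have "integral {0..L} (\<lambda>x. (h\<^sup>2 * (u' i x * u' j x) + W x * (u i x * u j x)) - \<epsilon> i * (u i x * u j x))
     = integral {0..L} (\<lambda>x. h\<^sup>2 * (u' i x * u' j x) + W x * (u i x * u j x)) - integral {0..L} (\<lambda>x. \<epsilon> i * (u i x * u j x))"
    using i j by (intro Henstock_Kurzweil_Integration.integral_diff integrable_continuous_real continuous_intros u_cont u'_cont W_cont)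
  ultimately show ?thesis using orthonormal[OF i j] by simp
qed

text \<open>The trace bound: for fixed \<open>x\<close> the combination \<open>w = \<Sum> u\<^sub>i(x) u\<^sub>i\<close> has \<open>w x = \<parallel>w\<parallel>\<^sup>2 = \<Sum> u\<^sub>i(x)\<^sup>2\<close>,
  and the one-dimensional inequality \<open>(w x)\<^sup>2 \<le> 2 \<parallel>w\<parallel> \<parallel>w'\<parallel>\<close> with the energy bound on \<open>w'\<close> closes.\<close>

lemma trace_bound:
  assumes K: "0 < K" "\<And>x. x \<in> {0..L} \<Longrightarrow> - K \<le> W x" and E: "\<And>i. i \<in> J \<Longrightarrow> \<epsilon> i \<le> 0" and x: "x \<in> {0..L}"
  shows "(\<Sum>i\<in>J. (u i x)\<^sup>2) \<le> 2 * sqrt K / h"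
proof -
  define c where "c i = u i x" for i
  define w w' where "w y = (\<Sum>i\<in>J. c i * u i y)" and "w' y = (\<Sum>i\<in>J. c i * u' i y)" for y
  define N D where "N = (\<Sum>i\<in>J. (u i x)\<^sup>2)" and "D = integral {0..L} (\<lambda>y. (w' y)\<^sup>2)"
  have N0: "0 \<le> N" unfolding N_def by (intro sum_nonneg) auto
  have wc: "continuous_on {0..L} w" "continuous_on {0..L} w'"
    unfolding w_def w'_def by (intro continuous_intros u_cont u'_cont; assumption)+
  have dw: "(w has_real_derivative w' y) (at y within {0..L})" if "y \<in> {0..L}" for y
    unfolding w_def[abs_def] w'_def
    by (rule DERIV_sum) (use is_solD(1)[OF states that] in \<open>auto intro!: derivative_eq_intros\<close>)
  have prod: "w y * w y = (\<Sum>i\<in>J. \<Sum>j\<in>J. c i * c j * (u i y * u j y))"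
    "w' y * w' y = (\<Sum>i\<in>J. \<Sum>j\<in>J. c i * c j * (u' i y * u' j y))" for y
    unfolding w_def w'_def by (simp_all add: sum_product mult_ac)
  have Nw: "integral {0..L} (\<lambda>y. (w y)\<^sup>2) = N"
  proof -
    have "integral {0..L} (\<lambda>y. (w y)\<^sup>2) = (\<Sum>i\<in>J. \<Sum>j\<in>J. c i * c j * integral {0..L} (\<lambda>y. u i y * u j y))"
      unfolding power2_eq_square prod by (intro integral_double_sum J continuous_intros u_cont)
    also have "\<dots> = (\<Sum>i\<in>J. \<Sum>j\<in>J. if i = j then c i * c j else 0)"
      by (intro sum.cong refl) (simp add: orthonormal)
    also have "\<dots> = N" using J by (simp add: N_def c_def power2_eq_square)
    finally show ?thesis .
  qed
  have wx: "w x = N" by (simp add: w_def N_def c_def power2_eq_square)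
  have energy: "integral {0..L} (\<lambda>y. h\<^sup>2 * (w' y)\<^sup>2 + W y * (w y)\<^sup>2) = (\<Sum>i\<in>J. \<epsilon> i * (c i)\<^sup>2)"
  proof -
    have "(\<lambda>y. h\<^sup>2 * (w' y)\<^sup>2 + W y * (w y)\<^sup>2)
        = (\<lambda>y. \<Sum>i\<in>J. \<Sum>j\<in>J. c i * c j * (h\<^sup>2 * (u' i y * u' j y) + W y * (u i y * u j y)))"
      unfolding power2_eq_square prod by (simp add: sum_distrib_left sum.distrib[symmetric] algebra_simps)
    then have "integral {0..L} (\<lambda>y. h\<^sup>2 * (w' y)\<^sup>2 + W y * (w y)\<^sup>2)
        = integral {0..L} (\<lambda>y. \<Sum>i\<in>J. \<Sum>j\<in>J. c i * c j * (h\<^sup>2 * (u' i y * u' j y) + W y * (u i y * u j y)))" by simp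
    also have "\<dots> = (\<Sum>i\<in>J. \<Sum>j\<in>J. c i * c j * integral {0..L} (\<lambda>y. h\<^sup>2 * (u' i y * u' j y) + W y * (u i y * u j y)))"
      by (intro integral_double_sum J continuous_intros u_cont u'_cont W_cont)
    also have "\<dots> = (\<Sum>i\<in>J. \<Sum>j\<in>J. if i = j then \<epsilon> i * (c i * c j) else 0)"
      by (intro sum.cong refl) (simp add: energy_form)
    also have "\<dots> = (\<Sum>i\<in>J. \<epsilon> i * (c i)\<^sup>2)" using J by (simp add: power2_eq_square)
    finally show ?thesis .
  qed
  have "h\<^sup>2 * D - K * N = integral {0..L} (\<lambda>y. h\<^sup>2 * (w' y)\<^sup>2 - K * (w y)\<^sup>2)"
    unfolding D_def Nw[symmetric]
    by (subst Henstock_Kurzweil_Integration.integral_diff)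
      (auto intro!: integrable_continuous_real continuous_intros wc)
  also have "\<dots> \<le> integral {0..L} (\<lambda>y. h\<^sup>2 * (w' y)\<^sup>2 + W y * (w y)\<^sup>2)"
  proof (rule integral_le)
    show "h\<^sup>2 * (w' y)\<^sup>2 - K * (w y)\<^sup>2 \<le> h\<^sup>2 * (w' y)\<^sup>2 + W y * (w y)\<^sup>2" if "y \<in> {0..L}" for y
      using mult_right_mono[OF K(2)[OF that], of "(w y)\<^sup>2"] by simp
  qed (auto intro!: integrable_continuous_real continuous_intros wc W_cont)
  also have "\<dots> \<le> 0" unfolding energy using E by (intro sum_nonpos) (auto simp: mult_nonpos_nonneg)
  finally have DK: "h\<^sup>2 * D \<le> K * N" by simp
  define a where "a = sqrt K / h"
  have a: "0 < a" "a * a = K / h\<^sup>2" using K(1) h by (simp_all add: a_def power2_eq_square)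
  have "N\<^sup>2 = (w x)\<^sup>2 - (w 0)\<^sup>2" using wx ends by (simp add: w_def)
  also have "\<dots> = integral {0..x} (\<lambda>y. 2 * (w y * w' y))"
  proof -
    have sub: "{0..x} \<subseteq> {0..L}" using x by auto
    have "((\<lambda>y. (w y)\<^sup>2) has_real_derivative 2 * (w y * w' y)) (at y within {0..x})" if "y \<in> {0..x}" for y
      using DERIV_subset[OF dw sub, of y] that sub by (auto intro!: derivative_eq_intros)
    then show ?thesis
      using x by (intro integral_has_real_derivative_eq(2)[where F = "\<lambda>y. (w y)\<^sup>2", symmetric]) auto
  qed
  also have "\<dots> \<le> integral {0..x} (\<lambda>y. a * (w y)\<^sup>2 + (w' y)\<^sup>2 / a)"
  proof (rule integral_le)
    have sub: "{0..x} \<subseteq> {0..L}" using x by auto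
    note wcs = continuous_on_subset[OF wc(1) sub] continuous_on_subset[OF wc(2) sub]
    show "(\<lambda>y. 2 * (w y * w' y)) integrable_on {0..x}" "(\<lambda>y. a * (w y)\<^sup>2 + (w' y)\<^sup>2 / a) integrable_on {0..x}"
      using a by (auto intro!: integrable_continuous_real continuous_intros wcs)
    show "2 * (w y * w' y) \<le> a * (w y)\<^sup>2 + (w' y)\<^sup>2 / a" for y
    proof -
      have "0 \<le> (a * w y - w' y)\<^sup>2 / a" using a by simp
      also have "\<dots> = a * (w y)\<^sup>2 + (w' y)\<^sup>2 / a - 2 * (w y * w' y)"
        using a by (simp add: power2_eq_square field_simps)
      finally show ?thesis by simp
    qed
  qed
  also have "\<dots> \<le> integral {0..L} (\<lambda>y. a * (w y)\<^sup>2 + (w' y)\<^sup>2 / a)"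
  proof (rule integral_subset_le)
    show "{0..x} \<subseteq> {0..L}" using x by auto
    show i: "(\<lambda>y. a * (w y)\<^sup>2 + (w' y)\<^sup>2 / a) integrable_on {0..L}"
      using a by (auto intro!: integrable_continuous_real continuous_intros wc)
    show "(\<lambda>y. a * (w y)\<^sup>2 + (w' y)\<^sup>2 / a) integrable_on {0..x}"
      by (rule integrable_subinterval_real[OF i]) (use x in auto)
  qed (use a in auto)
  also have "\<dots> = a * N + D / a"
    unfolding D_def Nw[symmetric] using a
    by (subst Henstock_Kurzweil_Integration.integral_add)
      (auto intro!: integrable_continuous_real continuous_intros wc)
  also have "\<dots> \<le> a * N + a * N"
  proof -
    have "D \<le> (a * a) * N" using DK h by (simp add: a(2) pos_le_divide_eq mult.commute)
    then show ?thesis using a(1) by (simp add: pos_divide_le_eq mult_ac)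
  qed
  finally have "N * N \<le> (2 * a) * N" by (simp add: power2_eq_square mult_ac)
  then have "N \<le> 2 * a" using N0 a(1) by (cases "N = 0") (auto simp: mult_le_cancel_right)
  then show ?thesis by (simp add: N_def a_def)
qed

lemma integral_sum_squares: "integral {0..L} (\<lambda>x. \<Sum>i\<in>J. (u i x)\<^sup>2) = real (card J)"
proof -
  have "integral {0..L} (\<lambda>x. \<Sum>i\<in>J. (u i x)\<^sup>2) = (\<Sum>i\<in>J. integral {0..L} (\<lambda>x. (u i x)\<^sup>2))"
    by (intro Henstock_Kurzweil_Integration.integral_sum J integrable_continuous_real continuous_intros u_cont)
  also have "\<dots> = (\<Sum>i\<in>J. 1)"
    by (intro sum.cong refl) (use orthonormal in \<open>simp add: power2_eq_square\<close>)
  finally show ?thesis by simp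
qed

lemma card_bound:
  assumes K: "0 < K" "\<And>x. x \<in> {0..L} \<Longrightarrow> - K \<le> W x" and E: "\<And>i. i \<in> J \<Longrightarrow> \<epsilon> i \<le> 0"
  shows "real (card J) \<le> L * (2 * sqrt K / h)"
proof -
  have "integral {0..L} (\<lambda>x. \<Sum>i\<in>J. (u i x)\<^sup>2) \<le> integral {0..L} (\<lambda>x. 2 * sqrt K / h)"
    by (intro integral_le trace_bound[OF K E] integrable_continuous_real continuous_intros u_cont)
  then have "real (card J) \<le> integral {0..L} (\<lambda>x. 2 * sqrt K / h)" by (simp only: integral_sum_squares)
  also have "\<dots> = L * (2 * sqrt K / h)" using L by (simp only: integral_const_real) simp
  finally show ?thesis .
qed

end

text \<open>The states with energy at most \<open>- s\<close> in a well of depth at most \<open>M\<close> and radius \<open>h\<close>, together with the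
  potential \<open>V\<close> generated by their charge.\<close>

locale poisson_states = dirichlet_states L h "\<lambda>x. Uh x + V x" J \<epsilon> u u'
  for L h Uh V J \<epsilon> u u' +
  fixes x0 M s :: real and f V' :: "real \<Rightarrow> real"
  assumes M: "0 < M" and s: "0 < s" and x0: "0 < x0" "x0 < L"
    and Uh_cont: "continuous_on {0..L} Uh" and Uh_bounds: "\<And>x. Uh x \<le> 0" "\<And>x. - M \<le> Uh x"
    and Uh_supp: "\<And>x. h \<le> \<bar>x - x0\<bar> \<Longrightarrow> Uh x = 0"
    and \<epsilon>_le: "\<And>i. i \<in> J \<Longrightarrow> \<epsilon> i \<le> - s"
    and f_nonneg: "\<And>x. 0 \<le> f x" and f_antimono: "\<And>x y. x \<le> y \<Longrightarrow> f y \<le> f x"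
    and dV: "\<And>x. x \<in> {0..L} \<Longrightarrow> (V has_real_derivative V' x) (at x within {0..L})"
    and dV': "\<And>x. x \<in> {0..L} \<Longrightarrow> (V' has_real_derivative - (\<Sum>i\<in>J. f (\<epsilon> i) * (u i x)\<^sup>2)) (at x within {0..L})"
    and V_ends: "V 0 = 0" "V L = 0"
begin

definition n :: "real \<Rightarrow> real" where
  "n x = (\<Sum>i\<in>J. f (\<epsilon> i) * (u i x)\<^sup>2)"

definition charge :: real where
  "charge = (\<Sum>i\<in>J. f (\<epsilon> i))"

lemma n_nonneg: "0 \<le> n x"
  unfolding n_def by (intro sum_nonneg mult_nonneg_nonneg f_nonneg) auto

lemma charge_nonneg: "0 \<le> charge"
  unfolding charge_def by (intro sum_nonneg f_nonneg)

lemma n_cont: "continuous_on {0..L} n"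
  unfolding n_def by (intro continuous_intros u_cont)

lemma weighted_density:
  assumes "continuous_on {0..L} g"
  shows "integral {0..L} (\<lambda>x. g x * n x) = (\<Sum>i\<in>J. f (\<epsilon> i) * integral {0..L} (\<lambda>x. g x * (u i x)\<^sup>2))"
proof -
  have "integral {0..L} (\<lambda>x. g x * n x) = integral {0..L} (\<lambda>x. \<Sum>i\<in>J. f (\<epsilon> i) * (g x * (u i x)\<^sup>2))"
    by (simp add: n_def sum_distrib_left mult_ac)
  also have "\<dots> = (\<Sum>i\<in>J. integral {0..L} (\<lambda>x. f (\<epsilon> i) * (g x * (u i x)\<^sup>2)))"
    by (intro Henstock_Kurzweil_Integration.integral_sum J integrable_continuous_real continuous_intros u_cont assms)
  finally show ?thesis by simp
qed

lemma integral_n: "integral {0..L} n = charge"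
proof -
  have "integral {0..L} (\<lambda>x. (u i x)\<^sup>2) = 1" if "i \<in> J" for i
    using orthonormal[OF that that] by (simp add: power2_eq_square)
  then show ?thesis using weighted_density[of "\<lambda>x. 1"] by (simp add: charge_def)
qed

lemma V'_antimono: "x \<in> {0..L} \<Longrightarrow> y \<in> {0..L} \<Longrightarrow> x \<le> y \<Longrightarrow> V' y \<le> V' x"
proof (rule nonpos_derivative_imp_ge[where f = V'])
  fix t assume "x \<in> {0..L}" "y \<in> {0..L}" "t \<in> {x..y}"
  then show "(V' has_real_derivative - n t) (at t within {x..y})"
    unfolding n_def by (intro DERIV_subset[OF dV']) auto
  show "- n t \<le> 0" using n_nonneg[of t] by simp
qed

text \<open>A concave function vanishing at both ends is non-negative.\<close>

lemma V_nonneg: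
  assumes x: "x \<in> {0..L}" shows "0 \<le> V x"
proof (rule ccontr)
  assume neg: "\<not> 0 \<le> V x"
  then have x': "0 < x" "x < L" using V_ends x by (auto simp: less_le)
  obtain a where a: "0 < a" "a < x" "V x - V 0 = V' a * (x - 0)"
    by (rule mvt_within[OF x'(1), of V V']) (use x in \<open>auto intro: DERIV_subset[OF dV]\<close>)
  obtain b where b: "x < b" "b < L" "V L - V x = V' b * (L - x)"
    by (rule mvt_within[OF x'(2), of V V']) (use x in \<open>auto intro: DERIV_subset[OF dV]\<close>)
  have "V' a < 0" using a neg V_ends x' by (auto simp: mult_less_0_iff zero_le_mult_iff not_le)
  moreover have "V' b \<le> V' a" by (rule V'_antimono) (use a b x' in auto)
  ultimately have "V' b * (L - x) < 0" using x' by (intro mult_neg_pos) auto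
  then show False using b neg V_ends by simp
qed

lemma V'_bound:
  assumes x: "x \<in> {0..L}" shows "\<bar>V' x\<bar> \<le> charge"
proof -
  obtain c where c: "0 < c" "c < L" "V L - V 0 = V' c * (L - 0)"
    by (rule mvt_within[OF L, of V V']) (use dV in auto)
  then have "V' c = 0" using V_ends L by simp
  then have "V' L \<le> 0" "0 \<le> V' 0" using V'_antimono[of c L] V'_antimono[of 0 c] c by auto
  moreover have "V' 0 - V' L = charge"
  proof -
    have "integral {0..L} (\<lambda>x. - n x) = V' L - V' 0"
      using integral_has_real_derivative_eq(2)[of 0 L V' "\<lambda>x. - n x"] dV' L by (simp add: n_def)
    then show ?thesis by (simp add: integral_n)
  qed
  moreover have "V' L \<le> V' x" "V' x \<le> V' 0" using V'_antimono[of x L] V'_antimono[of 0 x] x L by auto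
  ultimately show ?thesis by linarith
qed

lemma V_lipschitz:
  assumes "x \<in> {0..L}" "y \<in> {0..L}" shows "\<bar>V x - V y\<bar> \<le> charge * \<bar>x - y\<bar>"
  using field_differentiable_bound[of "{0..L}" V V' charge x y] dV V'_bound assms by auto

lemma V_bound:
  assumes "x \<in> {0..L}" shows "\<bar>V x\<bar> \<le> charge * L"
proof -
  have "\<bar>V x - V 0\<bar> \<le> charge * \<bar>x - 0\<bar>" by (rule V_lipschitz) (use assms L in auto)
  also have "\<dots> \<le> charge * L" using assms charge_nonneg by (intro mult_left_mono) auto
  finally show ?thesis using V_ends by simp
qed

lemma W_lower: "x \<in> {0..L} \<Longrightarrow> - M \<le> Uh x + V x"
  using V_nonneg[of x] Uh_bounds(2)[of x] by linarith

lemma \<epsilon>_ge: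
  assumes i: "i \<in> J" shows "- M \<le> \<epsilon> i"
proof -
  have "integral {0..L} (\<lambda>x. (- M) * (u i x * u i x)) \<le> integral {0..L} (\<lambda>x. h\<^sup>2 * (u' i x * u' i x) + (Uh x + V x) * (u i x * u i x))"
  proof (rule integral_le)
    show "(- M) * (u i x * u i x) \<le> h\<^sup>2 * (u' i x * u' i x) + (Uh x + V x) * (u i x * u i x)" if "x \<in> {0..L}" for x
    proof -
      have "(- M) * (u i x * u i x) \<le> (Uh x + V x) * (u i x * u i x)"
        by (intro mult_right_mono W_lower that) simp
      moreover have "0 \<le> h\<^sup>2 * (u' i x * u' i x)" by simp
      ultimately show ?thesis by linarith
    qed
  qed (intro integrable_continuous_real continuous_intros u_cont[OF i] u'_cont[OF i] W_cont)+
  then show ?thesis using energy_form[OF i i] orthonormal[OF i i] by simp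
qed

lemma integral_well: "integral {0..L} (\<lambda>x. - Uh x) \<le> 2 * h * M"
proof -
  define g where "g x = (if x \<in> {x0 - h..x0 + h} then M else 0)" for x
  have gi: "(g has_integral M * (2 * h)) {x0 - h..x0 + h}"
  proof -
    have "((\<lambda>x. M) has_integral M * (2 * h)) {x0 - h..x0 + h}"
      using has_integral_const_real[of M "x0 - h" "x0 + h"] h by (simp add: mult.commute)
    then show ?thesis by (rule has_integral_eq[rotated]) (simp add: g_def)
  qed
  have gU: "(g has_integral M * (2 * h)) UNIV"
    by (rule has_integral_on_superset[OF gi]) (auto simp: g_def)
  have g0L: "g integrable_on {0..L}"
    using gU by (intro integrable_on_subinterval[where S = UNIV]) (auto simp: integrable_on_def)
  have "integral {0..L} (\<lambda>x. - Uh x) \<le> integral {0..L} g"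
  proof (rule integral_le[OF _ g0L])
    show "- Uh x \<le> g x" for x using Uh_bounds(2)[of x] Uh_supp[of x] by (auto simp: g_def)
  qed (intro integrable_continuous_real continuous_intros Uh_cont)
  also have "\<dots> \<le> integral UNIV g"
    using gU g0L M by (intro integral_subset_le) (auto simp: integrable_on_def g_def)
  also have "\<dots> = 2 * h * M" using gU by (simp add: integral_unique)
  finally show ?thesis .
qed

text \<open>Summing the energies of all states: only the well contributes negatively, and by the trace
  bound it contributes at most an amount independent of \<open>h\<close>, since the well has width \<open>2 h\<close>.\<close>

lemma card_uniform: "s * real (card J) \<le> 4 * M * sqrt M"
proof -
  define \<rho> where "\<rho> x = (\<Sum>i\<in>J. (u i x)\<^sup>2)" for x
  have \<rho>c: "continuous_on {0..L} \<rho>" unfolding \<rho>_def by (intro continuous_intros u_cont)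
  have \<rho>b: "\<rho> x \<le> 2 * sqrt M / h" if "x \<in> {0..L}" for x
    unfolding \<rho>_def by (rule trace_bound[OF M W_lower _ that]) (use \<epsilon>_le s in force)+
  have \<rho>0: "0 \<le> \<rho> x" for x unfolding \<rho>_def by (intro sum_nonneg) auto
  have "integral {0..L} (\<lambda>x. Uh x * (u i x * u i x)) \<le> - s" if i: "i \<in> J" for i
  proof -
    have "integral {0..L} (\<lambda>x. Uh x * (u i x * u i x))
        \<le> integral {0..L} (\<lambda>x. h\<^sup>2 * (u' i x * u' i x) + (Uh x + V x) * (u i x * u i x))"
    proof (rule integral_le)
      show "Uh x * (u i x * u i x) \<le> h\<^sup>2 * (u' i x * u' i x) + (Uh x + V x) * (u i x * u i x)" if "x \<in> {0..L}" for x
      proof -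
        have "0 \<le> V x * (u i x * u i x)" using V_nonneg[OF that] by simp
        moreover have "0 \<le> h\<^sup>2 * (u' i x * u' i x)" by simp
        ultimately show ?thesis unfolding distrib_right by linarith
      qed
    qed (intro integrable_continuous_real continuous_intros u_cont[OF i] u'_cont[OF i] W_cont Uh_cont)+
    then show ?thesis using energy_form[OF i i] \<epsilon>_le[OF i] by simp
  qed
  then have "(\<Sum>i\<in>J. integral {0..L} (\<lambda>x. Uh x * (u i x * u i x))) \<le> (\<Sum>i\<in>J. - s)" by (rule sum_mono)
  also have "(\<Sum>i\<in>J. integral {0..L} (\<lambda>x. Uh x * (u i x * u i x))) = integral {0..L} (\<lambda>x. Uh x * \<rho> x)"
  proof -
    have "integral {0..L} (\<lambda>x. \<Sum>i\<in>J. Uh x * (u i x * u i x)) = (\<Sum>i\<in>J. integral {0..L} (\<lambda>x. Uh x * (u i x * u i x)))"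
      by (intro Henstock_Kurzweil_Integration.integral_sum J integrable_continuous_real continuous_intros u_cont Uh_cont)
    then show ?thesis by (simp add: \<rho>_def sum_distrib_left power2_eq_square)
  qed
  finally have "s * real (card J) \<le> integral {0..L} (\<lambda>x. - (Uh x * \<rho> x))" by (simp add: mult.commute)
  also have "\<dots> \<le> integral {0..L} (\<lambda>x. (2 * sqrt M / h) * (- Uh x))"
  proof (rule integral_le)
    show "- (Uh x * \<rho> x) \<le> (2 * sqrt M / h) * (- Uh x)" if "x \<in> {0..L}" for x
      using mult_right_mono[OF \<rho>b[OF that], of "- Uh x"] Uh_bounds(1)[of x] by (simp add: mult.commute)
  qed (intro integrable_continuous_real continuous_intros Uh_cont \<rho>c)+
  also have "\<dots> = (2 * sqrt M / h) * integral {0..L} (\<lambda>x. - Uh x)" by (rule integral_mult_right)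
  also have "\<dots> \<le> (2 * sqrt M / h) * (2 * h * M)"
    using integral_well M h by (intro mult_left_mono) auto
  also have "\<dots> = 4 * M * sqrt M" using h by simp
  finally show ?thesis .
qed

lemma charge_bound: "charge \<le> 4 * M * sqrt M / s * f (- M)"
proof -
  have "charge \<le> (\<Sum>i\<in>J. f (- M))" unfolding charge_def by (intro sum_mono f_antimono \<epsilon>_ge)
  also have "\<dots> = real (card J) * f (- M)" by simp
  also have "\<dots> \<le> 4 * M * sqrt M / s * f (- M)"
    using card_uniform s f_nonneg[of "- M"] by (intro mult_right_mono) (simp_all add: pos_le_divide_eq mult.commute)
  finally show ?thesis .
qed

text \<open>Testing the equation of a state \<open>v\<close> with \<open>(x - x0)\<^sup>2 v\<close>: the weight is at most \<open>h\<^sup>2\<close> on the well, and outside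
  the operator exceeds the energy by at least \<open>s\<close>.\<close>

lemma concentration:
  assumes i: "i \<in> J"
  shows "integral {0..L} (\<lambda>x. (x - x0)\<^sup>2 * (u i x)\<^sup>2) \<le> h\<^sup>2 * ((1 + M) / s)"
proof -
  define v v' where "v = u i" and "v' = u' i"
  have v: "is_sol (\<lambda>x. (Uh x + V x - \<epsilon> i) / h\<^sup>2) 0 L v v'" and e: "v 0 = 0" "v L = 0"
    using states[OF i] ends[OF i] by (simp_all add: v_def v'_def)
  have vc: "continuous_on {0..L} v" using u_cont[OF i] by (simp add: v_def)
  have v2: "integral {0..L} (\<lambda>x. (v x)\<^sup>2) = 1" using orthonormal[OF i i] by (simp add: v_def power2_eq_square)
  define F where "F x = h\<^sup>2 * ((x - x0)\<^sup>2 * (v x * v' x) - (x - x0) * (v x)\<^sup>2)" for x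
  define F' where "F' x = h\<^sup>2 * ((x - x0)\<^sup>2 * (v' x)\<^sup>2 - (v x)\<^sup>2) + (x - x0)\<^sup>2 * ((Uh x + V x - \<epsilon> i) * (v x)\<^sup>2)" for x
  have "(F has_real_derivative F' x) (at x within {0..L})" if "x \<in> {0..L}" for x
    unfolding F_def[abs_def] F'_def using is_solD[OF v that] h
    by (auto intro!: derivative_eq_intros simp: field_simps power2_eq_square)
  then have F': "F' integrable_on {0..L}" "integral {0..L} F' = 0"
    using integral_has_real_derivative_eq[of 0 L F F'] L e by (auto simp: F_def)
  have "integral {0..L} (\<lambda>x. s * ((x - x0)\<^sup>2 * (v x)\<^sup>2)) \<le> integral {0..L} (\<lambda>x. F' x + h\<^sup>2 * (1 + M) * (v x)\<^sup>2)"
  proof (rule integral_le)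
    show "(\<lambda>x. s * ((x - x0)\<^sup>2 * (v x)\<^sup>2)) integrable_on {0..L}"
      by (intro integrable_continuous_real continuous_intros vc)
    show "(\<lambda>x. F' x + h\<^sup>2 * (1 + M) * (v x)\<^sup>2) integrable_on {0..L}"
      by (intro Henstock_Kurzweil_Integration.integrable_add F' integrable_continuous_real continuous_intros vc)
    fix x assume x: "x \<in> {0..L}"
    have "- (h\<^sup>2 * M) \<le> (x - x0)\<^sup>2 * Uh x"
    proof (cases "h \<le> \<bar>x - x0\<bar>")
      case True
      then show ?thesis using Uh_supp M by simp
    next
      case False
      then have "\<bar>x - x0\<bar>\<^sup>2 \<le> h\<^sup>2" by (intro power_mono) auto
      then have "(x - x0)\<^sup>2 * (- Uh x) \<le> h\<^sup>2 * M"
        using Uh_bounds(1)[of x] Uh_bounds(2)[of x] by (intro mult_mono) auto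
      then show ?thesis by simp
    qed
    moreover have "(x - x0)\<^sup>2 * s \<le> (x - x0)\<^sup>2 * (V x - \<epsilon> i)"
      using V_nonneg[OF x] \<epsilon>_le[OF i] by (intro mult_left_mono) auto
    ultimately have "(x - x0)\<^sup>2 * s - h\<^sup>2 * M \<le> (x - x0)\<^sup>2 * (Uh x + V x - \<epsilon> i)"
      by (simp add: algebra_simps)
    then have "((x - x0)\<^sup>2 * s - h\<^sup>2 * M) * (v x)\<^sup>2 \<le> (x - x0)\<^sup>2 * (Uh x + V x - \<epsilon> i) * (v x)\<^sup>2"
      by (rule mult_right_mono) simp
    moreover have "0 \<le> h\<^sup>2 * ((x - x0)\<^sup>2 * (v' x)\<^sup>2)" by simp
    moreover have "F' x + h\<^sup>2 * (1 + M) * (v x)\<^sup>2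
        = h\<^sup>2 * ((x - x0)\<^sup>2 * (v' x)\<^sup>2) + (x - x0)\<^sup>2 * (Uh x + V x - \<epsilon> i) * (v x)\<^sup>2 + h\<^sup>2 * M * (v x)\<^sup>2"
      by (simp add: F'_def algebra_simps)
    moreover have "((x - x0)\<^sup>2 * s - h\<^sup>2 * M) * (v x)\<^sup>2 = s * ((x - x0)\<^sup>2 * (v x)\<^sup>2) - h\<^sup>2 * M * (v x)\<^sup>2"
      by (simp add: algebra_simps)
    ultimately show "s * ((x - x0)\<^sup>2 * (v x)\<^sup>2) \<le> F' x + h\<^sup>2 * (1 + M) * (v x)\<^sup>2"
      by linarith
  qed
  also have "\<dots> = h\<^sup>2 * (1 + M)"
    using F' v2 by (subst Henstock_Kurzweil_Integration.integral_add)
      (auto intro!: integrable_continuous_real continuous_intros vc)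
  finally have "s * integral {0..L} (\<lambda>x. (x - x0)\<^sup>2 * (v x)\<^sup>2) \<le> h\<^sup>2 * (1 + M)" by simp
  then show ?thesis using s by (simp add: v_def pos_le_divide_eq mult.commute)
qed

lemma second_moment:
  "integral {0..L} (\<lambda>x. (x - x0)\<^sup>2 * n x) \<le> h\<^sup>2 * ((1 + M) / s) * charge"
proof -
  have "integral {0..L} (\<lambda>x. (x - x0)\<^sup>2 * n x) = (\<Sum>i\<in>J. f (\<epsilon> i) * integral {0..L} (\<lambda>x. (x - x0)\<^sup>2 * (u i x)\<^sup>2))"
    by (intro weighted_density continuous_intros)
  also have "\<dots> \<le> (\<Sum>i\<in>J. f (\<epsilon> i) * (h\<^sup>2 * ((1 + M) / s)))"
    by (intro sum_mono mult_left_mono concentration f_nonneg)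
  also have "\<dots> = charge * (h\<^sup>2 * ((1 + M) / s))" unfolding charge_def by (rule sum_distrib_right[symmetric])
  finally show ?thesis by (simp only: mult.commute)
qed

text \<open>The kernel is the Green function of \<open>-d\<^sup>2/dx\<^sup>2\<close> on \<open>(0, L)\<close> with Dirichlet conditions.\<close>

lemma green_representation:
  assumes x: "x \<in> {0..L}"
  shows "((\<lambda>y. (min x y - x * y / L) * n y) has_integral V x) {0..L}"
proof -
  have sub: "{0..x} \<subseteq> {0..L}" "{x..L} \<subseteq> {0..L}" using x by auto
  have "((\<lambda>y. (1 - x / L) * (y * n y)) has_integral
      (1 - x / L) * (V x - x * V' x) - (1 - x / L) * (V 0 - 0 * V' 0)) {0..x}"
  proof (rule fundamental_theorem_of_calculus)
    fix y assume y: "y \<in> {0..x}"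
    have "((\<lambda>y. V y - y * V' y) has_real_derivative y * n y) (at y within {0..x})"
      using DERIV_subset[OF dV sub(1), of y] DERIV_subset[OF dV' sub(1), of y] y sub
      by (auto intro!: derivative_eq_intros simp: n_def)
    then have "((\<lambda>y. (1 - x / L) * (V y - y * V' y)) has_real_derivative (1 - x / L) * (y * n y)) (at y within {0..x})"
      by (rule DERIV_cmult)
    then show "((\<lambda>y. (1 - x / L) * (V y - y * V' y)) has_vector_derivative (1 - x / L) * (y * n y)) (at y within {0..x})"
      by (simp add: has_real_derivative_iff_has_vector_derivative)
  qed (use x in auto)
  then have 1: "((\<lambda>y. (min x y - x * y / L) * n y) has_integral (1 - x / L) * (V x - x * V' x)) {0..x}"
    using V_ends by (auto elim!: has_integral_eq[rotated] simp: algebra_simps)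
  have "((\<lambda>y. (x / L) * ((L - y) * n y)) has_integral
      (x / L) * (- (L - L) * V' L - V L) - (x / L) * (- (L - x) * V' x - V x)) {x..L}"
  proof (rule fundamental_theorem_of_calculus)
    fix y assume y: "y \<in> {x..L}"
    have "((\<lambda>y. - (L - y) * V' y - V y) has_real_derivative (L - y) * n y) (at y within {x..L})"
      using DERIV_subset[OF dV sub(2), of y] DERIV_subset[OF dV' sub(2), of y] y sub
      by (auto intro!: derivative_eq_intros simp: n_def algebra_simps)
    then have "((\<lambda>y. (x / L) * (- (L - y) * V' y - V y)) has_real_derivative (x / L) * ((L - y) * n y)) (at y within {x..L})"
      by (rule DERIV_cmult)
    then show "((\<lambda>y. (x / L) * (- (L - y) * V' y - V y)) has_vector_derivative (x / L) * ((L - y) * n y)) (at y within {x..L})"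
      by (simp add: has_real_derivative_iff_has_vector_derivative)
  qed (use x in auto)
  moreover have "(x / L) * (- (L - L) * V' L - V L) - (x / L) * (- (L - x) * V' x - V x) = (x / L) * ((L - x) * V' x + V x)"
    using V_ends by (simp add: algebra_simps)
  ultimately have "((\<lambda>y. (x / L) * ((L - y) * n y)) has_integral (x / L) * ((L - x) * V' x + V x)) {x..L}" by simp
  then have 2: "((\<lambda>y. (min x y - x * y / L) * n y) has_integral (x / L) * ((L - x) * V' x + V x)) {x..L}"
    by (rule has_integral_eq[rotated]) (use L in \<open>auto simp: field_simps\<close>)
  have "(1 - x / L) * (V x - x * V' x) + (x / L) * ((L - x) * V' x + V x) = V x"
    using L by (simp add: field_simps)
  then show ?thesis using has_integral_combine[OF _ _ 1 2] x by simp
qed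

text \<open>The Green function is Lipschitz in \<open>y\<close>, so that replacing the density by a point charge costs
  the first absolute moment.\<close>

lemma V_close_to_point_charge:
  assumes x: "x \<in> {0..L}"
  shows "\<bar>V x - limit_potential L x0 charge x\<bar> \<le> h * (((1 + M) / s + 1) / 2 * charge)"
proof -
  define G where "G y = min x y - x * y / L" for y
  have lp: "limit_potential L x0 charge x = charge * G x0"
    using L by (auto simp: limit_potential_def G_def min_def field_simps)
  have lip: "\<bar>G y - G x0\<bar> \<le> \<bar>y - x0\<bar>" for y
  proof -
    have t: "0 \<le> x / L" "x / L \<le> 1" using x L by auto

    have bound: "G z - G y \<le> z - y \<and> - (z - y) \<le> G z - G y" if "y \<le> z" for y z
    proof -
      have "0 \<le> (x / L) * (z - y)" using that by (intro mult_nonneg_nonneg t) simp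
      moreover have "(x / L) * (z - y) \<le> z - y"
        using t that mult_right_mono[of "x / L" 1 "z - y"] by auto
      moreover have "G z - G y = (min x z - min x y) - (x / L) * (z - y)"
        by (simp add: G_def diff_divide_distrib right_diff_distrib)
      moreover have "0 \<le> min x z - min x y" "min x z - min x y \<le> z - y" using that by auto
      ultimately show ?thesis by linarith
    qed
    show ?thesis using bound[of y x0] bound[of x0 y] by (cases "y \<le> x0") auto
  qed
  have Gc: "continuous_on S G" for S unfolding G_def using L by (intro continuous_intros) auto
  have Gn: "((\<lambda>y. G y * n y) has_integral V x) {0..L}"
    using green_representation[OF x] by (simp add: G_def)
  have G0: "((\<lambda>y. G x0 * n y) has_integral G x0 * charge) {0..L}"
    using integral_n integrable_continuous_real[OF n_cont]
    by (intro has_integral_mult_right) (simp add: has_integral_integrable_integral)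
  have eq: "V x - charge * G x0 = integral {0..L} (\<lambda>y. (G y - G x0) * n y)"
    using has_integral_diff[OF Gn G0] by (simp add: left_diff_distrib integral_unique mult.commute)
  have "norm (integral {0..L} (\<lambda>y. (G y - G x0) * n y))
      \<le> integral {0..L} (\<lambda>y. (1 / (2 * h)) * ((y - x0)\<^sup>2 * n y) + (h / 2) * n y)"
  proof (rule Henstock_Kurzweil_Integration.integral_norm_bound_integral)
    fix y assume "y \<in> {0..L}"
    have "2 * h * \<bar>y - x0\<bar> \<le> (y - x0)\<^sup>2 + h\<^sup>2"
      using sum_squares_bound[of h "\<bar>y - x0\<bar>"] by (simp add: mult_ac add.commute)
    then have "\<bar>y - x0\<bar> \<le> (1 / (2 * h)) * (y - x0)\<^sup>2 + h / 2"
      using h by (simp add: field_simps power2_eq_square)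
    then have le: "\<bar>G y - G x0\<bar> * n y \<le> ((1 / (2 * h)) * (y - x0)\<^sup>2 + h / 2) * n y"
      using lip[of y] n_nonneg[of y] by (intro mult_right_mono) auto
    have "norm ((G y - G x0) * n y) = \<bar>G y - G x0\<bar> * n y" using n_nonneg[of y] by (simp add: abs_mult)
    also note le
    also have "((1 / (2 * h)) * (y - x0)\<^sup>2 + h / 2) * n y = (1 / (2 * h)) * ((y - x0)\<^sup>2 * n y) + (h / 2) * n y"
      by (simp add: distrib_right)
    finally show "norm ((G y - G x0) * n y) \<le> (1 / (2 * h)) * ((y - x0)\<^sup>2 * n y) + (h / 2) * n y" .
  qed (intro integrable_continuous_real continuous_intros Gc n_cont)+
  also have "\<dots> = (1 / (2 * h)) * integral {0..L} (\<lambda>y. (y - x0)\<^sup>2 * n y) + (h / 2) * charge"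
    using integral_n h by (subst Henstock_Kurzweil_Integration.integral_add)
      (auto intro!: integrable_continuous_real continuous_intros n_cont)
  also have "\<dots> \<le> (1 / (2 * h)) * (h\<^sup>2 * ((1 + M) / s) * charge) + (h / 2) * charge"
    using second_moment h by (intro add_right_mono mult_left_mono) auto
  also have "\<dots> = h * (((1 + M) / s + 1) / 2 * charge)" using h s by (simp add: field_simps power2_eq_square)
  finally show ?thesis by (simp add: lp eq)
qed

end

section \<open>Solutions of the Schroedinger-Poisson system in classical terms\<close>

text \<open>The regularity of the eigenfunctions needs a continuous potential on the closed interval, and
  that of the potential needs continuous eigenfunctions. The circle is broken by the continuity of
  functions in \<open>H\<^sup>1\<^sub>0\<close>. Completeness of the eigensystem is kept in the form that every classical
  eigenvalue occurs among the \<open>\<epsilon> i\<close>.\<close>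

theorem schroedinger_poisson_classical:
  assumes L: "0 < L" and x0: "0 < x0" "x0 < L" and h: "0 < h" and M: "0 < M" and s: "0 < s"
    and U: "continuous_on UNIV U" "\<And>x. U x \<le> 0" "\<And>x. - M \<le> U x" "\<And>x. 1 \<le> \<bar>x\<bar> \<Longrightarrow> U x = 0"
    and f: "\<And>x. 0 \<le> f x" "\<And>x y. x \<le> y \<Longrightarrow> f y \<le> f x" "\<And>x. - s \<le> x \<Longrightarrow> f x = 0"
    and sp: "schroedinger_poisson L x0 U f h V \<epsilon> \<Psi>"
  defines "J \<equiv> {i. 1 \<le> i \<and> \<epsilon> i < - s}"
  obtains u u' Vc Vc' where
    "poisson_states L h (scaled_well U x0 h) Vc J \<epsilon> u u' x0 M s f Vc'"
    "\<And>x. x \<in> {0<..<L} \<Longrightarrow> V x = Vc x"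
    "charge_density f \<epsilon> \<Psi> \<in> borel_measurable (lebesgue_on {0<..<L})"
    "AE x in lebesgue_on {0<..<L}. charge_density f \<epsilon> \<Psi> x = (\<Sum>i\<in>J. f (\<epsilon> i) * (u i x)\<^sup>2)"
    "\<And>E w w' x. is_sol (\<lambda>x. (scaled_well U x0 h x + Vc x - E) / h\<^sup>2) 0 L w w' \<Longrightarrow> w 0 = 0 \<Longrightarrow> w L = 0 \<Longrightarrow>
      x \<in> {0<..<L} \<Longrightarrow> w x \<noteq> 0 \<Longrightarrow> \<exists>i\<ge>1. \<epsilon> i = E"
proof -
  let ?\<Omega> = "{0<..<L}" and ?M = "lebesgue_on {0<..<L}" and ?Uh = "scaled_well U x0 h"
  have \<Omega>: "open ?\<Omega>" by simp
  from sp obtain g where VH: "V \<in> H10 ?\<Omega>" and V_cont: "continuous_on ?\<Omega> V"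
    and es: "eigensystem ?\<Omega> (dirichlet_op L h (\<lambda>x. ?Uh x + V x)) \<epsilon> \<Psi>"
    and Vg: "has_weak_deriv ?\<Omega> V g" "has_weak_deriv ?\<Omega> g (\<lambda>x. - charge_density f \<epsilon> \<Psi> x)"
    by (auto simp: schroedinger_poisson_def)
  from es have ef: "\<And>i. 1 \<le> i \<Longrightarrow> eigenfunction ?\<Omega> (dirichlet_op L h (\<lambda>x. ?Uh x + V x)) (\<epsilon> i) (\<Psi> i)"
    and ortho: "\<And>i j. 1 \<le> i \<Longrightarrow> 1 \<le> j \<Longrightarrow> (LINT x|?M. \<Psi> i x * \<Psi> j x) = (if i = j then 1 else 0)"
    and complete: "\<And>E \<psi>. eigenfunction ?\<Omega> (dirichlet_op L h (\<lambda>x. ?Uh x + V x)) E \<psi> \<Longrightarrow>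
      \<exists>c. AE x in ?M. \<psi> x = (\<Sum>i | 1 \<le> i \<and> \<epsilon> i = E. c i * \<Psi> i x)"
    by (auto simp: eigensystem_def)
  have Uhc: "continuous_on S ?Uh" for S
    unfolding scaled_well_def using h
    by (intro continuous_on_compose2[OF U(1)] continuous_intros) auto
  \<comment> \<open>a continuous extension of \<open>V\<close> to the closed interval, not yet known to be differentiable\<close>
  obtain G where G: "continuous_on {0..L} G" "G 0 = 0" "G L = 0" "AE x in ?M. V x = G x"
    using H10_imp_indefinite_integral[OF L VH] by metis
  have sub: "?\<Omega> \<subseteq> {0..L}" by auto
  have VG: "V x = G x" if "x \<in> ?\<Omega>" for x
    by (rule AE_eq_continuous_imp_eq[OF \<Omega> V_cont continuous_on_subset[OF G(1) sub] G(4) that])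
  have Wc: "continuous_on {0..L} (\<lambda>x. ?Uh x + G x)" by (intro continuous_intros Uhc G)
  have ex: "\<forall>i. \<exists>p. 1 \<le> i \<longrightarrow> is_sol (\<lambda>x. (?Uh x + G x - \<epsilon> i) / h\<^sup>2) 0 L (fst p) (snd p) \<and>
      fst p 0 = 0 \<and> fst p L = 0 \<and> (AE x in ?M. \<Psi> i x = fst p x)"
  proof
    fix i
    show "\<exists>p. 1 \<le> i \<longrightarrow> is_sol (\<lambda>x. (?Uh x + G x - \<epsilon> i) / h\<^sup>2) 0 L (fst p) (snd p) \<and>
      fst p 0 = 0 \<and> fst p L = 0 \<and> (AE x in ?M. \<Psi> i x = fst p x)"
    proof (cases "1 \<le> i")
      case True
      have W: "?Uh x + V x = ?Uh x + G x" if "x \<in> ?\<Omega>" for x using VG[OF that] by simp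
      obtain v v' where "is_sol (\<lambda>x. (?Uh x + G x - \<epsilon> i) / h\<^sup>2) 0 L v v'" "v 0 = 0" "v L = 0"
        "AE x in ?M. \<Psi> i x = v x"
        by (rule dirichlet_eigenfunction_classical[OF L h Wc W ef[OF True]])
      then show ?thesis by (intro exI[of _ "(v, v')"]) simp
    qed simp
  qed
  from choice[OF ex] obtain p where p: "\<forall>i. 1 \<le> i \<longrightarrow>
      is_sol (\<lambda>x. (?Uh x + G x - \<epsilon> i) / h\<^sup>2) 0 L (fst (p i)) (snd (p i)) \<and>
      fst (p i) 0 = 0 \<and> fst (p i) L = 0 \<and> (AE x in ?M. \<Psi> i x = fst (p i) x)" ..
  define u u' where "u i = fst (p i)" and "u' i = snd (p i)" for i
  have u: "is_sol (\<lambda>x. (?Uh x + G x - \<epsilon> i) / h\<^sup>2) 0 L (u i) (u' i)"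
    "u i 0 = 0" "u i L = 0" "AE x in ?M. \<Psi> i x = u i x" if "1 \<le> i" for i
    using p[rule_format, OF that] by (simp_all add: u_def u'_def)
  have uc: "continuous_on {0..L} (u i)" if "1 \<le> i" for i using is_sol_continuous(1)[OF u(1)[OF that]] .
  have \<Psi>m: "\<Psi> i \<in> borel_measurable ?M" if "1 \<le> i" for i
    using ef[OF that] unfolding eigenfunction_def dirichlet_op_def schroedinger_def H2_def
    by (auto dest: L2_realD(1))
  have u_ortho: "integral {0..L} (\<lambda>x. u i x * u j x) = (if i = j then 1 else 0)" if ij: "1 \<le> i" "1 \<le> j" for i j
  proof -
    have c: "continuous_on {0..L} (\<lambda>x. u i x * u j x)" by (intro continuous_intros uc ij)
    have "(LINT x|?M. \<Psi> i x * \<Psi> j x) = (LINT x|?M. u i x * u j x)"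
    proof (rule integral_cong_AE)
      show "AE x in ?M. \<Psi> i x * \<Psi> j x = u i x * u j x" using u(4)[OF ij(1)] u(4)[OF ij(2)] by eventually_elim simp
    qed (use \<Psi>m ij integrable_Ioo_continuous[OF c] in auto)
    then show ?thesis using ortho[OF ij] LINT_Ioo_continuous[OF c] by simp
  qed
  obtain K0 where K0: "0 \<le> K0" "\<And>x. x \<in> {0..L} \<Longrightarrow> \<bar>?Uh x + G x\<bar> \<le> K0"
    using continuous_on_interval_bounded[OF Wc] by metis
  define K where "K = K0 + 1"
  have K: "0 < K" "\<And>x. x \<in> {0..L} \<Longrightarrow> - K \<le> ?Uh x + G x"
    using K0 by (force simp: K_def)+
  \<comment> \<open>the uniform bound of the cardinality of its finite subsets makes \<open>J\<close> finite\<close>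
  have finJ: "finite J"
  proof -
    have "card S \<le> nat \<lceil>L * (2 * sqrt K / h)\<rceil>" if S: "S \<subseteq> J" "finite S" for S
    proof -
      have S1: "1 \<le> i" "\<epsilon> i < - s" if "i \<in> S" for i using that S by (auto simp: J_def)
      interpret dirichlet_states L h "\<lambda>x. ?Uh x + G x" S \<epsilon> u u'
        by unfold_locales (use L h S S1 u u_ortho Wc in auto)
      have "real (card S) \<le> L * (2 * sqrt K / h)"
        by (rule card_bound[OF K]) (use S1 s in force)+
      then show ?thesis by linarith
    qed
    then show ?thesis using finite_if_finite_subsets_card_bdd[of J] by blast
  qed
  have J1: "1 \<le> i" if "i \<in> J" for i using that by (simp add: J_def)
  have cd: "charge_density f \<epsilon> \<Psi> x = (\<Sum>i\<in>J. f (\<epsilon> i) * \<bar>\<Psi> i x\<bar>\<^sup>2)" for x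
  proof -
    have "charge_density f \<epsilon> \<Psi> x = (\<Sum>\<^sub>\<infinity>i\<in>J. f (\<epsilon> i) * \<bar>\<Psi> i x\<bar>\<^sup>2)"
      unfolding charge_density_def by (rule infsum_cong_neutral) (auto simp: J_def f(3))
    then show ?thesis using finJ by simp
  qed
  have cdm: "charge_density f \<epsilon> \<Psi> \<in> borel_measurable ?M"
    unfolding cd[abs_def] by (intro borel_measurable_sum borel_measurable_times borel_measurable_const
        borel_measurable_power borel_measurable_abs \<Psi>m J1)
  have cdu: "AE x in ?M. charge_density f \<epsilon> \<Psi> x = (\<Sum>i\<in>J. f (\<epsilon> i) * (u i x)\<^sup>2)"
  proof -
    have "AE x in ?M. \<forall>i\<in>J. \<Psi> i x = u i x"
      using finJ u(4) J1 by (intro AE_finite_allI) auto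
    then show ?thesis by eventually_elim (simp add: cd)
  qed
  define q where "q x = - (\<Sum>i\<in>J. f (\<epsilon> i) * (u i x)\<^sup>2)" for x
  have qc: "continuous_on {0..L} q" unfolding q_def by (intro continuous_intros uc J1)
  have kq: "AE x in ?M. - charge_density f \<epsilon> \<Psi> x = q x"
    using cdu by eventually_elim (simp add: q_def)
  obtain Vc Vc' where Vc: "AE x in ?M. V x = Vc x" "Vc 0 = 0" "Vc L = 0"
    "\<And>x. x \<in> {0..L} \<Longrightarrow> (Vc has_real_derivative Vc' x) (at x within {0..L})"
    "\<And>x. x \<in> {0..L} \<Longrightarrow> (Vc' has_real_derivative q x) (at x within {0..L})"
    using H10_regularity[OF L VH Vg qc kq] by blast
  have Vcc: "continuous_on {0..L} Vc"
    using Vc(4) by (meson DERIV_continuous continuous_on_eq_continuous_within)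
  have VVc: "V x = Vc x" if "x \<in> ?\<Omega>" for x
    by (rule AE_eq_continuous_imp_eq[OF \<Omega> V_cont continuous_on_subset[OF Vcc sub] Vc(1) that])
  have GVc: "G x = Vc x" if x: "x \<in> {0..L}" for x
  proof (cases "x \<in> ?\<Omega>")
    case True
    then show ?thesis using VG[OF True] VVc[OF True] by simp
  next
    case False
    then have "x = 0 \<or> x = L" using x by auto
    then show ?thesis using Vc(2,3) G(2,3) by auto
  qed
  have u1: "is_sol (\<lambda>x. (?Uh x + Vc x - \<epsilon> i) / h\<^sup>2) 0 L (u i) (u' i)" if "1 \<le> i" for i
    by (rule is_sol_cong[OF u(1)[OF that]]) (simp add: GVc)
  have Wc': "continuous_on {0..L} (\<lambda>x. ?Uh x + Vc x)" by (intro continuous_intros Uhc Vcc)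
  have Uh0: "?Uh x = 0" if "h \<le> \<bar>x - x0\<bar>" for x
  proof -
    have "1 \<le> \<bar>(x - x0) / h\<bar>" using h that by (simp add: abs_divide)
    then show ?thesis unfolding scaled_well_def by (rule U(4))
  qed
  have dVc': "(Vc' has_real_derivative - (\<Sum>i\<in>J. f (\<epsilon> i) * (u i x)\<^sup>2)) (at x within {0..L})" if "x \<in> {0..L}" for x
    using Vc(5)[OF that] by (simp add: q_def)
  have ps: "poisson_states L h ?Uh Vc J \<epsilon> u u' x0 M s f Vc'"
  proof (unfold_locales)
    show "?Uh x \<le> 0" "- M \<le> ?Uh x" for x unfolding scaled_well_def by (rule U)+
    show "f y \<le> f x" if "x \<le> y" for x y by (rule f(2)[OF that])
    show "\<epsilon> i \<le> - s" if "i \<in> J" for i using that by (simp add: J_def)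
    show "is_sol (\<lambda>x. (?Uh x + Vc x - \<epsilon> i) / h\<^sup>2) 0 L (u i) (u' i)" if "i \<in> J" for i by (rule u1[OF J1[OF that]])
    show "u i 0 = 0" "u i L = 0" if "i \<in> J" for i by (rule u[OF J1[OF that]])+
    show "integral {0..L} (\<lambda>x. u i x * u j x) = (if i = j then 1 else 0)" if "i \<in> J" "j \<in> J" for i j
      by (rule u_ortho[OF J1[OF that(1)] J1[OF that(2)]])
    show "0 \<le> f x" for x by (rule f)
  qed (fact L h finJ Wc' M s x0 Uhc Uh0 Vc dVc')+
  have ex: "\<exists>i\<ge>1. \<epsilon> i = E"
    if w: "is_sol (\<lambda>x. (?Uh x + Vc x - E) / h\<^sup>2) 0 L w w'" "w 0 = 0" "w L = 0" "x \<in> ?\<Omega>" "w x \<noteq> 0" for E w w' x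
  proof (rule ccontr)
    assume no: "\<not> ?thesis"
    have "eigenfunction ?\<Omega> (dirichlet_op L h (\<lambda>x. ?Uh x + V x)) E w"
      by (rule is_sol_dirichlet_eigenfunction[OF L h Wc' _ w]) (simp add: VVc)
    then have nz: "\<not> (AE x in ?M. w x = 0)" and "\<exists>c. AE x in ?M. w x = (\<Sum>i | 1 \<le> i \<and> \<epsilon> i = E. c i * \<Psi> i x)"
      using complete by (auto simp only: eigenfunction_def)
    then obtain c where c: "AE x in ?M. w x = (\<Sum>i | 1 \<le> i \<and> \<epsilon> i = E. c i * \<Psi> i x)" by blast
    have "{i. 1 \<le> i \<and> \<epsilon> i = E} = {}" using no by auto
    then have "(\<Sum>i | 1 \<le> i \<and> \<epsilon> i = E. c i * \<Psi> i x) = 0" for x by (simp only: sum.empty)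
    then show False using c nz by simp
  qed
  show thesis by (rule that[OF ps VVc cdm cdu ex])
qed

section \<open>Comparison of the spectra\<close>

lemma finite_uniform_threshold:
  assumes "finite A" "\<And>k. k \<in> A \<Longrightarrow> \<exists>d>0. P k d" "\<And>k d d'. P k d \<Longrightarrow> 0 < d' \<Longrightarrow> d' \<le> d \<Longrightarrow> P k d'"
  shows "\<exists>d>(0::real). \<forall>k\<in>A. P k d"
  using assms(1,2)
proof (induction A rule: finite_induct)
  case empty
  show ?case by (intro exI[of _ 1]) simp
next
  case (insert a A)
  obtain d1 where d1: "d1 > 0" "\<forall>k\<in>A. P k d1" using insert.IH insert.prems by blast
  obtain d2 where d2: "d2 > 0" "P a d2" using insert.prems by blast
  have m: "0 < min d1 d2" "min d1 d2 \<le> d1" "min d1 d2 \<le> d2" using d1 d2 by auto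
  have "P a (min d1 d2)" by (rule assms(3)[OF d2(2) m(1) m(3)])
  moreover have "P k (min d1 d2)" if "k \<in> A" for k
    by (rule assms(3)[OF d1(2)[rule_format, OF that] m(1) m(2)])
  ultimately show ?case using m(1) by (intro exI[of _ "min d1 d2"]) blast
qed

text \<open>Needed to find an eigenvalue between two energies at which the solution has opposite signs at the
  right end.\<close>

lemma solution_continuous_in_energy:
  assumes ab: "a \<le> b" and W: "continuous_on {a..b} W"
    and sol: "\<And>E. E \<in> {E1..E2} \<Longrightarrow> is_sol (\<lambda>x. (W x - E) / q) a b (g E) (g' E)"
    and init: "\<And>E. E \<in> {E1..E2} \<Longrightarrow> g E a = \<alpha>" "\<And>E. E \<in> {E1..E2} \<Longrightarrow> g' E a = \<beta>" and q: "0 < q"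
  shows "continuous_on {E1..E2} (\<lambda>E. g E b)"
  unfolding continuous_on_def
proof
  fix E assume E: "E \<in> {E1..E2}"
  obtain K where K: "0 \<le> K" "\<And>x. x \<in> {a..b} \<Longrightarrow> \<bar>W x\<bar> \<le> K"
    using continuous_on_interval_bounded[OF W] by metis
  obtain C where C: "0 \<le> C" "\<And>x. x \<in> {a..b} \<Longrightarrow> \<bar>g E x\<bar> \<le> C"
    using continuous_on_interval_bounded[OF is_sol_continuous(1)[OF sol[OF E]]] by metis
  define k where "k = (K + \<bar>E1\<bar> + \<bar>E2\<bar>) / q"
  define B where "B = exp ((k + 2) * (b - a)) * (b - a)"
  have B: "0 \<le> B" using ab by (simp add: B_def)
  have le: "\<bar>g F b - g E b\<bar> \<le> sqrt B * (\<bar>F - E\<bar> / q * C)" if F: "F \<in> {E1..E2}" for F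
  proof -
    define d where "d = \<bar>F - E\<bar> / q * C"
    have d0: "0 \<le> d" using C q by (simp add: d_def)
    have kb: "\<bar>(W x - F) / q\<bar> \<le> k" if "x \<in> {a..b}" for x
    proof -
      have "\<bar>W x - F\<bar> \<le> K + \<bar>E1\<bar> + \<bar>E2\<bar>" using K(2)[OF that] F by auto
      then show ?thesis using q by (simp add: k_def abs_divide divide_right_mono)
    qed
    have db: "\<bar>((W x - F) / q - (W x - E) / q) * g E x\<bar> \<le> d" if "x \<in> {a..b}" for x
    proof -
      have "(W x - F) / q - (W x - E) / q = (E - F) / q" by (simp add: diff_divide_distrib)
      then have "\<bar>((W x - F) / q - (W x - E) / q) * g E x\<bar> = \<bar>F - E\<bar> / q * \<bar>g E x\<bar>"
        using q by (simp add: abs_mult abs_divide abs_minus_commute)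
      also have "\<dots> \<le> d" unfolding d_def using q by (intro mult_left_mono C that) auto
      finally show ?thesis .
    qed
    have b: "b \<in> {a..b}" using ab by simp
    have "(g F b - g E b)\<^sup>2 + (g' F b - g' E b)\<^sup>2
        \<le> exp ((k + 2) * (b - a)) * ((g F a - g E a)\<^sup>2 + (g' F a - g' E a)\<^sup>2 + d\<^sup>2 * (b - a))"
      by (rule sol_dependence[OF sol[OF F] sol[OF E] kb db b])
    also have "\<dots> = B * d\<^sup>2" using init[OF F] init[OF E] by (simp add: B_def)
    also have "\<dots> = (sqrt B * d)\<^sup>2" using B by (simp add: power_mult_distrib)
    finally have "(g F b - g E b)\<^sup>2 + (g' F b - g' E b)\<^sup>2 \<le> (sqrt B * d)\<^sup>2" .
    then have "\<bar>g F b - g E b\<bar>\<^sup>2 \<le> (sqrt B * d)\<^sup>2"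
      using zero_le_power2[of "g' F b - g' E b"] unfolding power2_abs by linarith
    then show ?thesis unfolding d_def[symmetric] by (rule power2_le_imp_le) (use B d0 in simp)
  qed
  have "((\<lambda>F. g F b - g E b) \<longlongrightarrow> 0) (at E within {E1..E2})"
  proof (rule Lim_null_comparison)
    show "\<forall>\<^sub>F F in at E within {E1..E2}. norm (g F b - g E b) \<le> sqrt B * (\<bar>F - E\<bar> / q * C)"
      using le by (auto simp: eventually_at_filter)
    have "((\<lambda>F. sqrt B * (\<bar>F - E\<bar> / q * C)) \<longlongrightarrow> sqrt B * (\<bar>E - E\<bar> / q * C)) (at E within {E1..E2})"
      using q by (intro tendsto_intros) auto
    then show "((\<lambda>F. sqrt B * (\<bar>F - E\<bar> / q * C)) \<longlongrightarrow> 0) (at E within {E1..E2})" by simp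
  qed
  then show "((\<lambda>E. g E b) \<longlongrightarrow> g E b) (at E within {E1..E2})" by (simp add: LIM_zero_iff)
qed

text \<open>The rescaled left solution of the Schroedinger-Poisson Hamiltonian is an instance of shooting, once
  \<open>h\<close> is so small that the potential is nearly constant on the window.\<close>

lemma rescaled_shooting:
  fixes U :: "real \<Rightarrow> real"
  assumes lw: "limit_well U M \<phi> \<phi>'" and ps: "poisson_states L h (scaled_well U x0 h) Vc J \<epsilon> u u' x0 M s f Vc'"
    and charge: "(\<Sum>i\<in>J. f (\<epsilon> i)) \<le> Q" and small: "h * (1 + R) \<le> x0" "h * (1 + R) \<le> L - x0" "Q * (h * (1 + R)) \<le> \<rho>"
    and R: "1 \<le> R" and E: "E \<le> - s" "- m \<le> E - Vc x0"
    and g: "is_sol (\<lambda>x. (scaled_well U x0 h x + Vc x - E) / h\<^sup>2) 0 L g g'" "g 0 = 0" "g' 0 = 1 / h"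
  shows "limit_well.shooting U s m R \<rho> (x0 / h) ((L - x0) / h) (Vc x0) (\<lambda>y. Vc (h * y + x0)) E
    (\<lambda>y. g (h * y + x0)) (\<lambda>y. h * g' (h * y + x0))"
proof -
  interpret limit_well U M \<phi> \<phi>' by fact
  interpret P: poisson_states L h "scaled_well U x0 h" Vc J \<epsilon> u u' x0 M s f Vc' by fact
  have h: "0 < h" and L: "0 < L" and x0: "0 < x0" "x0 < L" by (fact P.h P.L P.x0)+
  have rng: "h * y + x0 \<in> {0..L}" if "y \<in> {- (x0 / h)..(L - x0) / h}" for y
  proof -
    have "(- x0) / h \<le> y" "y \<le> (L - x0) / h" using that by simp_all
    then have "- x0 \<le> y * h" "y * h \<le> L - x0" using h by (simp_all only: pos_divide_le_eq pos_le_divide_eq)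
    then show ?thesis by (simp add: mult.commute)
  qed
  have Vcc: "continuous_on {0..L} Vc"
    using P.dV by (meson DERIV_continuous continuous_on_eq_continuous_within)
  have charge0: "P.charge \<le> Q" using charge by (simp add: P.charge_def)
  show ?thesis
    unfolding shooting_def
  proof (intro conjI ballI allI impI)
    show "1 + R \<le> x0 / h" "1 + R \<le> (L - x0) / h" using small h by (simp_all add: pos_le_divide_eq mult.commute)
    show "continuous_on {- (x0 / h)..(L - x0) / h} (\<lambda>y. Vc (h * y + x0))"
      by (rule continuous_on_compose2[OF Vcc]) (use rng in \<open>auto intro!: continuous_intros\<close>)
    show "0 \<le> Vc (h * y + x0)" if "y \<in> {- (x0 / h)..(L - x0) / h}" for y by (rule P.V_nonneg[OF rng[OF that]])
    show "\<bar>Vc (h * y + x0) - Vc x0\<bar> \<le> \<rho>" if y: "\<bar>y\<bar> \<le> 1 + R" for y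
    proof -
      have hy: "\<bar>h * y\<bar> \<le> h * (1 + R)" using y h by (simp add: abs_mult)
      then have "h * y + x0 \<in> {0..L}" using small by (auto simp: abs_le_iff)
      then have "\<bar>Vc (h * y + x0) - Vc x0\<bar> \<le> P.charge * \<bar>h * y + x0 - x0\<bar>"
        by (rule P.V_lipschitz) (use x0 in auto)
      also have "\<dots> \<le> Q * (h * (1 + R))"
        using hy charge0 P.charge_nonneg by (intro mult_mono) auto
      finally show ?thesis using small(3) by linarith
    qed
    show "0 \<le> Vc x0" by (rule P.V_nonneg) (use x0 in auto)
    have e: "h * - (x0 / h) + x0 = 0" using h by simp
    show "g (h * - (x0 / h) + x0) = 0" "h * g' (h * - (x0 / h) + x0) = 1" unfolding e using g h by simp_all
    have "is_sol (\<lambda>y. h\<^sup>2 * ((scaled_well U x0 h (h * y + x0) + Vc (h * y + x0) - E) / h\<^sup>2))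
        (- (x0 / h)) ((L - x0) / h) (\<lambda>y. g (h * y + x0)) (\<lambda>y. h * g' (h * y + x0))"
      by (rule is_sol_affine[OF g(1)]) (use h rng in auto)
    then show "is_sol (\<lambda>y. U y + Vc (h * y + x0) - E)
        (- (x0 / h)) ((L - x0) / h) (\<lambda>y. g (h * y + x0)) (\<lambda>y. h * g' (h * y + x0))"
      by (rule is_sol_cong) (use h in \<open>simp add: scaled_well_def\<close>)
  qed (use E in auto)
qed

context limit_well
begin

text \<open>A name for the neighbourhood of a bound state in which the sign argument works; one parameter
  \<open>d\<close> measures both the energies and the profiles, so that the condition is monotone in \<open>d\<close>.\<close>

definition profiles_positive :: "real \<Rightarrow> real \<Rightarrow> bool" where
  "profiles_positive \<nu> d \<longleftrightarrow> (\<forall>\<mu>1 \<mu>2 g1 g2. \<mu>1 < 0 \<and> \<mu>2 < 0 \<and> \<bar>\<mu>1 - \<nu>\<bar> < d \<and> \<bar>\<mu>2 - \<nu>\<bar> < d \<and>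
     continuous_on {-1..1} g1 \<and> continuous_on {-1..1} g2 \<and>
     (\<forall>y\<in>{-1..1}. \<bar>g1 y - \<phi> \<mu>1 y\<bar> \<le> d \<and> \<bar>g2 y - \<phi> \<mu>2 y\<bar> \<le> d) \<longrightarrow>
     0 < integral {-1..1} (\<lambda>y. g1 y * g2 y) \<and> 0 < g1 1 * g2 1)"

lemma profiles_positiveD:
  assumes "profiles_positive \<nu> d" "\<mu>1 < 0" "\<mu>2 < 0" "\<bar>\<mu>1 - \<nu>\<bar> < d" "\<bar>\<mu>2 - \<nu>\<bar> < d"
    "continuous_on {-1..1} g1" "continuous_on {-1..1} g2"
    "\<And>y. y \<in> {-1..1} \<Longrightarrow> \<bar>g1 y - \<phi> \<mu>1 y\<bar> \<le> d" "\<And>y. y \<in> {-1..1} \<Longrightarrow> \<bar>g2 y - \<phi> \<mu>2 y\<bar> \<le> d"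
  shows "0 < integral {-1..1} (\<lambda>y. g1 y * g2 y)" "0 < g1 1 * g2 1"
  using assms unfolding profiles_positive_def by blast+

lemma profiles_positive_mono:
  assumes p: "profiles_positive \<nu> d" and d: "0 < d'" "d' \<le> d"
  shows "profiles_positive \<nu> d'"
  unfolding profiles_positive_def
proof (intro allI impI)
  fix \<mu>1 \<mu>2 g1 g2
  assume "\<mu>1 < 0 \<and> \<mu>2 < 0 \<and> \<bar>\<mu>1 - \<nu>\<bar> < d' \<and> \<bar>\<mu>2 - \<nu>\<bar> < d' \<and>
     continuous_on {-1..1} g1 \<and> continuous_on {-1..1} g2 \<and>
     (\<forall>y\<in>{-1..1}. \<bar>g1 y - \<phi> \<mu>1 y\<bar> \<le> d' \<and> \<bar>g2 y - \<phi> \<mu>2 y\<bar> \<le> d')"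
  then have "\<mu>1 < 0" "\<mu>2 < 0" "\<bar>\<mu>1 - \<nu>\<bar> < d" "\<bar>\<mu>2 - \<nu>\<bar> < d"
     "continuous_on {-1..1} g1" "continuous_on {-1..1} g2"
     "\<And>y. y \<in> {-1..1} \<Longrightarrow> \<bar>g1 y - \<phi> \<mu>1 y\<bar> \<le> d" "\<And>y. y \<in> {-1..1} \<Longrightarrow> \<bar>g2 y - \<phi> \<mu>2 y\<bar> \<le> d"
    using d(2) by force+
  from profiles_positiveD[OF p this]
  show "0 < integral {-1..1} (\<lambda>y. g1 y * g2 y) \<and> 0 < g1 1 * g2 1" by blast
qed

lemma profiles_positive_exists:
  assumes "\<nu> < 0" "mismatch \<nu> = 0"
  shows "\<exists>d>0. profiles_positive \<nu> d"
proof -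
  obtain \<delta> \<eta> where de: "\<delta> > 0" "\<eta> > 0" and H: "\<forall>\<mu>1 \<mu>2 g1 g2. \<mu>1 < 0 \<and> \<mu>2 < 0 \<and> \<bar>\<mu>1 - \<nu>\<bar> < \<delta> \<and> \<bar>\<mu>2 - \<nu>\<bar> < \<delta> \<and>
     continuous_on {-1..1} g1 \<and> continuous_on {-1..1} g2 \<and>
     (\<forall>y\<in>{-1..1}. \<bar>g1 y - \<phi> \<mu>1 y\<bar> \<le> \<eta> \<and> \<bar>g2 y - \<phi> \<mu>2 y\<bar> \<le> \<eta>) \<longrightarrow>
     0 < integral {-1..1} (\<lambda>y. g1 y * g2 y) \<and> 0 < g1 1 * g2 1"
    using profiles_near_bound_state[OF assms] by blast
  have "profiles_positive \<nu> (min \<delta> \<eta>)"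
    unfolding profiles_positive_def
  proof (intro allI impI)
    fix \<mu>1 \<mu>2 g1 g2
    assume "\<mu>1 < 0 \<and> \<mu>2 < 0 \<and> \<bar>\<mu>1 - \<nu>\<bar> < min \<delta> \<eta> \<and> \<bar>\<mu>2 - \<nu>\<bar> < min \<delta> \<eta> \<and>
     continuous_on {-1..1} g1 \<and> continuous_on {-1..1} g2 \<and>
     (\<forall>y\<in>{-1..1}. \<bar>g1 y - \<phi> \<mu>1 y\<bar> \<le> min \<delta> \<eta> \<and> \<bar>g2 y - \<phi> \<mu>2 y\<bar> \<le> min \<delta> \<eta>)"
    then show "0 < integral {-1..1} (\<lambda>y. g1 y * g2 y) \<and> 0 < g1 1 * g2 1"
      by (intro H[rule_format, of \<mu>1 \<mu>2]) auto
  qed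
  then show ?thesis using de by (intro exI[of _ "min \<delta> \<eta>"]) auto
qed

lemma mismatch_signs:
  assumes p: "profiles_positive \<nu> d" and z: "mismatch \<nu> = 0" and d: "0 < d'" "d' < d" "\<nu> + d' < 0"
  shows "0 < \<phi> \<nu> 1 * mismatch (\<nu> - d')" "\<phi> \<nu> 1 * mismatch (\<nu> + d') < 0"
proof -
  have \<nu>: "\<nu> < 0" "\<nu> - d' < 0" using d by auto
  have pos: "0 < integral {-1..1} (\<lambda>y. \<phi> \<nu> y * \<phi> \<mu> y)" "0 < \<phi> \<nu> 1 * \<phi> \<mu> 1"
    if "\<mu> < 0" "\<bar>\<mu> - \<nu>\<bar> < d" for \<mu>
    using that \<nu> d by (intro profiles_positiveD[OF p \<nu>(1) that(1)] \<phi>_continuous; simp)+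
  have ab: "\<bar>\<nu> - d' - \<nu>\<bar> < d" "\<bar>\<nu> + d' - \<nu>\<bar> < d" using d by auto
  show "0 < \<phi> \<nu> 1 * mismatch (\<nu> - d')"
    by (rule mismatch_sign_change(1)[OF \<nu>(1) z \<nu>(2) pos[OF \<nu>(2) ab(1)]]) (use d in simp)
  show "\<phi> \<nu> 1 * mismatch (\<nu> + d') < 0"
    by (rule mismatch_sign_change(2)[OF \<nu>(1) z d(3) pos[OF d(3) ab(2)]]) (use d in simp)
qed

end

text \<open>Two different eigenvalues near the same bound state would have eigenfunctions whose product is
  non-negative on the tails and has positive integral over the well, contradicting orthogonality.\<close>

lemma matched_product_positive:
  assumes lw: "limit_well U M \<phi> \<phi>'" and pp: "limit_well.profiles_positive \<phi> \<nu> d" and \<eta>: "\<eta> \<le> d"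
    and AB: "1 \<le> A" "1 \<le> B"
    and 1: "limit_well.matched \<phi> \<phi>' \<eta> A B \<mu>1 w1" "continuous_on {-A..B} w1" "w1 B = 0" "\<mu>1 < 0" "\<bar>\<mu>1 - \<nu>\<bar> < d"
    and 2: "limit_well.matched \<phi> \<phi>' \<eta> A B \<mu>2 w2" "continuous_on {-A..B} w2" "w2 B = 0" "\<mu>2 < 0" "\<bar>\<mu>2 - \<nu>\<bar> < d"
  shows "0 < integral {-A..B} (\<lambda>y. w1 y * w2 y)"
proof -
  interpret limit_well U M \<phi> \<phi>' by fact
  have left: "\<And>y. y \<in> {-A..-1} \<Longrightarrow> 0 \<le> w1 y" "\<And>y. y \<in> {-A..-1} \<Longrightarrow> 0 \<le> w2 y" "0 < w1 (-1)" "0 < w2 (-1)"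
    using 1(1) 2(1) by (auto simp: matched_def)
  have cl: "\<bar>w1 y / w1 (-1) - \<phi> \<mu>1 y\<bar> \<le> d" "\<bar>w2 y / w2 (-1) - \<phi> \<mu>2 y\<bar> \<le> d" if "y \<in> {-1..1}" for y
  proof -
    have "\<bar>w1 y / w1 (-1) - \<phi> \<mu>1 y\<bar> \<le> \<eta>" "\<bar>w2 y / w2 (-1) - \<phi> \<mu>2 y\<bar> \<le> \<eta>"
      using 1(1) 2(1) that unfolding matched_def by blast+
    then show "\<bar>w1 y / w1 (-1) - \<phi> \<mu>1 y\<bar> \<le> d" "\<bar>w2 y / w2 (-1) - \<phi> \<mu>2 y\<bar> \<le> d" using \<eta> by linarith+
  qed
  obtain a1 z1 where z1: "0 < z1 1" "\<And>y. y \<in> {1..B} \<Longrightarrow> 0 \<le> z1 y \<and> w1 y = a1 * z1 y"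
    using 1(1,3) unfolding matched_def by blast
  obtain a2 z2 where z2: "0 < z2 1" "\<And>y. y \<in> {1..B} \<Longrightarrow> 0 \<le> z2 y \<and> w2 y = a2 * z2 y"
    using 2(1,3) unfolding matched_def by blast
  have sub: "{-1..1} \<subseteq> {-A..B}" using AB by auto
  have c: "continuous_on {-1..1} (\<lambda>y. w1 y / w1 (-1))" "continuous_on {-1..1} (\<lambda>y. w2 y / w2 (-1))"
    using left by (auto intro!: continuous_intros continuous_on_subset[OF 1(2) sub] continuous_on_subset[OF 2(2) sub])
  note pos = profiles_positiveD[OF pp 1(4) 2(4) 1(5) 2(5) c cl]
  have mid: "0 < integral {-1..1} (\<lambda>y. w1 y * w2 y)"
  proof -
    have "(\<lambda>y. w1 y * w2 y) = (\<lambda>y. (w1 (-1) * w2 (-1)) * (w1 y / w1 (-1) * (w2 y / w2 (-1))))"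
      using left by (auto simp: field_simps)
    then have "integral {-1..1} (\<lambda>y. w1 y * w2 y) = (w1 (-1) * w2 (-1)) * integral {-1..1} (\<lambda>y. w1 y / w1 (-1) * (w2 y / w2 (-1)))"
      by (simp only: integral_mult_right)
    then show ?thesis using mult_pos_pos[OF mult_pos_pos[OF left(3,4)] pos(1)] by (simp only:)
  qed
  have a: "0 < a1 * a2"
  proof -
    have "w1 1 * w2 1 = (w1 (-1) * w2 (-1)) * (w1 1 / w1 (-1) * (w2 1 / w2 (-1)))"
      using left(3,4) by simp
    then have "0 < w1 1 * w2 1" using mult_pos_pos[OF mult_pos_pos[OF left(3,4)] pos(2)] by (simp only:)
    also have "w1 1 * w2 1 = (a1 * a2) * (z1 1 * z2 1)" using z1(2)[of 1] z2(2)[of 1] AB by simp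
    finally show ?thesis using mult_pos_pos[OF z1(1) z2(1)] by (simp add: zero_less_mult_iff)
  qed
  have ci: "(\<lambda>y. w1 y * w2 y) integrable_on {-A..B}"
    by (intro integrable_continuous_real continuous_intros 1 2)
  have i: "(\<lambda>y. w1 y * w2 y) integrable_on {-A..-1}" "(\<lambda>y. w1 y * w2 y) integrable_on {1..B}"
    "(\<lambda>y. w1 y * w2 y) integrable_on {-1..B}"
    by (rule integrable_subinterval_real[OF ci]; use AB in auto)+
  have "0 \<le> integral {-A..-1} (\<lambda>y. w1 y * w2 y)"
    by (intro Henstock_Kurzweil_Integration.integral_nonneg i) (use left in auto)
  moreover have "0 \<le> integral {1..B} (\<lambda>y. w1 y * w2 y)"
  proof (intro Henstock_Kurzweil_Integration.integral_nonneg i)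
    fix y assume y: "y \<in> {1..B}"
    have "w1 y * w2 y = (a1 * a2) * (z1 y * z2 y)" using z1(2)[OF y] z2(2)[OF y] by simp
    moreover have "0 \<le> z1 y * z2 y" using z1(2)[OF y] z2(2)[OF y] by simp
    then have "0 \<le> (a1 * a2) * (z1 y * z2 y)" by (rule mult_nonneg_nonneg[OF less_imp_le[OF a]])
    ultimately show "0 \<le> w1 y * w2 y" by simp
  qed
  moreover have "integral {-A..-1} (\<lambda>y. w1 y * w2 y) + integral {-1..B} (\<lambda>y. w1 y * w2 y) = integral {-A..B} (\<lambda>y. w1 y * w2 y)"
    by (rule Henstock_Kurzweil_Integration.integral_combine[OF _ _ ci]) (use AB in auto)
  moreover have "integral {-1..1} (\<lambda>y. w1 y * w2 y) + integral {1..B} (\<lambda>y. w1 y * w2 y) = integral {-1..B} (\<lambda>y. w1 y * w2 y)"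
    by (rule Henstock_Kurzweil_Integration.integral_combine[OF _ _ i(3)]) (use AB in auto)
  ultimately show ?thesis using mid by linarith
qed

text \<open>For small \<open>h\<close> the eigenvalues below \<open>- s\<close>, shifted down by the potential \<open>Vc x0\<close> at the well, correspond
  one-to-one to the bound states of the limit operator, except for bound states within the
  tolerance of the threshold, where \<open>f\<close> is small anyway.\<close>

theorem charge_asymptotics:
  fixes U :: "real \<Rightarrow> real" and e :: "nat \<Rightarrow> real"
  assumes lw: "limit_well U M \<phi> \<phi>'" and M: "0 < M" and s: "0 < s" and x0: "0 < x0" "x0 < L"
    and e_neg: "\<And>k. k \<in> {1..N} \<Longrightarrow> e k < 0" and e_inj: "inj_on e {1..N}"
    and zeros: "\<And>\<mu>. \<mu> < 0 \<Longrightarrow> limit_well.mismatch \<phi> \<phi>' \<mu> = 0 \<longleftrightarrow> \<mu> \<in> e ` {1..N}"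
    and f_cont: "continuous_on UNIV f" and f0: "\<And>x. - s \<le> x \<Longrightarrow> f x = 0"
    and Q: "0 \<le> Q" and \<tau>: "0 < \<tau>"
  shows "\<exists>h1>0. \<forall>h Vc J \<epsilon> u u' Vc'. 0 < h \<and> h < h1 \<and> J = {i. 1 \<le> i \<and> \<epsilon> i < - s} \<and>
     poisson_states L h (scaled_well U x0 h) Vc J \<epsilon> u u' x0 M s f Vc' \<and> (\<Sum>i\<in>J. f (\<epsilon> i)) \<le> Q \<and>
     (\<forall>E w w' x. is_sol (\<lambda>x. (scaled_well U x0 h x + Vc x - E) / h\<^sup>2) 0 L w w' \<and> w 0 = 0 \<and> w L = 0 \<and>
        x \<in> {0<..<L} \<and> w x \<noteq> 0 \<longrightarrow> (\<exists>i\<ge>1. \<epsilon> i = E)) \<longrightarrow>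
     \<bar>(\<Sum>i\<in>J. f (\<epsilon> i)) - (\<Sum>k=1..N. f (e k + Vc x0))\<bar> \<le> \<tau>"
proof -
  interpret limit_well U M \<phi> \<phi>' by fact
  have L: "0 < L" using x0 by simp
  have mism: "mismatch (e k) = 0" if "k \<in> {1..N}" for k using zeros[OF e_neg[OF that]] that by auto
  define m where "m = M + Q * L + s + 1 + (\<Sum>k=1..N. \<bar>e k\<bar>)"
  have QL: "0 \<le> Q * L" using Q L by simp
  have sum0: "0 \<le> (\<Sum>k=1..N. \<bar>e k\<bar>)" by (intro sum_nonneg) auto
  have m: "M + Q * L + 1 \<le> m" "s \<le> m" using sum0 QL M s by (simp_all add: m_def)
  have em: "1 - m \<le> e k" if "k \<in> {1..N}" for k
  proof -
    have "\<bar>e k\<bar> \<le> (\<Sum>k=1..N. \<bar>e k\<bar>)" using that by (intro member_le_sum) auto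
    then show ?thesis using M QL s by (simp add: m_def)
  qed
  \<comment> \<open>one tolerance \<open>d\<close> that works for the profiles, the gaps, the sign of the energies and the
    uniform continuity of \<open>f\<close>\<close>
  define \<tau>' where "\<tau>' = \<tau> / (real N + 1)"
  have \<tau>': "0 < \<tau>'" "real N * \<tau>' \<le> \<tau>" using \<tau> by (simp_all add: \<tau>'_def field_simps)
  have "\<exists>d>0. \<forall>k\<in>{1..N}. profiles_positive (e k) d"
    using profiles_positive_exists[OF e_neg mism]
    by (intro finite_uniform_threshold) (auto intro: profiles_positive_mono)
  then obtain d1 where d1: "d1 > 0" "\<And>k. k \<in> {1..N} \<Longrightarrow> profiles_positive (e k) d1" by blast
  have "\<exists>d>0. \<forall>p\<in>{(k, l). k \<in> {1..N} \<and> l \<in> {1..N} \<and> k \<noteq> l}. 2 * d < \<bar>e (fst p) - e (snd p)\<bar>"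
  proof (rule finite_uniform_threshold)
    show "finite {(k, l). k \<in> {1..N} \<and> l \<in> {1..N} \<and> k \<noteq> l}"
      by (rule finite_subset[of _ "{1..N} \<times> {1..N}"]) auto
    fix p assume p: "p \<in> {(k, l). k \<in> {1..N} \<and> l \<in> {1..N} \<and> k \<noteq> l}"
    then have "e (fst p) \<noteq> e (snd p)" using inj_on_eq_iff[OF e_inj, of "fst p" "snd p"] by auto
    then show "\<exists>d>0. 2 * d < \<bar>e (fst p) - e (snd p)\<bar>"
      by (intro exI[of _ "\<bar>e (fst p) - e (snd p)\<bar> / 4"]) auto
  qed auto
  then obtain d2 where d2': "d2 > 0" "\<forall>p\<in>{(k, l). k \<in> {1..N} \<and> l \<in> {1..N} \<and> k \<noteq> l}. 2 * d2 < \<bar>e (fst p) - e (snd p)\<bar>" by blast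
  have d2: "d2 > 0" "\<And>k l. k \<in> {1..N} \<Longrightarrow> l \<in> {1..N} \<Longrightarrow> k \<noteq> l \<Longrightarrow> 2 * d2 < \<bar>e k - e l\<bar>"
    using d2'(1) bspec[OF d2'(2), of "(k, l)" for k l] by simp_all
  have "\<exists>d>0. \<forall>k\<in>{1..N}. e k + d < 0"
  proof (rule finite_uniform_threshold)
    fix k assume "k \<in> {1..N}"
    then show "\<exists>d>0. e k + d < 0" using e_neg[of k] by (intro exI[of _ "- e k / 2"]) auto
  qed auto
  then obtain d3 where d3: "d3 > 0" "\<And>k. k \<in> {1..N} \<Longrightarrow> e k + d3 < 0" by blast
  have "uniformly_continuous_on {- m..Q * L + 1} f"
    by (intro compact_uniformly_continuous continuous_on_subset[OF f_cont]) auto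
  then obtain d4 where d4: "d4 > 0" "\<And>x y. x \<in> {- m..Q * L + 1} \<Longrightarrow> y \<in> {- m..Q * L + 1} \<Longrightarrow> \<bar>y - x\<bar> < d4 \<Longrightarrow> \<bar>f y - f x\<bar> < \<tau>'"
    using \<tau>'(1) unfolding uniformly_continuous_on_def dist_real_def by metis
  define d where "d = min (min (d1 / 2) d2) (min (min (d3 / 2) (d4 / 2)) 1)"
  have d: "0 < d" "d < d1" "d \<le> d2" "d < d3" "d < d4" "d \<le> 1" using d1(1) d2(1) d3(1) d4(1) by (auto simp: d_def)
  \<comment> \<open>away from the bound states, and at the end points of the tolerance intervals, the mismatch is
    bounded away from zero\<close>
  define Z where "Z = {- m..- s} \<inter> (\<Inter>k\<in>{1..N}. {\<mu>. d \<le> \<bar>\<mu> - e k\<bar>})"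
  have Zc: "compact Z"
    unfolding Z_def by (intro compact_Int_closed compact_Icc closed_INT ballI closed_Collect_le continuous_intros)
  have Zneg: "\<mu> < 0" if "\<mu> \<in> Z" for \<mu> using that s by (auto simp: Z_def)
  have "\<exists>c>0. \<forall>\<mu>\<in>Z. c < \<bar>mismatch \<mu>\<bar>"
  proof (cases "Z = {}")
    case True
    then show ?thesis by (intro exI[of _ 1]) simp
  next
    case False
    have "continuous_on Z (\<lambda>\<mu>. \<bar>mismatch \<mu>\<bar>)"
      by (intro continuous_intros continuous_on_subset[OF mismatch_continuous]) (use Zneg in auto)
    then obtain \<mu>0 where \<mu>0: "\<mu>0 \<in> Z" "\<And>\<mu>. \<mu> \<in> Z \<Longrightarrow> \<bar>mismatch \<mu>0\<bar> \<le> \<bar>mismatch \<mu>\<bar>"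
      using continuous_attains_inf[OF Zc False] by blast
    have "mismatch \<mu>0 \<noteq> 0"
    proof
      assume "mismatch \<mu>0 = 0"
      then obtain k where k: "k \<in> {1..N}" "\<mu>0 = e k" using zeros[OF Zneg[OF \<mu>0(1)]] by auto
      have "d \<le> \<bar>\<mu>0 - e k\<bar>" using \<mu>0(1) k(1) unfolding Z_def by blast
      then show False using d(1) k(2) by simp
    qed
    then have nz: "0 < \<bar>mismatch \<mu>0\<bar>" by simp
    have "\<bar>mismatch \<mu>0\<bar> / 2 < \<bar>mismatch \<mu>\<bar>" if "\<mu> \<in> Z" for \<mu> using \<mu>0(2)[OF that] nz by linarith
    then show ?thesis using nz by (intro exI[of _ "\<bar>mismatch \<mu>0\<bar> / 2"] conjI ballI) auto
  qed
  then obtain c1 where c1: "c1 > 0" "\<And>\<mu>. \<mu> \<in> Z \<Longrightarrow> c1 < \<bar>mismatch \<mu>\<bar>" by blast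
  have signs: "0 < \<phi> (e k) 1 * mismatch (e k - d)" "\<phi> (e k) 1 * mismatch (e k + d) < 0" if k: "k \<in> {1..N}" for k
    using mismatch_signs[OF d1(2)[OF k] mism[OF k] d(1,2)] d3(2)[OF k] d(4) by auto
  have "\<exists>c>0. \<forall>k\<in>{1..N}. c < \<bar>mismatch (e k - d)\<bar> \<and> c < \<bar>mismatch (e k + d)\<bar>"
  proof (rule finite_uniform_threshold)
    fix k assume k: "k \<in> {1..N}"
    have "mismatch (e k - d) \<noteq> 0" "mismatch (e k + d) \<noteq> 0" using signs[OF k] by auto
    then show "\<exists>c>0. c < \<bar>mismatch (e k - d)\<bar> \<and> c < \<bar>mismatch (e k + d)\<bar>"
      by (intro exI[of _ "min \<bar>mismatch (e k - d)\<bar> \<bar>mismatch (e k + d)\<bar> / 2"]) auto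
  qed auto
  then obtain c2 where c2: "c2 > 0" "\<And>k. k \<in> {1..N} \<Longrightarrow> c2 < \<bar>mismatch (e k - d)\<bar> \<and> c2 < \<bar>mismatch (e k + d)\<bar>" by blast
  define \<eta> where "\<eta> = min d (min c1 c2)"
  have \<eta>: "0 < \<eta>" "\<eta> \<le> d" "\<eta> \<le> c1" "\<eta> \<le> c2" using d(1) c1(1) c2(1) by (auto simp: \<eta>_def)
  obtain R \<rho> where R: "1 \<le> R" "0 < \<rho>"
    and match: "\<And>A B \<theta> v E w w'. shooting s m R \<rho> A B \<theta> v E w w' \<Longrightarrow> matched \<eta> A B (E - \<theta>) w"
    using shooting_imp_matched[OF s m(2) \<eta>(1)] by metis
  define h1 where "h1 = min (min x0 (L - x0) / (1 + R)) (\<rho> / ((Q + 1) * (1 + R)))"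
  have h1: "0 < h1" using x0 R Q by (auto simp: h1_def)
  have main: "\<bar>(\<Sum>i\<in>J. f (\<epsilon> i)) - (\<Sum>k=1..N. f (e k + Vc x0))\<bar> \<le> \<tau>"
    if h: "0 < h" "h < h1" and Jdef: "J = {i. 1 \<le> i \<and> \<epsilon> i < - s}"
      and ps: "poisson_states L h (scaled_well U x0 h) Vc J \<epsilon> u u' x0 M s f Vc'"
      and charge: "(\<Sum>i\<in>J. f (\<epsilon> i)) \<le> Q"
      and complete: "\<And>E w w' x. is_sol (\<lambda>x. (scaled_well U x0 h x + Vc x - E) / h\<^sup>2) 0 L w w' \<Longrightarrow> w 0 = 0 \<Longrightarrow> w L = 0 \<Longrightarrow>
        x \<in> {0<..<L} \<Longrightarrow> w x \<noteq> 0 \<Longrightarrow> \<exists>i\<ge>1. \<epsilon> i = E"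
    for h Vc J \<epsilon> u u' Vc'
  proof -
    interpret P: poisson_states L h "scaled_well U x0 h" Vc J \<epsilon> u u' x0 M s f Vc' by (rule ps)
    define \<theta> where "\<theta> = Vc x0"
    have charge0: "P.charge \<le> Q" using charge by (simp add: P.charge_def)
    have \<theta>: "0 \<le> \<theta>" "\<theta> \<le> Q * L"
    proof -
      have x: "x0 \<in> {0..L}" using x0 by simp
      show "0 \<le> \<theta>" unfolding \<theta>_def by (rule P.V_nonneg[OF x])
      have "\<theta> \<le> P.charge * L" using P.V_bound[OF x] by (simp add: \<theta>_def)
      also have "\<dots> \<le> Q * L" using charge0 L by (intro mult_right_mono) auto
      finally show "\<theta> \<le> Q * L" .
    qed
    have small: "h * (1 + R) \<le> x0" "h * (1 + R) \<le> L - x0" "Q * (h * (1 + R)) \<le> \<rho>"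
    proof -
      have "h \<le> min x0 (L - x0) / (1 + R)" "h \<le> \<rho> / ((Q + 1) * (1 + R))" using h(2) by (auto simp: h1_def)
      then have "h * (1 + R) \<le> min x0 (L - x0)" "h * ((Q + 1) * (1 + R)) \<le> \<rho>"
        using R Q by (simp_all add: pos_le_divide_eq)
      moreover have "Q * (h * (1 + R)) \<le> h * ((Q + 1) * (1 + R))" using h R by (simp add: algebra_simps)
      ultimately show "h * (1 + R) \<le> x0" "h * (1 + R) \<le> L - x0" "Q * (h * (1 + R)) \<le> \<rho>" by auto
    qed
    define A B where "A = x0 / h" and "B = (L - x0) / h"
    have hR: "h < h * (1 + R)" using mult_strict_left_mono[of 1 "1 + R" h] h R by simp
    have AB: "1 \<le> A" "1 \<le> B"
    proof -
      have "h \<le> x0" "h \<le> L - x0" using hR small(1,2) by linarith+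
      then show "1 \<le> A" "1 \<le> B" using h by (simp_all add: A_def B_def pos_le_divide_eq)
    qed
    have hAB: "h * - A + x0 = 0" "h * B + x0 = L" using h by (simp_all add: A_def B_def)
    have Wc: "continuous_on {0..L} (\<lambda>x. scaled_well U x0 h x + Vc x)" by (rule P.W_cont)
    have matched_left: "matched \<eta> A B (E - \<theta>) (\<lambda>y. g (h * y + x0))"
      if "E \<le> - s" "- m \<le> E - \<theta>" "is_sol (\<lambda>x. (scaled_well U x0 h x + Vc x - E) / h\<^sup>2) 0 L g g'" "g 0 = 0" "g' 0 = 1 / h"
      for E g g'
      unfolding A_def B_def \<theta>_def
      by (rule match[OF rescaled_shooting[OF lw ps charge small R(1) that(1) that(2)[unfolded \<theta>_def] that(3-5)]])
    \<comment> \<open>the eigenfunctions, renormalized to unit slope at the left end in the rescaled variable\<close>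
    define g g' where "g i x = (1 / (h * u' i 0)) * u i x" and "g' i x = (1 / (h * u' i 0)) * u' i x" for i x
    have slope: "u' i 0 \<noteq> 0" if i: "i \<in> J" for i
    proof
      assume z: "u' i 0 = 0"
      have Qc: "continuous_on {0..L} (\<lambda>x. (scaled_well U x0 h x + Vc x - \<epsilon> i) / h\<^sup>2)"
        using h by (intro continuous_intros Wc) auto
      have "u i x = 0" if "x \<in> {0..L}" for x
        using sol_unique[OF P.states[OF i] is_sol_zero Qc _ _ that] P.ends[OF i] z by simp
      then have "integral {0..L} (\<lambda>x. u i x * u i x) = integral {0..L} (\<lambda>x. 0)"
        by (intro Henstock_Kurzweil_Integration.integral_cong) simp
      then show False using P.orthonormal[OF i i] by simp
    qed
    have g: "is_sol (\<lambda>x. (scaled_well U x0 h x + Vc x - \<epsilon> i) / h\<^sup>2) 0 L (g i) (g' i)"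
      "g i 0 = 0" "g' i 0 = 1 / h" "g i L = 0" if i: "i \<in> J" for i
    proof -
      show "is_sol (\<lambda>x. (scaled_well U x0 h x + Vc x - \<epsilon> i) / h\<^sup>2) 0 L (g i) (g' i)"
        unfolding g_def[abs_def] g'_def[abs_def] by (rule is_sol_scale[OF P.states[OF i]])
      show "g i 0 = 0" "g' i 0 = 1 / h" "g i L = 0" using P.ends[OF i] slope[OF i] by (simp_all add: g_def g'_def)
    qed
    have range: "\<epsilon> i \<le> - s" "- m \<le> \<epsilon> i - \<theta>" "\<epsilon> i - \<theta> < 0" "\<epsilon> i - \<theta> \<le> - s" if i: "i \<in> J" for i
      using P.\<epsilon>_le[OF i] P.\<epsilon>_ge[OF i] \<theta> m s by auto
    have gm: "matched \<eta> A B (\<epsilon> i - \<theta>) (\<lambda>y. g i (h * y + x0))" if i: "i \<in> J" for i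
      by (rule matched_left[OF range(1,2)[OF i] g(1,2,3)[OF i]])
    \<comment> \<open>the boundary condition at \<open>L\<close> makes the mismatch at an eigenvalue small\<close>
    have near: "\<exists>k\<in>{1..N}. \<bar>\<epsilon> i - \<theta> - e k\<bar> < d" if i: "i \<in> J" for i
    proof (rule ccontr)
      assume "\<not> ?thesis"
      then have "\<epsilon> i - \<theta> \<in> Z" using range[OF i] by (auto simp: Z_def not_less)
      then have "\<eta> < \<bar>mismatch (\<epsilon> i - \<theta>)\<bar>" using c1(2) \<eta>(3) by fastforce
      moreover have "\<bar>mismatch (\<epsilon> i - \<theta>)\<bar> \<le> \<eta>" using gm[OF i] g(4)[OF i] by (auto simp: matched_def hAB)
      ultimately show False by simp
    qed
    then obtain k where k: "\<And>i. i \<in> J \<Longrightarrow> k i \<in> {1..N}" "\<And>i. i \<in> J \<Longrightarrow> \<bar>\<epsilon> i - \<theta> - e (k i)\<bar> < d" by metis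
    \<comment> \<open>two eigenfunctions with energies near the same bound state would not be orthogonal\<close>
    have inj: "inj_on k J"
    proof (rule inj_onI, rule ccontr)
      fix i j assume ij: "i \<in> J" "j \<in> J" "k i = k j" "i \<noteq> j"
      have cont: "continuous_on {-A..B} (\<lambda>y. g i (h * y + x0))" if "i \<in> J" for i
      proof (rule continuous_on_compose2[OF is_sol_continuous(1)[OF g(1)[OF that]]])
        show "continuous_on {-A..B} (\<lambda>y. h * y + x0)" by (intro continuous_intros)
        show "(\<lambda>y. h * y + x0) ` {-A..B} \<subseteq> {0..L}"
        proof (rule image_subsetI)
          fix y assume "y \<in> {-A..B}"
          then have "h * - A \<le> h * y" "h * y \<le> h * B"
            using mult_left_mono[of "- A" y h] mult_left_mono[of y B h] h by simp_all
          then show "h * y + x0 \<in> {0..L}" using hAB by auto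
        qed
      qed
      have pp: "profiles_positive (e (k i)) d" by (rule profiles_positive_mono[OF d1(2)[OF k(1)[OF ij(1)]] d(1)]) (use d in auto)
      have z: "g i (h * B + x0) = 0" if "i \<in> J" for i using g(4)[OF that] hAB by simp
      have kj: "\<bar>\<epsilon> j - \<theta> - e (k i)\<bar> < d" using k(2)[OF ij(2)] ij(3) by simp
      have pos: "0 < integral {-A..B} (\<lambda>y. g i (h * y + x0) * g j (h * y + x0))"
        by (rule matched_product_positive[OF lw pp \<eta>(2) AB gm[OF ij(1)] cont[OF ij(1)] z[OF ij(1)] range(3)[OF ij(1)] k(2)[OF ij(1)]
              gm[OF ij(2)] cont[OF ij(2)] z[OF ij(2)] range(3)[OF ij(2)] kj])
      have "((\<lambda>x. g i x * g j x) has_integral 0) (cbox 0 L)"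
      proof -
        have c: "continuous_on {0..L} (\<lambda>x. g i x * g j x)"
          by (intro continuous_intros is_sol_continuous(1)[OF g(1)] ij)
        have "integral {0..L} (\<lambda>x. g i x * g j x) = integral {0..L} (\<lambda>x. (1 / (h * u' i 0)) * (1 / (h * u' j 0)) * (u i x * u j x))"
          by (simp add: g_def mult_ac)
        also have "\<dots> = (1 / (h * u' i 0)) * (1 / (h * u' j 0)) * integral {0..L} (\<lambda>x. u i x * u j x)"
          by (rule integral_mult_right)
        also have "\<dots> = 0" using P.orthonormal[OF ij(1,2)] ij(4) by simp
        finally show ?thesis using integrable_continuous_real[OF c] by (simp add: has_integral_iff)
      qed
      from has_integral_affinity'[OF this h(1), of x0]
      have "((\<lambda>y. g i (h * y + x0) * g j (h * y + x0)) has_integral 0) {-A..B}" by (simp add: A_def B_def divide_inverse mult.commute)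
      then show False using pos by (simp add: integral_unique)
    qed
    have close: "\<bar>f (\<epsilon> i) - f (e (k i) + \<theta>)\<bar> \<le> \<tau>'" if i: "i \<in> J" for i
    proof (rule less_imp_le, rule d4(2))
      show "e (k i) + \<theta> \<in> {- m..Q * L + 1}" using em[OF k(1)[OF i]] e_neg[OF k(1)[OF i]] \<theta> by auto
      show "\<epsilon> i \<in> {- m..Q * L + 1}" using range[OF i] \<theta> s QL by auto
      show "\<bar>\<epsilon> i - (e (k i) + \<theta>)\<bar> < d4" using k(2)[OF i] d(5) by auto
    qed
    \<comment> \<open>a bound state without an eigenvalue: either \<open>f\<close> is small there, or a sign change yields an
      eigenvalue after all\<close>
    have rest: "\<bar>f (e l + \<theta>)\<bar> \<le> \<tau>'" if l: "l \<in> {1..N} - k ` J" for l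
    proof (cases "e l + d + \<theta> < - s")
      case False
      then have "f (e l + d + \<theta>) = 0" by (intro f0) simp
      moreover have "\<bar>f (e l + d + \<theta>) - f (e l + \<theta>)\<bar> < \<tau>'"
        using em[of l] e_neg[of l] d3(2)[of l] l \<theta> d by (intro d4(2)) auto
      ultimately show ?thesis by simp
    next
      case True
      have l1: "l \<in> {1..N}" using l by simp
      define E1 E2 where "E1 = e l - d + \<theta>" and "E2 = e l + d + \<theta>"
      have E: "E1 \<le> E2" "E2 < - s" "- m \<le> E1 - \<theta>" using d True em[OF l1] by (auto simp: E1_def E2_def)
      have Qc: "continuous_on {0..L} (\<lambda>x. (scaled_well U x0 h x + Vc x - F) / h\<^sup>2)" for F
        using h by (intro continuous_intros Wc) auto
      have ode: "\<exists>w w'. w 0 = 0 \<and> w' 0 = 1 / h \<and> is_sol (\<lambda>x. (scaled_well U x0 h x + Vc x - F) / h\<^sup>2) 0 L w w'" for F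
        using L by (intro linear_ode_exists Qc) simp
      have "\<exists>W. \<forall>F. fst (W F) 0 = 0 \<and> snd (W F) 0 = 1 / h \<and>
          is_sol (\<lambda>x. (scaled_well U x0 h x + Vc x - F) / h\<^sup>2) 0 L (fst (W F)) (snd (W F))"
      proof (intro choice allI)
        fix F
        obtain w w' where "w 0 = 0" "w' 0 = 1 / h" "is_sol (\<lambda>x. (scaled_well U x0 h x + Vc x - F) / h\<^sup>2) 0 L w w'"
          using ode[of F] by blast
        then show "\<exists>p. fst p 0 = 0 \<and> snd p 0 = 1 / h \<and> is_sol (\<lambda>x. (scaled_well U x0 h x + Vc x - F) / h\<^sup>2) 0 L (fst p) (snd p)"
          by (intro exI[of _ "(w, w')"]) simp
      qed
      then obtain W where W: "\<forall>F. fst (W F) 0 = 0 \<and> snd (W F) 0 = 1 / h \<and>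
          is_sol (\<lambda>x. (scaled_well U x0 h x + Vc x - F) / h\<^sup>2) 0 L (fst (W F)) (snd (W F))" ..
      define G where "G F = fst (W F)" for F
      have G: "is_sol (\<lambda>x. (scaled_well U x0 h x + Vc x - F) / h\<^sup>2) 0 L (G F) (snd (W F))" "G F 0 = 0" "snd (W F) 0 = 1 / h" for F
        using W by (simp_all add: G_def)
      have Gc: "continuous_on {E1..E2} (\<lambda>F. G F L)"
        by (rule solution_continuous_in_energy[OF _ Wc G(1) G(2) G(3)]) (use L h in auto)
      have Gm: "matched \<eta> A B (F - \<theta>) (\<lambda>y. G F (h * y + x0))" if "F \<in> {E1..E2}" for F
        by (rule matched_left[OF _ _ G]) (use that E in auto)
      have sgn: "0 < mismatch (F - \<theta>) * G F L" if F: "F \<in> {E1..E2}" "\<eta> < \<bar>mismatch (F - \<theta>)\<bar>" for F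
      proof -
        obtain c where c: "c > 0" "\<bar>c * G F L - mismatch (F - \<theta>)\<bar> \<le> \<eta>"
          using Gm[OF F(1)] unfolding matched_def hAB by blast
        have "0 < mismatch (F - \<theta>) * (c * G F L)"
        proof (cases "0 < mismatch (F - \<theta>)")
          case True
          then have "0 < c * G F L" using c(2) F(2) by linarith
          with True show ?thesis by (rule mult_pos_pos)
        next
          case False
          then have "mismatch (F - \<theta>) < 0" "c * G F L < 0" using c(2) F(2) \<eta>(1) by linarith+
          then show ?thesis by (rule mult_neg_neg)
        qed
        moreover have "mismatch (F - \<theta>) * (c * G F L) = c * (mismatch (F - \<theta>) * G F L)"
          by (rule mult.left_commute)
        ultimately have "0 < c * (mismatch (F - \<theta>) * G F L)" by argo
        then show ?thesis by (rule zero_less_mult_pos[OF _ c(1)])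
      qed
      have e1: "E1 - \<theta> = e l - d" "E2 - \<theta> = e l + d" by (simp_all add: E1_def E2_def)
      have s1: "0 < mismatch (e l - d) * G E1 L" "0 < mismatch (e l + d) * G E2 L"
        using sgn[of E1] sgn[of E2] c2(2)[OF l1] \<eta>(4) E unfolding e1 by auto
      have opp: "G E1 L * G E2 L < 0"
        using signs[OF l1] s1 by (auto simp: zero_less_mult_iff mult_less_0_iff)
      have "\<exists>F\<in>{E1..E2}. G F L = 0"
      proof (cases "G E1 L < 0")
        case True
        then have "G E1 L \<le> 0" "0 \<le> G E2 L" using opp by (auto simp: mult_less_0_iff)
        then show ?thesis using IVT'[of "\<lambda>F. G F L" E1 0 E2] Gc E(1) by auto
      next
        case False
        then have "G E2 L \<le> 0" "0 \<le> G E1 L" using opp by (auto simp: mult_less_0_iff)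
        then show ?thesis using IVT2'[of "\<lambda>F. G F L" E2 0 E1] Gc E(1) by auto
      qed
      then obtain F where F: "F \<in> {E1..E2}" "G F L = 0" by blast
      have "0 < G F (h * -1 + x0)" using Gm[OF F(1)] by (simp add: matched_def)
      moreover have "h * -1 + x0 \<in> {0<..<L}"
      proof -
        have "h < x0" using hR small(1) by linarith
        then show ?thesis using x0 h by auto
      qed
      ultimately obtain i where i: "1 \<le> i" "\<epsilon> i = F"
        using complete[OF G(1) G(2) F(2), of "h * -1 + x0"] by auto
      then have iJ: "i \<in> J" using F(1) E by (auto simp: Jdef)
      have "\<bar>\<epsilon> i - \<theta> - e l\<bar> \<le> d" using F(1) i(2) by (auto simp: E1_def E2_def)
      then have "\<bar>e (k i) - e l\<bar> < 2 * d" using k(2)[OF iJ] by linarith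
      then have "k i = l" using d2(2)[OF k(1)[OF iJ] l1] d(3) by fastforce
      then show ?thesis using l iJ by auto
    qed
    have kJ: "k ` J \<subseteq> {1..N}" using k(1) by auto
    have "(\<Sum>l=1..N. f (e l + \<theta>)) = (\<Sum>l\<in>k ` J. f (e l + \<theta>)) + (\<Sum>l\<in>{1..N} - k ` J. f (e l + \<theta>))"
      using sum.subset_diff[OF kJ] by (simp add: add.commute)
    moreover have "(\<Sum>l\<in>k ` J. f (e l + \<theta>)) = (\<Sum>i\<in>J. f (e (k i) + \<theta>))"
      using sum.reindex[OF inj] by simp
    ultimately have "(\<Sum>i\<in>J. f (\<epsilon> i)) - (\<Sum>l=1..N. f (e l + \<theta>)) =
        (\<Sum>i\<in>J. f (\<epsilon> i) - f (e (k i) + \<theta>)) - (\<Sum>l\<in>{1..N} - k ` J. f (e l + \<theta>))"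
      by (simp add: sum_subtractf)
    also have "\<bar>\<dots>\<bar> \<le> (\<Sum>i\<in>J. \<tau>') + (\<Sum>l\<in>{1..N} - k ` J. \<tau>')"
    proof -
      have "\<bar>\<Sum>i\<in>J. f (\<epsilon> i) - f (e (k i) + \<theta>)\<bar> \<le> (\<Sum>i\<in>J. \<tau>')"
        by (rule order_trans[OF sum_abs]) (intro sum_mono close)
      moreover have "\<bar>\<Sum>l\<in>{1..N} - k ` J. f (e l + \<theta>)\<bar> \<le> (\<Sum>l\<in>{1..N} - k ` J. \<tau>')"
        by (rule order_trans[OF sum_abs]) (intro sum_mono rest)
      ultimately show ?thesis by linarith
    qed
    also have "\<dots> = (real (card J) + real (card ({1..N} - k ` J))) * \<tau>'" by (simp add: algebra_simps)
    also have "real (card J) + real (card ({1..N} - k ` J)) = real N"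
    proof -
      have "card (k ` J) + card ({1..N} - k ` J) = card {1..N}"
        using card_Diff_subset[OF finite_subset[OF kJ] kJ] card_mono[OF _ kJ] by simp
      then show ?thesis using card_image[OF inj] by simp
    qed
    finally show ?thesis using \<tau>'(2) by (simp add: \<theta>_def)
  qed
  show ?thesis
    by (rule exI[of _ h1], rule conjI[OF h1], intro allI impI, elim conjE, rule main) blast+
qed

section \<open>Norm estimates and weak* convergence\<close>

lemma Linf_norm_le:
  assumes "open \<Omega>" "continuous_on \<Omega> v" "\<And>x. x \<in> \<Omega> \<Longrightarrow> \<bar>v x\<bar> \<le> c"
  shows "Linf_norm \<Omega> v \<le> ennreal c"
  unfolding Linf_norm_def
proof (rule esssup_I)
  have "v \<in> borel_measurable (lebesgue_on \<Omega>)"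
    using assms by (intro continuous_imp_measurable_on_sets_lebesgue) auto
  then show "(\<lambda>x. ennreal \<bar>v x\<bar>) \<in> borel_measurable (lebesgue_on \<Omega>)" by simp
  show "AE x in lebesgue_on \<Omega>. ennreal \<bar>v x\<bar> \<le> ennreal c"
    using assms(1,3) by (intro AE_I2) (auto intro: ennreal_leI)
qed

text \<open>A function that is both small and Lipschitz is small in every Hoelder norm, by
  interpolation: \<open>t = t powr (1 - \<alpha>) * t powr \<alpha>\<close>, where the first factor is estimated by the
  supremum of the function and the second one by its Lipschitz constant.\<close>

lemma holder_norm_le_interpolation:
  assumes \<alpha>: "0 < \<alpha>" "\<alpha> < 1" and a: "0 \<le> a" and \<Lambda>: "0 \<le> \<Lambda>"
    and sup: "\<And>x. x \<in> \<Omega> \<Longrightarrow> \<bar>D x\<bar> \<le> a"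
    and lip: "\<And>x y. x \<in> \<Omega> \<Longrightarrow> y \<in> \<Omega> \<Longrightarrow> \<bar>D x - D y\<bar> \<le> \<Lambda> * \<bar>x - y\<bar>"
  shows "holder_norm \<alpha> \<Omega> D \<le> ennreal (a + (2 * a) powr (1 - \<alpha>) * \<Lambda> powr \<alpha>)"
proof -
  have "\<bar>D x - D y\<bar> / \<bar>x - y\<bar> powr \<alpha> \<le> (2 * a) powr (1 - \<alpha>) * \<Lambda> powr \<alpha>"
    if xy: "x \<in> \<Omega>" "y \<in> \<Omega>" "x \<noteq> y" for x y
  proof -
    have r: "0 < \<bar>x - y\<bar>" using xy by simp
    have "\<bar>D x - D y\<bar> = \<bar>D x - D y\<bar> powr (1 - \<alpha>) * \<bar>D x - D y\<bar> powr \<alpha>"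
      by (simp add: powr_add[symmetric])
    also have "\<dots> \<le> (2 * a) powr (1 - \<alpha>) * (\<Lambda> * \<bar>x - y\<bar>) powr \<alpha>"
    proof (intro mult_mono powr_mono2)
      show "\<bar>D x - D y\<bar> \<le> 2 * a" using sup[OF xy(1)] sup[OF xy(2)] by linarith
    qed (use \<alpha> lip[OF xy(1,2)] in auto)
    also have "\<dots> = (2 * a) powr (1 - \<alpha>) * \<Lambda> powr \<alpha> * \<bar>x - y\<bar> powr \<alpha>"
      using \<Lambda> by (simp add: powr_mult)
    finally show ?thesis using r by (simp add: pos_divide_le_eq)
  qed
  then have "(SUP (x, y)\<in>{(x, y). x \<in> \<Omega> \<and> y \<in> \<Omega> \<and> x \<noteq> y}. ennreal (\<bar>D x - D y\<bar> / \<bar>x - y\<bar> powr \<alpha>))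
      \<le> ennreal ((2 * a) powr (1 - \<alpha>) * \<Lambda> powr \<alpha>)"
    by (intro SUP_least) (auto intro!: ennreal_leI)
  moreover have "(SUP x\<in>\<Omega>. ennreal \<bar>D x\<bar>) \<le> ennreal a"
    using sup by (intro SUP_least) (auto intro!: ennreal_leI)
  ultimately have "holder_norm \<alpha> \<Omega> D \<le> ennreal a + ennreal ((2 * a) powr (1 - \<alpha>) * \<Lambda> powr \<alpha>)"
    unfolding holder_norm_def by (intro add_mono)
  also have "\<dots> = ennreal (a + (2 * a) powr (1 - \<alpha>) * \<Lambda> powr \<alpha>)"
    using a by (intro ennreal_plus[symmetric]) auto
  finally show ?thesis .
qed

lemma limit_potential_eq: "limit_potential L x0 S x = S * limit_potential L x0 1 x"
  by (simp add: limit_potential_def)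

lemma limit_potential_bounds:
  assumes "0 < x0" "x0 < L" "x \<in> {0..L}"
  shows "0 \<le> limit_potential L x0 1 x" "limit_potential L x0 1 x \<le> L"
proof -
  have a: "0 < x0 / L" "x0 / L < 1" using assms by simp_all
  show "0 \<le> limit_potential L x0 1 x"
    unfolding limit_potential_def using a assms by (auto intro!: mult_nonneg_nonneg divide_nonneg_nonneg)
  have "(1 - x0 / L) * x \<le> 1 * x" "x0 / L * (L - x) \<le> 1 * (L - x)"
    using a assms by (intro mult_right_mono; simp)+
  then show "limit_potential L x0 1 x \<le> L" using assms by (auto simp: limit_potential_def)
qed

text \<open>The two linear pieces have slopes of absolute value at most one and meet at \<open>x0\<close>.\<close>

lemma limit_potential_lipschitz:
  assumes "0 < x0" "x0 < L"
  shows "\<bar>limit_potential L x0 1 x - limit_potential L x0 1 y\<bar> \<le> \<bar>x - y\<bar>"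
proof -
  define a where "a = x0 / L"
  have a: "0 < a" "a < 1" "x0 = a * L" using assms by (simp_all add: a_def)
  have lp: "limit_potential L x0 1 z = (if z \<le> x0 then (1 - a) * z else a * (L - z))" for z
    by (simp add: limit_potential_def a_def)
  have ordered: "\<bar>limit_potential L x0 1 x - limit_potential L x0 1 y\<bar> \<le> y - x" if "x \<le> y" for x y
  proof -
    have b: "0 \<le> a * (y - x)" "a * (y - x) \<le> 1 * (y - x)" "0 \<le> (1 - a) * (y - x)" "(1 - a) * (y - x) \<le> 1 * (y - x)"
      using a that mult_right_mono[of a 1 "y - x"] mult_right_mono[of "1 - a" 1 "y - x"] by auto
    consider "y \<le> x0" | "x \<le> x0" "x0 < y" | "x0 < x" by linarith
    then show ?thesis
    proof cases
      case 1
      then have "limit_potential L x0 1 x - limit_potential L x0 1 y = - ((1 - a) * (y - x))"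
        using that by (simp add: lp algebra_simps)
      then show ?thesis using b by simp
    next
      case 2
      then have "limit_potential L x0 1 x = (1 - a) * x" "limit_potential L x0 1 y = a * (L - y)"
        using lp[of x] lp[of y] by simp_all
      moreover have "a * (L - y) = x0 - a * y" using a(3) by (simp add: right_diff_distrib)
      ultimately have eq: "limit_potential L x0 1 x - limit_potential L x0 1 y = (x - x0) + a * (y - x)"
        by (simp add: algebra_simps)
      have "\<bar>(x - x0) + P\<bar> \<le> y - x" if "0 \<le> P" "P \<le> y - x" for P using that 2 by linarith
      then show ?thesis using b unfolding eq by simp
    next
      case 3
      then have "limit_potential L x0 1 x - limit_potential L x0 1 y = a * (y - x)"
        using that by (simp add: lp algebra_simps)
      then show ?thesis using b by simp
    qed
  qed
  show ?thesis using ordered[of x y] ordered[of y x] by (cases "x \<le> y") auto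
qed

text \<open>A modulus of continuity that can be integrated against a density of small second moment.\<close>

lemma quadratic_modulus:
  fixes \<phi> :: "real \<Rightarrow> real"
  assumes \<phi>: "continuous_on {a..b} \<phi>" and x0: "x0 \<in> {a..b}" and \<eta>: "0 < \<eta>"
  obtains K where "0 \<le> K" "\<And>y. y \<in> {a..b} \<Longrightarrow> \<bar>\<phi> y - \<phi> x0\<bar> \<le> \<eta> + K * (y - x0)\<^sup>2"
proof -
  obtain B where B: "0 \<le> B" "\<And>x. x \<in> {a..b} \<Longrightarrow> \<bar>\<phi> x\<bar> \<le> B"
    using continuous_on_interval_bounded[OF \<phi>] by blast
  obtain d where d: "0 < d" "\<And>y. y \<in> {a..b} \<Longrightarrow> dist y x0 < d \<Longrightarrow> dist (\<phi> y) (\<phi> x0) < \<eta>"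
    using \<phi> x0 \<eta> unfolding continuous_on_iff by metis
  show thesis
  proof (rule that[of "2 * B / d\<^sup>2"])
    show "0 \<le> 2 * B / d\<^sup>2" using B by simp
    fix y assume y: "y \<in> {a..b}"
    show "\<bar>\<phi> y - \<phi> x0\<bar> \<le> \<eta> + 2 * B / d\<^sup>2 * (y - x0)\<^sup>2"
    proof (cases "\<bar>y - x0\<bar> < d")
      case True
      then have "\<bar>\<phi> y - \<phi> x0\<bar> < \<eta>" using d(2)[OF y] by (simp add: dist_real_def)
      moreover have "0 \<le> 2 * B / d\<^sup>2 * (y - x0)\<^sup>2" using B by simp
      ultimately show ?thesis by linarith
    next
      case False
      then have "d\<^sup>2 \<le> (y - x0)\<^sup>2" using d(1) by (metis abs_le_square_iff abs_of_pos not_le)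
      then have "2 * B * 1 \<le> 2 * B * ((y - x0)\<^sup>2 / d\<^sup>2)" using B d(1) by (intro mult_left_mono) auto
      moreover have "\<bar>\<phi> y - \<phi> x0\<bar> \<le> 2 * B" using B(2)[OF y] B(2)[OF x0] by linarith
      ultimately show ?thesis using \<eta> by simp
    qed
  qed
qed

text \<open>A scaled point mass is a point mass with constant density, for which integrals are known.\<close>

lemma scaled_dirac_mass:
  assumes x0: "x0 \<in> {0<..<L}" and S: "0 \<le> S"
  shows "finite_measure (scale_measure (ennreal S) (dirac_mass L x0))"
    and "continuous_on {0..L} \<phi> \<Longrightarrow> (LINT x|scale_measure (ennreal S) (dirac_mass L x0). \<phi> x) = S * \<phi> x0"
proof -
  let ?M = "lebesgue_on {0<..<L}"
  have sp: "x0 \<in> space ?M" using x0 by simp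
  have eq: "scale_measure (ennreal S) (dirac_mass L x0) = density (return ?M x0) (\<lambda>_. ennreal S)"
    by (rule measure_eqI) (simp_all add: dirac_mass_def emeasure_density_const)
  have "emeasure (dirac_mass L x0) (space ?M) = 1"
    using sp by (simp add: dirac_mass_def)
  then have "emeasure (scale_measure (ennreal S) (dirac_mass L x0)) (space ?M) = ennreal S" by simp
  then show "finite_measure (scale_measure (ennreal S) (dirac_mass L x0))"
    by (intro finite_measureI) (simp add: dirac_mass_def space_scale_measure)
  assume \<phi>: "continuous_on {0..L} \<phi>"
  have "{0<..<L} \<subseteq> {0..L}" by auto
  then have \<phi>m: "\<phi> \<in> borel_measurable ?M"
    by (intro continuous_imp_measurable_on_sets_lebesgue continuous_on_subset[OF \<phi>]) auto
  have "(LINT x|density (return ?M x0) (\<lambda>_. ennreal S). \<phi> x) = (LINT x|return ?M x0. S *\<^sub>R \<phi> x)"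
    using \<phi>m S by (intro integral_density) auto
  also have "\<dots> = S *\<^sub>R \<phi> x0" using \<phi>m sp by (intro integral_return) auto
  finally show "(LINT x|scale_measure (ennreal S) (dirac_mass L x0). \<phi> x) = S * \<phi> x0"
    by (simp add: eq)
qed

context poisson_states
begin

lemma W1inf_norm_le:
  assumes v: "\<And>x. x \<in> {0<..<L} \<Longrightarrow> v x = V x"
  shows "W1inf_norm {0<..<L} v \<le> ennreal (charge * L + charge)"
proof -
  let ?\<Omega> = "{0<..<L}"
  have V'c: "continuous_on {0..L} V'"
    using dV' by (meson DERIV_continuous continuous_on_eq_continuous_within)
  have Vc: "continuous_on {0..L} V"
    using dV by (meson DERIV_continuous continuous_on_eq_continuous_within)
  have sub: "?\<Omega> \<subseteq> {0..L}" by auto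
  have dv: "(v has_real_derivative V' x) (at x)" if x: "x \<in> ?\<Omega>" for x
  proof (rule has_field_derivative_transform_within_open[OF _ open_greaterThanLessThan x])
    show "(V has_real_derivative V' x) (at x)"
      using dV[of x] x by (simp add: at_within_Icc_at)
  qed (simp add: v)
  have "has_weak_deriv ?\<Omega> v V'"
    using L by (intro C1_imp_has_weak_deriv dv continuous_on_subset[OF V'c sub]) auto
  then have "W1inf_norm ?\<Omega> v \<le> Linf_norm ?\<Omega> v + Linf_norm ?\<Omega> V'"
    unfolding W1inf_norm_def by (intro INF_lower) simp
  also have "\<dots> \<le> ennreal (charge * L) + ennreal charge"
  proof (intro add_mono Linf_norm_le)
    show "continuous_on ?\<Omega> v"
      using continuous_on_subset[OF Vc sub] continuous_on_cong[OF refl, of ?\<Omega> v V] v by simp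
    show "continuous_on ?\<Omega> V'" by (rule continuous_on_subset[OF V'c sub])
    show "\<bar>v x\<bar> \<le> charge * L" if "x \<in> ?\<Omega>" for x using V_bound[of x] v[OF that] that by simp
    show "\<bar>V' x\<bar> \<le> charge" if "x \<in> ?\<Omega>" for x using V'_bound[of x] that by simp
  qed auto
  also have "\<dots> = ennreal (charge * L + charge)"
    using charge_nonneg L by (intro ennreal_plus[symmetric]) auto
  finally show ?thesis .
qed

lemma density_measure_states:
  assumes \<rho>: "\<rho> \<in> borel_measurable (lebesgue_on {0<..<L})" "AE x in lebesgue_on {0<..<L}. \<rho> x = n x"
  shows "finite_measure (density_measure L \<rho>)"
    and "continuous_on {0..L} \<phi> \<Longrightarrow> (LINT x|density_measure L \<rho>. \<phi> x) = integral {0..L} (\<lambda>x. \<phi> x * n x)"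
proof -
  let ?M = "lebesgue_on {0<..<L}"
  have \<rho>0: "AE x in ?M. 0 \<le> \<rho> x" using \<rho>(2) by (rule AE_mp) (auto simp: n_nonneg)
  have sub: "{0<..<L} \<subseteq> {0..L}" by auto
  have nm: "n \<in> borel_measurable ?M"
    by (intro continuous_imp_measurable_on_sets_lebesgue continuous_on_subset[OF n_cont sub]) auto
  have "integrable ?M n" by (rule integrable_Ioo_continuous[OF n_cont])
  then have fin: "(\<integral>\<^sup>+x. ennreal (n x) \<partial>?M) \<noteq> \<infinity>"
    using n_nonneg by (simp add: integrable_iff_bounded less_top)
  have "emeasure (density ?M (\<lambda>x. ennreal (\<rho> x))) (space ?M) = (\<integral>\<^sup>+x. ennreal (\<rho> x) \<partial>?M)"
    using \<rho>(1) by (subst emeasure_density) (auto intro!: nn_integral_cong)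
  also have "\<dots> = (\<integral>\<^sup>+x. ennreal (n x) \<partial>?M)"
    by (rule nn_integral_cong_AE) (rule AE_mp[OF \<rho>(2)], auto)
  finally show "finite_measure (density_measure L \<rho>)"
    using fin by (intro finite_measureI) (simp add: density_measure_def)
  assume \<phi>: "continuous_on {0..L} \<phi>"
  have \<phi>m: "\<phi> \<in> borel_measurable ?M"
    by (intro continuous_imp_measurable_on_sets_lebesgue continuous_on_subset[OF \<phi> sub]) auto
  have "(LINT x|density_measure L \<rho>. \<phi> x) = (LINT x|?M. \<rho> x *\<^sub>R \<phi> x)"
    unfolding density_measure_def by (rule integral_density[OF \<phi>m \<rho>(1) \<rho>0])
  also have "\<dots> = (LINT x|?M. \<phi> x * n x)"
    by (rule integral_cong_AE) (use \<rho>(1) \<phi>m nm in simp, use \<phi>m nm in simp, rule AE_mp[OF \<rho>(2)], auto)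
  also have "\<dots> = integral {0..L} (\<lambda>x. \<phi> x * n x)"
    by (intro LINT_Ioo_continuous continuous_intros \<phi> n_cont)
  finally show "(LINT x|density_measure L \<rho>. \<phi> x) = integral {0..L} (\<lambda>x. \<phi> x * n x)" .
qed

lemma density_concentrates:
  assumes \<phi>: "continuous_on {0..L} \<phi>" and K: "0 \<le> K"
    and mod: "\<And>y. y \<in> {0..L} \<Longrightarrow> \<bar>\<phi> y - \<phi> x0\<bar> \<le> \<eta> + K * (y - x0)\<^sup>2"
  shows "\<bar>integral {0..L} (\<lambda>x. \<phi> x * n x) - charge * \<phi> x0\<bar> \<le> \<eta> * charge + K * (h\<^sup>2 * ((1 + M) / s) * charge)"
proof -
  have "integral {0..L} (\<lambda>x. \<phi> x * n x) - \<phi> x0 * integral {0..L} n = integral {0..L} (\<lambda>x. (\<phi> x - \<phi> x0) * n x)"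
    by (subst Henstock_Kurzweil_Integration.integral_mult_right[symmetric],
        subst Henstock_Kurzweil_Integration.integral_diff[symmetric])
      (auto intro!: integrable_continuous_real continuous_intros \<phi> n_cont simp: algebra_simps)
  then have eq: "integral {0..L} (\<lambda>x. \<phi> x * n x) - charge * \<phi> x0 = integral {0..L} (\<lambda>x. (\<phi> x - \<phi> x0) * n x)"
    by (simp add: integral_n mult.commute)
  have "norm (integral {0..L} (\<lambda>x. (\<phi> x - \<phi> x0) * n x)) \<le> integral {0..L} (\<lambda>x. (\<eta> + K * (x - x0)\<^sup>2) * n x)"
  proof (rule Henstock_Kurzweil_Integration.integral_norm_bound_integral)
    fix x assume "x \<in> {0..L}"
    then show "norm ((\<phi> x - \<phi> x0) * n x) \<le> (\<eta> + K * (x - x0)\<^sup>2) * n x"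
      using mod n_nonneg[of x] by (simp add: abs_mult mult_right_mono)
  qed (intro integrable_continuous_real continuous_intros \<phi> n_cont)+
  also have "\<dots> = integral {0..L} (\<lambda>x. \<eta> * n x + K * ((x - x0)\<^sup>2 * n x))"
    by (simp add: algebra_simps)
  also have "\<dots> = \<eta> * charge + K * integral {0..L} (\<lambda>x. (x - x0)\<^sup>2 * n x)"
    by (subst Henstock_Kurzweil_Integration.integral_add)
      (auto intro!: integrable_continuous_real continuous_intros n_cont simp: integral_n)
  also have "\<dots> \<le> \<eta> * charge + K * (h\<^sup>2 * ((1 + M) / s) * charge)"
    by (intro add_left_mono mult_left_mono second_moment K)
  finally show ?thesis by (simp add: eq)
qed

end

section \<open>The limit\<close>

text \<open>Because \<open>F\<close> is non-increasing, \<open>t - c * F t\<close> grows at least as fast as \<open>t\<close>. So the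
  equation has a unique solution, and an approximate solution is close to it.\<close>

lemma decreasing_fixed_point:
  fixes F :: "real \<Rightarrow> real" and c b :: real
  assumes c: "0 < c" and b: "0 < b" and cont: "continuous_on {0..b} F"
    and anti: "\<And>x y. x \<le> y \<Longrightarrow> F y \<le> F x" and F0: "0 < F 0" "F b = 0"
  shows "\<exists>\<theta>. 0 < \<theta> \<and> \<theta> < b \<and> \<theta> = c * F \<theta> \<and> (\<forall>t. \<bar>t - \<theta>\<bar> \<le> \<bar>t - c * F t\<bar>)"
proof -
  have "\<exists>t\<ge>0. t \<le> b \<and> t - c * F t = 0"
    by (rule IVT') (use c b F0 in \<open>auto intro!: continuous_intros cont\<close>)
  then obtain \<theta> where \<theta>: "0 \<le> \<theta>" "\<theta> \<le> b" "\<theta> = c * F \<theta>" by auto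
  have mono: "y - x \<le> (y - c * F y) - (x - c * F x)" if "x \<le> y" for x y
    using anti[OF that] c by (simp add: mult_left_mono)
  have "\<bar>t - \<theta>\<bar> \<le> \<bar>t - c * F t\<bar>" for t
    using mono[of t \<theta>] mono[of \<theta> t] \<theta>(3) by (cases "t \<le> \<theta>") linarith+
  moreover have "\<theta> \<noteq> 0" "\<theta> \<noteq> b" using \<theta>(3) F0 b c by auto
  ultimately show ?thesis using \<theta> by (intro exI[of _ \<theta>]) auto
qed

theorem theorem1p1:
  fixes L x0 h0 \<epsilon>S :: real
    and U f :: "real \<Rightarrow> real"
    and N :: nat
    and e :: "nat \<Rightarrow> real"
    and V :: "real \<Rightarrow> real \<Rightarrow> real"
    and \<epsilon> :: "real \<Rightarrow> nat \<Rightarrow> real"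
    and \<Psi> :: "real \<Rightarrow> nat \<Rightarrow> real \<Rightarrow> real"
  assumes "L > 0" and "x0 \<in> {0<..<L}"
    and "test_function UNIV U" and "\<And>x. U x \<le> 0" and "closure {x. U x \<noteq> 0} \<subseteq> cball 0 1"
    and "h0 > 0"
    and "\<And>h. h \<in> {0<..h0} \<Longrightarrow> closure {x. scaled_well U x0 h x \<noteq> 0} \<subseteq> {0<..<L}"
    and "\<epsilon>S < 0"
    and "smooth f" and "\<And>x. x < \<epsilon>S \<Longrightarrow> f x > 0" and "\<And>x. x \<ge> \<epsilon>S \<Longrightarrow> f x = 0"
    and "\<And>x. deriv f x \<le> 0"
    and "strict_mono_on {1..N} e" and "\<And>i. i \<in> {1..N} \<Longrightarrow> e i < 0"
    and "e ` {1..N} = {E. E < 0 \<and> (\<exists>\<psi>. eigenfunction UNIV (H0 U) E \<psi>)}"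
    and "spectrum_on UNIV (H0 U) = complex_of_real ` (e ` {1..N} \<union> {0..})"
    and "\<And>i. i \<ge> N + 1 \<Longrightarrow> e i = 0"
    and "e 1 < \<epsilon>S"
    and "\<And>h. h \<in> {0<..h0} \<Longrightarrow> schroedinger_poisson L x0 U f h (V h) (\<epsilon> h) (\<Psi> h)"
  shows "(\<exists>C::real. \<forall>h\<in>{0<..h0}. W1inf_norm {0<..<L} (V h) \<le> ennreal C) \<and>
    (\<exists>\<theta>. \<theta> \<in> {0<..<\<epsilon>S - e 1} \<and>
       (\<forall>t\<ge>0. t = x0 * (1 - x0 / L) * (\<Sum>\<^sub>\<infinity>i\<in>{1..}. f (e i + t)) \<longleftrightarrow> t = \<theta>) \<and>
       (\<forall>\<alpha>\<in>{0<..<1}.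
          ((\<lambda>h. holder_norm \<alpha> {0<..<L}
                  (\<lambda>x. V h x - limit_potential L x0 (\<Sum>\<^sub>\<infinity>i\<in>{1..}. f (e i + \<theta>)) x))
             \<longlongrightarrow> 0) (at_right 0)) \<and>
       tendsto_weak_star L (\<lambda>h. density_measure L (charge_density f (\<epsilon> h) (\<Psi> h)))
         (scale_measure (ennreal (\<Sum>\<^sub>\<infinity>i\<in>{1..}. f (e i + \<theta>))) (dirac_mass L x0))
         (at_right 0))"
proof -
  let ?\<Omega> = "{0<..<L}"
  define s where "s = - \<epsilon>S"
  have s: "0 < s" using \<open>\<epsilon>S < 0\<close> by (simp add: s_def)
  have L: "0 < L" and x0: "0 < x0" "x0 < L" "x0 \<in> {0..L}" using assms(2) by auto
  have U_smooth: "smooth U" using assms(3) by (rule test_function_smooth)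
  have U_cont: "continuous_on S U" for S by (rule smooth_continuous_on[OF U_smooth])
  \<comment> \<open>the set where \<open>U\<close> does not vanish is open, so it avoids the end points of \<open>[-1, 1]\<close>\<close>
  have U_supp: "U x = 0" if x: "1 \<le> \<bar>x\<bar>" for x
  proof (rule ccontr)
    assume nz: "U x \<noteq> 0"
    have "open {x. U x \<noteq> 0}"
      using open_Collect_neq[of U "\<lambda>x. 0"] U_cont[of UNIV] by simp
    then have "{x. U x \<noteq> 0} \<subseteq> interior (cball 0 1)"
      using assms(5) closure_subset[of "{x. U x \<noteq> 0}"] by (intro interior_maximal) auto
    then have "x \<in> ball 0 1" using nz by auto
    then show False using x by simp
  qed
  obtain K where K: "0 \<le> K" "\<And>x. x \<in> {-1..1} \<Longrightarrow> \<bar>U x\<bar> \<le> K"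
    using continuous_on_interval_bounded[OF U_cont, of "-1" 1] by blast
  define M where "M = K + 1"
  have M: "0 < M" using K by (simp add: M_def)
  have U_bound: "\<bar>U x\<bar> \<le> M" for x
  proof (cases "1 \<le> \<bar>x\<bar>")
    case False
    then have "x \<in> {-1..1}" by auto
    then show ?thesis using K(2)[of x] by (simp add: M_def)
  qed (use U_supp M in auto)
  have U_lower: "- M \<le> U x" for x using U_bound[of x] by linarith
  have f_cont: "continuous_on S f" for S by (rule smooth_continuous_on[OF assms(9)])
  have f0: "f x = 0" if "- s \<le> x" for x using assms(11) that by (simp add: s_def)
  have f_nonneg: "0 \<le> f x" for x using assms(10)[of x] assms(11)[of x] by (cases "x < \<epsilon>S") auto
  have f_anti: "f y \<le> f x" if "x \<le> y" for x y
    by (rule DERIV_nonpos_imp_nonincreasing[OF that])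
      (use smooth_has_derivative[OF assms(9), of _ UNIV] assms(12) in blast)
  \<comment> \<open>otherwise \<open>e 1\<close> would have the value \<open>0\<close> of the convention, contradicting \<open>e 1 < \<epsilon>S\<close>\<close>
  have N: "1 \<in> {1..N}"
  proof (rule ccontr)
    assume "1 \<notin> {1..N}"
    then have "e 1 = 0" by (intro assms(17)) simp
    then show False using assms(18) \<open>\<epsilon>S < 0\<close> by simp
  qed
  have e_inj: "inj_on e {1..N}" using assms(13) by (rule strict_mono_on_imp_inj_on)

  have ex: "\<forall>\<mu>. \<exists>p. \<mu> < 0 \<longrightarrow> fst p (-1) = 1 \<and> snd p (-1) = sqrt (- \<mu>) \<and>
      is_sol (\<lambda>x. U x - \<mu>) (-1) 1 (fst p) (snd p)"
  proof
    fix \<mu> :: real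
    have "continuous_on {-1..1} (\<lambda>x. U x - \<mu>)" by (intro continuous_intros U_cont)
    from linear_ode_exists[OF _ this, of 1 "sqrt (- \<mu>)"]
    obtain w w' where "w (-1) = 1" "w' (-1) = sqrt (- \<mu>)" "is_sol (\<lambda>x. U x - \<mu>) (-1) 1 w w'" by auto
    then show "\<exists>p. \<mu> < 0 \<longrightarrow> fst p (-1) = 1 \<and> snd p (-1) = sqrt (- \<mu>) \<and>
      is_sol (\<lambda>x. U x - \<mu>) (-1) 1 (fst p) (snd p)"
      by (intro exI[of _ "(w, w')"]) simp
  qed
  from choice[OF ex] obtain p where p: "\<forall>\<mu>. \<mu> < 0 \<longrightarrow> fst (p \<mu>) (-1) = 1 \<and> snd (p \<mu>) (-1) = sqrt (- \<mu>) \<and>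
      is_sol (\<lambda>x. U x - \<mu>) (-1) 1 (fst (p \<mu>)) (snd (p \<mu>))" ..
  define \<phi> \<phi>' where "\<phi> \<mu> = fst (p \<mu>)" and "\<phi>' \<mu> = snd (p \<mu>)" for \<mu>
  have \<phi>: "\<phi> \<mu> (-1) = 1" "\<phi>' \<mu> (-1) = sqrt (- \<mu>)" "is_sol (\<lambda>x. U x - \<mu>) (-1) 1 (\<phi> \<mu>) (\<phi>' \<mu>)" if "\<mu> < 0" for \<mu>
    using p that by (simp_all add: \<phi>_def \<phi>'_def)
  have lw: "limit_well U M \<phi> \<phi>'"
    by (unfold_locales) (use U_cont U_bound U_supp \<phi> in blast)+
  have zeros: "limit_well.mismatch \<phi> \<phi>' \<mu> = 0 \<longleftrightarrow> \<mu> \<in> e ` {1..N}" if \<mu>: "\<mu> < 0" for \<mu>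
  proof -
    have k: "0 < sqrt (- \<mu>)" "(sqrt (- \<mu>))\<^sup>2 = - \<mu>" using \<mu> by simp_all
    have sol: "is_sol (\<lambda>x. U x + (sqrt (- \<mu>))\<^sup>2) (-1) 1 (\<phi> \<mu>) (\<phi>' \<mu>)"
      using \<phi>(3)[OF \<mu>] unfolding k(2) by simp
    have "(\<exists>\<psi>. eigenfunction UNIV (H0 U) (- (sqrt (- \<mu>))\<^sup>2) \<psi>) \<longleftrightarrow> \<phi>' \<mu> 1 + sqrt (- \<mu>) * \<phi> \<mu> 1 = 0"
      by (rule bound_state_iff[OF U_cont U_supp k(1) sol \<phi>(1,2)[OF \<mu>]])
    then show ?thesis
      unfolding limit_well.mismatch_def[OF lw] assms(15) k(2) using \<mu> by simp
  qed

  \<comment> \<open>\<open>Q\<close> bounds the charge for all \<open>h\<close>\<close>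
  define Q where "Q = 4 * M * sqrt M / s * f (- M)"
  have Q: "0 \<le> Q" unfolding Q_def using M s f_nonneg by (intro mult_nonneg_nonneg divide_nonneg_nonneg) auto
  define J where "J h = {i. 1 \<le> i \<and> \<epsilon> h i < - s}" for h
  define S where "S h = (\<Sum>i\<in>J h. f (\<epsilon> h i))" for h
  let ?states = "\<lambda>h Vc u u' Vc'. poisson_states L h (scaled_well U x0 h) Vc (J h) (\<epsilon> h) u u' x0 M s f Vc'"
  let ?complete = "\<lambda>h Vc. \<forall>E w w' x. is_sol (\<lambda>x. (scaled_well U x0 h x + Vc x - E) / h\<^sup>2) 0 L w w' \<and> w 0 = 0 \<and> w L = 0 \<and>
        x \<in> {0<..<L} \<and> w x \<noteq> 0 \<longrightarrow> (\<exists>i\<ge>1. \<epsilon> h i = E)"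
  have classical: "\<exists>u u' Vc Vc'. ?states h Vc u u' Vc' \<and> (\<forall>x\<in>?\<Omega>. V h x = Vc x) \<and>
      charge_density f (\<epsilon> h) (\<Psi> h) \<in> borel_measurable (lebesgue_on ?\<Omega>) \<and>
      (AE x in lebesgue_on ?\<Omega>. charge_density f (\<epsilon> h) (\<Psi> h) x = poisson_states.n (J h) (\<epsilon> h) u f x) \<and>
      ?complete h Vc" if h: "h \<in> {0<..h0}" for h
  proof -
    have h0: "0 < h" using h by simp
    show ?thesis
    proof (rule schroedinger_poisson_classical[OF L x0(1,2) h0 M s U_cont assms(4) U_lower U_supp
          f_nonneg f_anti f0 assms(19)[OF h], folded J_def])
      fix u u' Vc Vc'
      assume st: "?states h Vc u u' Vc'" and V: "\<And>x. x \<in> ?\<Omega> \<Longrightarrow> V h x = Vc x"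
        and meas: "charge_density f (\<epsilon> h) (\<Psi> h) \<in> borel_measurable (lebesgue_on ?\<Omega>)"
        and ae: "AE x in lebesgue_on ?\<Omega>. charge_density f (\<epsilon> h) (\<Psi> h) x = (\<Sum>i\<in>J h. f (\<epsilon> h i) * (u i x)\<^sup>2)"
        and co: "\<And>E w w' x. is_sol (\<lambda>x. (scaled_well U x0 h x + Vc x - E) / h\<^sup>2) 0 L w w' \<Longrightarrow> w 0 = 0 \<Longrightarrow> w L = 0 \<Longrightarrow>
          x \<in> ?\<Omega> \<Longrightarrow> w x \<noteq> 0 \<Longrightarrow> \<exists>i\<ge>1. \<epsilon> h i = E"
      have "?complete h Vc" using co by blast
      moreover have "AE x in lebesgue_on ?\<Omega>. charge_density f (\<epsilon> h) (\<Psi> h) x = poisson_states.n (J h) (\<epsilon> h) u f x"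
        using ae by (simp only: poisson_states.n_def[OF st])
      moreover have "\<forall>x\<in>?\<Omega>. V h x = Vc x" using V by blast
      ultimately show ?thesis using st meas by (intro exI conjI)
    qed
  qed

  have bounds: "0 \<le> S h" "S h \<le> Q" "W1inf_norm ?\<Omega> (V h) \<le> ennreal (Q * L + Q)"
    if h: "h \<in> {0<..h0}" for h
  proof -
    obtain u u' Vc Vc' where st: "?states h Vc u u' Vc'" and V: "\<forall>x\<in>?\<Omega>. V h x = Vc x"
      using classical[OF h] by blast
    interpret poisson_states L h "scaled_well U x0 h" Vc "J h" "\<epsilon> h" u u' x0 M s f Vc' by fact
    have S: "charge = S h" by (simp add: charge_def S_def)
    show "0 \<le> S h" "S h \<le> Q" using charge_nonneg charge_bound by (simp_all add: S Q_def)
    then have "S h * L + S h \<le> Q * L + Q" using L by (intro add_mono mult_right_mono) auto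
    moreover have "W1inf_norm ?\<Omega> (V h) \<le> ennreal (S h * L + S h)"
      using W1inf_norm_le[of "V h"] V by (simp add: S)
    ultimately show "W1inf_norm ?\<Omega> (V h) \<le> ennreal (Q * L + Q)"
      by (meson ennreal_leI order_trans)
  qed

  define F where "F t = (\<Sum>k=1..N. f (e k + t))" for t
  have F_sum: "(\<Sum>\<^sub>\<infinity>i\<in>{1..}. f (e i + t)) = F t" if "0 \<le> t" for t
  proof -
    have "(\<Sum>\<^sub>\<infinity>i\<in>{1..}. f (e i + t)) = (\<Sum>\<^sub>\<infinity>i\<in>{1..N}. f (e i + t))"
    proof (rule infsum_cong_neutral)
      fix i assume "i \<in> {1..} - {1..N}"
      then have "e i = 0" by (intro assms(17)) auto
      then show "f (e i + t) = 0" using that s by (intro f0) simp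
    qed auto
    then show ?thesis by (simp add: F_def)
  qed
  \<comment> \<open>the potential at \<open>x0\<close> of a unit charge at \<open>x0\<close>\<close>
  define c where "c = x0 * (1 - x0 / L)"
  have c: "0 < c" using x0 L by (simp add: c_def)
  have lp_x0: "limit_potential L x0 S x0 = c * S" for S
    by (simp add: limit_potential_def c_def)
  have e_ge: "e 1 \<le> e k" if "k \<in> {1..N}" for k
    using strict_mono_on_leD[OF assms(13) N that] that by simp
  have "\<exists>\<theta>. 0 < \<theta> \<and> \<theta> < \<epsilon>S - e 1 \<and> \<theta> = c * F \<theta> \<and> (\<forall>t. \<bar>t - \<theta>\<bar> \<le> \<bar>t - c * F t\<bar>)"
  proof (rule decreasing_fixed_point[OF c, of "\<epsilon>S - e 1" F])
    show "0 < \<epsilon>S - e 1" using assms(18) by simp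
    show "continuous_on {0..\<epsilon>S - e 1} F" unfolding F_def
      by (intro continuous_on_sum continuous_on_compose2[OF f_cont[of UNIV]] continuous_intros) auto
    show "F y \<le> F x" if "x \<le> y" for x y unfolding F_def using that by (intro sum_mono f_anti) simp
    have "0 < f (e 1 + 0)" using assms(10,18) by simp
    moreover have "f (e 1 + 0) \<le> F 0" unfolding F_def
      using N f_nonneg by (intro member_le_sum) auto
    ultimately show "0 < F 0" by simp
    have "f (e k + (\<epsilon>S - e 1)) = 0" if "k \<in> {1..N}" for k
      using e_ge[OF that] by (intro f0) (simp add: s_def)
    then show "F (\<epsilon>S - e 1) = 0" unfolding F_def by (intro sum.neutral) blast
  qed
  then obtain \<theta> where \<theta>: "0 < \<theta>" "\<theta> < \<epsilon>S - e 1" "\<theta> = c * F \<theta>" "\<And>t. \<bar>t - \<theta>\<bar> \<le> \<bar>t - c * F t\<bar>"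
    by blast
  define S0 where "S0 = F \<theta>"
  have S0: "0 \<le> S0" unfolding S0_def F_def by (intro sum_nonneg f_nonneg)
  define Kc where "Kc = ((1 + M) / s + 1) / 2 * Q"
  have Kc: "0 \<le> Kc" unfolding Kc_def using M s Q by simp

  have close: "\<bar>Vc x - limit_potential L x0 (S h) x\<bar> \<le> h * Kc"
    if hin: "h \<in> {0<..h0}" and st: "?states h Vc u u' Vc'" and x: "x \<in> {0..L}" for h Vc u u' Vc' x
  proof -
    interpret poisson_states L h "scaled_well U x0 h" Vc "J h" "\<epsilon> h" u u' x0 M s f Vc' by fact
    have S: "charge = S h" by (simp add: charge_def S_def)
    have "\<bar>Vc x - limit_potential L x0 (S h) x\<bar> \<le> h * (((1 + M) / s + 1) / 2 * S h)"
      using V_close_to_point_charge[OF x] by (simp only: S)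
    also have "\<dots> \<le> h * Kc" unfolding Kc_def
      using h bounds(2)[OF hin] M s by (intro mult_left_mono) auto
    finally show ?thesis .
  qed

  have S_lim: "(S \<longlongrightarrow> S0) (at_right 0)"
  proof (rule tendstoI)
    fix r :: real assume r: "0 < r"
    then have r4: "0 < r / 4" by simp
    obtain h1 where h1: "0 < h1" and asy: "\<forall>h Vc J \<epsilon> u u' Vc'. 0 < h \<and> h < h1 \<and> J = {i. 1 \<le> i \<and> \<epsilon> i < - s} \<and>
       poisson_states L h (scaled_well U x0 h) Vc J \<epsilon> u u' x0 M s f Vc' \<and> (\<Sum>i\<in>J. f (\<epsilon> i)) \<le> Q \<and>
       (\<forall>E w w' x. is_sol (\<lambda>x. (scaled_well U x0 h x + Vc x - E) / h\<^sup>2) 0 L w w' \<and> w 0 = 0 \<and> w L = 0 \<and>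
          x \<in> {0<..<L} \<and> w x \<noteq> 0 \<longrightarrow> (\<exists>i\<ge>1. \<epsilon> i = E)) \<longrightarrow>
       \<bar>(\<Sum>i\<in>J. f (\<epsilon> i)) - (\<Sum>k=1..N. f (e k + Vc x0))\<bar> \<le> r / 4"
      by (rule exE[OF charge_asymptotics[OF lw M s x0(1,2) assms(14) e_inj zeros f_cont f0 Q r4]],
          assumption, assumption, assumption, elim conjE, rule that)
    \<comment> \<open>the second bound makes \<open>h * Kc\<close> at most \<open>c * r / 8\<close>\<close>
    define h2 where "h2 = min (min h1 h0) (c * r / (8 * (Kc + 1)))"
    have h2: "0 < h2" using h1 \<open>h0 > 0\<close> c r Kc by (simp add: h2_def)
    have "dist (S h) S0 < r" if h: "0 < h" "h < h2" for h
    proof -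
      have hh: "h \<in> {0<..h0}" "h < h1" "h < c * r / (8 * (Kc + 1))" using h by (auto simp: h2_def)
      obtain u u' Vc Vc' where st: "?states h Vc u u' Vc'" and co: "?complete h Vc"
        using classical[OF hh(1)] by blast
      define T where "T = Vc x0"
      have 1: "\<bar>S h - F T\<bar> \<le> r / 4"
        unfolding S_def F_def T_def
        by (rule asy[THEN spec[of _ h], THEN spec[of _ Vc], THEN spec[of _ "J h"], THEN spec[of _ "\<epsilon> h"],
              THEN spec[of _ u], THEN spec[of _ u'], THEN spec[of _ Vc'], THEN mp])
          (intro conjI h(1) hh(2) J_def st bounds(2)[OF hh(1), unfolded S_def] co)
      have 2: "\<bar>T - c * S h\<bar> \<le> h * Kc"
        using close[OF hh(1) st x0(3)] by (simp add: T_def lp_x0)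
      have "\<bar>c * S h - c * F T\<bar> \<le> c * (r / 4)"
        using mult_left_mono[OF 1, of c] c by (simp add: abs_mult right_diff_distrib[symmetric])
      then have "\<bar>T - \<theta>\<bar> \<le> h * Kc + c * (r / 4)" using \<theta>(4)[of T] 2 by linarith
      then have "\<bar>c * S h - c * S0\<bar> \<le> 2 * (h * Kc) + c * (r / 4)" using 2 \<theta>(3) unfolding S0_def by linarith
      moreover have "h * Kc \<le> c * r / 8"
      proof -
        have "h * Kc \<le> h * (Kc + 1)" using h by simp
        also have "\<dots> \<le> c * r / (8 * (Kc + 1)) * (Kc + 1)" using hh(3) Kc by (intro mult_right_mono) auto
        also have "\<dots> = c * r / 8" using Kc by (simp add: field_simps)
        finally show ?thesis .
      qed
      ultimately have "\<bar>c * S h - c * S0\<bar> \<le> c * (r / 2)" by (simp add: field_simps)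
      then have "c * \<bar>S h - S0\<bar> \<le> c * (r / 2)"
        using c by (simp add: abs_mult right_diff_distrib[symmetric])
      then have "\<bar>S h - S0\<bar> \<le> r / 2" using c by simp
      then show ?thesis using r by (simp add: dist_real_def)
    qed
    then show "\<forall>\<^sub>F h in at_right 0. dist (S h) S0 < r"
      unfolding eventually_at_right_field using h2 by blast
  qed
  have h0_ev: "\<forall>\<^sub>F h in at_right 0. h \<in> {0<..h0}"
    unfolding eventually_at_right_field using \<open>h0 > 0\<close> by (intro exI[of _ h0]) auto
  have id_lim: "((\<lambda>h::real. h) \<longlongrightarrow> 0) (at_right 0)" by (rule tendsto_ident_at)

  have holder: "((\<lambda>h. holder_norm \<alpha> ?\<Omega> (\<lambda>x. V h x - limit_potential L x0 S0 x)) \<longlongrightarrow> 0) (at_right 0)"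
    if \<alpha>: "\<alpha> \<in> {0<..<1}" for \<alpha>
  proof -
    \<comment> \<open>\<open>a h\<close> bounds the distance to the limit, \<open>Q + S0\<close> its Lipschitz constant\<close>
    define a where "a h = h * Kc + \<bar>S h - S0\<bar> * L" for h
    define B where "B h = a h + (2 * a h) powr (1 - \<alpha>) * (Q + S0) powr \<alpha>" for h
    have "(a \<longlongrightarrow> 0 * Kc + \<bar>S0 - S0\<bar> * L) (at_right 0)"
      unfolding a_def by (intro tendsto_intros S_lim id_lim)
    then have a0: "(a \<longlongrightarrow> 0) (at_right 0)" by simp
    have a_nonneg: "\<forall>\<^sub>F h in at_right 0. 0 \<le> 2 * a h"
      using h0_ev by eventually_elim (use Kc L in \<open>simp add: a_def\<close>)
    have pow: "((\<lambda>h. (2 * a h) powr (1 - \<alpha>)) \<longlongrightarrow> (2 * 0) powr (1 - \<alpha>)) (at_right 0)"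
      by (rule tendsto_powr'[OF tendsto_mult[OF tendsto_const a0] tendsto_const]) (use \<alpha> a_nonneg in simp)
    have "(B \<longlongrightarrow> 0 + (2 * 0) powr (1 - \<alpha>) * (Q + S0) powr \<alpha>) (at_right 0)"
      unfolding B_def by (intro tendsto_add tendsto_mult tendsto_const a0 pow)
    then have "(B \<longlongrightarrow> 0) (at_right 0)" using \<alpha> by simp
    then have B0: "((\<lambda>h. ennreal (B h)) \<longlongrightarrow> 0) (at_right 0)"
      using tendsto_ennrealI by fastforce
    have "\<forall>\<^sub>F h in at_right 0. holder_norm \<alpha> ?\<Omega> (\<lambda>x. V h x - limit_potential L x0 S0 x) \<le> ennreal (B h)"
      using h0_ev
    proof eventually_elim
      fix h assume hin: "h \<in> {0<..h0}"
      obtain u u' Vc Vc' where st: "?states h Vc u u' Vc'" and V: "\<forall>x\<in>?\<Omega>. V h x = Vc x"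
        using classical[OF hin] by blast
      interpret poisson_states L h "scaled_well U x0 h" Vc "J h" "\<epsilon> h" u u' x0 M s f Vc' by fact
      have S: "charge = S h" by (simp add: charge_def S_def)
      show "holder_norm \<alpha> ?\<Omega> (\<lambda>x. V h x - limit_potential L x0 S0 x) \<le> ennreal (B h)"
        unfolding B_def
      proof (rule holder_norm_le_interpolation)
        show "0 < \<alpha>" "\<alpha> < 1" using \<alpha> by auto
        show "0 \<le> a h" using h Kc L by (simp add: a_def)
        show "0 \<le> Q + S0" using Q S0 by simp
        show "\<bar>V h x - limit_potential L x0 S0 x\<bar> \<le> a h" if x: "x \<in> ?\<Omega>" for x
        proof -
          have x': "x \<in> {0..L}" using x by auto
          have "limit_potential L x0 (S h) x - limit_potential L x0 S0 x = (S h - S0) * limit_potential L x0 1 x"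
            by (simp add: limit_potential_eq[of L x0 "S h"] limit_potential_eq[of L x0 S0] left_diff_distrib)
          then have "\<bar>limit_potential L x0 (S h) x - limit_potential L x0 S0 x\<bar> \<le> \<bar>S h - S0\<bar> * L"
            using limit_potential_bounds[OF x0(1,2) x'] by (simp add: abs_mult mult_left_mono)
          then show ?thesis using close[OF hin st x'] V x unfolding a_def by fastforce
        qed
        show "\<bar>(V h x - limit_potential L x0 S0 x) - (V h y - limit_potential L x0 S0 y)\<bar> \<le> (Q + S0) * \<bar>x - y\<bar>"
          if xy: "x \<in> ?\<Omega>" "y \<in> ?\<Omega>" for x y
        proof -
          have "\<bar>Vc x - Vc y\<bar> \<le> S h * \<bar>x - y\<bar>" using V_lipschitz[of x y] xy by (simp add: S)
          also have "\<dots> \<le> Q * \<bar>x - y\<bar>" by (intro mult_right_mono bounds(2) hin) simp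
          finally have 1: "\<bar>Vc x - Vc y\<bar> \<le> Q * \<bar>x - y\<bar>" .
          have "limit_potential L x0 S0 x - limit_potential L x0 S0 y = S0 * (limit_potential L x0 1 x - limit_potential L x0 1 y)"
            by (simp add: limit_potential_eq[of L x0 S0] right_diff_distrib)
          then have "\<bar>limit_potential L x0 S0 x - limit_potential L x0 S0 y\<bar> \<le> S0 * \<bar>x - y\<bar>"
            using limit_potential_lipschitz[OF x0(1,2), of x y] S0 by (simp add: abs_mult mult_left_mono)
          moreover have "V h x = Vc x" "V h y = Vc y" using V xy by auto
          ultimately show ?thesis using 1 by (simp add: distrib_right)
        qed
      qed
    qed
    then show ?thesis
      by (rule tendsto_sandwich[OF _ _ tendsto_const B0, rotated]) simp
  qed

  have weak: "tendsto_weak_star L (\<lambda>h. density_measure L (charge_density f (\<epsilon> h) (\<Psi> h)))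
         (scale_measure (ennreal S0) (dirac_mass L x0)) (at_right 0)"
    unfolding tendsto_weak_star_def
  proof (intro conjI allI impI)
    show "finite_measure (scale_measure (ennreal S0) (dirac_mass L x0))"
      by (rule scaled_dirac_mass(1)[OF assms(2) S0])
    show "\<forall>\<^sub>F h in at_right 0. finite_measure (density_measure L (charge_density f (\<epsilon> h) (\<Psi> h)))"
      using h0_ev
    proof eventually_elim
      fix h assume h: "h \<in> {0<..h0}"
      obtain u u' Vc Vc' where "?states h Vc u u' Vc'"
        "charge_density f (\<epsilon> h) (\<Psi> h) \<in> borel_measurable (lebesgue_on ?\<Omega>)"
        "AE x in lebesgue_on ?\<Omega>. charge_density f (\<epsilon> h) (\<Psi> h) x = poisson_states.n (J h) (\<epsilon> h) u f x"
        using classical[OF h] by blast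
      then show "finite_measure (density_measure L (charge_density f (\<epsilon> h) (\<Psi> h)))"
        by (rule poisson_states.density_measure_states(1))
    qed
    fix \<phi> :: "real \<Rightarrow> real" assume \<phi>: "continuous_on {0..L} \<phi>"
    define I where "I h = (LINT x|density_measure L (charge_density f (\<epsilon> h) (\<Psi> h)). \<phi> x)" for h
    have est: "\<bar>I h - S h * \<phi> x0\<bar> \<le> \<eta> * Q + K * (h\<^sup>2 * ((1 + M) / s) * Q)"
      if hin: "h \<in> {0<..h0}" and \<eta>: "0 \<le> \<eta>" and K: "0 \<le> K"
        and mod: "\<And>y. y \<in> {0..L} \<Longrightarrow> \<bar>\<phi> y - \<phi> x0\<bar> \<le> \<eta> + K * (y - x0)\<^sup>2" for h \<eta> K
    proof -
      obtain u u' Vc Vc' where st: "?states h Vc u u' Vc'"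
        and meas: "charge_density f (\<epsilon> h) (\<Psi> h) \<in> borel_measurable (lebesgue_on ?\<Omega>)"
        and ae: "AE x in lebesgue_on ?\<Omega>. charge_density f (\<epsilon> h) (\<Psi> h) x = poisson_states.n (J h) (\<epsilon> h) u f x"
        using classical[OF hin] by blast
      interpret poisson_states L h "scaled_well U x0 h" Vc "J h" "\<epsilon> h" u u' x0 M s f Vc' by fact
      have S: "charge = S h" by (simp add: charge_def S_def)
      have "I h = integral {0..L} (\<lambda>x. \<phi> x * n x)"
        unfolding I_def by (rule density_measure_states(2)[OF meas ae \<phi>])
      then have "\<bar>I h - S h * \<phi> x0\<bar> \<le> \<eta> * S h + K * (h\<^sup>2 * ((1 + M) / s) * S h)"
        using density_concentrates[OF \<phi> K mod] by (simp add: S)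
      also have "\<dots> \<le> \<eta> * Q + K * (h\<^sup>2 * ((1 + M) / s) * Q)"
        using bounds(2)[OF hin] \<eta> K M s by (intro add_mono mult_left_mono mult_nonneg_nonneg) auto
      finally show ?thesis .
    qed
    have "((\<lambda>h. I h - S h * \<phi> x0) \<longlongrightarrow> 0) (at_right 0)"
    proof (rule tendstoI)
      fix r :: real assume r: "0 < r"
      define \<eta> where "\<eta> = r / (2 * (Q + 1))"
      have \<eta>: "0 < \<eta>" using r Q by (simp add: \<eta>_def)
      have "\<eta> * Q \<le> \<eta> * (Q + 1)" using \<eta> by simp
      also have "\<dots> = r / 2" using Q by (simp add: \<eta>_def field_simps)
      finally have \<eta>Q: "\<eta> * Q \<le> r / 2" .
      obtain K where K: "0 \<le> K" "\<And>y. y \<in> {0..L} \<Longrightarrow> \<bar>\<phi> y - \<phi> x0\<bar> \<le> \<eta> + K * (y - x0)\<^sup>2"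
        by (rule quadratic_modulus[OF \<phi> x0(3) \<eta>]) blast
      have "((\<lambda>h. K * (h\<^sup>2 * ((1 + M) / s) * Q)) \<longlongrightarrow> K * (0\<^sup>2 * ((1 + M) / s) * Q)) (at_right 0)"
        by (intro tendsto_intros id_lim)
      then have "\<forall>\<^sub>F h in at_right 0. K * (h\<^sup>2 * ((1 + M) / s) * Q) < r / 2"
        using r by (intro order_tendstoD) auto
      then show "\<forall>\<^sub>F h in at_right 0. dist (I h - S h * \<phi> x0) 0 < r"
        using h0_ev
      proof eventually_elim
        fix h assume "K * (h\<^sup>2 * ((1 + M) / s) * Q) < r / 2" "h \<in> {0<..h0}"
        moreover from this(2) have "\<bar>I h - S h * \<phi> x0\<bar> \<le> \<eta> * Q + K * (h\<^sup>2 * ((1 + M) / s) * Q)"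
          by (rule est) (use \<eta> K in auto)
        ultimately have "\<bar>I h - S h * \<phi> x0\<bar> < r" using \<eta>Q by linarith
        then show "dist (I h - S h * \<phi> x0) 0 < r" by (simp add: dist_real_def)
      qed
    qed
    then have "((\<lambda>h. (I h - S h * \<phi> x0) + S h * \<phi> x0) \<longlongrightarrow> 0 + S0 * \<phi> x0) (at_right 0)"
      by (intro tendsto_intros S_lim)
    then show "(I \<longlongrightarrow> (LINT x|scale_measure (ennreal S0) (dirac_mass L x0). \<phi> x)) (at_right 0)"
      by (simp add: scaled_dirac_mass(2)[OF assms(2) S0 \<phi>])
  qed

  have fixed_point: "t = x0 * (1 - x0 / L) * (\<Sum>\<^sub>\<infinity>i\<in>{1..}. f (e i + t)) \<longleftrightarrow> t = \<theta>" if "0 \<le> t" for t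
    unfolding F_sum[OF that] c_def[symmetric] using \<theta>(3) \<theta>(4)[of t] by auto
  have S0_sum: "(\<Sum>\<^sub>\<infinity>i\<in>{1..}. f (e i + \<theta>)) = S0" using F_sum[of \<theta>] \<theta>(1) by (simp add: S0_def)
  show ?thesis
  proof (rule conjI)
    show "\<exists>C::real. \<forall>h\<in>{0<..h0}. W1inf_norm ?\<Omega> (V h) \<le> ennreal C" using bounds(3) by blast
  qed (rule exI[of _ \<theta>], use \<theta>(1,2) fixed_point holder weak S0_sum in auto)
qed

end
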